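(* Let $S^1\subset\mathbb A^1_{\mathbb C}$ be the unit circle, $\mathbb D^+\subset\mathbb A^1_{\mathbb C}$ the open unit disk, $\mathbb D^-\subset\mathbb P^1_{\mathbb C}$ the complementary open disk, and $\kappa(z)=\bar z^{-1}$ the conjugation of $\mathbb P^1_{\mathbb C}$ with real points $S^1$. Let $S\subset S^1$ and $S^+\subset\mathbb D^+$ be finite sets of points, let $S^-=\kappa(S^+)\subset\mathbb D^-$, and set $\mathbb S=S\cup S^+\cup S^-$. Let $G[\mathbb P^1\setminus\mathbb S]$ be the group of polynomial (i.e. algebraic) maps $\mathbb P^1\setminus\mathbb S\to G$, and let $G[\mathbb P^1\setminus\mathbb S]_c\subset G[\mathbb P^1\setminus\mathbb S]$ be the subgroup of maps taking $S^1\setminus S$ to $G_c$. Fix a point $s_0\in S^1\setminus S$ and let $G[\mathbb P^1\setminus\mathbb S]_{c,s_0}\subset G[\mathbb P^1\setminus\mathbb S]_c$ be the subgroup of maps taking $s_0$ to $1$. Then multiplication provides a homeomorphism $$G[\mathbb P^1\setminus\mathbb S]_{c,s_0}\times G[\mathbb P^1\setminus(S^-\cup S)]\;\xrightarrow{\ \sim\ }\;G[\mathbb P^1\setminus\mathbb S].$$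
   Context: $G$ is a connected complex reductive group and $G_c\subset G$ is a maximal compact subgroup (compact real form). For a finite set $\mathbb S\subset\mathbb P^1$, $G[\mathbb P^1\setminus\mathbb S]$ is the group of complex points of the group ind-scheme of algebraic maps $\mathbb P^1\setminus\mathbb S\to G$, equipped with the classical topology. *)

theory Defs
  imports
    "HOL-Analysis.Analysis"
    "HOL-Computational_Algebra.Polynomial"
    "HOL-Algebra.Coset"
begin

section \<open>Complex reductive groups and their compact real forms\<close>

text \<open>
  Every complex reductive group is affine, hence a Zariski closed subgroup of some
  \<open>GL\<^sub>n(\<complex>)\<close>; a group is represented by its set of complex points in such an embedding.
  The embedding is arbitrary (the set need not be closed in the space of all matrices).
\<close>

definition GL :: "(complex^'n^'n) monoid" where
  "GL = \<lparr>carrier = {A. invertible A}, monoid.mult = (**), one = mat 1\<rparr>"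

inductive matrix_poly :: "(complex^'n^'n \<Rightarrow> complex) \<Rightarrow> bool" where
  const: "matrix_poly (\<lambda>A. c)"
| entry: "matrix_poly (\<lambda>A. A $ i $ j)"
| add: "matrix_poly p \<Longrightarrow> matrix_poly q \<Longrightarrow> matrix_poly (\<lambda>A. p A + q A)"
| mult: "matrix_poly p \<Longrightarrow> matrix_poly q \<Longrightarrow> matrix_poly (\<lambda>A. p A * q A)"

definition linear_algebraic_group :: "(complex^'n^'n) set \<Rightarrow> bool" where
  "linear_algebraic_group G \<longleftrightarrow>
     subgroup G GL \<and>
     (\<exists>F. (\<forall>p\<in>F. matrix_poly p) \<and> G = {A. invertible A \<and> (\<forall>p\<in>F. p A = 0)})"

text \<open>
  Matrix powers are written as iterated \<open>**\<close>, because \<open>^\<close> on \<^typ>\<open>complex^'n^'n\<close>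
  is the entrywise power.
\<close>

definition unipotent :: "complex^'n^'n \<Rightarrow> bool" where
  "unipotent A \<longleftrightarrow> (\<exists>k. (((**) (A - mat 1)) ^^ k) (mat 1) = 0)"

text \<open>
  Reductive: the unipotent radical is trivial. Connectedness refers to the classical topology
  of the complex points, which for complex algebraic groups agrees with Zariski connectedness.
\<close>

definition reductive :: "(complex^'n^'n) set \<Rightarrow> bool" where
  "reductive G \<longleftrightarrow>
     linear_algebraic_group G \<and>
     (\<forall>U. linear_algebraic_group U \<and> connected U \<and> (\<forall>A\<in>U. unipotent A) \<and>
          normal U (GL\<lparr>carrier := G\<rparr>) \<longrightarrow> U = {mat 1})"

definition maximal_compact_subgroup ::
    "(complex^'n^'n) set \<Rightarrow> (complex^'n^'n) set \<Rightarrow> bool" where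
  "maximal_compact_subgroup G K \<longleftrightarrow>
     subgroup K GL \<and> K \<subseteq> G \<and> compact K \<and>
     (\<forall>K'. subgroup K' GL \<and> K' \<subseteq> G \<and> compact K' \<and> K \<subseteq> K' \<longrightarrow> K' = K)"

text \<open>
  A real form is the fixed-point group of a conjugation, i.e. of an involutive automorphism
  that is antiregular: its matrix entries are complex conjugates of regular functions on \<open>G\<close>,
  which are the restrictions of the functions \<open>p / det\<^sup>k\<close> with \<open>p\<close> polynomial.
\<close>

definition conjugation_on ::
    "(complex^'n^'n) set \<Rightarrow> (complex^'n^'n \<Rightarrow> complex^'n^'n) \<Rightarrow> bool" where
  "conjugation_on G \<theta> \<longleftrightarrow>
     \<theta> \<in> hom (GL\<lparr>carrier := G\<rparr>) (GL\<lparr>carrier := G\<rparr>) \<and>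
     (\<forall>A\<in>G. \<theta> (\<theta> A) = A) \<and>
     (\<forall>i j. \<exists>p k. matrix_poly p \<and> (\<forall>A\<in>G. \<theta> A $ i $ j = cnj (p A / det A ^ k)))"

definition compact_real_form ::
    "(complex^'n^'n) set \<Rightarrow> (complex^'n^'n) set \<Rightarrow> bool" where
  "compact_real_form G K \<longleftrightarrow>
     compact K \<and> (\<exists>\<theta>. conjugation_on G \<theta> \<and> K = {A \<in> G. \<theta> A = A})"


section \<open>The projective line\<close>

text \<open>\<open>Aff z\<close> is the point \<open>[z : 1]\<close> and \<open>Infty\<close> is \<open>[1 : 0]\<close>.\<close>

datatype proj_line = Aff complex | Infty

fun kappa :: "proj_line \<Rightarrow> proj_line" where
  "kappa (Aff z) = (if z = 0 then Infty else Aff (inverse (cnj z)))"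
| "kappa Infty = Aff 0"

text \<open>
  Regular functions on the complement of a finite set \<open>T\<close>: near every point, a quotient of
  polynomials in the coordinate \<open>z\<close> (at finite points) or \<open>w = 1/z\<close> (at infinity). The
  neighbourhood on which the quotient represents \<open>f\<close> is the locus where the denominator
  does not vanish; smaller Zariski neighbourhoods arise by enlarging numerator and denominator
  by a common factor.
\<close>

definition regular_off :: "proj_line set \<Rightarrow> (proj_line \<Rightarrow> complex) \<Rightarrow> bool" where
  "regular_off T f \<longleftrightarrow>
     (\<forall>a. Aff a \<notin> T \<longrightarrow>
        (\<exists>P Q. poly Q a \<noteq> 0 \<and>
           (\<forall>z. Aff z \<notin> T \<and> poly Q z \<noteq> 0 \<longrightarrow> f (Aff z) = poly P z / poly Q z))) \<and>
     (Infty \<notin> T \<longrightarrow>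
        (\<exists>P Q. poly Q 0 \<noteq> 0 \<and> f Infty = poly P 0 / poly Q 0 \<and>
           (\<forall>z. z \<noteq> 0 \<and> Aff z \<notin> T \<and> poly Q (1 / z) \<noteq> 0 \<longrightarrow>
                f (Aff z) = poly P (1 / z) / poly Q (1 / z))))"


section \<open>The group of algebraic maps into a group, with its classical topology\<close>

text \<open>
  \<open>alg_maps G T\<close> is the set of algebraic maps from the complement of \<open>T\<close> to \<open>G\<close>. Maps are
  extensional functions, so that equality is equality on the complement of \<open>T\<close>.
\<close>

definition alg_maps ::
    "(complex^'n^'n) set \<Rightarrow> proj_line set \<Rightarrow> (proj_line \<Rightarrow> complex^'n^'n) set" where
  "alg_maps G T = {f \<in> (- T) \<rightarrow>\<^sub>E G. \<forall>i j. regular_off T (\<lambda>x. f x $ i $ j)}"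

text \<open>
  The rational functions with poles of order at most \<open>N\<close> at each point of the finite set \<open>T\<close>
  (including infinity, if it belongs to \<open>T\<close>) are exactly the quotients by
  \<open>\<Prod> (z - s)\<^sup>N\<close>, over the finite \<open>s\<close> in \<open>T\<close>, of polynomials of degree at most
  \<open>N * card T\<close>. At infinity, if it is not in \<open>T\<close>, the value is the top coefficient.
\<close>

fun rat_fun :: "proj_line set \<Rightarrow> nat \<Rightarrow> (nat \<Rightarrow> complex) \<Rightarrow> proj_line \<Rightarrow> complex" where
  "rat_fun T N c (Aff z) =
     (\<Sum>k\<le>N * card T. c k * z ^ k) / (\<Prod>s | Aff s \<in> T. (z - s) ^ N)"
| "rat_fun T N c Infty = c (N * card T)"

definition has_coeffs ::
    "proj_line set \<Rightarrow> nat \<Rightarrow> (proj_line \<Rightarrow> complex^'n^'n) \<Rightarrow> (nat \<Rightarrow> complex^'n^'n) \<Rightarrow> bool" where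
  "has_coeffs T N f c \<longleftrightarrow>
     (\<forall>k > N * card T. c k = 0) \<and>
     (\<forall>x \<in> - T. \<forall>i j. f x $ i $ j = rat_fun T N (\<lambda>k. c k $ i $ j) x)"

definition coeffs_of ::
    "proj_line set \<Rightarrow> nat \<Rightarrow> (proj_line \<Rightarrow> complex^'n^'n) \<Rightarrow> nat \<Rightarrow> complex^'n^'n" where
  "coeffs_of T N f = (THE c. has_coeffs T N f c)"

definition pointwise_inv ::
    "(proj_line \<Rightarrow> complex^'n^'n) \<Rightarrow> proj_line \<Rightarrow> complex^'n^'n" where
  "pointwise_inv f = (\<lambda>x. matrix_inv (f x))"

text \<open>
  The ind-structure: \<open>G\<close> is closed in the affine space of pairs of matrices via
  \<open>g \<mapsto> (g, g\<^sup>-\<^sup>1)\<close>, so the maps \<open>f\<close> such that \<open>f\<close> and \<open>f\<^sup>-\<^sup>1\<close> have poles of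
  order at most \<open>N\<close> form a closed subvariety of an affine space of coefficients.
  \<open>piece_topology\<close> is its classical topology (all but finitely many coefficients vanish, so
  the product topology on coefficient sequences induces the Euclidean one), and
  \<open>map_topology\<close> is the colimit topology.
\<close>

definition piece ::
    "(complex^'n^'n) set \<Rightarrow> proj_line set \<Rightarrow> nat \<Rightarrow> (proj_line \<Rightarrow> complex^'n^'n) set" where
  "piece G T N = {f \<in> alg_maps G T.
     (\<exists>c. has_coeffs T N f c) \<and> (\<exists>c. has_coeffs T N (pointwise_inv f) c)}"

definition piece_topology ::
    "(complex^'n^'n) set \<Rightarrow> proj_line set \<Rightarrow> nat \<Rightarrow> (proj_line \<Rightarrow> complex^'n^'n) topology" where
  "piece_topology G T N =
     pullback_topology (piece G T N)
       (\<lambda>f. (coeffs_of T N f, coeffs_of T N (pointwise_inv f))) euclidean"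

definition map_topology ::
    "(complex^'n^'n) set \<Rightarrow> proj_line set \<Rightarrow> (proj_line \<Rightarrow> complex^'n^'n) topology" where
  "map_topology G T = topology (\<lambda>W. W \<subseteq> alg_maps G T \<and>
     (\<forall>N. openin (piece_topology G T N) (W \<inter> piece G T N)))"

lemma openin_map_topology:
  "openin (map_topology G T) W \<longleftrightarrow>
     W \<subseteq> alg_maps G T \<and> (\<forall>N. openin (piece_topology G T N) (W \<inter> piece G T N))"
proof -
  have "istopology (\<lambda>W. W \<subseteq> alg_maps G T \<and>
          (\<forall>N. openin (piece_topology G T N) (W \<inter> piece G T N)))" (is "istopology ?L")
    unfolding istopology_def
  proof (intro conjI allI impI)
    fix V W assume "?L V" "?L W"
    then show "V \<inter> W \<subseteq> alg_maps G T" by auto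
    fix N
    have "V \<inter> W \<inter> piece G T N = (V \<inter> piece G T N) \<inter> (W \<inter> piece G T N)" by auto
    then show "openin (piece_topology G T N) (V \<inter> W \<inter> piece G T N)"
      using \<open>?L V\<close> \<open>?L W\<close> by (simp only: openin_Int)
  next
    fix \<K> assume L: "\<forall>W\<in>\<K>. ?L W"
    then show "\<Union>\<K> \<subseteq> alg_maps G T" by auto
    fix N
    have "\<Union>\<K> \<inter> piece G T N = (\<Union>W\<in>\<K>. W \<inter> piece G T N)" by auto
    moreover have "openin (piece_topology G T N) (\<Union>W\<in>\<K>. W \<inter> piece G T N)"
      using L by (intro openin_Union) blast
    ultimately show "openin (piece_topology G T N) (\<Union>\<K> \<inter> piece G T N)"
      by simp
  qed
  then show ?thesis
    unfolding map_topology_def by (simp add: topology_inverse')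
qed

lemma topspace_map_topology: "topspace (map_topology G T) = alg_maps G T"
proof -
  have "alg_maps G T \<inter> piece G T N = topspace (piece_topology G T N)" for N
    by (auto simp: piece_topology_def topspace_pullback_topology piece_def)
  then have "openin (map_topology G T) (alg_maps G T)"
    by (simp add: openin_map_topology)
  then show ?thesis
    by (meson openin_map_topology openin_subset openin_topspace subset_antisym)
qed


section \<open>Subgroups of maps with compact boundary values, and multiplication\<close>

definition compact_maps ::
    "(complex^'n^'n) set \<Rightarrow> (complex^'n^'n) set \<Rightarrow> complex set \<Rightarrow> proj_line set
      \<Rightarrow> (proj_line \<Rightarrow> complex^'n^'n) set" where
  "compact_maps G K S T = {f \<in> alg_maps G T. \<forall>z \<in> sphere 0 1 - S. f (Aff z) \<in> K}"

definition based_compact_maps ::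
    "(complex^'n^'n) set \<Rightarrow> (complex^'n^'n) set \<Rightarrow> complex set \<Rightarrow> proj_line set \<Rightarrow> complex
      \<Rightarrow> (proj_line \<Rightarrow> complex^'n^'n) set" where
  "based_compact_maps G K S T s0 = {f \<in> compact_maps G K S T. f (Aff s0) = mat 1}"

definition map_mult ::
    "proj_line set \<Rightarrow> (proj_line \<Rightarrow> complex^'n^'n) \<Rightarrow> (proj_line \<Rightarrow> complex^'n^'n)
      \<Rightarrow> proj_line \<Rightarrow> complex^'n^'n" where
  "map_mult T f h = (\<lambda>x\<in>- T. f x ** h x)"

end

theory Submission
  imports Defs "HOL-Complex_Analysis.Complex_Analysis" "HOL-Computational_Algebra.Fundamental_Theorem_Algebra"
begin

text \<open>Averaging gives a Hermitian form invariant under \<open>Gc\<close>, so \<open>Gc\<close> becomes the unitary part of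
  \<open>G\<close>, and connectedness together with the conjugation makes \<open>G\<close> stable under adjoints.
  Removing the poles and the zeros of the determinant of \<open>g\<close> in the open disc one at a time by Blaschke
  factors writes \<open>g = u h\<close> with \<open>u\<close> unitary on the circle and \<open>h\<close> regular and invertible on the disc.
  By the reflection principle, a rational function that is regular on the disc and real on
  the circle is constant. Applied to projections onto subspaces of polynomials stable under the
  group this shows that \<open>u\<close> and \<open>h\<close> take values in \<open>G\<close>; a variant of it shows that they
  are unique once \<open>u\<close> is normalized at \<open>s0\<close>.
  The maps of bounded pole order form locally compact pieces, the \<open>Gc\<close>-valued ones among
  them being compact, and the factorization of a piece stays in a piece. Hence the factors depend
  continuously on \<open>g\<close> by the closed graph theorem, and multiplication is continuous since products commute with
  colimits of locally compact pieces.\<close>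

unbundle no fps_syntax

section \<open>Products of sequential colimits\<close>

text \<open>Blaschke factors are unitary matrices that ignore the equations of \<open>G\<close>, so
  the factorization is made among all invertible matrices and membership in \<open>G\<close> is
  recovered afterwards. What makes this possible is that every polynomial function is a matrix
  coefficient of a polynomial representation compatible with adjoints: an equation of the group
  becomes a stable subspace, hence an orthogonal projection. The factorization in the disc leaves a
  unitary constant free. Choosing it so that \<open>u\<close> is 1 at \<open>s0\<close> also
  provides the point at which the constant produced by reflection is evaluated. For the topology,
  pole orders have to stay bounded on each piece although the number of zeros of the determinant is
  not part of the data. Therefore the poles in the disc are cleared by one scalar function chosen
  from the pole order alone, and dividing by a Blaschke factor at a zero of the determinant does not
  raise the pole order at all. For the adjoints, every tangent direction of \<open>G\<close> is a
  complex combination of directions fixed by the conjugation, and on those the adjoint of the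
  invariant form acts as minus the identity.\<close>

lemma compact_neighbourhood_within_open:
  assumes "locally_compact_space X" "Hausdorff_space X" "compactin X K" "openin X U" "K \<subseteq> U"
  obtains V K' where "openin X V" "compactin X K'" "K \<subseteq> V" "V \<subseteq> K'" "K' \<subseteq> U"
proof -
  have lc: "locally_compact_space (subtopology X U)" 
    using assms by (intro locally_compact_space_open_subset) auto
  have "compactin (subtopology X U) K" using assms by (simp add: compactin_subtopology)
  then obtain V K' where "openin (subtopology X U) V" "compactin (subtopology X U) K'" "K \<subseteq> V" "V \<subseteq> K'"
    using locally_compact_space_compact_closed_compact[of "subtopology X U"] lc
      Hausdorff_space_subtopology[OF assms(2)] by metis
  then show thesis using that assms(4) by (auto simp: compactin_subtopology openin_open_subtopology)
qed

text \<open>Wallace's theorem puts an open rectangle between \<open>K \<times> L\<close> and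
  \<open>W\<close>, and local compactness shrinks it to a compact one. Ending with compact sets is
  what allows the step to be repeated one stage further up.\<close>

lemma locally_compact_rectangle_nbhd:
  assumes lc: "locally_compact_space X" "Hausdorff_space X" "locally_compact_space Y" "Hausdorff_space Y"
    and K: "compactin X K" and L: "compactin Y L"
    and W: "openin (prod_topology X Y) W" and sub: "K \<times> L \<subseteq> W"
  obtains U K' V L' where "openin X U" "K \<subseteq> U" "U \<subseteq> K'" "compactin X K'"
    "openin Y V" "L \<subseteq> V" "V \<subseteq> L'" "compactin Y L'" "K' \<times> L' \<subseteq> W"
proof -
  obtain U V where UV: "openin X U" "openin Y V" "K \<subseteq> U" "L \<subseteq> V" "U \<times> V \<subseteq> W"
    by (rule Wallace_theorem_prod_topology [OF K L W sub])
  obtain U' K' where 1: "openin X U'" "compactin X K'" "K \<subseteq> U'" "U' \<subseteq> K'" "K' \<subseteq> U"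
    using compact_neighbourhood_within_open [OF lc(1,2) K UV(1,3)] by metis
  obtain V' L' where 2: "openin Y V'" "compactin Y L'" "L \<subseteq> V'" "V' \<subseteq> L'" "L' \<subseteq> V"
    using compact_neighbourhood_within_open [OF lc(3,4) L UV(2,4)] by metis
  have "K' \<times> L' \<subseteq> W" using 1 2 UV by blast
  with 1 2 show thesis using that by blast
qed

text \<open>A point of the union that lies in stage \<open>j\<close> belongs to \<open>K n\<close>
  for all large \<open>n\<close>. Once \<open>A j\<close> is contained in stage
  \<open>m + Suc n\<close>, the trace of the open set \<open>U n\<close> on \<open>A j\<close> is a
  neighbourhood of the point, and it stays inside \<open>K (Suc n)\<close>.\<close>

lemma openin_colimit_of_nbhd_chain:
  assumes X: "\<And>U. openin X U \<longleftrightarrow> U \<subseteq> (\<Union>n. A n) \<and> (\<forall>n. openin (subtopology E (A n)) (U \<inter> A n))"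
    and mono: "\<And>m n. m \<le> n \<Longrightarrow> A m \<subseteq> A n"
    and KU: "\<And>n. openin (subtopology E (A (m + Suc n))) (U n) \<and> K n \<subseteq> U n \<and> U n \<subseteq> K (Suc n)"
  shows "openin X (\<Union>n. K n)"
proof -
  have Kmono: "K i \<subseteq> K j" if "i \<le> j" for i j
    using that
  proof (induction rule: dec_induct)
    case (step n)
    then show ?case using KU[of n] by blast
  qed simp
  have "U n \<subseteq> A (m + Suc n)" for n using openin_imp_subset KU by metis
  then have "(\<Union>n. K n) \<subseteq> (\<Union>n. A n)" using KU by blast
  moreover have "openin (subtopology E (A j)) ((\<Union>n. K n) \<inter> A j)" for j
  proof (subst openin_subopen, intro ballI)
    fix x assume "x \<in> (\<Union>n. K n) \<inter> A j"
    then obtain n0 where n0: "x \<in> K n0" "x \<in> A j" by auto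
    define n where "n = n0 + j"
    have "x \<in> K n" using n0 Kmono n_def by (meson le_add1 subsetD)
    have "A j \<subseteq> A (m + Suc n)" by (rule mono) (simp add: n_def)
    then have "openin (subtopology E (A j)) (U n \<inter> A j)"
      using KU[of n] by (metis openin_subtopology_Int2 subtopology_subtopology inf.absorb2 inf_commute)
    then show "\<exists>T. openin (subtopology E (A j)) T \<and> x \<in> T \<and> T \<subseteq> (\<Union>n. K n) \<inter> A j"
      using KU[of n] \<open>x \<in> K n\<close> n0 by blast
  qed
  ultimately show ?thesis using X by blast
qed

text \<open>Products commute with sequential colimits of locally compact Hausdorff spaces: a neighbourhood
  rectangle is grown one step of the filtration at a time.\<close>

lemma openin_prod_colimit:
  fixes A :: "nat \<Rightarrow> 'a set" and B :: "nat \<Rightarrow> 'b set"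
  assumes X: "\<And>U. openin X U \<longleftrightarrow> U \<subseteq> (\<Union>n. A n) \<and> (\<forall>n. openin (subtopology E (A n)) (U \<inter> A n))"
    and Y: "\<And>V. openin Y V \<longleftrightarrow> V \<subseteq> (\<Union>n. B n) \<and> (\<forall>n. openin (subtopology E' (B n)) (V \<inter> B n))"
    and haus: "Hausdorff_space E" "Hausdorff_space E'"
    and lc: "\<And>n. locally_compact_space (subtopology E (A n))"
      "\<And>n. locally_compact_space (subtopology E' (B n))"
    and mono: "\<And>m n. m \<le> n \<Longrightarrow> A m \<subseteq> A n" "\<And>m n. m \<le> n \<Longrightarrow> B m \<subseteq> B n"
    and top: "\<And>n. A n \<subseteq> topspace E" "\<And>n. B n \<subseteq> topspace E'"
    and Wsub: "W \<subseteq> (\<Union>n. A n) \<times> (\<Union>n. B n)"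
    and W: "\<And>n. openin (prod_topology (subtopology E (A n)) (subtopology E' (B n))) (W \<inter> A n \<times> B n)"
  shows "openin (prod_topology X Y) W"
proof (subst openin_prod_topology_alt, intro allI impI)
  fix a b assume ab: "(a, b) \<in> W"
  then obtain i j where ij: "a \<in> A i" "b \<in> B j" using Wsub by blast
  define m where "m = max i j"
  have m: "a \<in> A m" "b \<in> B m" unfolding m_def using ij mono(1)[OF max.cobounded1[of i j]] mono(2)[OF max.cobounded2[of j i]] by blast+
  \<comment> \<open>\<open>good\<close> is the invariant of the growth, a compact rectangle of stage
    \<open>m + n\<close> inside \<open>W\<close>. \<open>nxt\<close> asks for relatively open sets
    between consecutive rectangles, which is what makes the two unions open in the colimits.\<close>
  define good where "good n KL \<longleftrightarrow> compactin E (fst KL) \<and> fst KL \<subseteq> A (m + n) \<and>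
     compactin E' (snd KL) \<and> snd KL \<subseteq> B (m + n) \<and> fst KL \<times> snd KL \<subseteq> W" for n KL
  define nxt where "nxt n KL KL' \<longleftrightarrow>
      (\<exists>U. openin (subtopology E (A (m + Suc n))) U \<and> fst KL \<subseteq> U \<and> U \<subseteq> fst KL') \<and>
      (\<exists>V. openin (subtopology E' (B (m + Suc n))) V \<and> snd KL \<subseteq> V \<and> V \<subseteq> snd KL')" for n KL KL'
  have "\<exists>KL. (\<forall>n. good n (KL n)) \<and> KL 0 = ({a}, {b}) \<and> (\<forall>n. nxt n (KL n) (KL (Suc n)))"
  proof -
    have "\<exists>KL. \<forall>n. (good n (KL n) \<and> (n = 0 \<longrightarrow> KL n = ({a}, {b}))) \<and> nxt n (KL n) (KL (Suc n))"
    proof (rule dependent_nat_choice)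
      have "good 0 ({a}, {b})" using m top ab by (auto simp: good_def compactin_sing)
      then show "\<exists>x. good 0 x \<and> (0 = (0::nat) \<longrightarrow> x = ({a}, {b}))" by blast
    next
      fix KL n assume g: "good n KL \<and> (n = 0 \<longrightarrow> KL = ({a}, {b}))"
      let ?n = "m + Suc n"
      have "compactin (subtopology E (A ?n)) (fst KL)" "compactin (subtopology E' (B ?n)) (snd KL)"
        using g mono(1)[of "m+n" ?n] mono(2)[of "m+n" ?n] by (auto simp: good_def compactin_subtopology)
      moreover have "fst KL \<times> snd KL \<subseteq> W \<inter> A ?n \<times> B ?n"
        using g mono(1)[of "m+n" ?n] mono(2)[of "m+n" ?n] by (auto simp: good_def)
      ultimately obtain U K' V L' where *: "openin (subtopology E (A ?n)) U" "fst KL \<subseteq> U" "U \<subseteq> K'"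
        "compactin (subtopology E (A ?n)) K'" "openin (subtopology E' (B ?n)) V" "snd KL \<subseteq> V" "V \<subseteq> L'"
        "compactin (subtopology E' (B ?n)) L'" "K' \<times> L' \<subseteq> W \<inter> A ?n \<times> B ?n"
        using locally_compact_rectangle_nbhd[OF lc(1) Hausdorff_space_subtopology[OF haus(1)]
           lc(2) Hausdorff_space_subtopology[OF haus(2)] _ _ W[of ?n]] by metis
      then have "good (Suc n) (K', L') \<and> nxt n KL (K', L')"
        unfolding good_def nxt_def by (auto simp: compactin_subtopology)
      then show "\<exists>y. (good (Suc n) y \<and> (Suc n = 0 \<longrightarrow> y = ({a}, {b}))) \<and> nxt n KL y" by blast
    qed
    then show ?thesis by metis
  qed
  then obtain KL where KL: "\<And>n. good n (KL n)" "KL 0 = ({a}, {b})" "\<And>n. nxt n (KL n) (KL (Suc n))" by blast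
  obtain U where U: "\<And>n. openin (subtopology E (A (m + Suc n))) (U n) \<and> fst (KL n) \<subseteq> U n \<and> U n \<subseteq> fst (KL (Suc n))"
    using KL(3) unfolding nxt_def by metis
  obtain V where V: "\<And>n. openin (subtopology E' (B (m + Suc n))) (V n) \<and> snd (KL n) \<subseteq> V n \<and> V n \<subseteq> snd (KL (Suc n))"
    using KL(3) unfolding nxt_def by metis
  have 1: "openin X (\<Union>n. fst (KL n))"
    by (rule openin_colimit_of_nbhd_chain[where U=U and m=m and K="\<lambda>n. fst (KL n)", OF X mono(1)]) (use U in auto)
  have 2: "openin Y (\<Union>n. snd (KL n))"
    by (rule openin_colimit_of_nbhd_chain[where U=V and m=m and K="\<lambda>n. snd (KL n)", OF Y mono(2)]) (use V in auto)
  have Kmono: "fst (KL i) \<subseteq> fst (KL j) \<and> snd (KL i) \<subseteq> snd (KL j)" if "i \<le> j" for i j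
    using that
  proof (induction rule: dec_induct)
    case (step n)
    then show ?case using U[of n] V[of n] by blast
  qed simp
  have 3: "(\<Union>n. fst (KL n)) \<times> (\<Union>n. snd (KL n)) \<subseteq> W"
  proof clarify
    fix x y i j assume "x \<in> fst (KL i)" "y \<in> snd (KL j)"
    then have "x \<in> fst (KL (max i j))" "y \<in> snd (KL (max i j))"
      using Kmono[of i "max i j"] Kmono[of j "max i j"] by auto
    then show "(x, y) \<in> W" using KL(1)[of "max i j"] by (auto simp: good_def)
  qed
  have "a \<in> (\<Union>n. fst (KL n))" "b \<in> (\<Union>n. snd (KL n))" using KL(2) by (metis UN_iff UNIV_I fst_conv snd_conv singletonI)+
  with 1 2 3 show "\<exists>U V. openin X U \<and> openin Y V \<and> a \<in> U \<and> b \<in> V \<and> U \<times> V \<subseteq> W" by blast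
qed

section \<open>Rational functions with prescribed poles\<close>

text \<open>The normal form is the same \<open>rat_fun\<close> from which the coefficient topology
  is built, so the entrywise version for matrices matches \<open>has_coeffs\<close>. Values on
  \<open>T\<close> do not enter.\<close>

definition pole_le :: "proj_line set \<Rightarrow> nat \<Rightarrow> (proj_line \<Rightarrow> complex) \<Rightarrow> bool" where
  "pole_le T N f \<longleftrightarrow> (\<exists>c. \<forall>x\<in>- T. f x = rat_fun T N c x)"

definition den_poly :: "proj_line set \<Rightarrow> nat \<Rightarrow> complex poly" where
  "den_poly T N = (\<Prod>s | Aff s \<in> T. [:- s, 1:] ^ N)"

lemma finite_Aff_in: "finite T \<Longrightarrow> finite {s. Aff s \<in> T}"
  using finite_vimageI[of T Aff] by (simp add: vimage_def inj_def)

lemma card_proj_set: "finite T \<Longrightarrow> card T = card {s. Aff s \<in> T} + (if Infty \<in> T then 1 else 0)"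
proof -
  assume f: "finite T"
  have T: "T = Aff ` {s. Aff s \<in> T} \<union> (if Infty \<in> T then {Infty} else {})" (is "T = ?A \<union> ?B")
  proof (rule Set.set_eqI)
    fix x show "x \<in> T \<longleftrightarrow> x \<in> ?A \<union> ?B" by (cases x) auto
  qed
  have "card T = card ?A + card ?B" 
    by (subst T, rule card_Un_disjoint) (use f finite_Aff_in in auto)
  then show ?thesis by (simp add: card_image inj_on_def)
qed

lemma ex_Aff_notin: "finite T \<Longrightarrow> infinite {z. Aff z \<notin> T}"
proof -
  assume "finite T"
  then have "infinite (UNIV - {s. Aff s \<in> T})" 
    using finite_Aff_in infinite_UNIV_char_0[where 'a=complex] Diff_infinite_finite by blast
  moreover have "UNIV - {s. Aff s \<in> T} = {z. Aff z \<notin> T}" by auto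
  ultimately show ?thesis by simp
qed

lemma poly_den_poly: "poly (den_poly T N) z = (\<Prod>s | Aff s \<in> T. (z - s) ^ N)"
  by (simp add: den_poly_def poly_prod)

lemma poly_den_poly_nonzero: "finite T \<Longrightarrow> Aff z \<notin> T \<Longrightarrow> poly (den_poly T N) z \<noteq> 0"
  using finite_Aff_in[of T] by (auto simp: poly_den_poly)

lemma den_poly_nonzero: "den_poly T N \<noteq> 0"
  by (cases "finite {s. Aff s \<in> T}") (auto simp: den_poly_def)

lemma degree_prod_linear: "degree (\<Prod>s\<in>A. [:- s, 1:] ^ m s) = (\<Sum>s\<in>A. m s)" for m :: "complex \<Rightarrow> nat"
proof (induction A rule: infinite_finite_induct)
  case (insert a A)
  then show ?case by (simp add: degree_mult_eq degree_power_eq)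
qed auto

lemma lead_coeff_prod_linear: "lead_coeff (\<Prod>s\<in>A. [:- s, 1:] ^ m s) = 1" for m :: "complex \<Rightarrow> nat"
proof (induction A rule: infinite_finite_induct)
  case (insert a A)
  then show ?case by (simp add: lead_coeff_mult lead_coeff_power)
qed auto

lemma degree_den_poly: "degree (den_poly T N) = N * card {s. Aff s \<in> T}"
  unfolding den_poly_def by (subst degree_prod_linear) simp

lemma lead_coeff_den_poly: "lead_coeff (den_poly T N) = 1"
  unfolding den_poly_def by (rule lead_coeff_prod_linear)

lemma den_poly_add: "den_poly T (N + M) = den_poly T N * den_poly T M"
  by (simp add: den_poly_def power_add prod.distrib)

lemma degree_den_poly_le: "finite T \<Longrightarrow> degree (den_poly T N) \<le> N * card T"
  by (simp add: degree_den_poly card_proj_set)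

lemma coeff_den_poly_top: "finite T \<Longrightarrow> Infty \<notin> T \<Longrightarrow> coeff (den_poly T N) (N * card T) = 1"
  using lead_coeff_den_poly[of T N] by (simp add: degree_den_poly card_proj_set)

text \<open>With \<open>m\<close> and \<open>n\<close> as mere bounds of the degrees this is the
  multiplicativity of the value at infinity, which \<open>rat_fun\<close> reads off as a possibly
  vanishing top coefficient.\<close>

lemma coeff_mult_top:
  fixes p q :: "'a::comm_semiring_0 poly"
  assumes "degree p \<le> m" "degree q \<le> n"
  shows "coeff (p * q) (m + n) = coeff p m * coeff q n"
proof -
  have *: "coeff p i * coeff q (m + n - i) = (if i = m then coeff p m * coeff q n else 0)" if "i \<le> m + n" for i
  proof (cases "i < m")
    case True
    then have "coeff q (m + n - i) = 0" using assms by (intro coeff_eq_0) linarith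
    then show ?thesis using True by simp
  next
    case False
    then show ?thesis using assms coeff_eq_0[of p i] by (cases "i = m") auto
  qed
  have "coeff (p * q) (m + n) = (\<Sum>i\<le>m + n. if i = m then coeff p m * coeff q n else 0)"
    unfolding coeff_mult by (intro sum.cong) (use * in auto)
  then show ?thesis by simp
qed

lemma rat_fun_poly:
  assumes "degree P \<le> N * card T"
  shows "rat_fun T N (coeff P) (Aff z) = poly P z / poly (den_poly T N) z"
proof -
  have "poly P z = poly (\<Sum>k\<le>N * card T. monom (coeff P k) k) z"
    using poly_as_sum_of_monoms'[OF assms] by simp
  then show ?thesis by (simp add: poly_den_poly poly_sum poly_monom)
qed

text \<open>The denominator has degree \<open>N\<close> times the number of finite points of
  \<open>T\<close>. If infinity lies in \<open>T\<close>, the remaining \<open>N\<close> in the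
  degree bound permits a pole of order \<open>N\<close> there; otherwise the bound is the degree of
  the monic denominator, and the top coefficient is the value at infinity.\<close>

lemma pole_le_iff:
  "pole_le T N f \<longleftrightarrow> (\<exists>P. degree P \<le> N * card T \<and>
     (\<forall>z. Aff z \<notin> T \<longrightarrow> f (Aff z) = poly P z / poly (den_poly T N) z) \<and>
     (Infty \<notin> T \<longrightarrow> f Infty = coeff P (N * card T)))" (is "_ \<longleftrightarrow> (\<exists>P. ?Q P)")
proof
  assume "pole_le T N f"
  then obtain c where c: "\<And>x. x \<notin> T \<Longrightarrow> f x = rat_fun T N c x" by (auto simp: pole_le_def)
  define P where "P = (\<Sum>k\<le>N * card T. monom (c k) k)"
  have co: "coeff P k = (if k \<le> N * card T then c k else 0)" for k
    by (simp add: P_def coeff_sum)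
  have "degree P \<le> N * card T" using co by (intro degree_le) auto
  moreover have "poly P z = (\<Sum>k\<le>N * card T. c k * z ^ k)" for z
    by (simp add: P_def poly_sum poly_monom)
  ultimately have "?Q P" using c co by (auto simp: poly_den_poly)
  then show "\<exists>P. ?Q P" by blast
next
  assume "\<exists>P. ?Q P"
  then obtain P where P: "?Q P" by blast
  have "f x = rat_fun T N (coeff P) x" if "x \<in> - T" for x
    using P that rat_fun_poly[of P N T] by (cases x) auto
  then show "pole_le T N f" unfolding pole_le_def by blast
qed

lemma pole_leE:
  assumes "pole_le T N f"
  obtains P where "degree P \<le> N * card T" "\<And>z. Aff z \<notin> T \<Longrightarrow> f (Aff z) = poly P z / poly (den_poly T N) z"
    "Infty \<notin> T \<Longrightarrow> f Infty = coeff P (N * card T)"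
  using assms pole_le_iff by blast

lemma pole_leI:
  assumes "degree P \<le> N * card T" "\<And>z. Aff z \<notin> T \<Longrightarrow> f (Aff z) = poly P z / poly (den_poly T N) z"
    "Infty \<notin> T \<Longrightarrow> f Infty = coeff P (N * card T)"
  shows "pole_le T N f"
  using assms pole_le_iff by blast

lemma pole_le_cong: "(\<And>x. x \<notin> T \<Longrightarrow> f x = g x) \<Longrightarrow> pole_le T N f \<longleftrightarrow> pole_le T N g"
  by (simp add: pole_le_def)

lemma pole_le_const: "finite T \<Longrightarrow> pole_le T N (\<lambda>_. c)"
  by (rule pole_leI[of "smult c (den_poly T N)"])
     (use degree_den_poly_le[of T N] degree_smult_le[of c "den_poly T N"]
       in \<open>auto simp: poly_den_poly_nonzero coeff_den_poly_top\<close>)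

lemma pole_le_add: 
  assumes "pole_le T N f" "pole_le T N g" shows "pole_le T N (\<lambda>x. f x + g x)"
proof -
  from assms(1) obtain P where P: "degree P \<le> N * card T" "\<And>z. Aff z \<notin> T \<Longrightarrow> f (Aff z) = poly P z / poly (den_poly T N) z"
    "Infty \<notin> T \<Longrightarrow> f Infty = coeff P (N * card T)" by (rule pole_leE) blast
  from assms(2) obtain Q where Q: "degree Q \<le> N * card T" "\<And>z. Aff z \<notin> T \<Longrightarrow> g (Aff z) = poly Q z / poly (den_poly T N) z"
    "Infty \<notin> T \<Longrightarrow> g Infty = coeff Q (N * card T)" by (rule pole_leE) blast
  show ?thesis by (rule pole_leI[of "P + Q"]) (use P Q degree_add_le in \<open>auto simp: add_divide_distrib\<close>)
qed

lemma pole_le_mult: 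
  assumes "pole_le T N f" "pole_le T M g" shows "pole_le T (N + M) (\<lambda>x. f x * g x)"
proof -
  from assms(1) obtain P where P: "degree P \<le> N * card T" "\<And>z. Aff z \<notin> T \<Longrightarrow> f (Aff z) = poly P z / poly (den_poly T N) z"
    "Infty \<notin> T \<Longrightarrow> f Infty = coeff P (N * card T)" by (rule pole_leE) blast
  from assms(2) obtain Q where Q: "degree Q \<le> M * card T" "\<And>z. Aff z \<notin> T \<Longrightarrow> g (Aff z) = poly Q z / poly (den_poly T M) z"
    "Infty \<notin> T \<Longrightarrow> g Infty = coeff Q (M * card T)" by (rule pole_leE) blast
  show ?thesis
    by (rule pole_leI[of "P * Q"])
      (use P Q degree_mult_le[of P Q] coeff_mult_top[OF P(1) Q(1)] in \<open>auto simp: den_poly_add algebra_simps\<close>)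
qed

lemma pole_le_mono: 
  assumes "finite T" "pole_le T N f" "N \<le> M" shows "pole_le T M f"
  using pole_le_mult[OF assms(2) pole_le_const[OF assms(1), of "M - N" 1]] assms(3) by simp

lemma pole_le_cmult: "finite T \<Longrightarrow> pole_le T N f \<Longrightarrow> pole_le T N (\<lambda>x. c * f x)"
  using pole_le_mult[OF pole_le_const[of T 0 c], of N f] by simp

lemma pole_le_diff: 
  assumes "finite T" "pole_le T N f" "pole_le T N g" shows "pole_le T N (\<lambda>x. f x - g x)"
  using pole_le_add[OF assms(2) pole_le_cmult[OF assms(1,3), of "-1"]] by simp

lemma pole_le_sum: 
  assumes "finite T" "\<And>i. i \<in> I \<Longrightarrow> pole_le T N (f i)" shows "pole_le T N (\<lambda>x. \<Sum>i\<in>I. f i x)"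
  using assms(2) by (induction I rule: infinite_finite_induct) (auto intro: pole_le_const[OF assms(1)] pole_le_add)

lemma pole_le_prod: 
  assumes "finite T" "finite I" "\<And>i. i \<in> I \<Longrightarrow> pole_le T N (f i)" shows "pole_le T (card I * N) (\<lambda>x. \<Prod>i\<in>I. f i x)"
  using assms(2,3) by (induction I) (auto intro: pole_le_const[OF assms(1)] pole_le_mult)

lemma pole_le_superset:
  assumes T: "finite T'" "T \<subseteq> T'" and f: "pole_le T N f" shows "pole_le T' N f"
proof -
  obtain P where P: "degree P \<le> N * card T" "\<And>z. Aff z \<notin> T \<Longrightarrow> f (Aff z) = poly P z / poly (den_poly T N) z"
    "Infty \<notin> T \<Longrightarrow> f Infty = coeff P (N * card T)" using f by (rule pole_leE) blast
  have fT: "finite T" using T finite_subset by blast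
  define E where "E = den_poly (T' - T) N"
  have E: "den_poly T' N = den_poly T N * E"
  proof -
    have "{s. Aff s \<in> T'} = {s. Aff s \<in> T} \<union> {s. Aff s \<in> T' - T}" using T by auto
    then show ?thesis unfolding E_def den_poly_def
      using finite_Aff_in[OF fT] finite_Aff_in[of "T' - T"] T(1) by (subst prod.union_disjoint[symmetric]) auto
  qed
  have c: "card T' = card T + card (T' - T)" using T fT by (metis card_Diff_subset card_mono le_add_diff_inverse)
  have dE: "degree E \<le> N * card (T' - T)" unfolding E_def using T by (intro degree_den_poly_le) auto
  show ?thesis
  proof (rule pole_leI[of "P * E"])
    show "degree (P * E) \<le> N * card T'" using degree_mult_le[of P E] P(1) dE c by (simp add: algebra_simps)
    fix z assume z: "Aff z \<notin> T'"
    then have "poly E z \<noteq> 0" unfolding E_def using T by (intro poly_den_poly_nonzero) auto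
    then show "f (Aff z) = poly (P * E) z / poly (den_poly T' N) z" using P z T by (auto simp: E)
  next
    assume i: "Infty \<notin> T'"
    have "coeff (P * E) (N * card T') = coeff P (N * card T) * coeff E (N * card (T' - T))"
      using coeff_mult_top[OF P(1) dE] c by (simp add: algebra_simps)
    then show "f Infty = coeff (P * E) (N * card T')" using i P T by (auto simp: E_def coeff_den_poly_top)
  qed
qed

lemma poly_eq_if_infinite:
  assumes "infinite Z" "\<And>z. z \<in> Z \<Longrightarrow> poly p z = poly q z" shows "p = (q :: complex poly)"
proof (rule ccontr)
  assume "p \<noteq> q"
  then have "finite {z. poly (p - q) z = 0}" by (intro poly_roots_finite) auto
  moreover have "Z \<subseteq> {z. poly (p - q) z = 0}" using assms(2) by auto
  ultimately show False using assms(1) finite_subset by blast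
qed

text \<open>Identity theorem: infinitely many zeros kill the numerator of the difference, and with
  it the value at infinity.\<close>

lemma pole_le_eq_everywhere:
  assumes T: "finite T" and f: "pole_le T N f" and g: "pole_le T M g"
    and Z: "infinite Z" "\<And>z. z \<in> Z \<Longrightarrow> Aff z \<notin> T \<and> f (Aff z) = g (Aff z)" and x: "x \<notin> T"
  shows "f x = g x"
proof -
  have "pole_le T (max N M) (\<lambda>x. f x - g x)" 
    by (intro pole_le_diff[OF T] pole_le_mono[OF T f] pole_le_mono[OF T g]) auto
  then obtain P where P: "degree P \<le> max N M * card T" 
    "\<And>z. Aff z \<notin> T \<Longrightarrow> f (Aff z) - g (Aff z) = poly P z / poly (den_poly T (max N M)) z"
    "Infty \<notin> T \<Longrightarrow> f Infty - g Infty = coeff P (max N M * card T)" by (rule pole_leE) blast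
  have "poly P z = poly 0 z" if "z \<in> Z" for z 
    using P(2)[of z] Z(2)[OF that] poly_den_poly_nonzero[OF T] by auto
  then have "P = 0" using Z(1) poly_eq_if_infinite by blast
  then show ?thesis using P x by (cases x) auto
qed

lemma prod_linear_extend:
  fixes m :: "complex \<Rightarrow> nat"
  assumes "finite B" "A \<subseteq> B" "\<And>s. s \<in> B \<Longrightarrow> m s \<le> K" "\<And>s. s \<in> B - A \<Longrightarrow> m s = 0"
  shows "(\<Prod>s\<in>A. [:- s, 1:] ^ m s) * (\<Prod>s\<in>B. [:- s, 1:] ^ (K - m s)) = (\<Prod>s\<in>B. [:- s, 1:] ^ K)"
proof -
  have "(\<Prod>s\<in>A. [:- s, 1:] ^ m s) = (\<Prod>s\<in>B. [:- s, 1:] ^ m s)"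
    by (rule prod.mono_neutral_left) (use assms in auto)
  then show ?thesis using assms by (simp add: prod.distrib[symmetric] power_add[symmetric])
qed

text \<open>All roots of \<open>Q\<close> are finite points of \<open>T\<close>, and each has order
  at most the degree, so exponent \<open>K\<close> at every such point leaves room for a cofactor
  \<open>R\<close>.\<close>

lemma inverse_poly_over_den:
  assumes T: "finite T" and Q: "Q \<noteq> 0" "\<And>z. Aff z \<notin> T \<Longrightarrow> poly Q z \<noteq> 0" and K: "degree Q \<le> K"
  obtains R where "degree Q + degree R = K * card {s. Aff s \<in> T}" "Q * R = den_poly T K"
proof -
  define m where "m s = Polynomial.order s Q" for s
  define A where "A = {z. poly Q z = 0}"
  define B where "B = {s. Aff s \<in> T}"
  define R where "R = smult (inverse (lead_coeff Q)) (\<Prod>s\<in>B. [:- s, 1:] ^ (K - m s))"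
  have B: "finite B" using T finite_Aff_in B_def by blast
  have sub: "A \<subseteq> B" using Q A_def B_def by auto
  have mK: "m s \<le> K" for s using order_degree[OF Q(1), of s] K m_def by simp
  have m0: "m s = 0" if "s \<in> B - A" for s using that by (auto simp: m_def A_def order_0I)
  have "Q = smult (lead_coeff Q) (\<Prod>s\<in>A. [:- s, 1:] ^ m s)"
    unfolding A_def m_def by (rule complex_poly_decompose[symmetric])
  then have "Q * R = smult (lead_coeff Q) (\<Prod>s\<in>A. [:- s, 1:] ^ m s) * R" by argo
  also have "\<dots> = (\<Prod>s\<in>A. [:- s, 1:] ^ m s) * (\<Prod>s\<in>B. [:- s, 1:] ^ (K - m s))" using Q(1) by (simp add: R_def)
  also have "\<dots> = den_poly T K" unfolding den_poly_def B_def[symmetric] using prod_linear_extend[OF B sub mK m0] .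
  finally have QR: "Q * R = den_poly T K" .
  have "R \<noteq> 0" using QR den_poly_nonzero by (metis mult_zero_right)
  then have "degree Q + degree R = K * card {s. Aff s \<in> T}"
    using QR degree_den_poly[of T K] degree_mult_eq[OF Q(1)] by metis
  with QR that show thesis by blast
qed

text \<open>The numerator \<open>P\<close> has all its roots in \<open>T\<close> and degree at most
  \<open>N * card T\<close>, so it divides the denominator of that order. If infinity is outside
  \<open>T\<close>, the nonzero value there says that the degree is exactly
  \<open>N * card T\<close>, which makes the degrees match in the quotient.\<close>

lemma pole_le_inverse:
  assumes T: "finite T" and f: "pole_le T N f" and nz: "\<And>x. x \<notin> T \<Longrightarrow> f x \<noteq> 0"
  shows "pole_le T (N * card T) (\<lambda>x. inverse (f x))"
proof -
  obtain P where P: "degree P \<le> N * card T" "\<And>z. Aff z \<notin> T \<Longrightarrow> f (Aff z) = poly P z / poly (den_poly T N) z"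
    "Infty \<notin> T \<Longrightarrow> f Infty = coeff P (N * card T)" using f by (rule pole_leE) blast
  have Pz: "poly P z \<noteq> 0" if "Aff z \<notin> T" for z using P(2)[OF that] nz[OF that] by auto
  obtain z0 where "Aff z0 \<notin> T" using ex_Aff_notin[OF T] by (metis (no_types, lifting) Collect_empty_eq finite.emptyI)
  then have P0: "P \<noteq> 0" using Pz by auto
  define K where "K = N * card T"
  define D where "D = den_poly T N"
  obtain R where R: "degree P + degree R = K * card {s. Aff s \<in> T}" "P * R = den_poly T K"
    using inverse_poly_over_den[OF T P0 Pz, of K] P(1) K_def by blast
  have R0: "R \<noteq> 0" using R(2) den_poly_nonzero by (metis mult_zero_right)
  \<comment> \<open>From \<open>P * R = den_poly T K\<close> the inverse \<open>D / P\<close>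
    becomes \<open>D * R / den_poly T K\<close>.\<close>
  show ?thesis unfolding K_def[symmetric]
  proof (rule pole_leI[of "D * R"])
    have dd: "degree (D * R) = N * card {s. Aff s \<in> T} + degree R"
      by (metis D_def R0 degree_den_poly degree_mult_eq den_poly_nonzero)
    show "degree (D * R) \<le> K * card T"
    proof (cases "Infty \<in> T")
      case True
      then have c: "card T = card {s. Aff s \<in> T} + 1" using card_proj_set[OF T] by simp
      have "N * card {s. Aff s \<in> T} \<le> K" unfolding K_def c by simp
      then show ?thesis using dd R(1) c by simp
    next
      case False
      then have c: "card T = card {s. Aff s \<in> T}" using card_proj_set[OF T] by simp
      have "coeff P K \<noteq> 0" using nz[of Infty] False P(3) K_def by auto
      then have "degree P = K" using P(1) K_def le_degree[of P K] by simp
      then show ?thesis using dd R(1) c K_def by simp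
    qed
    fix z assume z: "Aff z \<notin> T"
    have "poly P z * poly R z = poly (den_poly T K) z" using R(2) by (metis poly_mult)
    moreover have "poly (den_poly T K) z \<noteq> 0" using poly_den_poly_nonzero[OF T z] .
    ultimately have "poly R z \<noteq> 0" "poly (den_poly T K) z = poly P z * poly R z" by auto
    then show "inverse (f (Aff z)) = poly (D * R) z / poly (den_poly T K) z"
      using P(2)[OF z] by (simp add: D_def)
  next
    assume i: "Infty \<notin> T"
    then have c: "card T = card {s. Aff s \<in> T}" using card_proj_set[OF T] by simp
    have f0: "coeff P K \<noteq> 0" using nz[of Infty] i P(3) K_def by auto
    then have dP: "degree P = K" using P(1) K_def le_degree[of P K] by simp
    have "lead_coeff P * lead_coeff R = 1" using R(2) lead_coeff_den_poly by (metis lead_coeff_mult)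
    moreover have "lead_coeff (D * R) = lead_coeff R" using lead_coeff_den_poly[of T N] by (simp add: lead_coeff_mult D_def)
    moreover have "degree (D * R) = K * card T"
      using R(1) dP c K_def D_def R0 degree_den_poly degree_mult_eq den_poly_nonzero
      by (metis add.commute)
    ultimately have "coeff P K * coeff (D * R) (K * card T) = 1" using dP by simp
    then show "inverse (f Infty) = coeff (D * R) (K * card T)"
      using P(3)[OF i] by (simp add: K_def inverse_unique)
  qed
qed

section \<open>Regular functions as rational functions of bounded pole order\<close>

lemma tendsto_inverse_poly_sum:
  fixes P :: "complex poly"
  assumes "degree P \<le> K"
  shows "((\<lambda>z. poly P z / z ^ K) \<longlongrightarrow> coeff P K) at_infinity"
proof -
  have *: "((\<lambda>z::complex. coeff P i * inverse z ^ (K - i)) \<longlongrightarrow> (if i = K then coeff P K else 0)) at_infinity" if "i \<le> K" for i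
  proof (cases "i = K")
    case False
    then have "((\<lambda>z::complex. coeff P i * inverse z ^ (K - i)) \<longlongrightarrow> coeff P i * 0 ^ (K - i)) at_infinity"
      by (intro tendsto_intros tendsto_inverse_0)
    then show ?thesis using False that by (simp add: power_0_left)
  qed auto
  have "((\<lambda>z. \<Sum>i\<le>K. coeff P i * inverse z ^ (K - i)) \<longlongrightarrow> (\<Sum>i\<le>K. if i = K then coeff P K else 0)) at_infinity"
    by (intro tendsto_sum *) auto
  moreover have "\<forall>\<^sub>F z in at_infinity. (\<Sum>i\<le>K. coeff P i * inverse z ^ (K - i)) = poly P z / z ^ K"
  proof (rule eventually_mono[OF eventually_not_equal_at_infinity[of 0]])
    fix z :: complex assume z: "z \<noteq> 0"
    have "poly P z = poly (\<Sum>k\<le>K. monom (coeff P k) k) z" using poly_as_sum_of_monoms'[OF assms] by simp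
    also have "\<dots> / z ^ K = (\<Sum>i\<le>K. coeff P i * inverse z ^ (K - i))"
      unfolding poly_sum poly_monom sum_divide_distrib
    proof (intro sum.cong refl)
      fix i assume "i \<in> {..K}"
      then have "z ^ K = z ^ i * z ^ (K - i)" by (simp flip: power_add)
      then show "coeff P i * z ^ i / z ^ K = coeff P i * inverse z ^ (K - i)" using z by (simp add: field_simps)
    qed
    finally show "(\<Sum>i\<le>K. coeff P i * inverse z ^ (K - i)) = poly P z / z ^ K" by simp
  qed
  ultimately show ?thesis by (simp add: tendsto_cong)
qed

text \<open>This converts regularity at infinity, which is given in the coordinate
  \<open>1 / z\<close>, into a degree bound and a formula for the value by coefficients.\<close>

lemma quotient_tendsto_at_infinity:
  fixes P Q :: "complex poly"
  assumes lim: "((\<lambda>z. poly P z / poly Q z) \<longlongrightarrow> l) at_infinity" and Q: "Q \<noteq> 0"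
  shows "degree P \<le> degree Q \<and> l = coeff P (degree Q) / lead_coeff Q"
proof -
  define n where "n = max (degree P) (degree Q)"
  have Q1: "((\<lambda>z. poly Q z / z ^ degree Q) \<longlongrightarrow> lead_coeff Q) at_infinity" by (rule tendsto_inverse_poly_sum) simp
  have lQ: "lead_coeff Q \<noteq> 0" using Q by simp
  have dP: "degree P \<le> degree Q"
  proof (rule ccontr)
    assume d: "\<not> degree P \<le> degree Q"
    have "((\<lambda>z. poly P z / z ^ degree P) \<longlongrightarrow> lead_coeff P) at_infinity" by (rule tendsto_inverse_poly_sum) simp
    moreover have "((\<lambda>z. (poly P z / poly Q z) * (poly Q z / z ^ degree Q) * inverse z ^ (degree P - degree Q))
       \<longlongrightarrow> l * lead_coeff Q * 0 ^ (degree P - degree Q)) at_infinity"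
      by (intro tendsto_intros tendsto_inverse_0 lim Q1)
    moreover have "\<forall>\<^sub>F z in at_infinity. (poly P z / poly Q z) * (poly Q z / z ^ degree Q) * inverse z ^ (degree P - degree Q) = poly P z / z ^ degree P"
    proof -
      have "\<forall>\<^sub>F z in at_infinity. poly Q z \<noteq> 0"
        by (rule eventually_mono[OF tendsto_imp_eventually_ne[OF Q1 lQ]]) auto
      then show ?thesis
      proof (rule eventually_mono[OF eventually_conj[OF _ eventually_not_equal_at_infinity[of 0]]])
        fix z :: complex assume z: "poly Q z \<noteq> 0 \<and> z \<noteq> 0"
        have "z ^ degree P = z ^ degree Q * z ^ (degree P - degree Q)" using d by (simp flip: power_add)
        then show "(poly P z / poly Q z) * (poly Q z / z ^ degree Q) * inverse z ^ (degree P - degree Q) = poly P z / z ^ degree P"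
          using z by (simp add: field_simps)
      qed
    qed
    ultimately have "((\<lambda>z. poly P z / z ^ degree P) \<longlongrightarrow> 0) at_infinity" using d by (simp add: tendsto_cong power_0_left)
    then have "lead_coeff P = 0" using \<open>((\<lambda>z. poly P z / z ^ degree P) \<longlongrightarrow> lead_coeff P) at_infinity\<close>
      using tendsto_unique[OF trivial_limit_at_infinity] by blast
    then show False using d by simp
  qed
  have "((\<lambda>z. (poly P z / z ^ degree Q) / (poly Q z / z ^ degree Q)) \<longlongrightarrow> coeff P (degree Q) / lead_coeff Q) at_infinity"
    by (intro tendsto_divide tendsto_inverse_poly_sum lQ Q1 dP)
  moreover have "\<forall>\<^sub>F z in at_infinity. (poly P z / z ^ degree Q) / (poly Q z / z ^ degree Q) = poly P z / poly Q z"
    by (rule eventually_mono[OF eventually_not_equal_at_infinity[of 0]]) auto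
  ultimately have "((\<lambda>z. poly P z / poly Q z) \<longlongrightarrow> coeff P (degree Q) / lead_coeff Q) at_infinity" by (rule Lim_transform_eventually)
  then show ?thesis using dP lim tendsto_unique[OF trivial_limit_at_infinity] by blast
qed

lemma cancel_common_roots:
  fixes P Q :: "complex poly"
  assumes "Q \<noteq> 0"
  shows "\<exists>g P' Q'. P = g * P' \<and> Q = g * Q' \<and> (\<forall>b. poly P' b = 0 \<longrightarrow> poly Q' b \<noteq> 0)"
  using assms
proof (induction "degree Q" arbitrary: P Q rule: less_induct)
  case less
  show ?case
  proof (cases "\<exists>b. poly P b = 0 \<and> poly Q b = 0")
    case True
    then obtain b P1 Q1 where b: "P = [:-b, 1:] * P1" "Q = [:-b, 1:] * Q1" by (auto simp: poly_eq_0_iff_dvd elim!: dvdE)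
    then have "Q1 \<noteq> 0" using less.prems by auto
    then have "degree Q1 < degree Q" unfolding b(2) by (subst degree_mult_eq) auto
    then obtain g P' Q' where "P1 = g * P'" "Q1 = g * Q'" "\<forall>b. poly P' b = 0 \<longrightarrow> poly Q' b \<noteq> 0"
      using less.hyps[of Q1 P1] \<open>Q1 \<noteq> 0\<close> by blast
    then show ?thesis unfolding b by (intro exI[of _ "[:-b, 1:] * g"] exI[of _ P'] exI[of _ Q']) (simp only: mult.assoc)
  next
    case False
    then show ?thesis by (intro exI[of _ 1] exI[of _ P] exI[of _ Q]) auto
  qed
qed

text \<open>A single reduced fraction \<open>P / Q\<close> represents \<open>f\<close> at all finite
  points outside \<open>T\<close>: cross-multiplying with the local quotient at \<open>b\<close>
  shows that a root \<open>b\<close> of \<open>Q\<close> would also be a root of \<open>P\<close>.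
  Hence the roots of \<open>Q\<close> lie in \<open>T\<close>, and \<open>Q\<close> can be completed
  to a power of the standard denominator.\<close>

lemma regular_off_imp_pole_le:
  assumes T: "finite T" and f: "regular_off T f"
  obtains N where "pole_le T N f"
proof -
  obtain a where a: "Aff a \<notin> T" using ex_Aff_notin[OF T] by (metis (no_types, lifting) Collect_empty_eq finite.emptyI)
  obtain P0 Q0 where P0: "poly Q0 a \<noteq> 0" "\<And>z. Aff z \<notin> T \<Longrightarrow> poly Q0 z \<noteq> 0 \<Longrightarrow> f (Aff z) = poly P0 z / poly Q0 z"
    using f a unfolding regular_off_def by blast
  have "Q0 \<noteq> 0" using P0 by auto
  then obtain g P Q where PQ: "P0 = g * P" "Q0 = g * Q" "\<And>b. poly P b = 0 \<Longrightarrow> poly Q b \<noteq> 0" 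
    using cancel_common_roots[of Q0 P0] by blast
  have Q0: "Q \<noteq> 0" using \<open>Q0 \<noteq> 0\<close> PQ by auto
  have inf: "infinite {z. Aff z \<notin> T \<and> poly R z \<noteq> 0}" if "R \<noteq> 0" for R
  proof -
    have "{z. Aff z \<notin> T \<and> poly R z \<noteq> 0} = {z. Aff z \<notin> T} - {z. poly R z = 0}" by auto
    then show ?thesis using ex_Aff_notin[OF T] poly_roots_finite[OF that] by (simp add: Diff_infinite_finite)
  qed
  have generic: "f (Aff z) = poly P z / poly Q z" if "Aff z \<notin> T" "poly Q0 z \<noteq> 0" for z
  proof -
    have "poly P0 z = poly g z * poly P z" "poly Q0 z = poly g z * poly Q z" using PQ(1,2) by simp_all
    then show ?thesis using P0(2)[OF that] that by auto
  qed
  have *: "poly Q b \<noteq> 0 \<and> f (Aff b) = poly P b / poly Q b" if b: "Aff b \<notin> T" for b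
  proof -
    obtain P2 Q2 where P2: "poly Q2 b \<noteq> 0" "\<And>z. Aff z \<notin> T \<Longrightarrow> poly Q2 z \<noteq> 0 \<Longrightarrow> f (Aff z) = poly P2 z / poly Q2 z"
      using f b unfolding regular_off_def by blast
    then have Q2: "Q2 \<noteq> 0" by auto
    have "P * Q2 = P2 * Q"
    proof (rule poly_eq_if_infinite)
      show "infinite {z. Aff z \<notin> T \<and> poly (Q0 * Q2) z \<noteq> 0}" by (rule inf) (use \<open>Q0 \<noteq> 0\<close> Q2 in simp)
      fix z assume z: "z \<in> {z. Aff z \<notin> T \<and> poly (Q0 * Q2) z \<noteq> 0}"
      then have "poly P z / poly Q z = poly P2 z / poly Q2 z" "poly Q z \<noteq> 0" using generic[of z] P2(2)[of z] PQ(2) by auto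
      then show "poly (P * Q2) z = poly (P2 * Q) z" using z by (simp add: field_simps)
    qed
    then have e: "poly P b * poly Q2 b = poly P2 b * poly Q b" by (metis poly_mult)
    have "poly Q b \<noteq> 0"
    proof
      assume Qb: "poly Q b = 0"
      then show False using e P2(1) PQ(3) by auto
    qed
    moreover have "f (Aff b) = poly P2 b / poly Q2 b" using P2(2)[OF b P2(1)] .
    ultimately show ?thesis using e P2(1) by (simp add: frac_eq_eq)
  qed
  \<comment> \<open>\<open>degree Q\<close> is what the completion of \<open>Q\<close> to the
    standard denominator requires, and \<open>degree P\<close> pays for the pole at infinity when
    infinity lies in \<open>T\<close>.\<close>
  define K where "K = degree P + degree Q"
  obtain R where R: "degree Q + degree R = K * card {s. Aff s \<in> T}" "Q * R = den_poly T K"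
    using inverse_poly_over_den[OF T Q0, of K] * K_def by (metis le_add2)
  have fz: "f (Aff z) = poly (P * R) z / poly (den_poly T K) z" if "Aff z \<notin> T" for z
  proof -
    have "poly Q z * poly R z = poly (den_poly T K) z" using R(2) by (metis poly_mult)
    moreover have "poly (den_poly T K) z \<noteq> 0" using poly_den_poly_nonzero[OF T that] .
    ultimately show ?thesis using *[OF that] by (simp add: field_simps)
  qed
  have "pole_le T K f"
  proof (cases "Infty \<in> T")
    case True
    then have c: "card T = card {s. Aff s \<in> T} + 1" using card_proj_set[OF T] by simp
    show ?thesis
      by (rule pole_leI[of "P * R"]) (use fz True degree_mult_le[of P R] R(1) c in \<open>auto simp: K_def\<close>)
  next
    case False
    then have c: "card T = card {s. Aff s \<in> T}" using card_proj_set[OF T] by simp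
    obtain P3 Q3 where P3: "poly Q3 0 \<noteq> 0" "f Infty = poly P3 0 / poly Q3 0"
       "\<And>z. z \<noteq> 0 \<Longrightarrow> Aff z \<notin> T \<Longrightarrow> poly Q3 (1 / z) \<noteq> 0 \<Longrightarrow> f (Aff z) = poly P3 (1 / z) / poly Q3 (1 / z)"
      using f False unfolding regular_off_def by blast
    have i0: "((\<lambda>z::complex. 1 / z) \<longlongrightarrow> 0) at_infinity"
      by (rule Lim_transform_eventually[OF tendsto_inverse_0]) (auto simp: inverse_eq_divide)
    have l3: "((\<lambda>z. poly Q3 (1 / z)) \<longlongrightarrow> poly Q3 0) at_infinity" "((\<lambda>z. poly P3 (1 / z)) \<longlongrightarrow> poly P3 0) at_infinity"
      by (rule isCont_tendsto_compose[OF poly_isCont i0])+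
    have "((\<lambda>z. poly P3 (1 / z) / poly Q3 (1 / z)) \<longlongrightarrow> f Infty) at_infinity"
      using tendsto_divide[OF l3(2,1) P3(1)] P3(2) by simp
    moreover have "\<forall>\<^sub>F z in at_infinity. poly P3 (1 / z) / poly Q3 (1 / z) = poly (P * R) z / poly (den_poly T K) z"
    proof -
      have 1: "\<forall>\<^sub>F z in at_infinity. poly Q3 (1 / z) \<noteq> 0" using tendsto_imp_eventually_ne[OF l3(1) P3(1)] .
      obtain B where B: "\<And>z. Aff z \<in> T \<Longrightarrow> norm z \<le> B" using finite_imp_bounded[OF finite_Aff_in[OF T]] by (auto simp: bounded_iff)
      have 2: "\<forall>\<^sub>F z in at_infinity. Aff z \<notin> T" unfolding eventually_at_infinity using B by (intro exI[of _ "B + 1"]) force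
      show ?thesis
        using eventually_not_equal_at_infinity[of 0] 1 2 by eventually_elim (metis fz P3(3))
    qed
    ultimately have "((\<lambda>z. poly (P * R) z / poly (den_poly T K) z) \<longlongrightarrow> f Infty) at_infinity" by (simp add: tendsto_cong)
    then have "degree (P * R) \<le> K * card T \<and> f Infty = coeff (P * R) (K * card T)"
      using quotient_tendsto_at_infinity[OF _ den_poly_nonzero[of T K], of "P * R" "f Infty"]
      by (simp add: degree_den_poly[of T K] lead_coeff_den_poly[of T K, unfolded degree_den_poly] c)
    then show ?thesis by (intro pole_leI[of "P * R"] fz) auto
  qed
  then show thesis by (rule that)
qed

lemma pole_le_imp_regular_off:
  assumes T: "finite T" and f: "pole_le T N f"
  shows "regular_off T f"
proof -
  obtain P where P: "degree P \<le> N * card T" "\<And>z. Aff z \<notin> T \<Longrightarrow> f (Aff z) = poly P z / poly (den_poly T N) z"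
    "Infty \<notin> T \<Longrightarrow> f Infty = coeff P (N * card T)" using f by (rule pole_leE) blast
  have "\<exists>P Q. poly Q 0 \<noteq> 0 \<and> f Infty = poly P 0 / poly Q 0 \<and>
           (\<forall>z. z \<noteq> 0 \<and> Aff z \<notin> T \<and> poly Q (1 / z) \<noteq> 0 \<longrightarrow> f (Aff z) = poly P (1 / z) / poly Q (1 / z))" if i: "Infty \<notin> T"
  proof -
    have c: "card T = card {s. Aff s \<in> T}" using card_proj_set[OF T] i by simp
    \<comment> \<open>Reversed polynomials: numerator and denominator are
      \<open>z ^ (N * card T)\<close> times \<open>P3\<close> and \<open>Q3\<close> at
      \<open>1 / z\<close>. The two powers agree because \<open>T\<close> has only finite points in
      this case.\<close>
    define P3 where "P3 = (\<Sum>k\<le>N * card T. monom (coeff P k) (N * card T - k))"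
    define Q3 where "Q3 = (\<Prod>s | Aff s \<in> T. [:1, - s:] ^ N)"
    have P0: "poly P3 0 = coeff P (N * card T)" 
    proof -
      have "poly P3 0 = (\<Sum>k\<le>N * card T. if k = N * card T then coeff P k else 0)"
        unfolding P3_def poly_sum poly_monom by (intro sum.cong) (auto simp: power_0_left)
      then show ?thesis by simp
    qed
    have Q0: "poly Q3 0 = 1" by (simp add: Q3_def poly_prod)
    have Pz: "poly P z = z ^ (N * card T) * poly P3 (1 / z)" if "z \<noteq> 0" for z
    proof -
      have "poly P z = poly (\<Sum>k\<le>N * card T. monom (coeff P k) k) z" using poly_as_sum_of_monoms'[OF P(1)] by simp
      also have "\<dots> = (\<Sum>k\<le>N * card T. coeff P k * z ^ k)" by (simp add: poly_sum poly_monom)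
      also have "\<dots> = (\<Sum>k\<le>N * card T. z ^ (N * card T) * (coeff P k * (1 / z) ^ (N * card T - k)))"
      proof (intro sum.cong refl)
        fix k assume "k \<in> {..N * card T}"
        then have "z ^ (N * card T) = z ^ k * z ^ (N * card T - k)" by (simp flip: power_add)
        then show "coeff P k * z ^ k = z ^ (N * card T) * (coeff P k * (1 / z) ^ (N * card T - k))" using that by (simp add: field_simps)
      qed
      finally show ?thesis by (simp add: P3_def poly_sum poly_monom sum_distrib_left)
    qed
    have Qz: "poly (den_poly T N) z = z ^ (N * card T) * poly Q3 (1 / z)" if "z \<noteq> 0" for z
    proof -
      have "poly (den_poly T N) z = (\<Prod>s | Aff s \<in> T. z ^ N * (1 - s * (1 / z)) ^ N)"
        unfolding poly_den_poly using that by (intro prod.cong refl) (simp flip: power_mult_distrib add: field_simps)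
      then show ?thesis by (simp add: Q3_def poly_prod prod.distrib c power_mult algebra_simps flip: power_mult)
    qed
    show ?thesis
      by (rule exI[of _ P3], rule exI[of _ Q3]) (use P0 Q0 P i Pz Qz in auto)
  qed
  moreover have "\<exists>P Q. poly Q a \<noteq> 0 \<and> (\<forall>z. Aff z \<notin> T \<and> poly Q z \<noteq> 0 \<longrightarrow> f (Aff z) = poly P z / poly Q z)" if "Aff a \<notin> T" for a
    using P(2) poly_den_poly_nonzero[OF T that] by blast
  ultimately show ?thesis unfolding regular_off_def by blast
qed

text \<open>At a point \<open>a\<close> where \<open>f\<close> vanishes, dividing by the Blaschke factor
  \<open>(z - a) / (1 - cnj a * z)\<close> creates no pole.\<close>

fun blaschke :: "complex \<Rightarrow> proj_line \<Rightarrow> complex" where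
  "blaschke a (Aff z) = (z - a) / (1 - cnj a * z)"
| "blaschke a Infty = - inverse (cnj a)"

lemma norm_blaschke_circle:
  assumes "norm a < 1" "norm z = 1" shows "norm (blaschke a (Aff z)) = 1"
proof -
  have "z * cnj z = 1" using assms(2) complex_norm_square[of z] by simp
  then have "1 - cnj a * z = z * cnj (z - a)" by (simp add: algebra_simps)
  then have "norm (1 - cnj a * z) = norm (z - a)" using assms(2) by (metis complex_mod_cnj mult_1 norm_mult)
  moreover have "z \<noteq> a" using assms by auto
  ultimately show ?thesis by (simp add: norm_divide)
qed

lemma blaschke_denominator_zero_iff: 
  "1 - cnj a * z = 0 \<longleftrightarrow> kappa (Aff a) = Aff z"
proof (cases "a = 0")
  case False
  then show ?thesis by (auto simp: field_simps)
qed auto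

text \<open>The factor \<open>z - a\<close> of the numerator is exchanged for
  \<open>1 - cnj a * z\<close>, so neither the denominator nor the degree bound changes. The
  preserved order \<open>N\<close> is essential: the division will be repeated a number of times
  that is not controlled in advance.\<close>

lemma pole_le_divide_blaschke:
  assumes T: "finite T" and f: "pole_le T N f" and a: "Aff a \<notin> T" and fa: "f (Aff a) = 0" 
    and k: "kappa (Aff a) \<in> T"
  obtains g where "pole_le T N g" "\<And>x. x \<notin> T \<Longrightarrow> f x = blaschke a x * g x"
proof -
  obtain P where P: "degree P \<le> N * card T" "\<And>z. Aff z \<notin> T \<Longrightarrow> f (Aff z) = poly P z / poly (den_poly T N) z"
    "Infty \<notin> T \<Longrightarrow> f Infty = coeff P (N * card T)" using f by (rule pole_leE) blast
  have "poly P a = 0" using P(2)[OF a] fa poly_den_poly_nonzero[OF T a] by simp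
  then obtain P1 where P1: "P = [:-a, 1:] * P1" by (auto simp: poly_eq_0_iff_dvd)
  define g where "g x = (case x of Aff z \<Rightarrow> (1 - cnj a * z) * poly P1 z / poly (den_poly T N) z | Infty \<Rightarrow> - cnj a * f Infty)" for x
  have sd: "degree P = Suc (degree P1)" if "P1 \<noteq> 0" unfolding P1 using that by (subst degree_mult_eq) auto
  have dP1: "degree P1 \<le> N * card T - 1" using P(1) sd by (cases "P1 = 0") auto
  have K1: "1 \<le> N * card T" if "P1 \<noteq> 0" using P(1) sd[OF that] by linarith
  have "pole_le T N g"
  proof (rule pole_leI[of "[:1, - cnj a:] * P1"])
    show "degree ([:1, - cnj a:] * P1) \<le> N * card T"
    proof (cases "P1 = 0")
      case False
      have "degree [:1, - cnj a:] \<le> 1" by simp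
      then show ?thesis using degree_mult_le[of "[:1, - cnj a:]" P1] dP1 K1[OF False] by linarith
    qed simp
    show "g (Aff z) = poly ([:1, - cnj a:] * P1) z / poly (den_poly T N) z" if "Aff z \<notin> T" for z
      by (simp add: g_def algebra_simps)
    assume i: "Infty \<notin> T"
    show "g Infty = coeff ([:1, - cnj a:] * P1) (N * card T)"
    proof (cases "P1 = 0")
      case True
      then show ?thesis using P(3)[OF i] P1 by (simp add: g_def)
    next
      case False
      obtain m where m: "N * card T = Suc m" using K1[OF False] by (metis Suc_le_D One_nat_def)
      have "coeff P1 (Suc m) = 0" using dP1 m by (intro coeff_eq_0) simp
      then show ?thesis using P(3)[OF i] P1 m by (simp add: g_def)
    qed
  qed
  moreover have "f x = blaschke a x * g x" if x: "x \<notin> T" for x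
  proof (cases x)
    case (Aff z)
    then have "1 - cnj a * z \<noteq> 0" using blaschke_denominator_zero_iff[of a z] k x by auto
    moreover have "f x = (z - a) * poly P1 z / poly (den_poly T N) z" using P(2)[of z] x Aff by (simp add: P1 algebra_simps)
    ultimately show ?thesis by (simp add: g_def Aff)
  next
    case Infty
    \<comment> \<open>For \<open>a = 0\<close> the point infinity is \<open>kappa (Aff a)\<close>
      and lies in \<open>T\<close>, so the meaningless value \<open>blaschke 0 Infty\<close> is
      never reached.\<close>
    then have "a \<noteq> 0" using k x by auto
    then show ?thesis using Infty by (simp add: g_def)
  qed
  ultimately show thesis by (rule that)
qed

lemma blaschke_nonzero: "kappa (Aff a) \<noteq> x \<Longrightarrow> x \<noteq> Aff a \<Longrightarrow> blaschke a x \<noteq> 0"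
  using blaschke_denominator_zero_iff[of a] by (cases x) (auto split: if_splits)

text \<open>The pole of order \<open>N\<close> at \<open>a\<close> is traded for additional order
  \<open>N\<close> at the reflected point, which already belongs to \<open>T\<close>; this is the
  origin of \<open>2 * N\<close>.\<close>

lemma pole_le_blaschke_mult:
  assumes T: "finite T" and a: "Aff a \<notin> T" and k: "kappa (Aff a) \<in> T" and f: "pole_le (insert (Aff a) T) N f" 
  obtains g where "pole_le T (2 * N) g" "\<And>x. x \<notin> insert (Aff a) T \<Longrightarrow> g x = blaschke a x ^ N * f x"
proof -
  obtain P where P: "degree P \<le> N * card (insert (Aff a) T)" 
    "\<And>z. Aff z \<notin> insert (Aff a) T \<Longrightarrow> f (Aff z) = poly P z / poly (den_poly (insert (Aff a) T) N) z"
    "Infty \<notin> insert (Aff a) T \<Longrightarrow> f Infty = coeff P (N * card (insert (Aff a) T))" using f by (rule pole_leE) blast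
  have c: "card (insert (Aff a) T) = Suc (card T)" using T a by simp
  define B where "B = {s. Aff s \<in> T}"
  have B: "finite B" "a \<notin> B" using finite_Aff_in[OF T] a B_def by auto
  define D where "D = den_poly T N"
  have D1: "den_poly (insert (Aff a) T) N = [:-a, 1:] ^ N * D"
  proof -
    have "{s. Aff s \<in> insert (Aff a) T} = insert a B" using B_def by auto
    then show ?thesis unfolding D_def den_poly_def using B by (simp add: B_def)
  qed
  have D2: "den_poly T (2 * N) = D * D" unfolding D_def by (simp add: mult_2 den_poly_add)
  \<comment> \<open>\<open>E\<close> is the quotient of \<open>D\<close> by the \<open>N\<close>-th
    power of \<open>1 - cnj a * z\<close>. For \<open>a \<noteq> 0\<close> that linear polynomial is
    \<open>- cnj a\<close> times one of the factors of \<open>D\<close>; for \<open>a = 0\<close> it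
    is 1, and the additional pole sits at infinity.\<close>
  define E where "E = (if a = 0 then D else smult ((- inverse (cnj a)) ^ N) (\<Prod>s\<in>B - {inverse (cnj a)}. [:-s, 1:] ^ N))"
  have ED: "D = [:1, - cnj a:] ^ N * E"
  proof (cases "a = 0")
    case False
    define b where "b = inverse (cnj a)"
    have b: "b \<in> B" using False k by (simp add: b_def B_def)
    have "D = [:-b, 1:] ^ N * (\<Prod>s\<in>B - {b}. [:-s, 1:] ^ N)"
      unfolding D_def den_poly_def B_def[symmetric] using B b by (simp add: prod.remove)
    moreover have "[:1, - cnj a:] ^ N * smult ((- inverse (cnj a)) ^ N) X = [:-b, 1:] ^ N * X" for X
    proof -
      have "[:1, - cnj a:] = smult (- cnj a) [:-b, 1:]" using False by (simp add: b_def)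
      then have "[:1, - cnj a:] ^ N = smult ((- cnj a) ^ N) ([:-b, 1:] ^ N)" by (metis smult_power)
      then show ?thesis using False by (simp add: power_mult_distrib[symmetric])
    qed
    ultimately show ?thesis using False by (simp add: E_def b_def)
  qed (simp add: E_def flip: one_pCons)
  have dE: "degree (P * E) \<le> 2 * N * card T \<and> (Infty \<notin> T \<longrightarrow> coeff (P * E) (2 * N * card T) = blaschke a Infty ^ N * coeff P (N * Suc (card T)))"
  proof (cases "a = 0")
    case True
    then have i: "Infty \<in> T" using k by simp
    then have cT: "card T = card B + 1" using card_proj_set[OF T] B_def by simp
    have "degree E = N * card B" using True by (simp add: E_def D_def degree_den_poly B_def)
    then show ?thesis using degree_mult_le[of P E] P(1) c cT i by (simp add: algebra_simps)
  next
    case False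
    have "inverse (cnj a) \<in> B" using False k by (simp add: B_def)
    then have cB: "card B = Suc (card (B - {inverse (cnj a)}))" using B(1) by (metis card.remove)
    define E1 where "E1 = (\<Prod>s\<in>B - {inverse (cnj a)}. [:-s, 1:] ^ N)"
    have dE1: "degree E1 = N * card (B - {inverse (cnj a)})" "lead_coeff E1 = 1" unfolding E1_def
      by (subst degree_prod_linear) (simp, rule lead_coeff_prod_linear)
    have E: "E = smult ((- inverse (cnj a)) ^ N) E1" using False by (simp add: E_def E1_def)
    define m where "m = card (B - {inverse (cnj a)})"
    have dE: "degree E \<le> N * m" using dE1 degree_smult_le[of _ E1] E m_def by metis
    have cT: "card T = Suc m + (if Infty \<in> T then 1 else 0)" using card_proj_set[OF T] cB B_def m_def by simp
    have 1: "degree (P * E) \<le> 2 * N * card T" using degree_mult_le[of P E] P(1) c cT dE by (simp add: algebra_simps split: if_splits)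
    have "coeff (P * E) (2 * N * card T) = blaschke a Infty ^ N * coeff P (N * Suc (card T))" if "Infty \<notin> T"
    proof -
      have "2 * N * card T = N * Suc (card T) + N * m" using cT that by (simp add: algebra_simps)
      then have "coeff (P * E) (2 * N * card T) = coeff P (N * Suc (card T)) * coeff E (N * m)"
        using coeff_mult_top[OF P(1)[unfolded c] dE] by argo
      then show ?thesis using dE1 E m_def by simp
    qed
    with 1 show ?thesis by blast
  qed
  define g where "g x = (case x of Aff z \<Rightarrow> poly (P * E) z / poly (den_poly T (2 * N)) z | Infty \<Rightarrow> blaschke a Infty ^ N * f Infty)" for x
  have "pole_le T (2 * N) g"
    by (rule pole_leI[of "P * E"]) (use dE P c in \<open>auto simp: g_def\<close>)
  moreover have "g x = blaschke a x ^ N * f x" if x: "x \<notin> insert (Aff a) T" for x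
  proof (cases x)
    case (Aff z)
    then have z: "Aff z \<notin> T" "z \<noteq> a" using x by auto
    have Dz: "poly D z \<noteq> 0" using poly_den_poly_nonzero[OF T z(1)] D_def by simp
    have e: "poly D z = (1 - cnj a * z) ^ N * poly E z" by (simp add: ED algebra_simps)
    then have Ez: "poly E z \<noteq> 0" "(1 - cnj a * z) ^ N \<noteq> 0" using Dz by auto
    have "blaschke a x ^ N * f x = ((z - a) ^ N / (1 - cnj a * z) ^ N) * (poly P z / ((z - a) ^ N * poly D z))"
      using P(2)[of z] x Aff by (simp add: D1 power_divide)
    also have "\<dots> = poly P z / ((1 - cnj a * z) ^ N * poly D z)" using z by simp
    also have "\<dots> = poly P z * poly E z / (poly D z * poly D z)" using Ez by (simp add: e)
    finally show ?thesis using Aff by (simp add: g_def D2)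
  qed (simp add: g_def)
  ultimately show thesis by (rule that)
qed

text \<open>\<open>q\<close> and \<open>M\<close> are chosen before \<open>f\<close>, so one scalar
  function serves all entries of a matrix and all members of a piece. The induction generalizes
  \<open>N\<close> because each point removed doubles the order at the others.\<close>

lemma remove_disc_poles:
  assumes A: "finite A" and T: "finite T" and k: "\<And>a. a \<in> A \<Longrightarrow> norm a < 1 \<and> Aff a \<notin> T \<and> kappa (Aff a) \<in> T"
  shows "\<exists>q M. (\<forall>z. norm z = 1 \<longrightarrow> norm (q (Aff z) :: complex) = 1) \<and> (\<forall>x. x \<notin> T \<union> Aff ` A \<longrightarrow> q x \<noteq> 0) \<and>
    (\<forall>f. pole_le (T \<union> Aff ` A) N f \<longrightarrow> (\<exists>g. pole_le T M g \<and> (\<forall>x. x \<notin> T \<union> Aff ` A \<longrightarrow> g x = q x * f x)))"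
  using A k
proof (induction A arbitrary: N)
  case empty
  then show ?case by (intro exI[of _ "\<lambda>_. 1"] exI[of _ N]) auto
next
  case (insert a A)
  let ?T = "T \<union> Aff ` A"
  have a: "norm a < 1" "Aff a \<notin> ?T" "kappa (Aff a) \<in> ?T" using insert by auto
  have e: "T \<union> Aff ` insert a A = insert (Aff a) ?T" by auto
  have "\<exists>q M. (\<forall>z. norm z = 1 \<longrightarrow> norm (q (Aff z) :: complex) = 1) \<and> (\<forall>x. x \<notin> ?T \<longrightarrow> q x \<noteq> 0) \<and>
    (\<forall>f. pole_le ?T (2 * N) f \<longrightarrow> (\<exists>g. pole_le T M g \<and> (\<forall>x. x \<notin> ?T \<longrightarrow> g x = q x * f x)))"
    by (rule insert.IH) (use insert.prems in simp)
  then obtain q M where q: "\<And>z. norm z = 1 \<Longrightarrow> norm (q (Aff z) :: complex) = 1" "\<And>x. x \<notin> ?T \<Longrightarrow> q x \<noteq> 0"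
    "\<And>f. pole_le ?T (2 * N) f \<Longrightarrow> \<exists>g. pole_le T M g \<and> (\<forall>x. x \<notin> ?T \<longrightarrow> g x = q x * f x)"
    by blast
  show ?case unfolding e
  proof (rule exI[of _ "\<lambda>x. q x * blaschke a x ^ N"], rule exI[of _ M], intro conjI allI impI)
    show "norm (q (Aff z) * blaschke a (Aff z) ^ N) = 1" if "norm z = 1" for z
      using q(1)[OF that] norm_blaschke_circle[OF a(1) that] by (simp add: norm_mult norm_power)
    show "q x * blaschke a x ^ N \<noteq> 0" if "x \<notin> insert (Aff a) ?T" for x
      using that q(2)[of x] blaschke_nonzero[of a x] a(3) by auto
    fix f assume f: "pole_le (insert (Aff a) ?T) N f"
    obtain g where g: "pole_le ?T (2 * N) g" "\<And>x. x \<notin> insert (Aff a) ?T \<Longrightarrow> g x = blaschke a x ^ N * f x"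
      by (rule pole_le_blaschke_mult[OF _ a(2,3) f]) (use T insert in auto)
    obtain h where h: "pole_le T M h" "\<And>x. x \<notin> ?T \<Longrightarrow> h x = q x * g x" using q(3)[OF g(1)] by blast
    show "\<exists>g. pole_le T M g \<and> (\<forall>x. x \<notin> insert (Aff a) ?T \<longrightarrow> g x = q x * blaschke a x ^ N * f x)"
      by (rule exI[of _ h]) (use h g in auto)
  qed
qed

lemma finite_infinite_subset_card:
  assumes "infinite Z" obtains X where "X \<subseteq> Z" "finite X" "card X = n"
  using infinite_arbitrarily_large[OF assms, of n] by blast

text \<open>Lagrange interpolation recovers the coefficients from finitely many values, so that the
  coefficient topology is the topology of pointwise convergence.\<close>

lemma rat_fun_coeff_interpolation:
  assumes T: "finite T" and Z: "infinite Z" "\<And>z. z \<in> Z \<Longrightarrow> Aff z \<notin> T"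
  obtains X :: "complex set" and l :: "nat \<Rightarrow> complex \<Rightarrow> complex" where "finite X" "X \<subseteq> Z"
    "\<And>c k. k \<le> N * card T \<Longrightarrow> c k = (\<Sum>z\<in>X. l k z * rat_fun T N c (Aff z))"
proof -
  \<comment> \<open>One node more than the degree bound, so that a polynomial vanishing at all nodes
    is zero.\<close>
  obtain X where X: "X \<subseteq> Z" "finite X" "card X = Suc (N * card T)" using finite_infinite_subset_card[OF Z(1)] by blast
  define L where "L z = smult (inverse (\<Prod>w\<in>X - {z}. z - w)) (\<Prod>w\<in>X - {z}. [:-w, 1:])" for z
  have Lz: "poly (L z) w = (if w = z then 1 else 0)" if "w \<in> X" "z \<in> X" for w z
    using that X by (auto simp: L_def poly_prod)
  have dL: "degree (L z) \<le> N * card T" if "z \<in> X" for z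
  proof -
    have "degree (L z) \<le> (\<Sum>w\<in>X - {z}. degree [:-w, 1:])"
      unfolding L_def using X by (intro degree_smult_le[THEN order_trans] degree_prod_sum_le[THEN order_trans]) auto
    then show ?thesis using X that by simp
  qed
  have "c k = (\<Sum>z\<in>X. (poly (den_poly T N) z * coeff (L z) k) * rat_fun T N c (Aff z))" if k: "k \<le> N * card T" for c k
  proof -
    define P where "P = (\<Sum>k\<le>N * card T. monom (c k) k)"
    have co: "coeff P k = (if k \<le> N * card T then c k else 0)" for k
      by (simp add: P_def coeff_sum)
    have dP: "degree P \<le> N * card T" using co by (intro degree_le) auto
    have Pz: "poly P z = poly (den_poly T N) z * rat_fun T N c (Aff z)" if "z \<in> X" for z
    proof -
      have "Aff z \<notin> T" using that X Z by auto
      then show ?thesis using poly_den_poly_nonzero[OF T, of z N] by (simp add: P_def poly_sum poly_monom poly_den_poly)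
    qed
    have "P = (\<Sum>z\<in>X. smult (poly P z) (L z))" (is "P = ?R")
    proof (rule ccontr)
      assume ne: "P \<noteq> ?R"
      have "degree (P - ?R) \<le> N * card T"
        by (intro degree_diff_le dP degree_sum_le X) (use dL degree_smult_le order_trans in blast)
      moreover have "X \<subseteq> {z. poly (P - ?R) z = 0}"
      proof
        fix w assume w: "w \<in> X"
        have "poly ?R w = (\<Sum>z\<in>X. if z = w then poly P z else 0)" unfolding poly_sum
          by (intro sum.cong) (use w Lz in auto)
        then show "w \<in> {z. poly (P - ?R) z = 0}" using w X by simp
      qed
      moreover have "card {z. poly (P - ?R) z = 0} \<le> degree (P - ?R)" "finite {z. poly (P - ?R) z = 0}"
        using ne card_poly_roots_bound[of "P - ?R"] poly_roots_finite[of "P - ?R"] by simp_all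
      ultimately show False using X(3) card_mono[of "{z. poly (P - ?R) z = 0}" X] by linarith
    qed
    then have "coeff P k = coeff ?R k" by argo
    then show ?thesis using k co[of k] Pz by (auto simp: coeff_sum intro!: sum.cong)
  qed
  then show thesis using X that[of X "\<lambda>k z. poly (den_poly T N) z * coeff (L z) k"] by blast
qed

text \<open>A bound on the pole order is a family of linear relations among values at points, hence
  a closed condition for pointwise convergence. All compactness and continuity arguments below use
  it in this form; the freedom in \<open>Z\<close> allows nodes on the circle or away from the
  poles.\<close>

lemma pole_le_interpolation:
  assumes T: "finite T" and Z: "infinite Z" "\<And>z. z \<in> Z \<Longrightarrow> Aff z \<notin> T"
  obtains X :: "complex set" and l :: "proj_line \<Rightarrow> complex \<Rightarrow> complex" where "finite X" "X \<subseteq> Z"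
    "\<And>f. pole_le T N f \<longleftrightarrow> (\<forall>x. x \<notin> T \<longrightarrow> f x = (\<Sum>z\<in>X. l x z * f (Aff z)))"
proof -
  obtain X l where X: "finite X" "X \<subseteq> Z" and l: "\<And>c k. k \<le> N * card T \<Longrightarrow> c k = (\<Sum>z\<in>X. l k z * rat_fun T N c (Aff z))"
    using rat_fun_coeff_interpolation[OF T Z, of N] by metis
  define m where "m x z = rat_fun T N (\<lambda>k. l k z) x" for x z
  have lin: "rat_fun T N (\<lambda>k. \<Sum>z\<in>X. l k z * v z) x = (\<Sum>z\<in>X. m x z * v z)" for v x
  proof (cases x)
    case (Aff w)
    have "(\<Sum>k\<le>N * card T. (\<Sum>z\<in>X. l k z * v z) * w ^ k) = (\<Sum>z\<in>X. (\<Sum>k\<le>N * card T. l k z * w ^ k) * v z)"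
      unfolding sum_distrib_right by (subst sum.swap) (simp add: mult_ac)
    then show ?thesis using Aff by (simp add: m_def) (simp add: sum_divide_distrib[of _ X])
  qed (simp add: m_def)
  have dep: "rat_fun T N c x = rat_fun T N c' x" if "\<And>k. k \<le> N * card T \<Longrightarrow> c k = c' k" for c c' x
    using that by (cases x) auto
  show thesis
  proof (rule that[OF X, of m], rule iffI)
    fix f assume "pole_le T N f"
    then obtain c where c: "\<And>x. x \<notin> T \<Longrightarrow> f x = rat_fun T N c x" by (auto simp: pole_le_def)
    show "\<forall>x. x \<notin> T \<longrightarrow> f x = (\<Sum>z\<in>X. m x z * f (Aff z))"
    proof (intro allI impI)
      fix x assume x: "x \<notin> T"
      have "f x = rat_fun T N (\<lambda>k. \<Sum>z\<in>X. l k z * rat_fun T N c (Aff z)) x" 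
        unfolding c[OF x] by (rule dep) (rule l)
      also have "\<dots> = (\<Sum>z\<in>X. m x z * rat_fun T N c (Aff z))" by (rule lin)
      also have "\<dots> = (\<Sum>z\<in>X. m x z * f (Aff z))" using X Z by (intro sum.cong refl) (auto simp del: rat_fun.simps simp: c subset_iff)
      finally show "f x = (\<Sum>z\<in>X. m x z * f (Aff z))" .
    qed
  next
    fix f assume f: "\<forall>x. x \<notin> T \<longrightarrow> f x = (\<Sum>z\<in>X. m x z * f (Aff z))"
    show "pole_le T N f" unfolding pole_le_def
      by (rule exI[of _ "\<lambda>k. \<Sum>z\<in>X. l k z * f (Aff z)"]) (use f in \<open>simp add: lin\<close>)
  qed
qed

section \<open>Matrices of rational functions\<close>

lemma matrix_inv_mult:
  fixes A :: "'a::semiring_1^'n^'n"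
  assumes "invertible A" shows "A ** matrix_inv A = mat 1" "matrix_inv A ** A = mat 1"
  using someI_ex[OF assms[unfolded invertible_def]] by (auto simp: matrix_inv_def)

lemma matrix_inv_unique:
  fixes A :: "'a::semiring_1^'n^'n"
  assumes "A ** B = mat 1" "B ** A = mat 1" shows "matrix_inv A = B"
proof -
  have "invertible A" using assms invertible_def by blast
  then have "matrix_inv A = matrix_inv A ** (A ** B)" using assms by simp
  also have "\<dots> = B" by (metis matrix_inv_mult(2)[OF \<open>invertible A\<close>] matrix_mul_assoc matrix_mul_lid)
  finally show ?thesis .
qed

lemma invertible_matrix_inv:
  fixes A :: "'a::semiring_1^'n^'n"
  shows "invertible A \<Longrightarrow> invertible (matrix_inv A)"
  using matrix_inv_mult invertible_def by metis

lemma matrix_inv_matrix_inv: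
  fixes A :: "'a::semiring_1^'n^'n"
  shows "invertible A \<Longrightarrow> matrix_inv (matrix_inv A) = A"
  by (intro matrix_inv_unique matrix_inv_mult)

lemma invertible_mat_1: "invertible (mat 1 :: 'a::semiring_1^'n^'n)"
  unfolding invertible_def by (rule exI[of _ "mat 1"]) simp

lemma matrix_inv_mat_1: "matrix_inv (mat 1 :: 'a::semiring_1^'n^'n) = mat 1"
  by (rule matrix_inv_unique) auto

lemma matrix_inv_mult_distrib:
  fixes A B :: "'a::semiring_1^'n^'n"
  assumes "invertible A" "invertible B"
  shows "matrix_inv (A ** B) = matrix_inv B ** matrix_inv A"
proof (rule matrix_inv_unique)
  show "A ** B ** (matrix_inv B ** matrix_inv A) = mat 1"
    by (metis assms matrix_inv_mult(1) matrix_mul_assoc matrix_mul_rid)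
  show "matrix_inv B ** matrix_inv A ** (A ** B) = mat 1"
    by (metis assms matrix_inv_mult(2) matrix_mul_assoc matrix_mul_rid)
qed

lemma matrix_inv_entry:
  fixes A :: "'a::field^'n^'n"
  assumes "invertible A"
  shows "matrix_inv A $ k $ m = det (\<chi> i j. if j = k then mat 1 $ i $ m else A $ i $ j) * inverse (det A)"
proof -
  have d: "det A \<noteq> 0" using assms invertible_det_nz by blast
  have "A *v column m (matrix_inv A) = column m (mat 1)"
  proof -
    have "A *v column m B = column m (A ** B)" for B
      by (simp add: vec_eq_iff matrix_vector_mult_def column_def matrix_matrix_mult_def)
    then show ?thesis using matrix_inv_mult(1)[OF assms] by simp
  qed
  then have "column m (matrix_inv A) = (\<chi> k. det (\<chi> i j. if j = k then column m (mat 1) $ i else A $ i $ j) / det A)"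
    using cramer[OF d] by blast
  then have "column m (matrix_inv A) $ k = det (\<chi> i j. if j = k then column m (mat 1) $ i else A $ i $ j) / det A" by simp
  moreover have "column l B $ i = B $ i $ l" for B :: "'a^'n^'n" and l i by (simp add: column_def)
  ultimately show ?thesis by (simp only: field_class.field_divide_inverse)
qed

text \<open>Let \<open>E\<close> be the identity with row \<open>k\<close> replaced by
  \<open>w\<close>. Conjugation by \<open>E\<close> turns the rank-one term into a change of the
  single column \<open>k\<close>, and \<open>F\<close> is the resulting matrix, whose determinant is
  its entry at \<open>(k, k)\<close>.\<close>

lemma det_identity_plus_rank_one:
  fixes v w :: "'a::field^'n"
  assumes w: "w \<noteq> 0"
  shows "det (mat 1 + (\<chi> i j. c * v $ i * w $ j)) = 1 + c * (\<Sum>i\<in>UNIV. w $ i * v $ i)"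
proof -
  obtain k where k: "w $ k \<noteq> 0" using w by (metis vec_eq_iff zero_index)
  define E :: "'a^'n^'n" where "E = (\<chi> i j. if i = k then w $ j else mat 1 $ i $ j)"
  define F :: "'a^'n^'n" where "F = (\<chi> i j. if j = k then (mat 1 *v (axis k 1 + c *s (E *v v))) $ i else mat 1 $ i $ j)"
  have dE: "det E = w $ k"
  proof -
    have "transpose E = (\<chi> i j. if j = k then (mat 1 *v w) $ i else mat 1 $ i $ j)"
      unfolding matrix_vector_mul_lid by (auto simp: E_def transpose_def vec_eq_iff mat_def)
    then have "det (transpose E) = w $ k * det (mat 1 :: 'a^'n^'n)" by (simp only: cramer_lemma)
    then show ?thesis by simp
  qed
  have dF: "det F = 1 + c * (\<Sum>i\<in>UNIV. w $ i * v $ i)"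
    unfolding F_def cramer_lemma by (simp add: axis_def matrix_vector_mult_def E_def)
  have "E ** (mat 1 + (\<chi> i j. c * v $ i * w $ j)) = F ** E"
  proof (simp only: vec_eq_iff, intro allI)
    fix i j
    have F: "F $ i $ l = mat 1 $ i $ l + (if l = k then c * (E *v v) $ i else 0)" for l
      unfolding F_def matrix_vector_mul_lid by (auto simp: mat_def axis_def)
    have "(F ** E) $ i $ j = (\<Sum>l\<in>UNIV. mat 1 $ i $ l * E $ l $ j + (if l = k then c * (E *v v) $ i * E $ l $ j else 0))"
      unfolding matrix_matrix_mult_def by (auto simp: F algebra_simps intro!: sum.cong)
    also have "\<dots> = (mat 1 ** E) $ i $ j + c * (E *v v) $ i * w $ j"
      by (simp add: sum.distrib matrix_matrix_mult_def E_def)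
    also have "\<dots> = E $ i $ j + (\<Sum>l\<in>UNIV. E $ i $ l * (c * v $ l * w $ j))"
      by (simp add: matrix_vector_mult_def sum_distrib_left sum_distrib_right mult_ac)
    also have "\<dots> = (E ** (mat 1 + (\<chi> i j. c * v $ i * w $ j))) $ i $ j"
      by (simp add: matrix_add_ldistrib) (simp add: matrix_matrix_mult_def)
    finally show "(E ** (mat 1 + (\<chi> i j. c * v $ i * w $ j))) $ i $ j = (F ** E) $ i $ j" by simp
  qed
  then have "det E * det (mat 1 + (\<chi> i j. c * v $ i * w $ j)) = det F * det E" by (metis det_mul)
  then show ?thesis using dE dF k by simp
qed

definition mpole_le :: "proj_line set \<Rightarrow> nat \<Rightarrow> (proj_line \<Rightarrow> complex^'n^'m) \<Rightarrow> bool" where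
  "mpole_le T N f \<longleftrightarrow> (\<forall>i j. pole_le T N (\<lambda>x. f x $ i $ j))"

lemma mpole_le_cong: "(\<And>x. x \<notin> T \<Longrightarrow> f x = g x) \<Longrightarrow> mpole_le T N f \<longleftrightarrow> mpole_le T N g"
proof -
  assume "\<And>x. x \<notin> T \<Longrightarrow> f x = g x"
  then have "pole_le T N (\<lambda>x. f x $ i $ j) = pole_le T N (\<lambda>x. g x $ i $ j)" for i j by (intro pole_le_cong) simp
  then show ?thesis by (simp add: mpole_le_def)
qed

lemma mpole_le_mono: "finite T \<Longrightarrow> mpole_le T N f \<Longrightarrow> N \<le> M \<Longrightarrow> mpole_le T M f"
  unfolding mpole_le_def using pole_le_mono by blast

lemma mpole_le_superset: "finite T' \<Longrightarrow> T \<subseteq> T' \<Longrightarrow> mpole_le T N f \<Longrightarrow> mpole_le T' N f"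
  unfolding mpole_le_def using pole_le_superset by blast

lemma mpole_le_const: "finite T \<Longrightarrow> mpole_le T N (\<lambda>_. A)"
  unfolding mpole_le_def using pole_le_const by blast

lemma mpole_le_mult:
  fixes f :: "proj_line \<Rightarrow> complex^'n^'m"
  assumes "finite T" "mpole_le T N f" "mpole_le T M g" shows "mpole_le T (N + M) (\<lambda>x. f x ** g x)"
  unfolding mpole_le_def matrix_matrix_mult_def using assms
  by (auto intro!: pole_le_sum pole_le_mult simp: mpole_le_def)

lemma pole_le_det:
  fixes f :: "proj_line \<Rightarrow> complex^'n^'n"
  assumes "finite T" "mpole_le T N f" shows "pole_le T (CARD('n) * N) (\<lambda>x. det (f x))"
  unfolding det_def using assms
  by (intro pole_le_sum pole_le_cmult pole_le_prod) (auto simp: mpole_le_def)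

text \<open>Cramer's rule: both determinants have pole order at most \<open>CARD('n) * N\<close>,
  and inverting the one in the denominator multiplies its order by \<open>card T\<close>.\<close>

lemma mpole_le_matrix_inv:
  fixes f :: "proj_line \<Rightarrow> complex^'n^'n"
  assumes T: "finite T" and f: "mpole_le T N f" and inv: "\<And>x. x \<notin> T \<Longrightarrow> invertible (f x)"
  shows "mpole_le T (CARD('n) * N + CARD('n) * N * card T) (\<lambda>x. matrix_inv (f x))"
  unfolding mpole_le_def
proof (intro allI)
  fix k m
  have "mpole_le T N (\<lambda>x. \<chi> i j. if j = k then mat 1 $ i $ m else f x $ i $ j)"
    unfolding mpole_le_def
  proof (intro allI)
    show "pole_le T N (\<lambda>x. (\<chi> i j. if j = k then mat 1 $ i $ m else f x $ i $ j) $ i $ j)" for i j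
      using f T by (cases "j = k") (auto simp: mpole_le_def intro: pole_le_const)
  qed
  then have 1: "pole_le T (CARD('n) * N) (\<lambda>x. det (\<chi> i j. if j = k then mat 1 $ i $ m else f x $ i $ j))" by (rule pole_le_det[OF T])
  have 2: "pole_le T (CARD('n) * N * card T) (\<lambda>x. inverse (det (f x)))"
    by (rule pole_le_inverse[OF T pole_le_det[OF T f]]) (use inv invertible_det_nz in blast)
  show "pole_le T (CARD('n) * N + CARD('n) * N * card T) (\<lambda>x. matrix_inv (f x) $ k $ m)"
    by (rule pole_le_cong[THEN iffD2, OF _ pole_le_mult[OF 1 2]]) (use inv matrix_inv_entry in blast)
qed

lemma pole_le_matrix_poly:
  assumes T: "finite T" and p: "matrix_poly p" and f: "mpole_le T N f"
  shows "\<exists>M. pole_le T M (\<lambda>x. p (f x))"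
  using p
proof induction
  case (const c)
  then show ?case using pole_le_const[OF T] by blast
next
  case (entry i j)
  then show ?case using f mpole_le_def by blast
next
  case (add p q)
  then obtain M K where MK: "pole_le T M (\<lambda>x. p (f x))" "pole_le T K (\<lambda>x. q (f x))" by blast
  have "pole_le T (max M K) (\<lambda>x. p (f x) + q (f x))" 
    by (intro pole_le_add pole_le_mono[OF T MK(1)] pole_le_mono[OF T MK(2)]) auto
  then show ?case by blast
next
  case (mult p q)
  then show ?case using pole_le_mult by blast
qed

section \<open>Continuity of matrix operations\<close>

lemma continuous_on_matrix_mult [continuous_intros]:
  fixes f :: "'a::topological_space \<Rightarrow> complex^'n^'m" and g :: "'a \<Rightarrow> complex^'k^'n"
  assumes "continuous_on S f" "continuous_on S g" shows "continuous_on S (\<lambda>x. f x ** g x)"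
  unfolding matrix_matrix_mult_def by (intro continuous_intros assms)

lemma continuous_on_det_complex [continuous_intros]:
  fixes f :: "'a::topological_space \<Rightarrow> complex^'n^'n"
  assumes "continuous_on S f" shows "continuous_on S (\<lambda>x. det (f x))"
  unfolding det_def by (intro continuous_intros assms)

lemma continuous_on_matrix_poly:
  assumes "matrix_poly p" shows "continuous_on S p"
  using assms by induction (auto intro!: continuous_intros)

lemma continuous_on_matrix_inv [continuous_intros]:
  fixes f :: "'a::topological_space \<Rightarrow> complex^'n^'n"
  assumes f: "continuous_on S f" and inv: "\<And>x. x \<in> S \<Longrightarrow> invertible (f x)"
  shows "continuous_on S (\<lambda>x. matrix_inv (f x))"
proof -
  have e: "continuous_on S (\<lambda>x. det (\<chi> i j. if j = k then mat 1 $ i $ m else f x $ i $ j) * inverse (det (f x)))" for k m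
  proof (intro continuous_intros f)
    show "continuous_on S (\<lambda>x. if j = k then mat 1 $ i $ m else f x $ i $ j)" for i j
      using f by (cases "j = k") (auto intro!: continuous_intros)
    show "\<forall>x\<in>S. det (f x) \<noteq> 0" using inv invertible_det_nz by blast
  qed
  have "continuous_on S (\<lambda>x. \<chi> k m. det (\<chi> i j. if j = k then mat 1 $ i $ m else f x $ i $ j) * inverse (det (f x)))"
    by (intro continuous_on_vec_lambda e)
  moreover have "matrix_inv (f x) = (\<chi> k m. det (\<chi> i j. if j = k then mat 1 $ i $ m else f x $ i $ j) * inverse (det (f x)))" if "x \<in> S" for x
    by (simp add: vec_eq_iff matrix_inv_entry[OF inv[OF that]])
  ultimately show ?thesis using continuous_on_eq[of S _ "\<lambda>x. matrix_inv (f x)"] by simp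
qed

lemma open_invertible: "open {A :: complex^'n^'n. invertible A}"
proof -
  have "{A :: complex^'n^'n. invertible A} = det -` (- {0})" by (auto simp: invertible_det_nz)
  moreover have "continuous_on UNIV (det :: complex^'n^'n \<Rightarrow> complex)" using continuous_on_det_complex[of UNIV "\<lambda>x. x"] by simp
  ultimately show ?thesis by (auto intro!: open_vimage)
qed

section \<open>Unitary factors of rational matrices\<close>

lemma matrix_add_rdistrib:
  fixes A B :: "'a::semiring_1^'n^'m"
  shows "(A + B) ** C = A ** C + B ** C"
  by (simp add: vec_eq_iff matrix_matrix_mult_def distrib_right sum.distrib)

definition cadj :: "complex^'n^'m \<Rightarrow> complex^'m^'n" where
  "cadj A = (\<chi> i j. cnj (A $ j $ i))"

lemma cadj_entry [simp]: "cadj A $ i $ j = cnj (A $ j $ i)"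
  by (simp add: cadj_def)

lemma cadj_cadj [simp]: "cadj (cadj A) = A"
  by (simp add: vec_eq_iff)

lemma cadj_mult: "cadj (A ** B) = cadj B ** cadj A"
  by (simp add: vec_eq_iff matrix_matrix_mult_def mult.commute)

lemma cadj_mat_1 [simp]: "cadj (mat 1) = mat 1"
  by (simp add: vec_eq_iff mat_def)

lemma cadj_add: "cadj (A + B) = cadj A + cadj B"
  by (simp add: vec_eq_iff)

text \<open>\<open>U\<close> multiplies one line by the unimodular number \<open>b\<close> and fixes
  its orthogonal complement. The matrices \<open>q c\<close> are the multiples of the projection
  onto that line, so the claim reduces to \<open>b * cnj b = 1\<close>.\<close>

lemma unitary_identity_plus_projection:
  fixes w :: "complex^'n"
  assumes w: "(\<Sum>i\<in>UNIV. w $ i * cnj (w $ i)) = 1" and b: "norm b = 1"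
  defines "U \<equiv> mat 1 + (\<chi> i j. (b - 1) * cnj (w $ i) * w $ j)"
  shows "cadj U ** U = mat 1"
proof -
  define q :: "complex \<Rightarrow> complex^'n^'n" where "q c = (\<chi> i j. c * cnj (w $ i) * w $ j)" for c
  have qq: "q c ** q d = q (c * d)" for c d
  proof (simp only: vec_eq_iff, intro allI)
    fix i j
    have "(q c ** q d) $ i $ j = c * cnj (w $ i) * d * w $ j * (\<Sum>k\<in>UNIV. w $ k * cnj (w $ k))"
      by (simp add: q_def matrix_matrix_mult_def sum_distrib_left mult_ac)
    then show "(q c ** q d) $ i $ j = q (c * d) $ i $ j" using w by (simp add: q_def mult_ac)
  qed
  have q1: "q c + q d = q (c + d)" for c d by (simp add: q_def vec_eq_iff algebra_simps)
  have q2: "cadj (q c) = q (cnj c)" for c by (simp add: q_def vec_eq_iff mult_ac)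
  have q0: "q 0 = 0" by (simp add: q_def vec_eq_iff)
  have bb: "b * cnj b = 1" using b complex_norm_square[of b] by simp
  have "cadj U ** U = (mat 1 + q (cnj (b - 1))) ** (mat 1 + q (b - 1))"
    unfolding U_def q_def[symmetric] by (simp only: cadj_add cadj_mat_1 q2)
  also have "\<dots> = mat 1 + (q (cnj (b - 1)) + q (b - 1) + q (cnj (b - 1) * (b - 1)))"
    by (simp only: matrix_add_ldistrib matrix_add_rdistrib matrix_mul_lid matrix_mul_rid qq add.assoc)
  also have "q (cnj (b - 1)) + q (b - 1) + q (cnj (b - 1) * (b - 1)) = q (b * cnj b - 1)"
    by (simp add: q1 algebra_simps)
  finally show ?thesis using bb q0 by simp
qed

lemma unit_left_null_vector:
  fixes A :: "complex^'n^'n"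
  assumes "det A = 0"
  obtains w :: "complex^'n" where "(\<Sum>i\<in>UNIV. w $ i * cnj (w $ i)) = 1" "\<And>j. (\<Sum>i\<in>UNIV. w $ i * A $ i $ j) = 0"
proof -
  have "\<not> invertible (transpose A)" using assms invertible_det_nz[of "transpose A"] by simp
  then obtain x where x: "x \<noteq> 0" "transpose A *v x = 0"
    using matrix_left_invertible_ker[of "transpose A"] invertible_left_inverse by blast
  define s where "s = (\<Sum>i\<in>UNIV. (cmod (x $ i))\<^sup>2)"
  have "s > 0"
  proof -
    obtain k where "x $ k \<noteq> 0" using x(1) by (metis vec_eq_iff zero_index)
    then show ?thesis unfolding s_def by (intro sum_pos2[of _ k]) auto
  qed
  define t where "t = 1 / sqrt s"
  define r where "r = complex_of_real t"
  have rr: "r * cnj r * complex_of_real s = 1"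
  proof -
    have "r * cnj r = complex_of_real (t * t)" by (simp add: r_def)
    also have "t * t = 1 / s" using \<open>s > 0\<close> by (simp add: t_def)
    finally show ?thesis using \<open>s > 0\<close> by simp
  qed
  define w where "w = r *s x"
  have "(\<Sum>i\<in>UNIV. w $ i * cnj (w $ i)) = r * cnj r * (\<Sum>i\<in>UNIV. x $ i * cnj (x $ i))"
    by (simp add: w_def sum_distrib_left mult_ac)
  also have "(\<Sum>i\<in>UNIV. x $ i * cnj (x $ i)) = complex_of_real s"
    unfolding s_def of_real_sum complex_norm_square ..
  finally have 1: "(\<Sum>i\<in>UNIV. w $ i * cnj (w $ i)) = 1" using rr by simp
  have "(\<Sum>i\<in>UNIV. w $ i * A $ i $ j) = 0" for j
  proof -
    have "(\<Sum>i\<in>UNIV. A $ i $ j * x $ i) = 0" using x(2) by (simp add: vec_eq_iff matrix_vector_mult_def transpose_def)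
    then have "r * (\<Sum>i\<in>UNIV. A $ i $ j * x $ i) = 0" by simp
    then show ?thesis by (simp add: w_def sum_distrib_left mult_ac)
  qed
  with 1 that show thesis by blast
qed

text \<open>At a zero \<open>a\<close> of the determinant, \<open>g = U h\<close> with
  \<open>U\<close> equal to the Blaschke factor in the direction of a left null vector and to 1 on
  the complement; the determinant then loses exactly this factor while \<open>M\<close> stays. In
  the identity for the determinant, \<open>\<Delta>\<close> carries the zeros still to be removed
  and its degree drops, \<open>\<Gamma>\<close> collects the factors \<open>1 - cnj a * z\<close>,
  which do not vanish on \<open>A\<close>, and \<open>E\<close> is the denominator.\<close>

lemma clear_determinant_zeros:
  fixes g :: "proj_line \<Rightarrow> complex^'n^'n"
  assumes T: "finite T" and A: "\<And>a. a \<in> A \<Longrightarrow> norm a < 1 \<and> Aff a \<notin> T \<and> kappa (Aff a) \<in> T"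
    and E: "\<And>z. Aff z \<notin> T \<Longrightarrow> poly E z \<noteq> 0"
    and "mpole_le T M g" "\<And>x. x \<notin> T \<union> Aff ` A \<Longrightarrow> det (g x) \<noteq> 0"
    and "\<Delta> \<noteq> 0" "\<And>a. a \<in> A \<Longrightarrow> poly \<Gamma> a \<noteq> 0"
    and "\<And>z. Aff z \<notin> T \<Longrightarrow> det (g (Aff z)) * poly E z = poly \<Delta> z * poly \<Gamma> z"
  shows "\<exists>h :: proj_line \<Rightarrow> complex^'n^'n. mpole_le T M h \<and> (\<forall>x. x \<notin> T \<longrightarrow> invertible (h x)) \<and>
    (\<forall>z. norm z = 1 \<and> Aff z \<notin> T \<longrightarrow> cadj (h (Aff z)) ** h (Aff z) = cadj (g (Aff z)) ** g (Aff z))"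
  using assms(4-)
proof (induction "degree \<Delta>" arbitrary: \<Delta> \<Gamma> g rule: less_induct)
  case less
  show ?case
  proof (cases "\<exists>a\<in>A. det (g (Aff a)) = 0")
    case False
    then have "invertible (g x)" if "x \<notin> T" for x using that less.prems(2)[of x] invertible_det_nz[of "g x"] by auto
    then show ?thesis using less.prems(1) by blast
  next
    case True
    then obtain a where a: "a \<in> A" "det (g (Aff a)) = 0" by blast
    note aT = A[OF a(1)]
    obtain w :: "complex^'n" where w: "(\<Sum>i\<in>UNIV. w $ i * cnj (w $ i)) = 1" "\<And>j. (\<Sum>i\<in>UNIV. w $ i * g (Aff a) $ i $ j) = 0"
      using unit_left_null_vector[OF a(2)] by blast
    define f where "f j x = (\<Sum>i\<in>UNIV. w $ i * g x $ i $ j)" for j x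
    have pf: "pole_le T M (f j)" for j unfolding f_def using less.prems(1)
      by (intro pole_le_sum[OF T] pole_le_cmult[OF T]) (simp add: mpole_le_def)
    have "\<exists>g'. pole_le T M g' \<and> (\<forall>x. x \<notin> T \<longrightarrow> f j x = blaschke a x * g' x)" for j
      using pole_le_divide_blaschke[OF T pf, of a j] aT w(2) f_def by metis
    then obtain g' where g': "\<And>j. pole_le T M (g' j)" "\<And>j x. x \<notin> T \<Longrightarrow> f j x = blaschke a x * g' j x" by metis
    \<comment> \<open>\<open>h\<close> is \<open>g\<close> with its component \<open>f\<close> along
      \<open>w\<close> replaced by the quotient \<open>g'\<close>.\<close>
    define h where "h x = (\<chi> i j. g x $ i $ j + cnj (w $ i) * (g' j x - f j x))" for x
    have ph: "mpole_le T M h" unfolding mpole_le_def h_def using less.prems(1)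
      by (auto simp: mpole_le_def intro!: pole_le_add pole_le_cmult pole_le_diff pf g' T)
    define U :: "proj_line \<Rightarrow> complex^'n^'n" where "U x = mat 1 + (\<chi> i j. (blaschke a x - 1) * cnj (w $ i) * w $ j)" for x
    have wh: "(\<Sum>i\<in>UNIV. w $ i * h x $ i $ j) = g' j x" for j x
    proof -
      have "(\<Sum>i\<in>UNIV. w $ i * h x $ i $ j) = f j x + (\<Sum>i\<in>UNIV. w $ i * cnj (w $ i)) * (g' j x - f j x)"
        by (simp add: h_def f_def distrib_left sum.distrib sum_distrib_right mult_ac)
      then show ?thesis using w(1) by simp
    qed
    have gU: "g x = U x ** h x" if x: "x \<notin> T" for x
    proof (simp only: vec_eq_iff, intro allI)
      fix i j
      have "(U x ** h x) $ i $ j = h x $ i $ j + (blaschke a x - 1) * cnj (w $ i) * (\<Sum>k\<in>UNIV. w $ k * h x $ k $ j)"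
        by (simp add: U_def matrix_add_rdistrib) (simp add: matrix_matrix_mult_def sum_distrib_left mult_ac)
      also have "\<dots> = g x $ i $ j" using g'(2)[OF x, of j] by (simp add: wh) (simp add: h_def algebra_simps)
      finally show "g x $ i $ j = (U x ** h x) $ i $ j" by simp
    qed
    have dg: "det (g x) = blaschke a x * det (h x)" if x: "x \<notin> T" for x
    proof -
      have "w \<noteq> 0" using w(1) by auto
      then have "det (U x) = 1 + (blaschke a x - 1) * (\<Sum>i\<in>UNIV. w $ i * cnj (w $ i))"
        unfolding U_def using det_identity_plus_rank_one[of w "blaschke a x - 1" "\<chi> i. cnj (w $ i)"] by simp
      then show ?thesis using w(1) gU[OF x] by (simp add: det_mul)
    qed
    have "poly \<Delta> a = 0" using less.prems(4)[OF a(1)] less.prems(5)[of a] a(2) aT by auto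
    then obtain \<Delta>' where \<Delta>': "\<Delta> = [:-a, 1:] * \<Delta>'" by (auto simp: poly_eq_0_iff_dvd)
    then have d: "\<Delta>' \<noteq> 0" "degree \<Delta>' < degree \<Delta>"
      using less.prems(3) by (auto simp: degree_mult_eq simp del: mult_pCons_left)
    define \<Gamma>' where "\<Gamma>' = [:1, - cnj a:] * \<Gamma>"
    have nz: "1 - cnj a * z \<noteq> 0" if "Aff z \<notin> T" for z using that aT blaschke_denominator_zero_iff[of a z] by auto
    have generic: "det (h (Aff z)) * poly E z = poly \<Delta>' z * poly \<Gamma>' z" if "Aff z \<notin> T" "z \<noteq> a" for z
    proof -
      have "(z - a) / (1 - cnj a * z) * (det (h (Aff z)) * poly E z) = (z - a) * poly \<Delta>' z * poly \<Gamma> z"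
        using less.prems(5)[OF that(1)] dg[OF that(1)] by (simp add: \<Delta>' algebra_simps)
      then have "(z - a) * (det (h (Aff z)) * poly E z) = (z - a) * (poly \<Delta>' z * poly \<Gamma>' z)"
        using nz[OF that(1)] by (simp add: \<Gamma>'_def field_simps)
      then show ?thesis using that by simp
    qed
    obtain P where P: "\<And>z. Aff z \<notin> T \<Longrightarrow> det (h (Aff z)) = poly P z / poly (den_poly T (CARD('n) * M)) z"
      using pole_le_det[OF T ph] by (rule pole_leE) blast
    \<comment> \<open>At \<open>z = a\<close> the Blaschke factor vanishes and cannot be cancelled,
      so the identity there comes from an identity of polynomials.\<close>
    have "P * E = \<Delta>' * \<Gamma>' * den_poly T (CARD('n) * M)"
    proof (rule poly_eq_if_infinite)
      have "{z. Aff z \<notin> T} - {a} = {z. Aff z \<notin> T \<and> z \<noteq> a}" by auto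
      then show "infinite {z. Aff z \<notin> T \<and> z \<noteq> a}" using ex_Aff_notin[OF T] by (metis Diff_infinite_finite finite.emptyI finite.insertI)
      fix z assume "z \<in> {z. Aff z \<notin> T \<and> z \<noteq> a}"
      then show "poly (P * E) z = poly (\<Delta>' * \<Gamma>' * den_poly T (CARD('n) * M)) z"
        using generic[of z] P[of z] poly_den_poly_nonzero[OF T, of z "CARD('n) * M"] by (simp add: field_simps)
    qed
    then have Pe: "poly P z * poly E z = poly \<Delta>' z * poly \<Gamma>' z * poly (den_poly T (CARD('n) * M)) z" for z by (metis poly_mult)
    have id: "det (h (Aff z)) * poly E z = poly \<Delta>' z * poly \<Gamma>' z" if "Aff z \<notin> T" for z
      unfolding P[OF that] using poly_den_poly_nonzero[OF T that, of "CARD('n) * M"] by (simp add: Pe)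
    have "\<exists>k :: proj_line \<Rightarrow> complex^'n^'n. mpole_le T M k \<and> (\<forall>x. x \<notin> T \<longrightarrow> invertible (k x)) \<and>
      (\<forall>z. norm z = 1 \<and> Aff z \<notin> T \<longrightarrow> cadj (k (Aff z)) ** k (Aff z) = cadj (h (Aff z)) ** h (Aff z))"
    proof (rule less.hyps[OF d(2) ph _ d(1)])
      show "det (h x) \<noteq> 0" if "x \<notin> T \<union> Aff ` A" for x using less.prems(2)[OF that] dg[of x] that by auto
      show "poly \<Gamma>' a' \<noteq> 0" if "a' \<in> A" for a' using less.prems(4)[OF that] nz[of a'] A[OF that] by (simp add: \<Gamma>'_def algebra_simps)
    qed (use id in blast)
    then obtain k :: "proj_line \<Rightarrow> complex^'n^'n" where k: "mpole_le T M k" "\<And>x. x \<notin> T \<Longrightarrow> invertible (k x)"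
      "\<And>z. norm z = 1 \<Longrightarrow> Aff z \<notin> T \<Longrightarrow> cadj (k (Aff z)) ** k (Aff z) = cadj (h (Aff z)) ** h (Aff z)" by blast
    have "cadj (h (Aff z)) ** h (Aff z) = cadj (g (Aff z)) ** g (Aff z)" if "norm z = 1" "Aff z \<notin> T" for z
    proof -
      have "cadj (U (Aff z)) ** U (Aff z) = mat 1"
        unfolding U_def by (rule unitary_identity_plus_projection[OF w(1)]) (use norm_blaschke_circle aT that in blast)
      then show ?thesis using gU[OF that(2)] by (metis cadj_mult matrix_mul_assoc matrix_mul_lid)
    qed
    with k show ?thesis by (intro exI[of _ k]) simp
  qed
qed

text \<open>The unitary factor is not named: equality of \<open>cadj h ** h\<close> and
  \<open>cadj g ** g\<close> on the circle says that \<open>g\<close> times the inverse of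
  \<open>h\<close> is unitary there. The bound \<open>M\<close> is chosen before \<open>g\<close>,
  and only the scalar step that clears the poles determines it.\<close>

lemma unitary_disc_factorization:
  assumes A: "finite A" and T: "finite T" and k: "\<And>a. a \<in> A \<Longrightarrow> norm a < 1 \<and> Aff a \<notin> T \<and> kappa (Aff a) \<in> T"
  shows "\<exists>M. \<forall>g :: proj_line \<Rightarrow> complex^'n^'n. mpole_le (T \<union> Aff ` A) N g \<and> (\<forall>x. x \<notin> T \<union> Aff ` A \<longrightarrow> invertible (g x)) \<longrightarrow>
    (\<exists>h :: proj_line \<Rightarrow> complex^'n^'n. mpole_le T M h \<and> (\<forall>x. x \<notin> T \<longrightarrow> invertible (h x)) \<and>
    (\<forall>z. norm z = 1 \<and> Aff z \<notin> T \<longrightarrow> cadj (h (Aff z)) ** h (Aff z) = cadj (g (Aff z)) ** g (Aff z)))"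
proof -
  obtain q M where q: "\<And>z. norm z = 1 \<Longrightarrow> norm (q (Aff z) :: complex) = 1" "\<And>x. x \<notin> T \<union> Aff ` A \<Longrightarrow> q x \<noteq> 0"
    "\<And>f. pole_le (T \<union> Aff ` A) N f \<Longrightarrow> \<exists>g. pole_le T M g \<and> (\<forall>x. x \<notin> T \<union> Aff ` A \<longrightarrow> g x = q x * f x)"
    using remove_disc_poles[OF A T k, of N] by blast
  show ?thesis
  proof (rule exI[of _ M], intro allI impI, elim conjE)
    fix g :: "proj_line \<Rightarrow> complex^'n^'n"
    assume g: "mpole_le (T \<union> Aff ` A) N g" "\<forall>x. x \<notin> T \<union> Aff ` A \<longrightarrow> invertible (g x)"
    have "\<exists>f. pole_le T M f \<and> (\<forall>x. x \<notin> T \<union> Aff ` A \<longrightarrow> f x = q x * g x $ i $ j)" for i j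
      using q(3) g(1) unfolding mpole_le_def by blast
    then obtain F where F: "\<And>i j. pole_le T M (F i j)" "\<And>i j x. x \<notin> T \<union> Aff ` A \<Longrightarrow> F i j x = q x * g x $ i $ j" by metis
    define f :: "proj_line \<Rightarrow> complex^'n^'n" where "f x = (\<chi> i j. F i j x)" for x
    have pf: "mpole_le T M f" using F(1) by (simp add: mpole_le_def f_def)
    have df: "det (f x) \<noteq> 0" if "x \<notin> T \<union> Aff ` A" for x
    proof -
      have "f x = (\<chi> i. q x *s (g x $ i))" using F(2)[OF that] by (simp add: f_def vec_eq_iff)
      then have "det (f x) = (\<Prod>i\<in>(UNIV :: 'n set). q x) * det (\<chi> i. g x $ i)" using det_rows_mul[of "\<lambda>_. q x" "\<lambda>i. g x $ i"] by simp
      then show ?thesis using g(2) that q(2)[OF that] invertible_det_nz[of "g x"] by auto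
    qed
    obtain P where P: "\<And>z. Aff z \<notin> T \<Longrightarrow> det (f (Aff z)) = poly P z / poly (den_poly T (CARD('n) * M)) z"
      using pole_le_det[OF T pf] by (rule pole_leE) blast
    have fin: "finite (T \<union> Aff ` A)" using A T by simp
    obtain z0 where z0: "Aff z0 \<notin> T \<union> Aff ` A" using ex_Aff_notin[OF fin] by (metis (no_types, lifting) Collect_empty_eq finite.emptyI)
    have "P \<noteq> 0" using df[OF z0] P[of z0] z0 by auto
    have "\<exists>h :: proj_line \<Rightarrow> complex^'n^'n. mpole_le T M h \<and> (\<forall>x. x \<notin> T \<longrightarrow> invertible (h x)) \<and>
    (\<forall>z. norm z = 1 \<and> Aff z \<notin> T \<longrightarrow> cadj (h (Aff z)) ** h (Aff z) = cadj (f (Aff z)) ** f (Aff z))"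
      by (rule clear_determinant_zeros[where E = "den_poly T (CARD('n) * M)" and \<Gamma> = 1 and \<Delta> = P and A = A, OF T k])
        (use P pf df \<open>P \<noteq> 0\<close> poly_den_poly_nonzero[OF T] in auto)
    moreover have "cadj (f (Aff z)) ** f (Aff z) = cadj (g (Aff z)) ** g (Aff z)" if z: "norm z = 1" "Aff z \<notin> T" for z
    proof -
      have x: "Aff z \<notin> T \<union> Aff ` A" using z k by force
      have qq: "cnj (q (Aff z)) * q (Aff z) = 1" using q(1)[OF z(1)] complex_norm_square[of "q (Aff z)"] by (simp add: mult.commute)
      have "cnj (f (Aff z) $ l $ i) * f (Aff z) $ l $ j = cnj (g (Aff z) $ l $ i) * g (Aff z) $ l $ j" for i j l
      proof -
        have "cnj (f (Aff z) $ l $ i) * f (Aff z) $ l $ j = (cnj (q (Aff z)) * q (Aff z)) * (cnj (g (Aff z) $ l $ i) * g (Aff z) $ l $ j)"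
          using F(2)[OF x] by (simp add: f_def mult_ac)
        then show ?thesis using qq by simp
      qed
      then show ?thesis by (simp add: vec_eq_iff matrix_matrix_mult_def)
    qed
    ultimately show "\<exists>h :: proj_line \<Rightarrow> complex^'n^'n. mpole_le T M h \<and> (\<forall>x. x \<notin> T \<longrightarrow> invertible (h x)) \<and>
    (\<forall>z. norm z = 1 \<and> Aff z \<notin> T \<longrightarrow> cadj (h (Aff z)) ** h (Aff z) = cadj (g (Aff z)) ** g (Aff z))" by simp
  qed
qed

section \<open>Reflection in the unit circle\<close>

lemma circle_closure:
  assumes "finite F" "norm s = 1" shows "(s::complex) \<in> closure (sphere 0 1 - F)"
proof -
  have "s islimpt sphere 0 1"
  proof (rule connected_imp_perfect)
    show "connected (sphere (0::complex) 1)" by (intro connected_sphere) simp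
    show "sphere 0 1 \<noteq> {a}" for a :: complex
    proof
      assume a: "sphere 0 1 = {a}"
      have "(1::complex) \<in> sphere 0 1" "(-1::complex) \<in> sphere 0 1" by auto
      then show False unfolding a by simp
    qed
  qed (use assms in auto)
  then have "s islimpt (F \<union> (sphere 0 1 - F))" by (rule islimpt_subset) auto
  then have "s islimpt (sphere 0 1 - F)" using islimpt_Un_finite[OF assms(1)] by blast
  then show ?thesis by (simp add: closure_def)
qed

lemma circle_minus_finite_infinite:
  assumes "finite F" shows "infinite (sphere (0::complex) 1 - F)"
proof
  assume "finite (sphere (0::complex) 1 - F)"
  then have "finite (sphere (0::complex) 1 - insert 1 F)" by (metis Diff_insert finite_Diff)
  then have "closure (sphere (0::complex) 1 - insert 1 F) = sphere 0 1 - insert 1 F" by (simp add: closure_closed finite_imp_closed)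
  then show False using circle_closure[of "insert 1 F" 1] assms by simp
qed

text \<open>Each of the finitely many excluded points is a limit of the rest of the circle.
  Equations are covered by applying the inequality with both signs.\<close>

lemma circle_property_extends:
  fixes F :: "complex \<Rightarrow> real"
  assumes "finite S" "continuous_on UNIV F" "\<And>z. norm z = 1 \<Longrightarrow> z \<notin> S \<Longrightarrow> F z \<le> 0" "norm z = 1"
  shows "F z \<le> 0"
proof -
  have "closed {z. F z \<le> 0}" using assms(2) by (intro closed_Collect_le) auto
  moreover have "sphere 0 1 - S \<subseteq> {z. F z \<le> 0}" using assms(3) by auto
  ultimately have "closure (sphere 0 1 - S) \<subseteq> {z. F z \<le> 0}" by (rule closure_minimal[rotated])
  then show ?thesis using circle_closure[OF assms(1,4)] by blast
qed

text \<open>The functions \<open>exp (- \<i> f)\<close> and \<open>exp (\<i> f)\<close> have modulus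
  1 on the circle, so the maximum principle bounds the imaginary part of \<open>f\<close> from both
  sides. A real-valued holomorphic function is not open, hence constant.\<close>

lemma holomorphic_real_on_circle_constant:
  assumes hol: "f holomorphic_on ball 0 1" and cont: "continuous_on (cball 0 1) f"
    and real: "\<And>z. norm z = 1 \<Longrightarrow> Im (f z) = 0"
  shows "f constant_on ball 0 1"
proof -
  have *: "Im (f z) * r \<le> 0" if "z \<in> ball 0 1" "r = 1 \<or> r = -1" for z and r :: real
  proof -
    define e where "e z = exp (- (\<i> * complex_of_real r * f z))" for z
    have "norm (e z) \<le> 1"
    proof (rule maximum_modulus_frontier[of e "ball 0 1"])
      show "e holomorphic_on interior (ball 0 1)" unfolding e_def using hol by (auto intro!: holomorphic_intros)
      show "continuous_on (closure (ball 0 1)) e" unfolding e_def using cont by (auto intro!: continuous_intros)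
      show "norm (e w) \<le> 1" if "w \<in> frontier (ball 0 1)" for w
        using real[of w] that by (simp add: e_def norm_exp_eq_Re)
    qed (use that in auto)
    then show ?thesis by (simp add: e_def norm_exp_eq_Re mult.commute)
  qed
  have im: "Im (f z) = 0" if "z \<in> ball 0 1" for z using *[OF that, of 1] *[OF that, of "-1"] by auto
  show ?thesis
  proof (rule ccontr)
    assume "\<not> f constant_on ball 0 1"
    then have "open (f ` ball 0 1)" by (intro open_mapping_thm[OF hol]) auto
    moreover have "f 0 \<in> f ` ball 0 1" by simp
    ultimately obtain e where e: "e > 0" "cball (f 0) e \<subseteq> f ` ball 0 1" unfolding open_contains_cball by blast
    have "f 0 + \<i> * of_real e \<in> cball (f 0) e" using e(1) by (simp add: dist_norm norm_mult)
    then have "f 0 + \<i> * of_real e \<in> f ` ball 0 1" by (rule subsetD[OF e(2)])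
    then obtain w where w: "f 0 + \<i> * of_real e = f w" "w \<in> ball 0 1" by (rule imageE)
    have "Im (f 0 + \<i> * of_real e) = 0" unfolding w(1) by (rule im[OF w(2)])
    then show False using im[of 0] e(1) by simp
  qed
qed

text \<open>Boundedness removes the poles on the circle: in the reduced fraction the denominator has
  no root there. Inside there is no pole by assumption on \<open>T\<close>, so the function is
  constant on the disc and then everywhere by the identity theorem.\<close>

lemma rational_real_on_circle_constant:
  assumes T: "finite T" and disc: "\<And>z. Aff z \<in> T \<Longrightarrow> norm z \<ge> 1" and f: "pole_le T N f"
    and bd: "\<And>z. norm z = 1 \<Longrightarrow> Aff z \<notin> T \<Longrightarrow> norm (f (Aff z)) \<le> B"
    and real: "\<And>z. norm z = 1 \<Longrightarrow> Aff z \<notin> T \<Longrightarrow> Im (f (Aff z)) = 0"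
  shows "\<exists>c. \<forall>x. x \<notin> T \<longrightarrow> f x = c"
proof -
  obtain P where P: "\<And>z. Aff z \<notin> T \<Longrightarrow> f (Aff z) = poly P z / poly (den_poly T N) z" using f by (rule pole_leE) blast
  obtain g P' D' where gP: "P = g * P'" "den_poly T N = g * D'" "\<And>b. poly P' b = 0 \<Longrightarrow> poly D' b \<noteq> 0"
    using cancel_common_roots[OF den_poly_nonzero, of P] by blast
  have nz: "poly g z \<noteq> 0 \<and> poly D' z \<noteq> 0" if "Aff z \<notin> T" for z
    using poly_den_poly_nonzero[OF T that, of N] gP(2) by auto
  have fz: "f (Aff z) = poly P' z / poly D' z" if "Aff z \<notin> T" for z
    using P[OF that] nz[OF that] gP by simp
  define S where "S = {z. Aff z \<in> T}"
  have S: "finite S" using T finite_Aff_in S_def by blast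
  have nzc: "poly D' z \<noteq> 0" if z: "norm z = 1" for z
  proof
    assume D0: "poly D' z = 0"
    \<comment> \<open>The bound multiplied by the denominator is continuous and extends to the
      excluded points; at a root of \<open>D'\<close> it would force a common root with
      \<open>P'\<close>.\<close>
    have "norm (poly P' z) - B * norm (poly D' z) \<le> 0"
    proof (rule circle_property_extends[OF S _ _ z])
      show "continuous_on UNIV (\<lambda>z. norm (poly P' z) - B * norm (poly D' z))" by (intro continuous_intros)
      fix w :: complex assume w: "norm w = 1" "w \<notin> S"
      then have "Aff w \<notin> T" by (simp add: S_def)
      then show "norm (poly P' w) - B * norm (poly D' w) \<le> 0"
        using bd[OF w(1)] fz[of w] nz[of w] by (simp add: norm_divide field_simps)
    qed
    then show False using D0 gP(3)[of z] by auto
  qed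
  have nzd: "poly D' z \<noteq> 0" if "norm z \<le> 1" for z
    using nzc[of z] nz[of z] disc[of z] that by force
  define k where "k z = poly P' z / poly D' z" for z
  have "k constant_on ball 0 1"
  proof (rule holomorphic_real_on_circle_constant)
    show "k holomorphic_on ball 0 1" unfolding k_def using nzd by (intro holomorphic_intros) auto
    show "continuous_on (cball 0 1) k" unfolding k_def using nzd by (intro continuous_intros) auto
    fix z :: complex assume z: "norm z = 1"
    \<comment> \<open>This expression is \<open>f\<close> times the squared modulus of
      \<open>D'\<close>. It is continuous on the whole circle, so reality passes to the excluded
      points.\<close>
    have Q: "Im (poly P' w * cnj (poly D' w)) = 0" if "norm w = 1" for w
    proof -
      have *: "r * Im (poly P' w * cnj (poly D' w)) \<le> 0" for r :: real
      proof (rule circle_property_extends[OF S _ _ that, of "\<lambda>w. r * Im (poly P' w * cnj (poly D' w))"])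
        show "continuous_on UNIV (\<lambda>w. r * Im (poly P' w * cnj (poly D' w)))" by (intro continuous_intros)
        fix w :: complex assume w: "norm w = 1" "w \<notin> S"
        then have w': "Aff w \<notin> T" by (simp add: S_def)
        have "poly P' w * cnj (poly D' w) = f (Aff w) * (poly D' w * cnj (poly D' w))" using fz[OF w'] nz[OF w'] by simp
        also have "\<dots> = f (Aff w) * of_real ((norm (poly D' w))\<^sup>2)" by (simp add: complex_norm_square del: of_real_power)
        finally have "Im (poly P' w * cnj (poly D' w)) = Im (f (Aff w)) * (norm (poly D' w))\<^sup>2" by simp
        then show "r * Im (poly P' w * cnj (poly D' w)) \<le> 0" using real[OF w(1) w'] by simp
      qed
      show ?thesis using *[of 1] *[of "-1"] by simp
    qed
    have "k z = (poly P' z * cnj (poly D' z)) / (poly D' z * cnj (poly D' z))" using nzc[OF z] by (simp add: k_def)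
    also have "\<dots> = (poly P' z * cnj (poly D' z)) / of_real ((norm (poly D' z))\<^sup>2)" by (simp add: complex_norm_square del: of_real_power)
    finally show "Im (k z) = 0" using Q[OF z] by simp
  qed
  then obtain c where c: "\<And>z. norm z < 1 \<Longrightarrow> k z = c" by (auto simp: constant_on_def)
  show ?thesis
  proof (rule exI[of _ c], intro allI impI)
    fix x assume x: "x \<notin> T"
    show "f x = c"
    proof (rule pole_le_eq_everywhere[OF T f pole_le_const[OF T, of 0 c] _ _ x, where Z = "ball 0 1"])
      show "infinite (ball (0::complex) 1)" using uncountable_infinite uncountable_ball[of 1 "0::complex"] by simp
      fix z :: complex assume "z \<in> ball 0 1"
      then have z: "norm z < 1" by simp
      then have "Aff z \<notin> T" using disc[of z] by auto
      then show "Aff z \<notin> T \<and> f (Aff z) = c" using c[OF z] fz by (simp add: k_def)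
    qed
  qed
qed

text \<open>The conjugate of \<open>f\<close> is not rational; \<open>g\<close> is a rational
  function agreeing with it on the circle. Then \<open>f + g\<close> and
  \<open>\<i> * (f - g)\<close> are real there, hence constant.\<close>

lemma rational_conjugate_on_circle_constant:
  assumes T: "finite T" and disc: "\<And>z. Aff z \<in> T \<Longrightarrow> norm z \<ge> 1" and f: "pole_le T N f" and g: "pole_le T N g"
    and bd: "\<And>z. norm z = 1 \<Longrightarrow> Aff z \<notin> T \<Longrightarrow> norm (f (Aff z)) \<le> B"
    and fg: "\<And>z. norm z = 1 \<Longrightarrow> Aff z \<notin> T \<Longrightarrow> g (Aff z) = cnj (f (Aff z))"
    and x: "x \<notin> T" "y \<notin> T"
  shows "f x = f y"
proof -
  have "\<exists>c. \<forall>x. x \<notin> T \<longrightarrow> f x + g x = c"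
  proof (rule rational_real_on_circle_constant[OF T disc, of N _ "B + B"])
    show "norm (f (Aff z) + g (Aff z)) \<le> B + B" if "norm z = 1" "Aff z \<notin> T" for z
      using bd[OF that] fg[OF that] by (intro norm_triangle_mono) auto
  qed (use f g fg in \<open>auto intro: pole_le_add\<close>)
  then obtain c where c: "\<And>x. x \<notin> T \<Longrightarrow> f x + g x = c" by blast
  have "\<exists>c. \<forall>x. x \<notin> T \<longrightarrow> \<i> * (f x - g x) = c"
  proof (rule rational_real_on_circle_constant[OF T disc, of N _ "B + B"])
    show "norm (\<i> * (f (Aff z) - g (Aff z))) \<le> B + B" if "norm z = 1" "Aff z \<notin> T" for z
    proof -
      have "norm (f (Aff z) - g (Aff z)) \<le> norm (f (Aff z)) + norm (g (Aff z))" by (rule norm_triangle_ineq4)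
      then show ?thesis using bd[OF that] fg[OF that] by (simp add: norm_mult)
    qed
  qed (use f g fg in \<open>auto intro!: pole_le_cmult[OF T] pole_le_diff[OF T]\<close>)
  then obtain d where d: "\<And>x. x \<notin> T \<Longrightarrow> \<i> * (f x - g x) = d" by blast
  have eq: "f z = (c - \<i> * d) / 2" if "z \<notin> T" for z
  proof -
    have "c - \<i> * d = (f z + g z) - \<i> * (\<i> * (f z - g z))" by (simp only: c[OF that] d[OF that])
    also have "\<dots> = 2 * f z" by simp
    finally show ?thesis by simp
  qed
  show ?thesis by (simp only: eq[OF x(1)] eq[OF x(2)])
qed

section \<open>Polynomial representations compatible with adjoints\<close>

text \<open>Matrices are functions of two indices because the index set of a representation is only
  found during the proof and so cannot be a type.\<close>

definition mmult :: "'a set \<Rightarrow> ('a \<Rightarrow> 'a \<Rightarrow> complex) \<Rightarrow> ('a \<Rightarrow> 'a \<Rightarrow> complex) \<Rightarrow> 'a \<Rightarrow> 'a \<Rightarrow> complex" where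
  "mmult W X Y = (\<lambda>i j. \<Sum>k\<in>W. X i k * Y k j)"

lemma mmult_assoc: "mmult W (mmult W X Y) Z = mmult W X (mmult W Y Z)"
proof (intro ext)
  fix i j
  have "mmult W (mmult W X Y) Z i j = (\<Sum>k\<in>W. \<Sum>l\<in>W. X i l * Y l k * Z k j)"
    by (simp add: mmult_def sum_distrib_right)
  also have "\<dots> = (\<Sum>l\<in>W. \<Sum>k\<in>W. X i l * Y l k * Z k j)" by (rule sum.swap)
  also have "\<dots> = mmult W X (mmult W Y Z) i j" by (simp add: mmult_def sum_distrib_left mult.assoc)
  finally show "mmult W (mmult W X Y) Z i j = mmult W X (mmult W Y Z) i j" .
qed

text \<open>A finite-dimensional polynomial representation of the matrix monoid compatible with adjoints,
  written in coordinates indexed by \<open>W\<close> and extended by zero.\<close>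

definition star_rep :: "'a set \<Rightarrow> (complex^'n^'n \<Rightarrow> 'a \<Rightarrow> 'a \<Rightarrow> complex) \<Rightarrow> bool" where
  "star_rep W R \<longleftrightarrow> finite W \<and> (\<forall>A i j. i \<notin> W \<or> j \<notin> W \<longrightarrow> R A i j = 0) \<and>
     (\<forall>A B. R (A ** B) = mmult W (R A) (R B)) \<and> (\<forall>i\<in>W. \<forall>j\<in>W. R (mat 1) i j = (if i = j then 1 else 0)) \<and>
     (\<forall>A i j. R (cadj A) i j = cnj (R A j i)) \<and> (\<forall>i j. matrix_poly (\<lambda>A. R A i j))"

definition matrix_coeff :: "'a set \<Rightarrow> (complex^'n^'n \<Rightarrow> 'a \<Rightarrow> 'a \<Rightarrow> complex) \<Rightarrow> (complex^'n^'n \<Rightarrow> complex) \<Rightarrow> bool" where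
  "matrix_coeff W R p \<longleftrightarrow> (\<exists>\<xi> \<eta>. \<forall>A. p A = (\<Sum>i\<in>W. \<Sum>j\<in>W. \<xi> i * R A i j * \<eta> j))"

lemma matrix_coeffI: "(\<And>A. p A = (\<Sum>i\<in>W. \<Sum>j\<in>W. \<xi> i * R A i j * \<eta> j)) \<Longrightarrow> matrix_coeff W R p"
  unfolding matrix_coeff_def by blast

lemma star_repI:
  assumes "finite W" "\<And>A i j. i \<notin> W \<or> j \<notin> W \<Longrightarrow> R A i j = 0"
    "\<And>A B i j. i \<in> W \<Longrightarrow> j \<in> W \<Longrightarrow> R (A ** B) i j = (\<Sum>k\<in>W. R A i k * R B k j)"
    "\<And>i j. i \<in> W \<Longrightarrow> j \<in> W \<Longrightarrow> R (mat 1) i j = (if i = j then 1 else 0)"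
    "\<And>A i j. i \<in> W \<Longrightarrow> j \<in> W \<Longrightarrow> R (cadj A) i j = cnj (R A j i)"
    "\<And>i j. i \<in> W \<Longrightarrow> j \<in> W \<Longrightarrow> matrix_poly (\<lambda>A. R A i j)"
  shows "star_rep W R"
proof -
  have "R (A ** B) = mmult W (R A) (R B)" for A B
  proof (intro ext)
    fix i j show "R (A ** B) i j = mmult W (R A) (R B) i j"
      using assms(2,3) by (cases "i \<in> W \<and> j \<in> W") (auto simp: mmult_def)
  qed
  moreover have "R (cadj A) i j = cnj (R A j i)" for A i j
    using assms(2,5) by (cases "i \<in> W \<and> j \<in> W") auto
  moreover have "matrix_poly (\<lambda>A. R A i j)" for i j
    using assms(2,6) matrix_poly.const[of 0] by (cases "i \<in> W \<and> j \<in> W") auto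
  ultimately show ?thesis using assms unfolding star_rep_def by blast
qed

text \<open>Direct sums and tensor products change the index type. Carrying them back to one fixed
  type makes the existence of a representation expressible in an induction.\<close>

lemma star_rep_transport:
  fixes e :: "'a \<Rightarrow> 'b" and W :: "'a set"
  assumes R: "star_rep W R" and p: "matrix_coeff W R p" and e: "inj e"
  shows "\<exists>(W' :: 'b set) R'. star_rep W' R' \<and> matrix_coeff W' R' p"
proof -
  define R' where "R' A x y = (if x \<in> e ` W \<and> y \<in> e ` W then R A (inv_into UNIV e x) (inv_into UNIV e y) else 0)" for A x y
  have Re: "R' A (e i) (e j) = R A i j" if "i \<in> W" "j \<in> W" for A i j using that e by (simp add: R'_def)
  have sum_e: "(\<Sum>k\<in>e ` W. F k) = (\<Sum>k\<in>W. F (e k))" for F :: "'b \<Rightarrow> complex"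
    using e by (subst sum.reindex) (auto intro: inj_on_subset)
  have "star_rep (e ` W) R'"
  proof (rule star_repI)
    show "finite (e ` W)" using R by (simp add: star_rep_def)
    show "R' A i j = 0" if "i \<notin> e ` W \<or> j \<notin> e ` W" for A i j using that by (auto simp: R'_def)
    show "R' (A ** B) x y = (\<Sum>k\<in>e ` W. R' A x k * R' B k y)" if "x \<in> e ` W" "y \<in> e ` W" for A B x y
      using that R by (auto simp: Re sum_e star_rep_def mmult_def)
    show "R' (mat 1) x y = (if x = y then 1 else 0)" if "x \<in> e ` W" "y \<in> e ` W" for x y
      using that R e by (auto simp: Re star_rep_def inj_eq)
    show "R' (cadj A) x y = cnj (R' A y x)" if "x \<in> e ` W" "y \<in> e ` W" for A x y
      using that R by (auto simp: Re star_rep_def)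
    show "matrix_poly (\<lambda>A. R' A x y)" if "x \<in> e ` W" "y \<in> e ` W" for x y
      using that R by (auto simp: Re star_rep_def)
  qed
  moreover obtain \<xi> \<eta> where "\<And>A. p A = (\<Sum>i\<in>W. \<Sum>j\<in>W. \<xi> i * R A i j * \<eta> j)" using p by (auto simp: matrix_coeff_def)
  then have "matrix_coeff (e ` W) R' p"
    by (intro matrix_coeffI[where \<xi> = "\<lambda>x. \<xi> (inv_into UNIV e x)" and \<eta> = "\<lambda>x. \<eta> (inv_into UNIV e x)"]) (use e in \<open>simp add: sum_e Re\<close>)
  ultimately show ?thesis by blast
qed

lemma star_rep_standard: "star_rep UNIV (\<lambda>A i j. (A :: complex^'n^'n) $ i $ j)"
  by (rule star_repI) (auto simp: matrix_matrix_mult_def mat_def intro: matrix_poly.intros)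

lemma star_rep_direct_sum:
  assumes R1: "star_rep W1 R1" and R2: "star_rep W2 R2"
  shows "star_rep (W1 <+> W2) (\<lambda>A x y. case x of Inl a \<Rightarrow> (case y of Inl b \<Rightarrow> R1 A a b | Inr b \<Rightarrow> 0)
     | Inr a \<Rightarrow> (case y of Inl b \<Rightarrow> 0 | Inr b \<Rightarrow> R2 A a b))" (is "star_rep ?W ?R")
proof (rule star_repI)
  have f: "finite W1" "finite W2" using R1 R2 by (auto simp: star_rep_def)
  have z1: "R1 A i j = 0" if "i \<notin> W1 \<or> j \<notin> W1" for A i j using R1 that unfolding star_rep_def by blast
  have z2: "R2 A i j = 0" if "i \<notin> W2 \<or> j \<notin> W2" for A i j using R2 that unfolding star_rep_def by blast
  show "finite ?W" using f by simp
  show "?R A i j = 0" if "i \<notin> ?W \<or> j \<notin> ?W" for A i j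
    using that by (cases i; cases j) (auto intro: z1 z2)
  show "?R (A ** B) i j = (\<Sum>k\<in>?W. ?R A i k * ?R B k j)" if "i \<in> ?W" "j \<in> ?W" for A B i j
    using that R1 R2 unfolding sum.Plus[OF f] by (auto simp: star_rep_def mmult_def)
qed (use R1 R2 in \<open>auto simp: star_rep_def split: sum.splits intro: matrix_poly.const\<close>)

lemma star_rep_tensor:
  assumes R1: "star_rep W1 R1" and R2: "star_rep W2 R2"
  shows "star_rep (W1 \<times> W2) (\<lambda>A x y. R1 A (fst x) (fst y) * R2 A (snd x) (snd y))" (is "star_rep ?W ?R")
proof (rule star_repI)
  have z1: "R1 A i j = 0" if "i \<notin> W1 \<or> j \<notin> W1" for A i j using R1 that unfolding star_rep_def by blast
  have z2: "R2 A i j = 0" if "i \<notin> W2 \<or> j \<notin> W2" for A i j using R2 that unfolding star_rep_def by blast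
  show "finite ?W" using R1 R2 by (auto simp: star_rep_def)
  show "?R A i j = 0" if "i \<notin> ?W \<or> j \<notin> ?W" for A i j
    using that z1 z2 by (cases i; cases j) auto
  show "?R (A ** B) i j = (\<Sum>k\<in>?W. ?R A i k * ?R B k j)" for A B i j
  proof -
    have "(\<Sum>k\<in>?W. ?R A i k * ?R B k j) = (\<Sum>k\<in>W1. \<Sum>l\<in>W2. (R1 A (fst i) k * R1 B k (fst j)) * (R2 A (snd i) l * R2 B l (snd j)))"
      by (simp add: sum.cartesian_product split_beta mult_ac)
    also have "\<dots> = (\<Sum>k\<in>W1. R1 A (fst i) k * R1 B k (fst j)) * (\<Sum>l\<in>W2. R2 A (snd i) l * R2 B l (snd j))"
      by (simp add: sum_product)
    finally show ?thesis using R1 R2 by (simp add: star_rep_def mmult_def)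
  qed
  show "?R (mat 1) i j = (if i = j then 1 else 0)" if "i \<in> ?W" "j \<in> ?W" for i j
    using that R1 R2 by (cases i; cases j) (auto simp: star_rep_def split: if_splits)
qed (use R1 R2 in \<open>auto simp: star_rep_def intro!: matrix_poly.mult\<close>)

text \<open>Each way of forming a polynomial has its representation: the trivial one for constants,
  the standard one for entries, the direct sum for sums and the tensor product for products.\<close>

lemma matrix_poly_is_matrix_coeff:
  fixes p :: "complex^'n^'n \<Rightarrow> complex"
  assumes "matrix_poly p"
  shows "\<exists>(W :: nat set) R. star_rep W R \<and> matrix_coeff W R p"
  using assms
proof induction
  case (const c)
  have "star_rep {0::nat} (\<lambda>A i j. if i = 0 \<and> j = 0 then 1 else 0)"
    by (rule star_repI) (auto intro: matrix_poly.const)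
  moreover have "matrix_coeff {0::nat} (\<lambda>A i j. if i = 0 \<and> j = 0 then 1 else 0) (\<lambda>A. c)"
    by (rule matrix_coeffI[where \<xi> = "\<lambda>_. c" and \<eta> = "\<lambda>_. 1"]) simp
  ultimately show ?case by blast
next
  case (entry i j)
  obtain e :: "'n \<Rightarrow> nat" where e: "inj e" using finite_imp_inj_to_nat_seg[of "UNIV :: 'n set"] by auto
  have "matrix_coeff UNIV (\<lambda>A i j. (A :: complex^'n^'n) $ i $ j) (\<lambda>A. A $ i $ j)"
    by (rule matrix_coeffI[where \<xi> = "\<lambda>k. if k = i then 1 else 0" and \<eta> = "\<lambda>k. if k = j then 1 else 0"])
       (simp add: mult_delta_left mult_delta_right)
  then show ?case using star_rep_transport[OF star_rep_standard _ e] by blast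
next
  case (add p q)
  then obtain W1 W2 :: "nat set" and R1 R2 where R: "star_rep W1 R1" "matrix_coeff W1 R1 p" "star_rep W2 R2" "matrix_coeff W2 R2 q" by blast
  obtain \<xi>1 \<eta>1 where 1: "\<And>A. p A = (\<Sum>i\<in>W1. \<Sum>j\<in>W1. \<xi>1 i * R1 A i j * \<eta>1 j)" using R by (auto simp: matrix_coeff_def)
  obtain \<xi>2 \<eta>2 where 2: "\<And>A. q A = (\<Sum>i\<in>W2. \<Sum>j\<in>W2. \<xi>2 i * R2 A i j * \<eta>2 j)" using R by (auto simp: matrix_coeff_def)
  have f: "finite W1" "finite W2" using R by (auto simp: star_rep_def)
  have "matrix_coeff (W1 <+> W2) (\<lambda>A x y. case x of Inl a \<Rightarrow> (case y of Inl b \<Rightarrow> R1 A a b | Inr b \<Rightarrow> 0)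
     | Inr a \<Rightarrow> (case y of Inl b \<Rightarrow> 0 | Inr b \<Rightarrow> R2 A a b)) (\<lambda>A. p A + q A)"
    by (rule matrix_coeffI[where \<xi> = "case_sum \<xi>1 \<xi>2" and \<eta> = "case_sum \<eta>1 \<eta>2"]) (simp add: sum.Plus f 1 2)
  then show ?case using star_rep_transport[OF star_rep_direct_sum[OF R(1,3)] _ inj_sum_encode] by blast
next
  case (mult p q)
  then obtain W1 W2 :: "nat set" and R1 R2 where R: "star_rep W1 R1" "matrix_coeff W1 R1 p" "star_rep W2 R2" "matrix_coeff W2 R2 q" by blast
  obtain \<xi>1 \<eta>1 where 1: "\<And>A. p A = (\<Sum>i\<in>W1. \<Sum>j\<in>W1. \<xi>1 i * R1 A i j * \<eta>1 j)" using R by (auto simp: matrix_coeff_def)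
  obtain \<xi>2 \<eta>2 where 2: "\<And>A. q A = (\<Sum>i\<in>W2. \<Sum>j\<in>W2. \<xi>2 i * R2 A i j * \<eta>2 j)" using R by (auto simp: matrix_coeff_def)
  have "matrix_coeff (W1 \<times> W2) (\<lambda>A x y. R1 A (fst x) (fst y) * R2 A (snd x) (snd y)) (\<lambda>A. p A * q A)"
  proof (rule matrix_coeffI[where \<xi> = "\<lambda>x. \<xi>1 (fst x) * \<xi>2 (snd x)" and \<eta> = "\<lambda>x. \<eta>1 (fst x) * \<eta>2 (snd x)"])
    fix A
    have "p A * q A = (\<Sum>i\<in>W1. \<Sum>k\<in>W2. (\<Sum>j\<in>W1. \<xi>1 i * R1 A i j * \<eta>1 j) * (\<Sum>l\<in>W2. \<xi>2 k * R2 A k l * \<eta>2 l))"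
      by (simp add: 1 2 sum_product)
    also have "\<dots> = (\<Sum>i\<in>W1. \<Sum>k\<in>W2. \<Sum>j\<in>W1. \<Sum>l\<in>W2. (\<xi>1 i * R1 A i j * \<eta>1 j) * (\<xi>2 k * R2 A k l * \<eta>2 l))"
      by (simp only: sum_product)
    also have "\<dots> = (\<Sum>x\<in>W1 \<times> W2. \<Sum>y\<in>W1 \<times> W2. (\<xi>1 (fst x) * \<xi>2 (snd x)) * (R1 A (fst x) (fst y) * R2 A (snd x) (snd y)) * (\<eta>1 (fst y) * \<eta>2 (snd y)))"
    proof -
      have pr: "(\<Sum>x\<in>W1 \<times> W2. F x) = (\<Sum>i\<in>W1. \<Sum>k\<in>W2. F (i, k))" for F :: "nat \<times> nat \<Rightarrow> complex"
        by (simp add: sum.cartesian_product)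
      show ?thesis unfolding pr by (simp add: mult_ac)
    qed
    finally show "p A * q A = (\<Sum>x\<in>W1 \<times> W2. \<Sum>y\<in>W1 \<times> W2. (\<xi>1 (fst x) * \<xi>2 (snd x)) * (R1 A (fst x) (fst y) * R2 A (snd x) (snd y)) * (\<eta>1 (fst y) * \<eta>2 (snd y)))" .
  qed
  then show ?case using star_rep_transport[OF star_rep_tensor[OF R(1,3)] _ inj_prod_encode] by blast
qed

section \<open>Orthogonal projections onto stable subspaces\<close>

definition subspace_on :: "'a set \<Rightarrow> ('a \<Rightarrow> complex) set \<Rightarrow> bool" where
  "subspace_on W N \<longleftrightarrow> (\<lambda>_. 0) \<in> N \<and> (\<forall>x\<in>N. \<forall>y\<in>N. (\<lambda>i. x i + y i) \<in> N) \<and> (\<forall>c. \<forall>x\<in>N. (\<lambda>i. c * x i) \<in> N) \<and>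
     (\<forall>x\<in>N. \<forall>y. (\<forall>i\<in>W. x i = y i) \<longrightarrow> y \<in> N)"

lemma subspace_on_sum:
  assumes "subspace_on W N" "\<And>j. j \<in> J \<Longrightarrow> x j \<in> N" shows "(\<lambda>i. \<Sum>j\<in>J. c j * x j i) \<in> N"
  using assms(2) by (induction J rule: infinite_finite_induct) (use assms(1) in \<open>auto simp: subspace_on_def\<close>)

text \<open>Gram-Schmidt, one coordinate at a time. \<open>N0\<close> is the part of
  \<open>N\<close> whose new coordinate vanishes. If some \<open>c\<close> in \<open>N\<close> has a
  nonzero new coordinate, subtracting its projection gives \<open>e\<close> in \<open>N\<close>
  orthogonal to \<open>N0\<close>, and the projection onto the line of \<open>e\<close> is
  added.\<close>

lemma orthogonal_projection_exists:
  assumes "finite W" "subspace_on W N"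
  shows "\<exists>P. (\<forall>j\<in>W. (\<lambda>i. P i j) \<in> N) \<and> (\<forall>i j. P j i = cnj (P i j)) \<and> (\<forall>i j. i \<notin> W \<or> j \<notin> W \<longrightarrow> P i j = 0) \<and>
    (\<forall>x\<in>N. \<forall>i\<in>W. (\<Sum>j\<in>W. P i j * x j) = x i)"
  using assms
proof (induction W arbitrary: N)
  case empty
  then show ?case by (intro exI[of _ "\<lambda>_ _. 0"]) auto
next
  case (insert o1 W)
  note N = insert.prems[unfolded subspace_on_def]
  have Nadd: "(\<lambda>i. x i + y i) \<in> N" if "x \<in> N" "y \<in> N" for x y using N that by blast
  have Nscale: "(\<lambda>i. c * x i) \<in> N" if "x \<in> N" for c x using N that by blast
  have Ncong: "y \<in> N" if "x \<in> N" "\<And>i. i \<in> insert o1 W \<Longrightarrow> x i = y i" for x y using N that by blast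
  define z where "z x = (\<lambda>i. if i = o1 then 0 else x i)" for x :: "'a \<Rightarrow> complex"
  define N0 where "N0 = {x. z x \<in> N}"
  have "subspace_on W N0" unfolding subspace_on_def
  proof (intro conjI allI ballI impI)
    show "(\<lambda>_. 0) \<in> N0" using N by (simp add: N0_def z_def)
    fix x assume x: "x \<in> N0"
    show "(\<lambda>i. x i + y i) \<in> N0" if "y \<in> N0" for y
    proof -
      have "(\<lambda>i. z x i + z y i) \<in> N" using x that N by (simp add: N0_def)
      moreover have "(\<lambda>i. z x i + z y i) = z (\<lambda>i. x i + y i)" by (auto simp: z_def)
      ultimately show ?thesis by (simp add: N0_def)
    qed
    show "(\<lambda>i. c * x i) \<in> N0" for c
    proof -
      have "(\<lambda>i. c * z x i) \<in> N" using x N by (simp add: N0_def)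
      moreover have "(\<lambda>i. c * z x i) = z (\<lambda>i. c * x i)" by (auto simp: z_def)
      ultimately show ?thesis by (simp add: N0_def)
    qed
    show "y \<in> N0" if "\<forall>i\<in>W. x i = y i" for y
    proof -
      have "\<forall>i\<in>insert o1 W. z x i = z y i" using that by (auto simp: z_def)
      then show ?thesis using x N by (simp add: N0_def)
    qed
  qed
  then obtain P where P: "\<And>j. j \<in> W \<Longrightarrow> (\<lambda>i. P i j) \<in> N0" "\<And>i j. P j i = cnj (P i j)" "\<And>i j. i \<notin> W \<or> j \<notin> W \<Longrightarrow> P i j = 0"
    "\<And>x i. x \<in> N0 \<Longrightarrow> i \<in> W \<Longrightarrow> (\<Sum>j\<in>W. P i j * x j) = x i" using insert.IH by blast
  have PN: "(\<lambda>i. P i j) \<in> N" for j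
  proof (cases "j \<in> W")
    case True
    have "z (\<lambda>i. P i j) = (\<lambda>i. P i j)" using P(3) insert.hyps by (auto simp: z_def)
    then show ?thesis using P(1)[OF True] by (simp add: N0_def)
  next
    case False
    then have "(\<lambda>i. P i j) = (\<lambda>_. 0)" using P(3) by auto
    then show ?thesis using N by simp
  qed
  have P0: "P o1 j = 0" "P j o1 = 0" for j using P(3) insert.hyps by auto
  have zN0: "x \<in> N0" if "x \<in> N" "x o1 = 0" for x
  proof -
    have "z x = x" using that by (auto simp: z_def)
    then show ?thesis using that by (simp add: N0_def)
  qed
  show ?case
  proof (cases "\<exists>c\<in>N. c o1 \<noteq> 0")
    case False
    show ?thesis
    proof (intro exI[of _ P] conjI ballI allI impI)
      show "(\<Sum>j\<in>insert o1 W. P i j * x j) = x i" if "x \<in> N" "i \<in> insert o1 W" for x i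
        using that P(4)[OF zN0] False P0 insert.hyps by auto
      show "(\<lambda>i. P i j) \<in> N" for j by (rule PN)
      show "P j i = cnj (P i j)" for i j by (rule P(2))
      show "P i j = 0" if "i \<notin> insert o1 W \<or> j \<notin> insert o1 W" for i j using that P(3) by auto
    qed
  next
    case True
    then obtain c where c: "c \<in> N" "c o1 \<noteq> 0" by blast
    define e where "e i = c i + (-1) * (\<Sum>j\<in>W. c j * P i j)" for i
    have eN: "e \<in> N"
    proof -
      have "(\<lambda>i. \<Sum>j\<in>W. c j * P i j) \<in> N" by (rule subspace_on_sum[OF insert.prems PN])
      from Nadd[OF c(1) Nscale[OF this, of "-1"]] show ?thesis unfolding e_def .
    qed
    have e0: "e o1 \<noteq> 0" using c(2) by (simp add: e_def P0)
    have orth: "(\<Sum>i\<in>W. cnj (e i) * x i) = 0" if x: "x \<in> N0" for x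
    proof -
      have "(\<Sum>i\<in>W. cnj (e i) * x i) = (\<Sum>i\<in>W. cnj (c i) * x i) - (\<Sum>i\<in>W. \<Sum>j\<in>W. cnj (c j) * (cnj (P i j) * x i))"
        by (simp add: e_def algebra_simps sum.distrib sum_negf sum_distrib_left sum_subtractf)
      also have "(\<Sum>i\<in>W. \<Sum>j\<in>W. cnj (c j) * (cnj (P i j) * x i)) = (\<Sum>j\<in>W. cnj (c j) * (\<Sum>i\<in>W. P j i * x i))"
        by (subst sum.swap) (simp add: P(2)[symmetric] sum_distrib_left)
      also have "\<dots> = (\<Sum>j\<in>W. cnj (c j) * x j)" using P(4)[OF x] by simp
      finally show ?thesis by simp
    qed
    define n2 where "n2 = (\<Sum>i\<in>insert o1 W. cnj (e i) * e i)"
    have n2: "n2 = complex_of_real (\<Sum>i\<in>insert o1 W. (cmod (e i))\<^sup>2)"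
      unfolding n2_def of_real_sum complex_norm_square by (simp add: mult.commute)
    have "(\<Sum>i\<in>insert o1 W. (cmod (e i))\<^sup>2) > 0"
      by (rule sum_pos2[of _ o1]) (use e0 insert.hyps in auto)
    then have n20: "n2 \<noteq> 0" "cnj n2 = n2" unfolding n2 by (metis less_irrefl of_real_eq_0_iff) simp
    define Q where "Q i j = (if i \<in> insert o1 W \<and> j \<in> insert o1 W then P i j + e i * cnj (e j) / n2 else 0)" for i j
    have Pe: "(\<Sum>j\<in>W. P i j * e j) = 0" if "i \<in> W" for i
    proof -
      have "(\<Sum>j\<in>W. cnj (e j) * P j i) = 0" using orth[OF P(1)[OF that]] .
      then have "cnj (\<Sum>j\<in>W. cnj (e j) * P j i) = 0" by simp
      then show ?thesis by (simp add: P(2)[symmetric] mult.commute)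
    qed
    show ?thesis
    proof (intro exI[of _ Q] conjI ballI allI impI)
      show "(\<lambda>i. Q i j) \<in> N" if j: "j \<in> insert o1 W" for j
      proof -
        have "(\<lambda>i. P i j + (cnj (e j) / n2) * e i) \<in> N" by (rule Nadd[OF PN Nscale[OF eN]])
        then show ?thesis by (rule Ncong) (use j in \<open>simp add: Q_def\<close>)
      qed
      show "Q j i = cnj (Q i j)" for i j using P(2)[of j i] n20(2) by (simp add: Q_def)
      show "Q i j = 0" if "i \<notin> insert o1 W \<or> j \<notin> insert o1 W" for i j using that by (auto simp: Q_def)
      fix x i assume x: "x \<in> N" and i: "i \<in> insert o1 W"
      define t where "t = x o1 / e o1"
      define y where "y j = x j + (- t) * e j" for j
      have "y \<in> N" unfolding y_def by (rule Nadd[OF x Nscale[OF eN]])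
      moreover have y0: "y o1 = 0" using e0 by (simp add: y_def t_def)
      ultimately have yN0: "y \<in> N0" using zN0 by blast
      have xy: "x j = t * e j + y j" for j by (simp add: y_def)
      have Px: "(\<Sum>j\<in>insert o1 W. P i j * x j) = y i"
      proof (cases "i = o1")
        case True
        then show ?thesis using P0 y0 by simp
      next
        case False
        then have "i \<in> W" using i by simp
        have "(\<Sum>j\<in>insert o1 W. P i j * x j) = (\<Sum>j\<in>W. t * (P i j * e j)) + (\<Sum>j\<in>W. P i j * y j)"
          using insert.hyps by (simp add: P0 xy algebra_simps sum.distrib)
        also have "\<dots> = y i" using Pe[OF \<open>i \<in> W\<close>] P(4)[OF yN0 \<open>i \<in> W\<close>] by (simp flip: sum_distrib_left)
        finally show ?thesis .
      qed
      have ex: "(\<Sum>j\<in>insert o1 W. cnj (e j) * x j) = t * n2"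
      proof -
        have "(\<Sum>j\<in>insert o1 W. cnj (e j) * x j) = t * n2 + (\<Sum>j\<in>insert o1 W. cnj (e j) * y j)"
          by (simp only: xy n2_def distrib_left sum.distrib sum_distrib_left) (simp add: mult_ac)
        also have "(\<Sum>j\<in>insert o1 W. cnj (e j) * y j) = 0" using orth[OF yN0] y0 insert.hyps by simp
        finally show ?thesis by simp
      qed
      have "(\<Sum>j\<in>insert o1 W. Q i j * x j) = (\<Sum>j\<in>insert o1 W. P i j * x j + e i / n2 * (cnj (e j) * x j))"
        by (intro sum.cong refl) (use i in \<open>simp add: Q_def algebra_simps\<close>)
      also have "\<dots> = y i + e i / n2 * (t * n2)" unfolding sum.distrib sum_distrib_left[symmetric] Px ex ..
      also have "\<dots> = x i" using n20 xy[of i] by simp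
      finally show "(\<Sum>j\<in>insert o1 W. Q i j * x j) = x i" .
    qed
  qed
qed

lemma unitary_entry_le_1:
  fixes u :: "complex^'n^'n"
  assumes "cadj u ** u = mat 1" shows "norm (u $ i $ j) \<le> 1"
proof -
  have "(cadj u ** u) $ j $ j = 1" using assms by (simp add: mat_def)
  then have "(\<Sum>k\<in>UNIV. cnj (u $ k $ j) * u $ k $ j) = 1" by (simp add: matrix_matrix_mult_def)
  moreover have "(\<Sum>k\<in>UNIV. cnj (u $ k $ j) * u $ k $ j) = complex_of_real (\<Sum>k\<in>UNIV. (norm (u $ k $ j))\<^sup>2)"
    unfolding of_real_sum complex_norm_square by (simp add: mult.commute)
  ultimately have s: "(\<Sum>k\<in>UNIV. (norm (u $ k $ j))\<^sup>2) = 1" by (metis of_real_eq_1_iff)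
  have "(norm (u $ i $ j))\<^sup>2 \<le> (\<Sum>k\<in>UNIV. (norm (u $ k $ j))\<^sup>2)"
    by (rule member_le_sum) auto
  then show ?thesis using s by (simp add: power2_le_imp_le abs_square_le_1)
qed

text \<open>This supplies the bound that the reflection argument demands: its functions are, on the
  circle, polynomial in the entries of a unitary matrix and of its adjoint.\<close>

lemma matrix_poly_bounded_on_unitary:
  fixes p :: "complex^'n^'n \<Rightarrow> complex"
  assumes "matrix_poly p" shows "\<exists>B. \<forall>u. cadj u ** u = mat 1 \<longrightarrow> norm (p u) \<le> B"
  using assms
proof induction
  case (const c)
  then show ?case by blast
next
  case (entry i j)
  then show ?case using unitary_entry_le_1 by blast
next
  case (add p q)
  then obtain B C where "\<forall>u. cadj u ** u = mat 1 \<longrightarrow> norm (p u) \<le> B" "\<forall>u. cadj u ** u = mat 1 \<longrightarrow> norm (q u) \<le> C" by blast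
  then show ?case by (intro exI[of _ "B + C"]) (meson add_mono norm_triangle_le)
next
  case (mult p q)
  then obtain B C where "\<forall>u. cadj u ** u = mat 1 \<longrightarrow> norm (p u) \<le> B" "\<forall>u. cadj u ** u = mat 1 \<longrightarrow> norm (q u) \<le> C" by blast
  then show ?case by (intro exI[of _ "B * C"]) (auto simp: norm_mult intro!: mult_mono order_trans[OF norm_ge_zero])
qed

lemma right_inverse_cadj:
  fixes u :: "complex^'n^'n"
  assumes "cadj u ** u = mat 1" shows "u ** cadj u = mat 1"
  using assms matrix_left_right_inverse by blast

lemma bounded_pole_order:
  assumes T: "finite T" and "finite I" "\<And>i. i \<in> I \<Longrightarrow> \<exists>N. pole_le T N (f i)"
  shows "\<exists>N. \<forall>i\<in>I. pole_le T N (f i)"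
  using assms(2,3)
proof (induction I)
  case (insert a I)
  then obtain N M where "\<forall>i\<in>I. pole_le T N (f i)" "pole_le T M (f a)" by blast
  then show ?case by (intro exI[of _ "max N M"]) (auto intro: pole_le_mono[OF T])
qed auto

text \<open>Stability under \<open>A\<close> gives \<open>P R P = R P\<close> for
  \<open>R = R A\<close>. Stability under \<open>cadj A\<close>, after taking adjoints, gives
  \<open>P R P = P R\<close>.\<close>

lemma commutes_with_projection:
  assumes R: "star_rep W R" and N: "\<And>A x. A \<in> H \<Longrightarrow> x \<in> N \<Longrightarrow> (\<lambda>i. \<Sum>j\<in>W. R A i j * x j) \<in> N"
    and H: "A \<in> H" "cadj A \<in> H"
    and P: "\<And>j. j \<in> W \<Longrightarrow> (\<lambda>i. P i j) \<in> N" "\<And>i j. P j i = cnj (P i j)" "\<And>i j. i \<notin> W \<or> j \<notin> W \<Longrightarrow> P i j = 0"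
    "\<And>x i. x \<in> N \<Longrightarrow> i \<in> W \<Longrightarrow> (\<Sum>j\<in>W. P i j * x j) = x i"
  shows "mmult W (R A) P = mmult W P (R A)"
proof -
  have st: "mmult W P (mmult W (R B) P) = mmult W (R B) P" if "B \<in> H" for B
  proof (intro ext)
    fix i j
    show "mmult W P (mmult W (R B) P) i j = mmult W (R B) P i j"
    proof (cases "i \<in> W \<and> j \<in> W")
      case True
      then show ?thesis using P(4)[OF N[OF that P(1)], of j i] by (simp add: mmult_def)
    next
      case False
      then show ?thesis using P(3) R by (auto simp: mmult_def star_rep_def)
    qed
  qed
  have adj: "mmult W X Y i j = cnj (mmult W (\<lambda>i j. cnj (Y j i)) (\<lambda>i j. cnj (X j i)) j i)" for X Y i j
    by (simp add: mmult_def mult.commute)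
  have Pa: "(\<lambda>i j. cnj (P j i)) = P" using P(2) by (intro ext) metis
  have Ra: "(\<lambda>i j. cnj (R (cadj A) j i)) = R A" using R by (intro ext) (simp add: star_rep_def)
  have "mmult W (mmult W P (R A)) P = mmult W P (R A)"
  proof (intro ext)
    fix i j
    have a1: "(\<lambda>i j. cnj (mmult W (R (cadj A)) P j i)) = mmult W P (R A)"
      by (intro ext) (subst adj, simp add: Pa Ra)
    have "mmult W P (R A) i j = cnj (mmult W (R (cadj A)) P j i)" using a1 by metis
    also have "\<dots> = cnj (mmult W P (mmult W (R (cadj A)) P) j i)" using st[OF H(2)] by simp
    also have "\<dots> = mmult W (mmult W P (R A)) P i j" by (subst adj) (simp add: Pa a1)
    finally show "mmult W (mmult W P (R A)) P i j = mmult W P (R A) i j" by simp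
  qed
  then show ?thesis using st[OF H(1)] by (simp add: mmult_assoc)
qed

text \<open>If \<open>g = u h\<close> with \<open>u\<close> unitary on the circle and \<open>h\<close> regular inside, then for the projection \<open>P\<close>
  onto a subspace stable under the group the function \<open>R h P (R h)\<^sup>-\<^sup>1\<close> is regular inside and equals
  \<open>(R u)\<^sup>* P (R u)\<close> on the circle, where it is Hermitian. By reflection it is constant, so \<open>u\<close>
  stabilizes the subspace.\<close>

lemma unitary_factor_satisfies_equations:
  fixes H :: "(complex^'n^'n) set" and g h :: "proj_line \<Rightarrow> complex^'n^'n"
  assumes p: "matrix_poly p" "\<And>A. A \<in> H \<Longrightarrow> p A = 0"
    and H1: "\<And>A B. A \<in> H \<Longrightarrow> B \<in> H \<Longrightarrow> A ** B \<in> H" "mat 1 \<in> H" "\<And>A. A \<in> H \<Longrightarrow> invertible A \<and> matrix_inv A \<in> H"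
      "\<And>A. A \<in> H \<Longrightarrow> cadj A \<in> H"
    and T: "finite T" "\<And>z. Aff z \<in> T \<Longrightarrow> norm z \<ge> 1" and T': "finite T'" "T \<subseteq> T'" "\<And>z. norm z = 1 \<Longrightarrow> Aff z \<in> T' \<Longrightarrow> Aff z \<in> T"
    and g: "mpole_le T' N g" "\<And>x. x \<notin> T' \<Longrightarrow> g x \<in> H"
    and h: "mpole_le T M h" "\<And>x. x \<notin> T \<Longrightarrow> invertible (h x)"
    and gh: "\<And>z. norm z = 1 \<Longrightarrow> Aff z \<notin> T \<Longrightarrow> cadj (h (Aff z)) ** h (Aff z) = cadj (g (Aff z)) ** g (Aff z)"
    and s0: "norm s0 = 1" "Aff s0 \<notin> T" "g (Aff s0) = h (Aff s0)"
    and x: "x \<notin> T'"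
  shows "p (g x ** matrix_inv (h x)) = 0"
proof -
  obtain W :: "nat set" and R where R: "star_rep W R" "matrix_coeff W R p" using matrix_poly_is_matrix_coeff[OF p(1)] by blast
  obtain \<xi> \<eta> where pc: "\<And>A. p A = (\<Sum>i\<in>W. \<Sum>j\<in>W. \<xi> i * R A i j * \<eta> j)" using R by (auto simp: matrix_coeff_def)
  have fW: "finite W" and Rm: "\<And>A B. R (A ** B) = mmult W (R A) (R B)" and R1: "\<And>i j. i \<in> W \<Longrightarrow> j \<in> W \<Longrightarrow> R (mat 1) i j = (if i = j then 1 else 0)"
    and Ra: "\<And>A i j. R (cadj A) i j = cnj (R A j i)" and Rp: "\<And>i j. matrix_poly (\<lambda>A. R A i j)"
    and R0: "\<And>A i j. i \<notin> W \<or> j \<notin> W \<Longrightarrow> R A i j = 0"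
    using R(1) unfolding star_rep_def by blast+
  have one: "mmult W (R (mat 1)) X i j = X i j" if "i \<in> W" for X i j
    using that fW by (simp add: mmult_def R1 mult_delta_left mult_delta_right)
  have one': "mmult W X (R (mat 1)) i j = X i j" if "j \<in> W" for X i j
    using that fW by (simp add: mmult_def R1 mult_delta_left mult_delta_right)
  \<comment> \<open>The largest stable subspace on which the functional \<open>\<xi>\<close>
    vanishes. It contains \<open>\<eta>\<close> because \<open>p\<close> vanishes on
    \<open>H\<close>; conversely, if \<open>R u\<close> maps \<open>\<eta>\<close> into it, testing
    with the identity of \<open>H\<close> gives \<open>p u = 0\<close>.\<close>
  define NN where "NN = {y. \<forall>A\<in>H. (\<Sum>i\<in>W. \<xi> i * (\<Sum>j\<in>W. R A i j * y j)) = 0}"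
  have sub: "subspace_on W NN" unfolding subspace_on_def
  proof (intro conjI ballI allI impI)
    show "(\<lambda>_. 0) \<in> NN" by (simp add: NN_def)
    fix x assume x: "x \<in> NN"
    show "(\<lambda>i. x i + y i) \<in> NN" if "y \<in> NN" for y
      using x that by (simp add: NN_def distrib_left sum.distrib)
    show "(\<lambda>i. c * x i) \<in> NN" for c
    proof -
      have "(\<Sum>i\<in>W. \<xi> i * (\<Sum>j\<in>W. R A i j * (c * x j))) = c * (\<Sum>i\<in>W. \<xi> i * (\<Sum>j\<in>W. R A i j * x j))" for A
        by (simp add: sum_distrib_left mult_ac)
      then show ?thesis using x by (simp add: NN_def)
    qed
    show "y \<in> NN" if "\<forall>i\<in>W. x i = y i" for y
      using x that by (simp add: NN_def)
  qed
  have stable: "(\<lambda>i. \<Sum>j\<in>W. R A i j * y j) \<in> NN" if A: "A \<in> H" and y: "y \<in> NN" for A y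
  proof -
    have "(\<Sum>j\<in>W. R B i j * (\<Sum>k\<in>W. R A j k * y k)) = (\<Sum>k\<in>W. R (B ** A) i k * y k)" for B i
    proof -
      have "(\<Sum>j\<in>W. R B i j * (\<Sum>k\<in>W. R A j k * y k)) = (\<Sum>j\<in>W. \<Sum>k\<in>W. R B i j * R A j k * y k)"
        by (simp add: sum_distrib_left mult_ac)
      also have "\<dots> = (\<Sum>k\<in>W. \<Sum>j\<in>W. R B i j * R A j k * y k)" by (rule sum.swap)
      finally show ?thesis by (simp add: Rm mmult_def sum_distrib_right)
    qed
    then show ?thesis using y H1(1)[OF _ A] by (simp add: NN_def)
  qed
  have \<eta>: "\<eta> \<in> NN"
  proof -
    have "(\<Sum>i\<in>W. \<xi> i * (\<Sum>j\<in>W. R A i j * \<eta> j)) = p A" for A by (simp add: pc sum_distrib_left mult_ac)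
    then show ?thesis using p(2) by (simp add: NN_def)
  qed
  obtain P where P: "\<And>j. j \<in> W \<Longrightarrow> (\<lambda>i. P i j) \<in> NN" "\<And>i j. P j i = cnj (P i j)" "\<And>i j. i \<notin> W \<or> j \<notin> W \<Longrightarrow> P i j = 0"
    "\<And>x i. x \<in> NN \<Longrightarrow> i \<in> W \<Longrightarrow> (\<Sum>j\<in>W. P i j * x j) = x i"
    using orthogonal_projection_exists[OF fW sub] by blast
  have comm: "mmult W (R A) P = mmult W P (R A)" if "A \<in> H" for A
    by (rule commutes_with_projection[OF R(1) stable that H1(4)[OF that] P])
  define hi where "hi x = matrix_inv (h x)" for x
  define u where "u x = g x ** hi x" for x
  have hi_eq: "hi = (\<lambda>x. matrix_inv (h x))" by (simp add: hi_def fun_eq_iff)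
  obtain M' where hi: "mpole_le T M' hi" using mpole_le_matrix_inv[OF T(1) h] unfolding hi_eq by blast
  define f where "f i j x = mmult W (mmult W (R (h x)) P) (R (hi x)) i j" for i j x
  have uu: "cadj (u (Aff z)) ** u (Aff z) = mat 1" if z: "norm z = 1" "Aff z \<notin> T" for z
  proof -
    let ?h = "h (Aff z)" and ?g = "g (Aff z)" and ?k = "hi (Aff z)"
    have hk: "?h ** ?k = mat 1" using matrix_inv_mult(1)[OF h(2)[OF z(2)]] by (simp add: hi_def)
    have "cadj (u (Aff z)) ** u (Aff z) = cadj ?k ** (cadj ?g ** ?g) ** ?k" by (simp add: u_def cadj_mult matrix_mul_assoc)
    also have "\<dots> = (cadj ?k ** cadj ?h) ** (?h ** ?k)" unfolding gh[OF z, symmetric] by (simp only: matrix_mul_assoc)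
    also have "\<dots> = cadj (?h ** ?k) ** (?h ** ?k)" by (simp add: cadj_mult)
    finally show ?thesis using hk by simp
  qed
  \<comment> \<open>On the circle \<open>h = cadj u ** g\<close>, since \<open>u\<close> is unitary
    there and \<open>u ** h = g\<close>. As \<open>g\<close> takes values in \<open>H\<close>, its
    representation commutes with \<open>P\<close> and cancels.\<close>
  have f_eq: "f i j (Aff z) = mmult W (mmult W (R (cadj (u (Aff z)))) P) (R (u (Aff z))) i j" if z: "norm z = 1" "Aff z \<notin> T" for z i j
  proof -
    let ?h = "h (Aff z)" and ?g = "g (Aff z)" and ?k = "hi (Aff z)" and ?u = "u (Aff z)"
    have gH: "?g \<in> H" using g(2) T'(3) z by blast
    have kh: "?k ** ?h = mat 1" using matrix_inv_mult(2)[OF h(2)[OF z(2)]] by (simp add: hi_def)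
    have "?u ** ?h = ?g" using kh by (simp add: u_def matrix_mul_assoc[symmetric])
    then have "cadj ?u ** ?g = (cadj ?u ** ?u) ** ?h" by (metis matrix_mul_assoc)
    then have hu: "?h = cadj ?u ** ?g" using uu[OF z] by simp
    have gi: "matrix_inv ?g ** ?u = ?k"
      using matrix_inv_mult(2)[of ?g] H1(3)[OF gH] by (simp add: u_def matrix_mul_assoc)
    have "mmult W (mmult W (R ?h) P) (R ?k) = mmult W (mmult W (mmult W (R (cadj ?u)) (R ?g)) P) (mmult W (R (matrix_inv ?g)) (R ?u))"
      by (simp only: Rm[symmetric] hu[symmetric] gi)
    also have "\<dots> = mmult W (R (cadj ?u)) (mmult W (mmult W (R ?g) P) (mmult W (R (matrix_inv ?g)) (R ?u)))"
      by (simp add: mmult_assoc)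
    also have "\<dots> = mmult W (R (cadj ?u)) (mmult W P (mmult W (R (?g ** matrix_inv ?g)) (R ?u)))"
      by (simp add: comm[OF gH] mmult_assoc Rm)
    also have "?g ** matrix_inv ?g = mat 1" using matrix_inv_mult(1) H1(3)[OF gH] by blast
    also have "mmult W (R (mat 1)) (R ?u) = R (mat 1 ** ?u)" by (simp only: Rm)
    finally show ?thesis by (simp add: f_def mmult_assoc)
  qed
  have f_const: "f i j (Aff z) = P i j" if ij: "i \<in> W" "j \<in> W" and z: "norm z = 1" "Aff z \<notin> T" for i j z
  proof -
    have pf: "\<exists>K. pole_le T K (f i j)" for i j
    proof -
      have 1: "\<exists>K. \<forall>k\<in>W. \<forall>l\<in>W. pole_le T K (\<lambda>x. R (h x) k l)" 
      proof -
        have "\<exists>K. \<forall>kl\<in>W \<times> W. pole_le T K (\<lambda>x. R (h x) (fst kl) (snd kl))"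
          by (rule bounded_pole_order[OF T(1)]) (use fW pole_le_matrix_poly[OF T(1) Rp h(1)] in blast)+
        then show ?thesis by force
      qed
      have 2: "\<exists>K. \<forall>k\<in>W. \<forall>l\<in>W. pole_le T K (\<lambda>x. R (hi x) k l)" 
      proof -
        have "\<exists>K. \<forall>kl\<in>W \<times> W. pole_le T K (\<lambda>x. R (hi x) (fst kl) (snd kl))"
          by (rule bounded_pole_order[OF T(1)]) (use fW pole_le_matrix_poly[OF T(1) Rp hi] in blast)+
        then show ?thesis by force
      qed
      obtain K L where KL: "\<And>k l. k \<in> W \<Longrightarrow> l \<in> W \<Longrightarrow> pole_le T K (\<lambda>x. R (h x) k l)" "\<And>k l. k \<in> W \<Longrightarrow> l \<in> W \<Longrightarrow> pole_le T L (\<lambda>x. R (hi x) k l)"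
        using 1 2 by blast
      show ?thesis
      proof (cases "i \<in> W \<and> j \<in> W")
        case True
        have "pole_le T (K + 0 + L) (f i j)" unfolding f_def mmult_def
          by (intro pole_le_sum[OF T(1)] pole_le_mult pole_le_const[OF T(1)] KL) (use True in auto)
        then show ?thesis by blast
      next
        case False
        then have "f i j x = 0" for x using R0 by (auto simp: f_def mmult_def)
        then have "f i j = (\<lambda>_. 0)" by auto
        then show ?thesis using pole_le_const[OF T(1), of 0 0] by auto
      qed
    qed
    obtain K1 K2 where K: "pole_le T K1 (f i j)" "pole_le T K2 (f j i)" using pf by blast
    obtain B where B: "\<And>v. cadj v ** v = mat 1 \<Longrightarrow> norm (\<Sum>l\<in>W. (\<Sum>k\<in>W. R (cadj v) i k * P k l) * R v l j) \<le> B"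
    proof -
      have "\<exists>B. \<forall>v. cadj v ** v = mat 1 \<longrightarrow> norm (R v k l) \<le> B" for k l by (rule matrix_poly_bounded_on_unitary[OF Rp])
      then obtain C where C: "\<And>k l v. cadj v ** v = mat 1 \<Longrightarrow> norm (R v k l) \<le> C k l" by metis
      have "norm (\<Sum>l\<in>W. (\<Sum>k\<in>W. R (cadj v) i k * P k l) * R v l j) \<le> (\<Sum>l\<in>W. (\<Sum>k\<in>W. C k i * norm (P k l)) * C l j)"
        if v: "cadj v ** v = mat 1" for v
      proof -
        have "norm (\<Sum>l\<in>W. (\<Sum>k\<in>W. R (cadj v) i k * P k l) * R v l j) \<le> (\<Sum>l\<in>W. norm ((\<Sum>k\<in>W. R (cadj v) i k * P k l)) * norm (R v l j))"
          by (rule norm_sum[THEN order_trans]) (simp add: norm_mult)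
        also have "\<dots> \<le> (\<Sum>l\<in>W. (\<Sum>k\<in>W. C k i * norm (P k l)) * C l j)"
        proof (intro sum_mono mult_mono C v)
          fix l
          have "norm (\<Sum>k\<in>W. R (cadj v) i k * P k l) \<le> (\<Sum>k\<in>W. norm (R v k i) * norm (P k l))"
            by (rule norm_sum[THEN order_trans]) (simp add: norm_mult Ra)
          also have "\<dots> \<le> (\<Sum>k\<in>W. C k i * norm (P k l))" by (intro sum_mono mult_right_mono C v) auto
          finally show "norm (\<Sum>k\<in>W. R (cadj v) i k * P k l) \<le> (\<Sum>k\<in>W. C k i * norm (P k l))" .
          then show "0 \<le> (\<Sum>k\<in>W. C k i * norm (P k l))" by (meson norm_ge_zero order_trans)
        qed auto
        finally show ?thesis .
      qed
      then show thesis using that by blast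
    qed
    have "f i j (Aff z) = f i j (Aff s0)"
    proof (rule rational_conjugate_on_circle_constant[OF T pole_le_mono[OF T(1) K(1)] pole_le_mono[OF T(1) K(2)], of "max K1 K2" B])
      fix w :: complex assume w: "norm w = 1" "Aff w \<notin> T"
      show "norm (f i j (Aff w)) \<le> B" using B[OF uu[OF w]] f_eq[OF w, of i j] by (simp add: mmult_def)
      show "f j i (Aff w) = cnj (f i j (Aff w))"
      proof -
        let ?u = "u (Aff w)"
        have "cnj (f i j (Aff w)) = (\<Sum>l\<in>W. \<Sum>k\<in>W. cnj (R ?u l j) * (P l k * R ?u k i))"
          unfolding f_eq[OF w] by (simp add: mmult_def Ra sum_distrib_right sum_distrib_left P(2)[symmetric] mult_ac)
        also have "\<dots> = (\<Sum>k\<in>W. \<Sum>l\<in>W. cnj (R ?u l j) * (P l k * R ?u k i))" by (rule sum.swap)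
        also have "\<dots> = f j i (Aff w)" unfolding f_eq[OF w] by (simp add: mmult_def Ra sum_distrib_right sum_distrib_left mult_ac)
        finally show ?thesis by simp
      qed
    qed (use z s0 in auto)
    \<comment> \<open>At \<open>s0\<close> the value of \<open>h\<close> is that of \<open>g\<close>
      and lies in \<open>H\<close>, so it commutes with \<open>P\<close> and the constant is
      \<open>P\<close> itself.\<close>
    also have "f i j (Aff s0) = mmult W (mmult W P (R (h (Aff s0)))) (R (hi (Aff s0))) i j"
    proof -
      have "h (Aff s0) \<in> H" using s0 g(2) T'(3) by metis
      then show ?thesis by (simp add: f_def comm)
    qed
    also have "\<dots> = mmult W P (R (h (Aff s0) ** hi (Aff s0))) i j" by (simp add: mmult_assoc Rm)
    also have "h (Aff s0) ** hi (Aff s0) = mat 1" using matrix_inv_mult(1)[OF h(2)[OF s0(2)]] by (simp add: hi_def)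
    finally show ?thesis using one'[OF ij(2)] by simp
  qed
  have circle: "p (u (Aff z)) = 0" if z: "norm z = 1" "Aff z \<notin> T" for z
  proof -
    let ?u = "u (Aff z)"
    have "mmult W (mmult W (R (cadj ?u)) P) (R ?u) = P"
    proof (intro ext)
      fix i j show "mmult W (mmult W (R (cadj ?u)) P) (R ?u) i j = P i j"
        using f_const[OF _ _ z, of i j] f_eq[OF z, of i j] P(3)[of i j] R0 
        by (cases "i \<in> W \<and> j \<in> W") (auto simp: mmult_def)
    qed
    then have "mmult W (R ?u) P = mmult W (R (?u ** cadj ?u)) (mmult W P (R ?u))"
      by (metis mmult_assoc Rm)
    then have comu: "mmult W (R ?u) P i j = mmult W P (R ?u) i j" if "i \<in> W" for i j
      using right_inverse_cadj[OF uu[OF z]] one[OF that] by simp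
    \<comment> \<open>\<open>y\<close> is \<open>R u\<close> applied to \<open>\<eta>\<close>. Since
      \<open>R u\<close> commutes with \<open>P\<close> and \<open>P\<close> fixes
      \<open>\<eta>\<close>, \<open>P\<close> also fixes \<open>y\<close>, which therefore lies in
      \<open>NN\<close>.\<close>
    define y where "y j = (\<Sum>k\<in>W. R ?u j k * \<eta> k)" for j
    have yN: "(\<lambda>i. \<Sum>j\<in>W. y j * P i j) \<in> NN" by (rule subspace_on_sum[OF sub P(1)])
    have yy: "(\<Sum>j\<in>W. y j * P i j) = y i" if i: "i \<in> W" for i
    proof -
      have "(\<Sum>j\<in>W. y j * P i j) = (\<Sum>j\<in>W. \<Sum>k\<in>W. P i j * R ?u j k * \<eta> k)"
        by (simp add: y_def sum_distrib_left sum_distrib_right mult_ac)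
      also have "\<dots> = (\<Sum>k\<in>W. mmult W P (R ?u) i k * \<eta> k)" 
        by (subst sum.swap) (simp add: mmult_def sum_distrib_right)
      also have "\<dots> = (\<Sum>k\<in>W. mmult W (R ?u) P i k * \<eta> k)" by (simp add: comu[OF i])
      also have "\<dots> = (\<Sum>k\<in>W. \<Sum>j\<in>W. R ?u i j * (P j k * \<eta> k))" by (simp add: mmult_def sum_distrib_right sum_distrib_left mult_ac)
      also have "\<dots> = (\<Sum>j\<in>W. R ?u i j * (\<Sum>k\<in>W. P j k * \<eta> k))" by (subst sum.swap) (simp add: sum_distrib_left)
      also have "\<dots> = y i" unfolding y_def by (intro sum.cong refl) (simp add: P(4)[OF \<eta>])
      finally show ?thesis .
    qed
    have "y \<in> NN" using yN by (simp add: NN_def yy)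
    then have "(\<Sum>i\<in>W. \<xi> i * (\<Sum>j\<in>W. R (mat 1) i j * y j)) = 0" using H1(2) by (simp add: NN_def)
    moreover have "(\<Sum>j\<in>W. R (mat 1) i j * y j) = y i" if "i \<in> W" for i using that fW by (simp add: R1 mult_delta_left)
    ultimately have "(\<Sum>i\<in>W. \<xi> i * y i) = 0" by simp
    then show ?thesis by (simp add: pc y_def sum_distrib_left mult_ac)
  qed
  have "mpole_le T' (N + M') u" unfolding u_def
    by (rule mpole_le_mult[OF T'(1) g(1) mpole_le_superset[OF T'(1,2) hi]])
  then obtain K where "pole_le T' K (\<lambda>x. p (u x))" using pole_le_matrix_poly[OF T'(1) p(1)] by blast
  then have "p (u x) = (\<lambda>_. 0) x"
  proof (rule pole_le_eq_everywhere[OF T'(1) _ pole_le_const[OF T'(1), of 0 0] _ _ x])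
    show "infinite (sphere 0 1 - {z. Aff z \<in> T'})" by (rule circle_minus_finite_infinite[OF finite_Aff_in[OF T'(1)]])
    show "Aff z \<notin> T' \<and> p (u (Aff z)) = 0" if "z \<in> sphere 0 1 - {z. Aff z \<in> T'}" for z
      using that circle[of z] T'(2) by auto
  qed
  then show ?thesis by (simp add: u_def hi_def)
qed

section \<open>Complex matrices as a Banach algebra\<close>

text \<open>On \<open>complex^'n^'n\<close> the powers are entrywise, so the exponential series is
  taken in a copy whose product is \<open>**\<close>. The operator norm makes the copy a normed
  algebra in which 1 has norm 1.\<close>

typedef (overloaded) ('n::finite) cmat = "UNIV :: (complex^'n^'n) set" morphisms mat_of Cmat ..

setup_lifting type_definition_cmat

instantiation cmat :: (finite) real_algebra_1
begin
lift_definition zero_cmat :: "'a cmat" is 0 .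
lift_definition one_cmat :: "'a cmat" is "mat 1" .
lift_definition plus_cmat :: "'a cmat \<Rightarrow> 'a cmat \<Rightarrow> 'a cmat" is "(+)" .
lift_definition minus_cmat :: "'a cmat \<Rightarrow> 'a cmat \<Rightarrow> 'a cmat" is "(-)" .
lift_definition uminus_cmat :: "'a cmat \<Rightarrow> 'a cmat" is "uminus" .
lift_definition times_cmat :: "'a cmat \<Rightarrow> 'a cmat \<Rightarrow> 'a cmat" is "(**)" .
lift_definition scaleR_cmat :: "real \<Rightarrow> 'a cmat \<Rightarrow> 'a cmat" is "scaleR" .
instance
proof
  fix a b c :: "'a cmat" and r s :: real
  show "a * b * c = a * (b * c)" by transfer (simp add: matrix_mul_assoc)
  show "(a + b) * c = a * c + b * c" by transfer (simp add: vec_eq_iff matrix_matrix_mult_def distrib_right sum.distrib)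
  show "a * (b + c) = a * b + a * c" by transfer (rule matrix_add_ldistrib)
  show "r *\<^sub>R a * b = r *\<^sub>R (a * b)" by transfer (simp add: vec_eq_iff matrix_matrix_mult_def scaleR_sum_right)
  show "a * r *\<^sub>R b = r *\<^sub>R (a * b)" by transfer (simp add: vec_eq_iff matrix_matrix_mult_def scaleR_sum_right)
  show "(0 :: 'a cmat) \<noteq> 1" by transfer (auto simp: vec_eq_iff mat_def)
qed (transfer; simp add: algebra_simps)+
end

instantiation cmat :: (finite) real_normed_algebra_1
begin
lift_definition norm_cmat :: "'a cmat \<Rightarrow> real" is "\<lambda>A. onorm ((*v) A)" .
definition dist_cmat :: "'a cmat \<Rightarrow> 'a cmat \<Rightarrow> real" where "dist_cmat a b = norm (a - b)"
definition sgn_cmat :: "'a cmat \<Rightarrow> 'a cmat" where "sgn_cmat a = a /\<^sub>R norm a"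
definition uniformity_cmat :: "('a cmat \<times> 'a cmat) filter" where
  "uniformity_cmat = (INF e\<in>{0 <..}. principal {(x, y). dist x y < e})"
definition open_cmat :: "'a cmat set \<Rightarrow> bool" where
  "open_cmat U \<longleftrightarrow> (\<forall>x\<in>U. \<forall>\<^sub>F (x', y) in uniformity. x' = x \<longrightarrow> y \<in> U)"
instance
proof
  fix a b :: "'a cmat" and r :: real
  show "(norm a = 0) = (a = 0)" 
    by transfer (simp add: onorm_eq_0 matrix_eq)
  show "norm (a + b) \<le> norm a + norm b"
  proof transfer
    fix A B :: "complex^'a^'a"
    have "(*v) (A + B) = (\<lambda>x. A *v x + B *v x)" by (simp add: fun_eq_iff matrix_vector_mult_add_rdistrib)
    then show "onorm ((*v) (A + B)) \<le> onorm ((*v) A) + onorm ((*v) B)" by (simp add: onorm_triangle)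
  qed
  show "norm (r *\<^sub>R a) = \<bar>r\<bar> * norm a"
  proof transfer
    fix r :: real and A :: "complex^'a^'a"
    have "(*v) (r *\<^sub>R A) = (\<lambda>x. r *\<^sub>R (A *v x))" by (simp add: fun_eq_iff vec_eq_iff matrix_vector_mult_def scaleR_sum_right)
    then show "onorm ((*v) (r *\<^sub>R A)) = \<bar>r\<bar> * onorm ((*v) A)" by (simp add: onorm_scaleR)
  qed
  show "norm (a * b) \<le> norm a * norm b"
  proof transfer
    fix A B :: "complex^'a^'a"
    have "(*v) (A ** B) = (*v) A \<circ> (*v) B" by (simp add: fun_eq_iff matrix_vector_mul_assoc)
    then show "onorm ((*v) (A ** B)) \<le> onorm ((*v) A) * onorm ((*v) B)" by (simp add: onorm_compose)
  qed
  show "norm (1 :: 'a cmat) = 1"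
  proof transfer
    have "(*v) (mat 1 :: complex^'a^'a) = (\<lambda>x. x)" by (simp add: fun_eq_iff)
    then show "onorm ((*v) (mat 1 :: complex^'a^'a)) = 1" by (simp add: onorm_id)
  qed
qed (auto simp: dist_cmat_def sgn_cmat_def uniformity_cmat_def open_cmat_def)
end

lemma norm_entry_le_norm_cmat: "norm (mat_of X $ i $ j) \<le> norm X"
proof transfer
  fix X :: "complex^'a^'a" and i j :: 'a
  have "norm (X $ i $ j) = norm ((X *v axis j 1) $ i)" by (simp add: matrix_vector_mult_def axis_def mult_delta_right)
  also have "\<dots> \<le> norm (X *v axis j 1)" by (rule Finite_Cartesian_Product.norm_nth_le)
  also have "\<dots> \<le> onorm ((*v) X) * norm (axis j 1 :: complex^'a)" by (rule onorm) simp
  finally show "norm (X $ i $ j) \<le> onorm ((*v) X)" by simp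
qed

lemma norm_vec_le_sum: "norm x \<le> (\<Sum>i\<in>UNIV. norm (x $ i))"
  unfolding norm_vec_def by (rule L2_set_le_sum) simp

lemma norm_cmat_le_sum: "norm X \<le> (\<Sum>i\<in>UNIV. \<Sum>j\<in>UNIV. norm (mat_of X $ i $ j))"
proof transfer
  fix X :: "complex^'a^'a"
  show "onorm ((*v) X) \<le> (\<Sum>i\<in>UNIV. \<Sum>j\<in>UNIV. norm (X $ i $ j))"
  proof (rule onorm_bound)
    fix x :: "complex^'a"
    have "norm (X *v x) \<le> (\<Sum>i\<in>UNIV. norm ((X *v x) $ i))" by (rule norm_vec_le_sum)
    also have "\<dots> \<le> (\<Sum>i\<in>UNIV. \<Sum>j\<in>UNIV. norm (X $ i $ j) * norm x)"
    proof (rule sum_mono)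
      fix i
      have "norm ((X *v x) $ i) \<le> (\<Sum>j\<in>UNIV. norm (X $ i $ j * x $ j))"
        by (simp add: matrix_vector_mult_def norm_sum)
      also have "\<dots> \<le> (\<Sum>j\<in>UNIV. norm (X $ i $ j) * norm x)"
        by (intro sum_mono) (simp add: norm_mult mult_left_mono Finite_Cartesian_Product.norm_nth_le)
      finally show "norm ((X *v x) $ i) \<le> (\<Sum>j\<in>UNIV. norm (X $ i $ j) * norm x)" .
    qed
    finally show "norm (X *v x) \<le> (\<Sum>i\<in>UNIV. \<Sum>j\<in>UNIV. norm (X $ i $ j)) * norm x" by (simp add: sum_distrib_right)
  qed (simp add: sum_nonneg)
qed

lemma bounded_linear_mat_of: "bounded_linear mat_of"
proof (rule bounded_linear_intro)
  show "mat_of (x + y) = mat_of x + mat_of y" for x y :: "'a cmat" by (rule plus_cmat.rep_eq)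
  show "mat_of (r *\<^sub>R x) = r *\<^sub>R mat_of x" for r and x :: "'a cmat" by (rule scaleR_cmat.rep_eq)
  fix x :: "'a cmat"
  have "norm (mat_of x) \<le> (\<Sum>i\<in>UNIV. \<Sum>j\<in>UNIV. norm (mat_of x $ i $ j))"
    by (rule order_trans[OF norm_vec_le_sum]) (intro sum_mono norm_vec_le_sum)
  also have "\<dots> \<le> (\<Sum>i\<in>(UNIV::'a set). \<Sum>j\<in>(UNIV::'a set). norm x)" by (intro sum_mono norm_entry_le_norm_cmat)
  finally show "norm (mat_of x) \<le> norm x * (real CARD('a) * real CARD('a))" by (simp add: mult_ac)
qed

lemma bounded_linear_Cmat: "bounded_linear (Cmat :: complex^'n^'n \<Rightarrow> 'n cmat)"
proof (rule bounded_linear_intro)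
  show "(Cmat (x + y) :: 'n cmat) = Cmat x + Cmat y" for x y by (simp add: plus_cmat.abs_eq)
  show "(Cmat (r *\<^sub>R x) :: 'n cmat) = r *\<^sub>R Cmat x" for r x by (simp add: scaleR_cmat.abs_eq)
  fix x :: "complex^'n^'n"
  have "norm (Cmat x) \<le> (\<Sum>i\<in>UNIV. \<Sum>j\<in>UNIV. norm (x $ i $ j))" using norm_cmat_le_sum[of "Cmat x"] by (simp add: Cmat_inverse)
  also have "\<dots> \<le> (\<Sum>i\<in>(UNIV::'n set). \<Sum>j\<in>(UNIV::'n set). norm x)"
    by (intro sum_mono) (meson Finite_Cartesian_Product.norm_nth_le order_trans)
  finally show "norm (Cmat x) \<le> norm x * (real CARD('n) * real CARD('n))" by (simp add: mult_ac)
qed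

lemma mat_of_Cmat [simp]: "mat_of (Cmat A) = A" by (simp add: Cmat_inverse)
lemma Cmat_mat_of [simp]: "Cmat (mat_of A) = A" by (rule mat_of_inverse)

instance cmat :: (finite) banach
proof
  fix X :: "nat \<Rightarrow> 'a cmat" assume "Cauchy X"
  then have "Cauchy (\<lambda>n. mat_of (X n))" using bounded_linear.Cauchy[OF bounded_linear_mat_of] by blast
  then obtain L where "(\<lambda>n. mat_of (X n)) \<longlonglongrightarrow> L" using Cauchy_convergent convergent_def by blast
  then have "(\<lambda>n. Cmat (mat_of (X n))) \<longlonglongrightarrow> Cmat L" by (rule bounded_linear.tendsto[OF bounded_linear_Cmat])
  then show "convergent X" by (auto simp: convergent_def)
qed

section \<open>The exponential as a limit of powers\<close>

lemma norm_power_diff_le: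
  fixes a b :: "'a::real_normed_algebra_1"
  assumes "norm a \<le> M" "norm b \<le> M" "1 \<le> M"
  shows "norm (a ^ k - b ^ k) \<le> real k * M ^ k * norm (a - b)"
proof (induction k)
  case (Suc k)
  have Mk: "norm (b ^ k) \<le> M ^ k" using assms(2) norm_power_ineq[of b k] power_mono[of "norm b" M k] by simp
  have "a ^ Suc k - b ^ Suc k = a * (a ^ k - b ^ k) + (a - b) * b ^ k" by (simp add: algebra_simps)
  then have "norm (a ^ Suc k - b ^ Suc k) \<le> norm a * norm (a ^ k - b ^ k) + norm (a - b) * norm (b ^ k)"
    by (metis add_mono norm_mult_ineq norm_triangle_le)
  also have "\<dots> \<le> M * (real k * M ^ k * norm (a - b)) + norm (a - b) * (M * M ^ k)"
  proof (intro add_mono mult_mono Suc assms(1) mult_left_mono)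
    show "norm (b ^ k) \<le> M * M ^ k" 
    proof -
      have "1 * M ^ k \<le> M * M ^ k" using assms(3) by (intro mult_right_mono) auto
      then show ?thesis using Mk by simp
    qed
  qed (use assms norm_ge_zero order_trans in \<open>auto intro: order_trans[OF norm_ge_zero]\<close>)
  also have "\<dots> = real (Suc k) * M ^ Suc k * norm (a - b)" by (simp add: algebra_simps)
  finally show ?case .
qed simp

lemma exp_power_scaleR:
  fixes X :: "'a::{real_normed_algebra_1,banach}"
  shows "exp X ^ k = exp (real k *\<^sub>R X)"
proof (induction k)
  case (Suc k)
  have "exp (X + real k *\<^sub>R X) = exp X * exp (real k *\<^sub>R X)" by (rule exp_add_commuting) simp
  then show ?case using Suc by (simp add: algebra_simps)
qed simp

lemma exp_difference_quotient:
  fixes Y :: "'a::{real_normed_algebra_1,banach}"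
  shows "((\<lambda>s::real. (exp (s *\<^sub>R Y) - 1) /\<^sub>R s) \<longlongrightarrow> Y) (at 0)"
proof -
  have "((\<lambda>t. exp (t *\<^sub>R Y)) has_vector_derivative exp (0 *\<^sub>R Y) * Y) (at 0 within UNIV)"
    by (rule exp_scaleR_has_vector_derivative_right)
  then have "((\<lambda>h::real. norm (exp (h *\<^sub>R Y) - 1 - h *\<^sub>R Y) / norm h) \<longlongrightarrow> 0) (at 0)"
    by (simp add: has_vector_derivative_def has_derivative_at)
  then have "((\<lambda>h::real. norm ((exp (h *\<^sub>R Y) - 1) /\<^sub>R h - Y)) \<longlongrightarrow> 0) (at 0)"
  proof (rule Lim_transform_eventually)
    show "\<forall>\<^sub>F h::real in at 0. norm (exp (h *\<^sub>R Y) - 1 - h *\<^sub>R Y) / norm h = norm ((exp (h *\<^sub>R Y) - 1) /\<^sub>R h - Y)"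
    proof (rule eventually_mono[OF eventually_neq_at_within[of 0]])
      fix h :: real assume h: "h \<noteq> 0"
      have "(exp (h *\<^sub>R Y) - 1) /\<^sub>R h - Y = inverse h *\<^sub>R (exp (h *\<^sub>R Y) - 1 - h *\<^sub>R Y)" using h by (simp add: scaleR_diff_right)
      then show "norm (exp (h *\<^sub>R Y) - 1 - h *\<^sub>R Y) / norm h = norm ((exp (h *\<^sub>R Y) - 1) /\<^sub>R h - Y)" by (simp add: divide_inverse_commute)
    qed
  qed
  then show ?thesis by (rule LIM_zero_cancel[OF tendsto_norm_zero_cancel])
qed

text \<open>\<open>A n\<close> is compared with \<open>b n\<close>, the exponential of
  \<open>Y\<close> divided by \<open>c n\<close>, whose powers are known exactly. The difference of
  the powers is at most a bounded factor times \<open>c n\<close> times the distance of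
  \<open>A n\<close> from \<open>b n\<close>, and that product tends to 0. The scale
  \<open>c\<close> is any real sequence tending to infinity, since later it is the reciprocal of a
  distance.\<close>

lemma power_tendsto_exp:
  fixes A :: "nat \<Rightarrow> 'a::{real_normed_algebra_1,banach}"
  assumes c: "filterlim c at_top sequentially" and A: "(\<lambda>n. c n *\<^sub>R (A n - 1)) \<longlonglongrightarrow> Y"
    and k: "(\<lambda>n. real (k n) / c n) \<longlonglongrightarrow> t"
  shows "(\<lambda>n. A n ^ k n) \<longlonglongrightarrow> exp (t *\<^sub>R Y)"
proof -
  define b where "b n = exp (inverse (c n) *\<^sub>R Y)" for n
  have ci: "filterlim (\<lambda>n. inverse (c n)) (at 0) sequentially"
    using filterlim_mono[OF filterlim_compose[OF filterlim_inverse_at_right_top c] at_le[OF subset_UNIV] order_refl] .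
  have cpos: "\<forall>\<^sub>F n in sequentially. c n > 0" using c by (simp add: filterlim_at_top_dense)
  have b1: "(\<lambda>n. c n *\<^sub>R (b n - 1)) \<longlonglongrightarrow> Y"
    using filterlim_compose[OF exp_difference_quotient ci] by (simp add: b_def)
  have ab: "(\<lambda>n. c n *\<^sub>R (A n - b n)) \<longlonglongrightarrow> 0"
    using tendsto_diff[OF A b1] by (simp add: scaleR_diff_right)
  obtain C where C: "C > 0" "\<And>n. norm (c n *\<^sub>R (A n - 1)) \<le> C" 
    using convergent_imp_Bseq[OF convergentI[OF A]] by (auto simp: Bseq_def)
  define L where "L = C + norm Y"
  have L: "L \<ge> 0" "C \<le> L" "norm Y \<le> L" using C by (auto simp: L_def)
  have ineq: "norm (A n ^ k n - b n ^ k n) \<le> (real (k n) / c n) * exp (L * (real (k n) / c n)) * norm (c n *\<^sub>R (A n - b n))" if cn: "c n > 0" for n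
  proof -
    define M where "M = exp (L / c n)"
    have "norm (A n - 1) \<le> L / c n" 
    proof -
      have "c n * norm (A n - 1) \<le> L" using C(2)[of n] L(2) cn by simp
      then show ?thesis using cn by (simp add: field_simps)
    qed
    moreover have "norm (A n) \<le> 1 + norm (A n - 1)" using norm_triangle_ineq[of 1 "A n - 1"] by simp
    ultimately have "norm (A n) \<le> M" unfolding M_def using exp_ge_add_one_self[of "L / c n"] by linarith
    moreover have "norm (b n) \<le> M"
    proof -
      have "norm (b n) \<le> exp (norm (inverse (c n) *\<^sub>R Y))" unfolding b_def by (rule norm_exp)
      also have "\<dots> \<le> M" using L(3) cn by (simp add: M_def divide_inverse mult.commute mult_right_mono)
      finally show ?thesis .
    qed
    moreover have "1 \<le> M" using L(1) cn by (simp add: M_def)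
    ultimately have "norm (A n ^ k n - b n ^ k n) \<le> real (k n) * M ^ k n * norm (A n - b n)" by (rule norm_power_diff_le)
    also have "M ^ k n = exp (L * (real (k n) / c n))" by (simp add: M_def exp_of_nat_mult[symmetric] mult_ac)
    finally show ?thesis using cn by simp
  qed
  have "(\<lambda>n. (real (k n) / c n) * exp (L * (real (k n) / c n)) * norm (c n *\<^sub>R (A n - b n))) \<longlonglongrightarrow> t * exp (L * t) * norm (0::'a)"
    by (intro tendsto_intros k ab)
  then have "(\<lambda>n. (real (k n) / c n) * exp (L * (real (k n) / c n)) * norm (c n *\<^sub>R (A n - b n))) \<longlonglongrightarrow> 0" by simp
  then have diff: "(\<lambda>n. A n ^ k n - b n ^ k n) \<longlonglongrightarrow> 0"
    by (rule Lim_null_comparison[rotated]) (use cpos ineq in \<open>auto elim: eventually_mono\<close>)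
  have "b n ^ k n = exp ((real (k n) / c n) *\<^sub>R Y)" for n
    by (simp add: b_def exp_power_scaleR divide_inverse)
  moreover have "(\<lambda>n. exp ((real (k n) / c n) *\<^sub>R Y)) \<longlonglongrightarrow> exp (t *\<^sub>R Y)"
    by (rule isCont_tendsto_compose[OF has_vector_derivative_continuous[OF exp_scaleR_has_vector_derivative_right] k])
  ultimately have "(\<lambda>n. b n ^ k n) \<longlonglongrightarrow> exp (t *\<^sub>R Y)" by simp
  from tendsto_add[OF diff this] show ?thesis by simp
qed

section \<open>Linear algebraic groups with a compact real form\<close>

definition cscale :: "complex \<Rightarrow> complex^'n^'m \<Rightarrow> complex^'n^'m" where
  "cscale c A = (\<chi> i j. c * A $ i $ j)"

lemma cscale_entry [simp]: "cscale c A $ i $ j = c * A $ i $ j"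
  by (simp add: cscale_def)

lemma cscale_of_real: "cscale (of_real r) A = r *\<^sub>R A"
  by (simp add: vec_eq_iff) (simp add: scaleR_conv_of_real)

lemma cscale_cscale: "cscale c (cscale d A) = cscale (c * d) A"
  by (simp add: vec_eq_iff)

lemma cscale_add: "cscale c (A + B) = cscale c A + cscale c B" "cscale (c + d) A = cscale c A + cscale d A"
  by (simp_all add: vec_eq_iff algebra_simps)

lemma cscale_mult: "cscale c A ** B = cscale c (A ** B)" "A ** cscale c B = cscale c (A ** B)"
  by (simp_all add: vec_eq_iff matrix_matrix_mult_def sum_distrib_left mult_ac)

lemma cscale_1 [simp]: "cscale 1 A = A" by (simp add: vec_eq_iff)
lemma cscale_0 [simp]: "cscale 0 A = 0" by (simp add: vec_eq_iff)

lemma tendsto_matrix_mult: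
  fixes f :: "'a \<Rightarrow> complex^'n^'m" and g :: "'a \<Rightarrow> complex^'k^'n"
  assumes "(f \<longlongrightarrow> A) F" "(g \<longlongrightarrow> B) F" shows "((\<lambda>x. f x ** g x) \<longlongrightarrow> A ** B) F"
  unfolding matrix_matrix_mult_def by (intro tendsto_intros assms)

definition mpow :: "complex^'n^'n \<Rightarrow> nat \<Rightarrow> complex^'n^'n" where
  "mpow A k = mat_of (Cmat A ^ k)"

lemma mat_of_mult: "mat_of (X * Y) = mat_of X ** mat_of Y" by (rule times_cmat.rep_eq)
lemma mat_of_1: "mat_of 1 = mat 1" by (rule one_cmat.rep_eq)

lemma mpow_0 [simp]: "mpow A 0 = mat 1" by (simp add: mpow_def mat_of_1)
lemma mpow_Suc [simp]: "mpow A (Suc k) = A ** mpow A k" by (simp add: mpow_def mat_of_mult)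

text \<open>The complex one-parameter subgroup in direction \<open>Y\<close>. Complex time is
  included from the start, because equations will be continued analytically in
  \<open>z\<close>.\<close>

definition one_par :: "complex^'n^'n \<Rightarrow> complex \<Rightarrow> complex^'n^'n" where
  "one_par Y z = mat_of (exp (Cmat (cscale z Y)))"

lemma Cmat_hom: "Cmat (A + B) = Cmat A + Cmat B" "Cmat (A ** B) = Cmat A * Cmat B" "Cmat (r *\<^sub>R A) = r *\<^sub>R Cmat A"
  "Cmat (A - B) = Cmat A - Cmat B" "Cmat (mat 1) = 1" "Cmat 0 = 0"
  by (simp_all add: plus_cmat.abs_eq times_cmat.abs_eq scaleR_cmat.abs_eq minus_cmat.abs_eq one_cmat.abs_eq zero_cmat.abs_eq)

lemma one_par_0 [simp]: "one_par Y 0 = mat 1"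
  by (simp add: one_par_def mat_of_1 Cmat_hom)

lemma one_par_add: "one_par Y (z + w) = one_par Y z ** one_par Y w"
proof -
  have "Cmat (cscale z Y) * Cmat (cscale w Y) = Cmat (cscale w Y) * Cmat (cscale z Y)"
    by (simp add: Cmat_hom[symmetric] cscale_mult cscale_cscale mult.commute)
  then have "exp (Cmat (cscale z Y) + Cmat (cscale w Y)) = exp (Cmat (cscale z Y)) * exp (Cmat (cscale w Y))" by (rule exp_add_commuting)
  then show ?thesis by (simp add: one_par_def cscale_add Cmat_hom mat_of_mult)
qed

lemma one_par_cscale: "one_par (cscale w Y) z = one_par Y (z * w)"
  by (simp add: one_par_def cscale_cscale)

lemma one_par_inverse: "one_par Y z ** one_par Y (- z) = mat 1" "one_par Y (- z) ** one_par Y z = mat 1"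
  using one_par_add[of Y z "- z"] one_par_add[of Y "- z" z] by simp_all

lemma invertible_one_par: "invertible (one_par Y z)"
  using one_par_inverse invertible_def by blast

lemma matrix_inv_one_par: "matrix_inv (one_par Y z) = one_par Y (- z)"
  by (rule matrix_inv_unique[OF one_par_inverse])

lemma mpow_tendsto_one_par:
  assumes c: "filterlim c at_top sequentially" and A: "(\<lambda>n. c n *\<^sub>R (A n - mat 1)) \<longlonglongrightarrow> Y"
    and k: "(\<lambda>n. real (k n) / c n) \<longlonglongrightarrow> t"
  shows "(\<lambda>n. mpow (A n) (k n)) \<longlonglongrightarrow> one_par Y (of_real t)"
proof -
  have "(\<lambda>n. c n *\<^sub>R (Cmat (A n) - 1)) \<longlonglongrightarrow> Cmat Y"
    using bounded_linear.tendsto[OF bounded_linear_Cmat A] by (simp add: Cmat_hom)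
  then have "(\<lambda>n. Cmat (A n) ^ k n) \<longlonglongrightarrow> exp (t *\<^sub>R Cmat Y)" by (rule power_tendsto_exp[OF c _ k])
  then have "(\<lambda>n. mat_of (Cmat (A n) ^ k n)) \<longlonglongrightarrow> mat_of (exp (t *\<^sub>R Cmat Y))" by (rule bounded_linear.tendsto[OF bounded_linear_mat_of])
  then show ?thesis by (simp add: mpow_def one_par_def cscale_of_real Cmat_hom)
qed

lemma floor_ratio_tendsto:
  assumes c: "filterlim c at_top sequentially" and t: "t \<ge> 0"
  shows "(\<lambda>n. real (nat \<lfloor>t * c n\<rfloor>) / c n) \<longlonglongrightarrow> t"
proof (rule tendsto_sandwich)
  have ev: "\<forall>\<^sub>F n in sequentially. c n > 0" using c by (simp add: filterlim_at_top_dense)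
  show "\<forall>\<^sub>F n in sequentially. t - inverse (c n) \<le> real (nat \<lfloor>t * c n\<rfloor>) / c n"
  proof (rule eventually_mono[OF ev])
    fix n assume "c n > 0"
    moreover have "t * c n - 1 \<le> real (nat \<lfloor>t * c n\<rfloor>)" by linarith
    ultimately have "(t * c n - 1) / c n \<le> real (nat \<lfloor>t * c n\<rfloor>) / c n" by (intro divide_right_mono) auto
    then show "t - inverse (c n) \<le> real (nat \<lfloor>t * c n\<rfloor>) / c n" using \<open>c n > 0\<close> by (simp add: field_simps)
  qed
  show "\<forall>\<^sub>F n in sequentially. real (nat \<lfloor>t * c n\<rfloor>) / c n \<le> t"
  proof (rule eventually_mono[OF ev])
    fix n assume "c n > 0"
    then have "real (nat \<lfloor>t * c n\<rfloor>) \<le> t * c n" using t by simp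
    then show "real (nat \<lfloor>t * c n\<rfloor>) / c n \<le> t" using \<open>c n > 0\<close> by (simp add: field_simps)
  qed
  have "(\<lambda>n. t - inverse (c n)) \<longlonglongrightarrow> t - 0"
    by (intro tendsto_diff tendsto_const tendsto_inverse_0_at_top c)
  then show "(\<lambda>n. t - inverse (c n)) \<longlonglongrightarrow> t" by simp
qed auto

lemma mpow_floor_tendsto_one_par:
  assumes c: "filterlim c at_top sequentially" and A: "(\<lambda>n. c n *\<^sub>R (A n - mat 1)) \<longlonglongrightarrow> Y" and t: "t \<ge> 0"
  shows "(\<lambda>n. mpow (A n) (nat \<lfloor>t * c n\<rfloor>)) \<longlonglongrightarrow> one_par Y (of_real t)"
  by (rule mpow_tendsto_one_par[OF c A floor_ratio_tendsto[OF c t]])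

lemma one_par_difference_quotient:
  assumes c: "filterlim c at_top sequentially"
  shows "(\<lambda>n. c n *\<^sub>R (one_par Y (of_real (inverse (c n))) - mat 1)) \<longlonglongrightarrow> Y"
proof -
  have ci: "filterlim (\<lambda>n. inverse (c n)) (at 0) sequentially"
    using filterlim_mono[OF filterlim_compose[OF filterlim_inverse_at_right_top c] at_le[OF subset_UNIV] order_refl] .
  have "(\<lambda>n. (exp (inverse (c n) *\<^sub>R Cmat Y) - 1) /\<^sub>R inverse (c n)) \<longlonglongrightarrow> Cmat Y"
    by (rule filterlim_compose[OF exp_difference_quotient ci])
  from bounded_linear.tendsto[OF bounded_linear_mat_of this]
  show ?thesis unfolding one_par_def cscale_of_real Cmat_hom by (simp add: scaleR_cmat.rep_eq minus_cmat.rep_eq mat_of_1)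
qed

lemma mpow_one_par: "mpow (one_par Y z) k = one_par Y (of_nat k * z)"
  by (induction k) (simp_all add: one_par_add[symmetric] algebra_simps)

lemma holomorphic_one_par: "(\<lambda>z. one_par Y z $ i $ j) holomorphic_on S"
proof -
  have bl: "bounded_linear (\<lambda>X. mat_of X $ i $ j)"
    by (rule bounded_linear_compose[OF bounded_linear_vec_nth bounded_linear_compose[OF bounded_linear_vec_nth bounded_linear_mat_of]])
  have pw: "Cmat (cscale z Y) ^ n = Cmat (cscale (z ^ n) (mpow Y n))" for z n
    by (induction n) (simp_all add: mpow_def Cmat_hom cscale_mult cscale_cscale mat_of_mult mat_of_1 mult.commute flip: Cmat_hom(2))
  have "(\<lambda>n. (mpow Y n $ i $ j / fact n) * (z - 0) ^ n) sums (one_par Y z $ i $ j)" for z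
  proof -
    have "(\<lambda>n. mat_of (Cmat (cscale z Y) ^ n /\<^sub>R fact n) $ i $ j) sums (one_par Y z $ i $ j)"
      unfolding one_par_def by (rule bounded_linear.sums[OF bl exp_converges])
    moreover have "mat_of (Cmat (cscale z Y) ^ n /\<^sub>R fact n) $ i $ j = (mpow Y n $ i $ j / fact n) * (z - 0) ^ n" for n
      by (simp add: pw scaleR_cmat.rep_eq) (simp add: scaleR_conv_of_real field_simps)
    ultimately show ?thesis by simp
  qed
  then have "(\<lambda>z. one_par Y z $ i $ j) holomorphic_on ball 0 r" for r
    by (intro power_series_holomorphic)
  then have "(\<lambda>z. one_par Y z $ i $ j) holomorphic_on (\<Union>r::nat. ball 0 (real r))"
    by (intro holomorphic_on_UN_open) auto
  moreover have "(\<Union>r::nat. ball (0::complex) (real r)) = UNIV" using reals_Archimedean2 by auto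
  ultimately show ?thesis using holomorphic_on_subset by auto
qed

lemma holomorphic_matrix_poly_comp:
  fixes f :: "complex \<Rightarrow> complex^'n^'n"
  assumes p: "matrix_poly p" and f: "\<And>i j. (\<lambda>z. f z $ i $ j) holomorphic_on S"
  shows "(\<lambda>z. p (f z)) holomorphic_on S"
  using p by induction (auto intro!: holomorphic_intros f)

lemma holomorphic_det:
  fixes f :: "complex \<Rightarrow> complex^'n^'n"
  assumes f: "\<And>i j. (\<lambda>z. f z $ i $ j) holomorphic_on S"
  shows "(\<lambda>z. det (f z)) holomorphic_on S"
  unfolding det_def by (intro holomorphic_intros f)

lemma isCont_matrix_poly: "matrix_poly p \<Longrightarrow> isCont p A"
  using continuous_on_eq_continuous_at[of UNIV p] continuous_on_matrix_poly[of p UNIV] by simp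

section \<open>Tangent directions of an algebraic group of matrices\<close>

locale matrix_group =
  fixes G :: "(complex^'n^'n) set" and F :: "(complex^'n^'n \<Rightarrow> complex) set"
  assumes F: "\<And>p. p \<in> F \<Longrightarrow> matrix_poly p" and G_eq: "G = {A. invertible A \<and> (\<forall>p\<in>F. p A = 0)}"
    and G_mult: "\<And>A B. A \<in> G \<Longrightarrow> B \<in> G \<Longrightarrow> A ** B \<in> G" and G_one: "mat 1 \<in> G"
    and G_inv: "\<And>A. A \<in> G \<Longrightarrow> matrix_inv A \<in> G"
begin

lemma G_invertible: "A \<in> G \<Longrightarrow> invertible A"
  by (simp add: G_eq)

lemma G_vanish: "A \<in> G \<Longrightarrow> p \<in> F \<Longrightarrow> p A = 0"
  by (simp add: G_eq)

lemma G_limit: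
  assumes "\<And>n. X n \<in> G" "X \<longlonglongrightarrow> L" "invertible L"
  shows "L \<in> G"
proof -
  have "p L = 0" if "p \<in> F" for p
  proof -
    have "isCont p L" by (rule isCont_matrix_poly[OF F[OF that]])
    then have "(\<lambda>n. p (X n)) \<longlonglongrightarrow> p L" by (rule isCont_tendsto_compose[OF _ assms(2)])
    moreover have "(\<lambda>n. p (X n)) = (\<lambda>_. 0)" using assms(1) that G_vanish by auto
    ultimately show ?thesis using LIMSEQ_unique tendsto_const by metis
  qed
  then show ?thesis using assms(3) G_eq by simp
qed

lemma mpow_in: "A \<in> G \<Longrightarrow> mpow A k \<in> G"
  by (induction k) (auto intro: G_one G_mult)

text \<open>The Lie algebra, described without differential geometry: the directions whose real
  one-parameter subgroups stay in \<open>G\<close>.\<close>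

definition tang :: "(complex^'n^'n) set" where
  "tang = {Y. \<forall>t::real. one_par Y (of_real t) \<in> G}"

lemma tang_if_nonneg:
  assumes "\<And>t::real. t \<ge> 0 \<Longrightarrow> one_par Y (of_real t) \<in> G" shows "Y \<in> tang"
  unfolding tang_def
proof (clarify)
  fix t :: real
  show "one_par Y (of_real t) \<in> G"
  proof (cases "t \<ge> 0")
    case False
    then have "matrix_inv (one_par Y (of_real (- t))) \<in> G" using assms[of "- t"] G_inv by simp
    then show ?thesis by (simp add: matrix_inv_one_par)
  qed (use assms in simp)
qed

text \<open>The powers of \<open>A n\<close> with exponent about \<open>t * c n\<close> stay in
  \<open>G\<close> and tend to \<open>one_par Y t\<close>. That limit is invertible, which matters
  because \<open>G\<close> is closed only among invertible matrices.\<close>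

lemma tang_sequence:
  assumes "filterlim c at_top sequentially" "(\<lambda>n. c n *\<^sub>R (A n - mat 1)) \<longlonglongrightarrow> Y" "\<And>n. A n \<in> G"
  shows "Y \<in> tang"
proof (rule tang_if_nonneg)
  fix t :: real assume "t \<ge> 0"
  then show "one_par Y (of_real t) \<in> G"
    using G_limit[OF mpow_in[OF assms(3)] mpow_floor_tendsto_one_par[OF assms(1,2)] invertible_one_par] by blast
qed

text \<open>Each equation of \<open>G\<close> along the subgroup is an entire function of
  \<open>z\<close> that vanishes on the real line, so it vanishes identically. Thus the tangent
  directions form a complex space.\<close>

lemma tang_complex:
  assumes Y: "Y \<in> tang" shows "one_par Y z \<in> G"
proof -
  have "p (one_par Y z) = 0" if p: "p \<in> F" for p
  proof (rule analytic_continuation[of "\<lambda>z. p (one_par Y z)" UNIV \<real> 0])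
    show "(\<lambda>z. p (one_par Y z)) holomorphic_on UNIV" by (rule holomorphic_matrix_poly_comp[OF F[OF p] holomorphic_one_par])
    show "p (one_par Y w) = 0" if w: "w \<in> \<real>" for w
    proof -
      obtain x where "w = complex_of_real x" using w by (rule Reals_cases)
      then have "one_par Y w \<in> G" using Y by (simp add: tang_def)
      then show ?thesis using G_vanish p by blast
    qed
    show "(0::complex) islimpt \<real>"
    proof (rule islimptI)
      fix T :: "complex set" assume "0 \<in> T" "open T"
      then obtain e where e: "e > 0" "ball 0 e \<subseteq> T" by (auto elim: openE)
      have "complex_of_real (e / 2) \<in> ball 0 e" using e(1) by (simp add: norm_divide)
      then show "\<exists>y\<in>\<real>. y \<in> T \<and> y \<noteq> 0" using e by (intro bexI[of _ "complex_of_real (e / 2)"]) auto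
    qed
  qed auto
  then show ?thesis using G_eq invertible_one_par by auto
qed

lemma tang_cscale: "Y \<in> tang \<Longrightarrow> cscale w Y \<in> tang"
  by (rule tang_if_nonneg) (simp only: one_par_cscale tang_complex)

end

text \<open>Write \<open>A B - 1\<close> as \<open>(A - 1) B + (B - 1)\<close>, where
  \<open>B\<close> tends to 1. This first-order product rule replaces the differentiation of
  products of curves.\<close>

lemma product_difference_quotient:
  assumes c: "filterlim c at_top sequentially"
    and A: "(\<lambda>n. c n *\<^sub>R (A n - mat 1)) \<longlonglongrightarrow> X" and B: "(\<lambda>n. c n *\<^sub>R (B n - mat 1 :: complex^'n^'n)) \<longlonglongrightarrow> Y"
  shows "(\<lambda>n. c n *\<^sub>R (A n ** B n - mat 1)) \<longlonglongrightarrow> X + Y"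
proof -
  have cpos: "\<forall>\<^sub>F n in sequentially. c n > 0" using c by (simp add: filterlim_at_top_dense)
  have "(\<lambda>n. inverse (c n) *\<^sub>R (c n *\<^sub>R (B n - mat 1))) \<longlonglongrightarrow> 0 *\<^sub>R Y"
    by (intro tendsto_scaleR tendsto_inverse_0_at_top c B)
  then have "(\<lambda>n. inverse (c n) *\<^sub>R (c n *\<^sub>R (B n - mat 1)) + mat 1) \<longlonglongrightarrow> 0 *\<^sub>R Y + mat 1"
    by (rule tendsto_add[OF _ tendsto_const])
  moreover have "\<forall>\<^sub>F n in sequentially. inverse (c n) *\<^sub>R (c n *\<^sub>R (B n - mat 1)) + mat 1 = B n"
    by (rule eventually_mono[OF cpos]) simp
  ultimately have B1: "B \<longlonglongrightarrow> mat 1" using Lim_transform_eventually by fastforce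
  have "(\<lambda>n. (c n *\<^sub>R (A n - mat 1)) ** B n + c n *\<^sub>R (B n - mat 1)) \<longlonglongrightarrow> X ** mat 1 + Y"
    by (intro tendsto_add tendsto_matrix_mult A B B1)
  moreover have "(c n *\<^sub>R (A n - mat 1)) ** B n + c n *\<^sub>R (B n - mat 1) = c n *\<^sub>R (A n ** B n - mat 1)" for n
  proof -
    have "(A n - mat 1) ** B n = A n ** B n - B n"
      using matrix_add_rdistrib[of "A n - mat 1" "mat 1" "B n"] by (simp add: eq_diff_eq)
    moreover have "(c n *\<^sub>R (A n - mat 1)) ** B n = c n *\<^sub>R ((A n - mat 1) ** B n)"
      by (simp add: cscale_of_real[symmetric] cscale_mult)
    ultimately show ?thesis by (simp add: scaleR_diff_right)
  qed
  ultimately show ?thesis by simp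
qed

context matrix_group begin

lemma Suc_at_top: "filterlim (\<lambda>n. real (Suc n)) at_top sequentially"
  by (rule filterlim_compose[OF filterlim_real_sequentially filterlim_Suc])

lemma tang_add:
  assumes "X \<in> tang" "Y \<in> tang" shows "X + Y \<in> tang"
proof (rule tang_sequence[OF Suc_at_top product_difference_quotient[OF Suc_at_top]])
  show "(\<lambda>n. real (Suc n) *\<^sub>R (one_par X (of_real (inverse (real (Suc n)))) - mat 1)) \<longlonglongrightarrow> X"
    "(\<lambda>n. real (Suc n) *\<^sub>R (one_par Y (of_real (inverse (real (Suc n)))) - mat 1)) \<longlonglongrightarrow> Y"
    by (rule one_par_difference_quotient[OF Suc_at_top])+
qed (use assms tang_complex G_mult in blast)

end

section \<open>The differential of a conjugation\<close>

locale matrix_group_conj = matrix_group G F for G :: "(complex^'n^'n) set" and F +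
  fixes \<theta> :: "complex^'n^'n \<Rightarrow> complex^'n^'n"
  assumes \<theta>_in: "\<And>A. A \<in> G \<Longrightarrow> \<theta> A \<in> G" and \<theta>_mult: "\<And>A B. A \<in> G \<Longrightarrow> B \<in> G \<Longrightarrow> \<theta> (A ** B) = \<theta> A ** \<theta> B"
    and \<theta>_\<theta>: "\<And>A. A \<in> G \<Longrightarrow> \<theta> (\<theta> A) = A"
    and \<theta>_anti: "\<And>i j. \<exists>p k. matrix_poly p \<and> (\<forall>A\<in>G. \<theta> A $ i $ j = cnj (p A / det A ^ k))"
begin

lemma \<theta>_one: "\<theta> (mat 1) = mat 1"
proof -
  have "\<theta> (mat 1) = \<theta> (mat 1) ** \<theta> (mat 1)" using \<theta>_mult[OF G_one G_one] by simp
  then have "matrix_inv (\<theta> (mat 1)) ** \<theta> (mat 1) = matrix_inv (\<theta> (mat 1)) ** \<theta> (mat 1) ** \<theta> (mat 1)"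
    by (simp flip: matrix_mul_assoc)
  then show ?thesis using matrix_inv_mult(2)[OF G_invertible[OF \<theta>_in[OF G_one]]] by simp
qed

lemma \<theta>_mpow: "A \<in> G \<Longrightarrow> \<theta> (mpow A k) = mpow (\<theta> A) k"
  by (induction k) (auto simp: \<theta>_one \<theta>_mult mpow_in)

lemma \<theta>_tendsto:
  assumes "\<And>n. X n \<in> G" "X \<longlonglongrightarrow> L" "L \<in> G" shows "(\<lambda>n. \<theta> (X n)) \<longlonglongrightarrow> \<theta> L"
proof (intro vec_tendstoI)
  fix i j
  obtain p k where p: "matrix_poly p" "\<And>A. A \<in> G \<Longrightarrow> \<theta> A $ i $ j = cnj (p A / det A ^ k)" using \<theta>_anti by metis
  have "isCont p L" by (rule isCont_matrix_poly[OF p(1)])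
  then have 1: "(\<lambda>n. p (X n)) \<longlonglongrightarrow> p L" by (rule isCont_tendsto_compose[OF _ assms(2)])
  have "continuous_on UNIV (det :: complex^'n^'n \<Rightarrow> complex)" using continuous_on_det_complex[of UNIV "\<lambda>x. x"] by simp
  then have "isCont det L" by (simp add: continuous_on_eq_continuous_at)
  then have 2: "(\<lambda>n. det (X n)) \<longlonglongrightarrow> det L" by (rule isCont_tendsto_compose[OF _ assms(2)])
  have "det L \<noteq> 0" using G_invertible[OF assms(3)] invertible_det_nz by blast
  then have "(\<lambda>n. cnj (p (X n) / det (X n) ^ k)) \<longlonglongrightarrow> cnj (p L / det L ^ k)"
    by (intro tendsto_intros 1 2) auto
  then show "(\<lambda>n. \<theta> (X n) $ i $ j) \<longlonglongrightarrow> \<theta> L $ i $ j" using p(2) assms by simp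
qed

text \<open>\<open>Z\<close> is the image of \<open>Y\<close> under the differential of
  \<open>\<theta>\<close>, obtained from entire functions whose conjugates are the entries of
  \<open>\<theta>\<close> along the subgroup. Powers of short steps are evaluated in two ways, as
  \<open>\<theta>\<close> of a power and as a power of \<open>\<theta>\<close>. The parameter
  \<open>w\<close> records that the differential is conjugate-linear.\<close>

lemma \<theta>_one_par:
  assumes Y: "Y \<in> tang"
  obtains Z where "Z \<in> tang"
    "\<And>w t. t \<ge> 0 \<Longrightarrow> \<theta> (one_par (cscale w Y) (of_real t)) = one_par (cscale (cnj w) Z) (of_real t)"
proof -
  have "\<exists>f f'. f holomorphic_on UNIV \<and> (\<forall>z. \<theta> (one_par Y z) $ i $ j = cnj (f z)) \<and> (f has_field_derivative f') (at 0)" for i j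
  proof -
    obtain p k where p: "matrix_poly p" "\<And>A. A \<in> G \<Longrightarrow> \<theta> A $ i $ j = cnj (p A / det A ^ k)" using \<theta>_anti by metis
    define f where "f z = p (one_par Y z) / det (one_par Y z) ^ k" for z
    have h: "f holomorphic_on UNIV" unfolding f_def
      by (intro holomorphic_intros holomorphic_matrix_poly_comp[OF p(1)] holomorphic_det holomorphic_one_par)
        (use invertible_one_par invertible_det_nz in auto)
    then have "(f has_field_derivative deriv f 0) (at 0)" by (simp add: holomorphic_derivI)
    then show ?thesis using h p(2)[OF tang_complex[OF Y]] unfolding f_def by blast
  qed
  then obtain f f' where f: "\<And>i j. f i j holomorphic_on UNIV" "\<And>i j z. \<theta> (one_par Y z) $ i $ j = cnj (f i j z)"
    "\<And>i j. (f i j has_field_derivative f' i j) (at 0)" by metis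
  define Z :: "complex^'n^'n" where "Z = (\<chi> i j. cnj (f' i j))"
  have main: "\<theta> (one_par (cscale w Y) (of_real t)) = one_par (cscale (cnj w) Z) (of_real t)" if t: "t \<ge> 0" for w and t :: real
  proof -
    define c where "c n = real (Suc n)" for n
    have c: "filterlim c at_top sequentially" unfolding c_def by (rule Suc_at_top)
    have c0: "c n > 0" for n by (simp add: c_def)
    define A where "A n = one_par Y (w * of_real (inverse (c n)))" for n
    have AG: "A n \<in> G" for n unfolding A_def by (rule tang_complex[OF Y])
    have lim: "(\<lambda>n. c n *\<^sub>R (\<theta> (A n) - mat 1)) \<longlonglongrightarrow> cscale (cnj w) Z"
    proof (intro vec_tendstoI)
      fix i j
      have f0: "cnj (f i j 0) = mat 1 $ i $ j" using f(2)[of 0 i j] \<theta>_one by simp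
      have "((\<lambda>z. f i j (w * z)) has_field_derivative f' i j * w) (at 0)"
        by (rule DERIV_chain2[of "f i j"]) (auto intro!: derivative_eq_intros simp: f(3))
      then have "((\<lambda>h. (f i j (w * h) - f i j 0) / h) \<longlongrightarrow> f' i j * w) (at 0)" by (simp add: DERIV_def)
      moreover have "filterlim (\<lambda>n. complex_of_real (inverse (c n))) (at 0) sequentially"
      proof -
        have "(\<lambda>n. complex_of_real (inverse (c n))) \<longlonglongrightarrow> of_real 0" by (intro tendsto_of_real tendsto_inverse_0_at_top c)
        then show ?thesis using c0 by (auto simp: filterlim_at less_imp_neq[THEN not_sym])
      qed
      ultimately have "(\<lambda>n. (f i j (w * complex_of_real (inverse (c n))) - f i j 0) / complex_of_real (inverse (c n))) \<longlonglongrightarrow> f' i j * w"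
        by (rule filterlim_compose)
      then have "(\<lambda>n. cnj ((f i j (w * complex_of_real (inverse (c n))) - f i j 0) / complex_of_real (inverse (c n)))) \<longlonglongrightarrow> cnj (f' i j * w)"
        by (rule tendsto_cnj)
      moreover have "cnj ((f i j (w * complex_of_real (inverse (c n))) - f i j 0) / complex_of_real (inverse (c n))) = (c n *\<^sub>R (\<theta> (A n) - mat 1)) $ i $ j" for n
        using f0 c0[of n] by (simp add: A_def f(2) scaleR_conv_of_real[where 'a=complex] field_simps)
      ultimately show "(\<lambda>n. (c n *\<^sub>R (\<theta> (A n) - mat 1)) $ i $ j) \<longlonglongrightarrow> cscale (cnj w) Z $ i $ j"
        by (simp add: Z_def mult.commute)
    qed
    let ?k = "\<lambda>n. nat \<lfloor>t * c n\<rfloor>"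
    have 1: "(\<lambda>n. mpow (\<theta> (A n)) (?k n)) \<longlonglongrightarrow> one_par (cscale (cnj w) Z) (of_real t)"
      by (rule mpow_floor_tendsto_one_par[OF c lim t])
    have 2: "(\<lambda>n. mpow (\<theta> (A n)) (?k n)) \<longlonglongrightarrow> \<theta> (one_par Y (w * of_real t))"
    proof (intro vec_tendstoI)
      fix i j
      have "isCont (f i j) (w * of_real t)" using holomorphic_on_imp_continuous_on[OF f(1)] by (simp add: continuous_on_eq_continuous_at)
      moreover have "(\<lambda>n. w * complex_of_real (real (?k n) / c n)) \<longlonglongrightarrow> w * of_real t"
        by (intro tendsto_mult tendsto_const tendsto_of_real floor_ratio_tendsto c t)
      ultimately have "(\<lambda>n. f i j (w * complex_of_real (real (?k n) / c n))) \<longlonglongrightarrow> f i j (w * of_real t)" by (rule isCont_tendsto_compose)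
      then have "(\<lambda>n. cnj (f i j (w * complex_of_real (real (?k n) / c n)))) \<longlonglongrightarrow> cnj (f i j (w * of_real t))" by (rule tendsto_cnj)
      moreover have "mpow (\<theta> (A n)) (?k n) $ i $ j = cnj (f i j (w * complex_of_real (real (?k n) / c n)))" for n
      proof -
        have "mpow (\<theta> (A n)) (?k n) = \<theta> (mpow (A n) (?k n))" by (simp only: \<theta>_mpow[OF AG])
        also have "mpow (A n) (?k n) = one_par Y (of_nat (?k n) * (w * of_real (inverse (c n))))"
          by (simp only: A_def mpow_one_par)
        also have "of_nat (?k n) * (w * of_real (inverse (c n))) = w * complex_of_real (real (?k n) / c n)"
          by (simp add: divide_inverse)
        finally show ?thesis by (simp only: f(2))
      qed
      ultimately show "(\<lambda>n. mpow (\<theta> (A n)) (?k n) $ i $ j) \<longlonglongrightarrow> \<theta> (one_par Y (w * of_real t)) $ i $ j" by (simp only: f(2))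
    qed
    have "\<theta> (one_par Y (w * of_real t)) = one_par (cscale (cnj w) Z) (of_real t)" by (rule LIMSEQ_unique[OF 2 1])
    then show ?thesis by (simp add: one_par_cscale mult.commute)
  qed
  have "Z \<in> tang"
  proof (rule tang_if_nonneg)
    fix t :: real assume "t \<ge> 0"
    then show "one_par Z (of_real t) \<in> G" using main[of t 1] \<theta>_in[OF tang_complex[OF Y, of "of_real t"]] by simp
  qed
  then show thesis using that main by blast
qed

text \<open>Additivity of the differential by a product formula: a short step along \<open>X\<close>
  followed by one along \<open>Y\<close> has direction \<open>X + Y\<close>, and its image under
  \<open>\<theta>\<close> has direction \<open>X' + Y'\<close>.\<close>

lemma \<theta>_one_par_add:
  assumes T: "X \<in> tang" "Y \<in> tang" and X': "\<And>t. t \<ge> 0 \<Longrightarrow> \<theta> (one_par X (of_real t)) = one_par X' (of_real t)"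
    and Y': "\<And>t. t \<ge> 0 \<Longrightarrow> \<theta> (one_par Y (of_real t)) = one_par Y' (of_real t)" and t: "t \<ge> 0"
  shows "\<theta> (one_par (X + Y) (of_real t)) = one_par (X' + Y') (of_real t)"
proof -
  define c where "c n = real (Suc n)" for n
  have c: "filterlim c at_top sequentially" unfolding c_def by (rule Suc_at_top)
  have c0: "inverse (c n) \<ge> 0" for n by (simp add: c_def)
  define A where "A n = one_par X (of_real (inverse (c n))) ** one_par Y (of_real (inverse (c n)))" for n
  have AG: "A n \<in> G" for n unfolding A_def using T tang_complex G_mult by blast
  have \<theta>A: "\<theta> (A n) = one_par X' (of_real (inverse (c n))) ** one_par Y' (of_real (inverse (c n)))" for n
    unfolding A_def using T tang_complex X'[OF c0] Y'[OF c0] \<theta>_mult by simp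
  let ?k = "\<lambda>n. nat \<lfloor>t * c n\<rfloor>"
  have "(\<lambda>n. c n *\<^sub>R (A n - mat 1)) \<longlonglongrightarrow> X + Y" unfolding A_def
    by (rule product_difference_quotient[OF c one_par_difference_quotient[OF c] one_par_difference_quotient[OF c]])
  from mpow_floor_tendsto_one_par[OF c this t]
  have "(\<lambda>n. \<theta> (mpow (A n) (?k n))) \<longlonglongrightarrow> \<theta> (one_par (X + Y) (of_real t))"
    by (rule \<theta>_tendsto[OF mpow_in[OF AG] _ tang_complex[OF tang_add[OF T]]])
  then have 1: "(\<lambda>n. mpow (\<theta> (A n)) (?k n)) \<longlonglongrightarrow> \<theta> (one_par (X + Y) (of_real t))" by (simp only: \<theta>_mpow[OF AG])
  have 2: "(\<lambda>n. c n *\<^sub>R (\<theta> (A n) - mat 1)) \<longlonglongrightarrow> X' + Y'" unfolding \<theta>A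
    by (rule product_difference_quotient[OF c one_par_difference_quotient[OF c] one_par_difference_quotient[OF c]])
  show ?thesis by (rule LIMSEQ_unique[OF 1 mpow_floor_tendsto_one_par[OF c 2 t]])
qed

end

section \<open>Stability of the group under the adjoint of the invariant form\<close>

locale matrix_group_dagger = matrix_group_conj G F \<theta> for G :: "(complex^'n^'n) set" and F \<theta> +
  fixes dag :: "complex^'n^'n \<Rightarrow> complex^'n^'n"
  assumes dag_mult: "\<And>A B. dag (A ** B) = dag B ** dag A" and dag_add: "\<And>A B. dag (A + B) = dag A + dag B"
    and dag_cscale: "\<And>c A. dag (cscale c A) = cscale (cnj c) (dag A)" and dag_one: "dag (mat 1) = mat 1"
    and dag_tendsto: "\<And>X L. X \<longlonglongrightarrow> L \<Longrightarrow> (\<lambda>n. dag (X n)) \<longlonglongrightarrow> dag L"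
    and dag_fix: "\<And>A. A \<in> G \<Longrightarrow> \<theta> A = A \<Longrightarrow> dag A = matrix_inv A"
    and conn: "connected G"
begin

lemma mpow_commute: "mpow A k ** A = A ** mpow A k"
  by (induction k) (simp_all flip: matrix_mul_assoc)

lemma dag_mpow: "dag (mpow A k) = mpow (dag A) k"
  by (induction k) (simp_all add: dag_one dag_mult mpow_commute)

lemma dag_scaleR: "dag (r *\<^sub>R A) = r *\<^sub>R dag A"
  using dag_cscale[of "of_real r" A] by (simp add: cscale_of_real)

lemma dag_diff: "dag (A - B) = dag A - dag B"
  using dag_add[of "A - B" B] by simp

lemma dag_one_par:
  assumes t: "t \<ge> 0" shows "dag (one_par Y (of_real t)) = one_par (dag Y) (of_real t)"
proof -
  define c where "c n = real (Suc n)" for n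
  have c: "filterlim c at_top sequentially" unfolding c_def by (rule Suc_at_top)
  define A where "A n = one_par Y (of_real (inverse (c n)))" for n
  have A: "(\<lambda>n. c n *\<^sub>R (A n - mat 1)) \<longlonglongrightarrow> Y" unfolding A_def by (rule one_par_difference_quotient[OF c])
  have 1: "(\<lambda>n. dag (mpow (A n) (nat \<lfloor>t * c n\<rfloor>))) \<longlonglongrightarrow> dag (one_par Y (of_real t))"
    by (rule dag_tendsto[OF mpow_floor_tendsto_one_par[OF c A t]])
  have 2: "(\<lambda>n. c n *\<^sub>R (dag (A n) - mat 1)) \<longlonglongrightarrow> dag Y" using dag_tendsto[OF A] by (simp add: dag_scaleR dag_diff dag_one)
  show ?thesis by (rule LIMSEQ_unique[OF 1[unfolded dag_mpow] mpow_floor_tendsto_one_par[OF c 2 t]])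
qed

text \<open>The one-parameter subgroup of \<open>K\<close> consists of fixed points of
  \<open>\<theta>\<close>, on which \<open>dag\<close> is inversion. Difference quotients at the
  identity turn inversion into the minus sign.\<close>

lemma dag_fixed_direction:
  assumes "K \<in> tang" and K: "\<And>t. t \<ge> 0 \<Longrightarrow> \<theta> (one_par K (of_real t)) = one_par K (of_real t)"
  shows "dag K = - K"
proof -
  define c where "c n = real (Suc n)" for n
  have c: "filterlim c at_top sequentially" unfolding c_def by (rule Suc_at_top)
  have c0: "inverse (c n) \<ge> 0" for n by (simp add: c_def)
  have "dag (one_par K (of_real (inverse (c n)))) = one_par (cscale (-1) K) (of_real (inverse (c n)))" for n
    using dag_fix[OF tang_complex[OF assms(1)] K[OF c0]] by (simp add: matrix_inv_one_par one_par_cscale)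
  then have e: "c n *\<^sub>R (one_par (cscale (-1) K) (of_real (inverse (c n))) - mat 1) = dag (c n *\<^sub>R (one_par K (of_real (inverse (c n))) - mat 1))" for n
    by (simp only: dag_scaleR dag_diff dag_one)
  have 1: "(\<lambda>n. dag (c n *\<^sub>R (one_par K (of_real (inverse (c n))) - mat 1))) \<longlonglongrightarrow> dag K"
    by (rule dag_tendsto[OF one_par_difference_quotient[OF c]])
  have 2: "(\<lambda>n. c n *\<^sub>R (one_par (cscale (-1) K) (of_real (inverse (c n))) - mat 1)) \<longlonglongrightarrow> cscale (-1) K"
    by (rule one_par_difference_quotient[OF c])
  have "dag K = cscale (-1) K" by (rule LIMSEQ_unique[OF 1 2[unfolded e]])
  then show ?thesis by (simp add: vec_eq_iff)
qed

text \<open>With \<open>Z\<close> the image of \<open>Y\<close> under the differential of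
  \<open>\<theta>\<close>, both \<open>Y + Z\<close> and \<open>\<i> (Y - Z)\<close> are fixed
  directions, so \<open>dag\<close> changes their signs. As \<open>dag\<close> is conjugate-linear,
  the two equations combine to \<open>dag Y = - Z\<close>, which is tangent.\<close>

lemma dag_tang:
  assumes Y: "Y \<in> tang" shows "dag Y \<in> tang"
proof -
  obtain Z where Z: "Z \<in> tang" and E: "\<And>w t. t \<ge> 0 \<Longrightarrow> \<theta> (one_par (cscale w Y) (of_real t)) = one_par (cscale (cnj w) Z) (of_real t)"
    using \<theta>_one_par[OF Y] by metis
  have E': "\<theta> (one_par (cscale (cnj w) Z) (of_real t)) = one_par (cscale w Y) (of_real t)" if "t \<ge> 0" for w t
    using \<theta>_\<theta>[OF tang_complex[OF tang_cscale[OF Y]]] E[OF that, of w] by metis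
  have 1: "dag (Y + Z) = - (Y + Z)"
  proof (rule dag_fixed_direction[OF tang_add[OF Y Z]])
    fix t :: real assume t: "t \<ge> 0"
    have "\<theta> (one_par (Y + Z) (of_real t)) = one_par (Z + Y) (of_real t)"
      by (rule \<theta>_one_par_add[OF Y Z _ _ t]) (use E[of _ 1] E'[of _ 1] in auto)
    then show "\<theta> (one_par (Y + Z) (of_real t)) = one_par (Y + Z) (of_real t)" by (simp add: add.commute)
  qed
  let ?K = "cscale \<i> Y + cscale (- \<i>) Z"
  have 2: "dag ?K = - ?K"
  proof (rule dag_fixed_direction[OF tang_add[OF tang_cscale[OF Y] tang_cscale[OF Z]]])
    fix t :: real assume t: "t \<ge> 0"
    have "\<theta> (one_par ?K (of_real t)) = one_par (cscale (- \<i>) Z + cscale \<i> Y) (of_real t)"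
      by (rule \<theta>_one_par_add[OF tang_cscale[OF Y] tang_cscale[OF Z] _ _ t]) (use E[of _ \<i>] E'[of _ \<i>] in auto)
    then show "\<theta> (one_par ?K (of_real t)) = one_par ?K (of_real t)" by (simp add: add.commute)
  qed
  have "dag Y = cscale (-1) Z"
  proof (simp only: vec_eq_iff, intro allI)
    fix i j
    have a: "dag Y $ i $ j + dag Z $ i $ j = - (Y $ i $ j + Z $ i $ j)"
      using 1 by (metis dag_add vector_add_component vector_uminus_component)
    have "(- \<i>) * dag Y $ i $ j + \<i> * dag Z $ i $ j = - (\<i> * Y $ i $ j + (- \<i>) * Z $ i $ j)"
    proof -
      have "dag ?K $ i $ j = (- ?K) $ i $ j" using 2 by simp
      then show ?thesis by (simp add: dag_add dag_cscale)
    qed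
    then have "\<i> * (dag Z $ i $ j - dag Y $ i $ j) = \<i> * (Z $ i $ j - Y $ i $ j)" by (simp add: algebra_simps)
    then have b: "dag Z $ i $ j - dag Y $ i $ j = Z $ i $ j - Y $ i $ j" by simp
    have "2 * dag Y $ i $ j = (dag Y $ i $ j + dag Z $ i $ j) - (dag Z $ i $ j - dag Y $ i $ j)" by simp
    also have "\<dots> = 2 * (- Z $ i $ j)" unfolding a b by simp
    finally have "2 * dag Y $ i $ j = 2 * (- Z $ i $ j)" .
    then show "dag Y $ i $ j = cscale (-1) Z $ i $ j" by simp
  qed
  then show ?thesis by (simp only: tang_cscale[OF Z])
qed

text \<open>The part of \<open>G\<close> on which stability holds. It is a subgroup, closed among
  invertible matrices, and contains all real one-parameter subgroups of \<open>G\<close>; what is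
  missing is that it is open in \<open>G\<close>.\<close>

definition G1 :: "(complex^'n^'n) set" where "G1 = {A \<in> G. dag A \<in> G}"

lemma G1_mult: "A \<in> G1 \<Longrightarrow> B \<in> G1 \<Longrightarrow> A ** B \<in> G1"
  by (simp add: G1_def G_mult dag_mult)

lemma dag_inverse: "invertible A \<Longrightarrow> invertible (dag A) \<and> dag (matrix_inv A) = matrix_inv (dag A)"
proof -
  assume A: "invertible A"
  have "dag A ** dag (matrix_inv A) = mat 1" "dag (matrix_inv A) ** dag A = mat 1"
    using matrix_inv_mult[OF A] dag_mult dag_one by metis+
  then show ?thesis using matrix_inv_unique invertible_def by metis
qed

lemma G1_inv: "A \<in> G1 \<Longrightarrow> matrix_inv A \<in> G1"
  using dag_inverse G_invertible G_inv by (simp add: G1_def)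

lemma G1_one_par: 
  assumes Y: "Y \<in> tang" shows "one_par Y (of_real t) \<in> G1"
proof -
  have *: "one_par Y (of_real t) \<in> G1" if "Y \<in> tang" "t \<ge> 0" for Y and t :: real
    unfolding G1_def using tang_complex[OF that(1)] tang_complex[OF dag_tang[OF that(1)]] by (simp add: dag_one_par[OF that(2)])
  show ?thesis
  proof (cases "t \<ge> 0")
    case False
    have "one_par (cscale (-1) Y) (of_real (- t)) \<in> G1" using False by (intro * tang_cscale Y) auto
    then show ?thesis by (simp add: one_par_cscale)
  next
    case True
    show ?thesis by (rule *[OF Y True])
  qed
qed

lemma G1_limit:
  assumes "\<And>n. X n \<in> G1" "X \<longlonglongrightarrow> L" "invertible L"
  shows "L \<in> G1"
  unfolding G1_def using assms G_limit[of X L] G_limit[of "\<lambda>n. dag (X n)" "dag L"] dag_tendsto[OF assms(2)] dag_inverse[OF assms(3)]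
  by (auto simp: G1_def)

text \<open>A point of \<open>G\<close> close to the identity but outside \<open>G1\<close> could be moved by \<open>G1\<close> to the nearest
  position to the identity; the limiting direction \<open>Y\<close> of such points is tangent, so \<open>one_par Y\<close>
  lies in \<open>G1\<close> and moves them still closer.\<close>

lemma G1_neighbourhood: "\<exists>e>0. \<forall>A\<in>G. dist A (mat 1) < e \<longrightarrow> A \<in> G1"
proof (rule ccontr)
  assume "\<not> ?thesis"
  then have neg: "\<And>e. e > 0 \<Longrightarrow> \<exists>A. A \<in> G \<and> dist A (mat 1) < e \<and> A \<notin> G1" by blast
  obtain r where r: "r > 0" "cball (mat 1 :: complex^'n^'n) r \<subseteq> {A. invertible A}"
    using open_invertible[unfolded open_contains_cball] invertible_mat_1 by blast
  have "\<forall>n. \<exists>A. A \<in> G \<and> dist A (mat 1) < min r (inverse (real (Suc n))) \<and> A \<notin> G1"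
    by (intro allI neg) (use r(1) in simp)
  then obtain A where A: "\<And>n. A n \<in> G" "\<And>n. dist (A n) (mat 1) < min r (inverse (real (Suc n)))" "\<And>n. A n \<notin> G1" by metis
  \<comment> \<open>The part of the coset of \<open>A n\<close> under left multiplication by
    \<open>G1\<close> that lies in a closed ball of invertible matrices. Invertibility on the whole
    ball lets \<open>G1_limit\<close> prove closedness, so a point \<open>B n\<close> nearest to the
    identity exists.\<close>
  define M where "M n = {B \<in> cball (mat 1) r. B ** matrix_inv (A n) \<in> G1}" for n
  have invB: "invertible B" if "B \<in> M n" for B n using that r(2) by (auto simp: M_def)
  have "compact (M n)" for n
  proof -
    have "closed (M n)"
    proof (subst closed_sequential_limits, intro allI impI, elim conjE)
      fix X L assume X: "\<forall>k. X k \<in> M n" and lim: "X \<longlonglongrightarrow> L"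
      have L: "L \<in> cball (mat 1) r" by (rule closed_sequentially[OF closed_cball _ lim]) (use X M_def in blast)
      have "(\<lambda>k. X k ** matrix_inv (A n)) \<longlonglongrightarrow> L ** matrix_inv (A n)" by (intro tendsto_matrix_mult lim tendsto_const)
      moreover have "invertible (L ** matrix_inv (A n))"
        using L r(2) invertible_matrix_inv[OF G_invertible[OF A(1)]] by (auto intro!: invertible_mult)
      ultimately have "L ** matrix_inv (A n) \<in> G1" by (rule G1_limit[rotated]) (use X M_def in blast)
      then show "L \<in> M n" using L by (simp add: M_def)
    qed
    moreover have "bounded (M n)" by (rule bounded_subset[OF bounded_cball]) (auto simp: M_def)
    ultimately show ?thesis by (simp add: compact_eq_bounded_closed)
  qed
  moreover have AM: "A n \<in> M n" for n
  proof -
    have "mat 1 \<in> G1" by (simp add: G1_def G_one dag_one)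
    then show ?thesis using A(2)[of n] matrix_inv_mult(1)[OF G_invertible[OF A(1)[of n]]] by (simp add: M_def dist_commute)
  qed
  ultimately have "\<exists>B\<in>M n. \<forall>C\<in>M n. dist B (mat 1) \<le> dist C (mat 1)" for n
    by (intro continuous_attains_inf) (auto intro!: continuous_intros)
  then obtain B where B: "\<And>n. B n \<in> M n" "\<And>n C. C \<in> M n \<Longrightarrow> dist (B n) (mat 1) \<le> dist C (mat 1)" by metis
  have BA: "B n = (B n ** matrix_inv (A n)) ** A n" for n
    using matrix_inv_mult(2)[OF G_invertible[OF A(1)[of n]]] by (simp flip: matrix_mul_assoc)
  have BG1: "B n ** matrix_inv (A n) \<in> G1" for n using B(1)[of n] by (simp add: M_def)
  have BG: "B n \<in> G" for n using G_mult[of "B n ** matrix_inv (A n)" "A n"] BG1[of n] A(1) BA[of n] by (simp add: G1_def)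
  have Bn: "B n \<notin> G1" for n
  proof
    assume b: "B n \<in> G1"
    have "matrix_inv (B n ** matrix_inv (A n)) ** B n = A n"
      using matrix_inv_mult(2)[of "B n ** matrix_inv (A n)"] BG1[of n] G_invertible BA[of n]
      by (metis (no_types, lifting) G1_def mem_Collect_eq matrix_mul_assoc matrix_mul_lid)
    then show False using G1_mult[OF G1_inv[OF BG1[of n]] b] A(3)[of n] by simp
  qed
  define d where "d n = dist (B n) (mat 1)" for n
  have d0: "d n > 0" for n using Bn[of n] G_one dag_one by (auto simp: d_def G1_def)
  have dlt: "d n < min r (inverse (real (Suc n)))" for n using B(2)[OF AM[of n]] A(2)[of n] by (simp add: d_def)
  have dlim: "d \<longlonglongrightarrow> 0"
  proof (rule tendsto_sandwich[OF _ _ tendsto_const LIMSEQ_inverse_real_of_nat])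
    show "\<forall>\<^sub>F n in sequentially. 0 \<le> d n" by (rule always_eventually) (simp add: d_def)
    show "\<forall>\<^sub>F n in sequentially. d n \<le> inverse (real (Suc n))"
      by (rule always_eventually, rule allI) (use dlt in \<open>auto intro: less_imp_le\<close>)
  qed
  define E where "E n = inverse (d n) *\<^sub>R (B n - mat 1)" for n
  have "E n \<in> sphere 0 1" for n using d0[of n] by (simp add: E_def d_def dist_norm)
  then obtain Y \<sigma> where Y: "Y \<in> sphere 0 1" "strict_mono (\<sigma> :: nat \<Rightarrow> nat)" "(E \<circ> \<sigma>) \<longlonglongrightarrow> Y"
    using compact_sphere[of "0 :: complex^'n^'n" 1] unfolding compact_def by metis
  define c where "c n = inverse (d (\<sigma> n))" for n
  have dsub: "(\<lambda>n. d (\<sigma> n)) \<longlonglongrightarrow> 0" using LIMSEQ_subseq_LIMSEQ[OF dlim Y(2)] by (simp add: o_def)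
  have c: "filterlim c at_top sequentially" unfolding c_def
    by (rule filterlim_inverse_at_top[OF dsub]) (use d0 in simp)
  have cE: "(\<lambda>n. c n *\<^sub>R (B (\<sigma> n) - mat 1)) \<longlonglongrightarrow> Y" using Y(3) by (simp add: o_def E_def c_def)
  have "Y \<in> tang" by (rule tang_sequence[OF c cE]) (rule BG)
  \<comment> \<open>The time of this step is the distance \<open>d (\<sigma> n)\<close>, so the move
    cancels the first-order term and leaves a distance of smaller order, against the minimality of
    \<open>B\<close>.\<close>
  define P where "P n = one_par (cscale (-1) Y) (of_real (inverse (c n)))" for n
  have PG: "P n \<in> G1" for n unfolding P_def by (rule G1_one_par[OF tang_cscale[OF \<open>Y \<in> tang\<close>]])
  have "(\<lambda>n. c n *\<^sub>R (P n ** B (\<sigma> n) - mat 1)) \<longlonglongrightarrow> cscale (-1) Y + Y"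
    unfolding P_def by (rule product_difference_quotient[OF c one_par_difference_quotient[OF c] cE])
  moreover have "cscale (-1) Y + Y = 0" by (simp add: vec_eq_iff)
  ultimately have "(\<lambda>n. c n *\<^sub>R (P n ** B (\<sigma> n) - mat 1)) \<longlonglongrightarrow> 0" by (simp only:)
  then have "(\<lambda>n. norm (c n *\<^sub>R (P n ** B (\<sigma> n) - mat 1))) \<longlonglongrightarrow> 0" by (rule tendsto_norm_zero)
  then have "\<forall>\<^sub>F n in sequentially. norm (c n *\<^sub>R (P n ** B (\<sigma> n) - mat 1)) < 1" by (rule order_tendstoD) simp
  then obtain n where n: "norm (c n *\<^sub>R (P n ** B (\<sigma> n) - mat 1)) < 1" using eventually_happens'[OF sequentially_bot] by blast
  have lt: "dist (P n ** B (\<sigma> n)) (mat 1) < d (\<sigma> n)"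
  proof -
    have "norm (P n ** B (\<sigma> n) - mat 1) / d (\<sigma> n) < 1" using n d0[of "\<sigma> n"] by (simp add: c_def divide_inverse mult.commute)
    then show ?thesis using d0[of "\<sigma> n"] by (simp add: dist_norm)
  qed
  moreover have "P n ** B (\<sigma> n) \<in> M (\<sigma> n)"
    unfolding M_def using G1_mult[OF PG BG1] lt dlt[of "\<sigma> n"] by (simp add: matrix_mul_assoc dist_commute)
  ultimately show False using B(2)[of "P n ** B (\<sigma> n)" "\<sigma> n"] by (simp add: d_def)
qed

text \<open>Translates of the neighbourhood of the identity contained in \<open>G1\<close> show that
  \<open>G1\<close> and its complement are both open in \<open>G\<close>; connectedness of
  \<open>G\<close> excludes a nonempty complement.\<close>

lemma dag_closed:
  assumes A: "A \<in> G" shows "dag A \<in> G"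
proof -
  obtain e where e: "e > 0" "\<And>A. A \<in> G \<Longrightarrow> dist A (mat 1) < e \<Longrightarrow> A \<in> G1" using G1_neighbourhood by blast
  define near where "near X = {B \<in> G. dist (matrix_inv X ** B) (mat 1) < e}" for X
  have near_open: "openin (top_of_set G) (near X)" for X
  proof -
    have "near X = G \<inter> (\<lambda>B. matrix_inv X ** B) -` ball (mat 1) e" by (auto simp: near_def dist_commute)
    moreover have "open ((\<lambda>B. matrix_inv X ** B) -` ball (mat 1) e)"
      by (intro open_vimage open_ball continuous_intros)
    ultimately show ?thesis by auto
  qed
  have near_G1: "matrix_inv X ** B \<in> G1" if "X \<in> G" "B \<in> near X" for X B
    using that e(2) G_mult G_inv by (simp add: near_def)
  have self: "X \<in> near X" if "X \<in> G" for X
    using that e(1) matrix_inv_mult(2)[OF G_invertible[OF that]] by (simp add: near_def)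
  have "A \<in> G1"
  proof (rule ccontr)
    assume A1: "A \<notin> G1"
    have 1: "openin (top_of_set G) G1"
    proof (subst openin_subopen, intro ballI)
      fix X assume X: "X \<in> G1"
      then have XG: "X \<in> G" by (simp add: G1_def)
      have "near X \<subseteq> G1"
      proof
        fix B assume "B \<in> near X"
        then have "X ** (matrix_inv X ** B) \<in> G1" using X XG near_G1 G1_mult by blast
        then show "B \<in> G1" using matrix_inv_mult(1)[OF G_invertible[OF XG]] by (simp add: matrix_mul_assoc)
      qed
      then show "\<exists>T. openin (top_of_set G) T \<and> X \<in> T \<and> T \<subseteq> G1" using near_open self[OF XG] by blast
    qed
    have 2: "openin (top_of_set G) (G - G1)"
    proof (subst openin_subopen, intro ballI)
      fix X assume X: "X \<in> G - G1"
      have "near X \<subseteq> G - G1"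
      proof
        fix B assume B: "B \<in> near X"
        have "B \<notin> G1"
        proof
          assume "B \<in> G1"
          then have "B ** matrix_inv (matrix_inv X ** B) \<in> G1" using X B near_G1 G1_mult G1_inv by blast
          moreover have "B ** matrix_inv (matrix_inv X ** B) = X"
            using X B G_invertible by (simp add: near_def matrix_inv_mult_distrib invertible_matrix_inv matrix_inv_matrix_inv matrix_mul_assoc matrix_inv_mult)
          ultimately show False using X by simp
        qed
        then show "B \<in> G - G1" using B by (simp add: near_def)
      qed
      then show "\<exists>T. openin (top_of_set G) T \<and> X \<in> T \<and> T \<subseteq> G - G1" using near_open self[of X] X by blast
    qed
    have "mat 1 \<in> G1" by (simp add: G1_def G_one dag_one)
    then have "G1 \<noteq> {}" "G - G1 \<noteq> {}" "G \<subseteq> G1 \<union> (G - G1)" "G1 \<inter> (G - G1) = {}" using A A1 by blast+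
    with 1 2 conn show False unfolding connected_openin by blast
  qed
  then show ?thesis by (simp add: G1_def)
qed

end

section \<open>Invariant Hermitian forms\<close>

definition herm :: "complex^'n^'n \<Rightarrow> complex^'n \<Rightarrow> complex^'n \<Rightarrow> complex" where
  "herm M x y = (\<Sum>i\<in>UNIV. \<Sum>j\<in>UNIV. cnj (x $ i) * M $ i $ j * y $ j)"

definition posdef :: "(complex^'n^'n) set" where
  "posdef = {M. cadj M = M \<and> (\<forall>x. x \<noteq> 0 \<longrightarrow> Re (herm M x x) > 0)}"

lemma herm_add: "herm M x (y + z) = herm M x y + herm M x z" "herm M (y + z) x = herm M y x + herm M z x"
  by (simp_all add: herm_def algebra_simps sum.distrib)

lemma herm_scale: "herm M x (c *s y) = c * herm M x y" "herm M (c *s y) x = cnj c * herm M y x"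
  by (simp_all add: herm_def sum_distrib_left mult_ac)

lemma herm_0 [simp]: "herm M x 0 = 0" "herm M 0 x = 0"
  by (simp_all add: herm_def)

lemma herm_sum: "herm M x (\<Sum>i\<in>S. c i *s y i) = (\<Sum>i\<in>S. c i * herm M x (y i))"
  by (induction S rule: infinite_finite_induct) (simp_all add: herm_add herm_scale)

lemma herm_cnj: "cadj M = M \<Longrightarrow> cnj (herm M x y) = herm M y x"
proof -
  assume M: "cadj M = M"
  have M': "cnj (M $ i $ j) = M $ j $ i" for i j using M by (metis cadj_entry)
  have "cnj (herm M x y) = (\<Sum>i\<in>UNIV. \<Sum>j\<in>UNIV. cnj (y $ j) * M $ j $ i * x $ i)"
    by (simp add: herm_def M' mult_ac)
  also have "\<dots> = herm M y x" unfolding herm_def by (rule sum.swap)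
  finally show ?thesis .
qed

text \<open>Gram-Schmidt for the form \<open>M\<close>. The condition on supports guarantees that
  the new vector is nonzero: earlier vectors vanish at \<open>p\<close>, so its coordinate there is
  1.\<close>

lemma orthonormal_frame:
  fixes M :: "complex^'n^'n"
  assumes M: "M \<in> posdef" and "finite S"
  shows "\<exists>e. (\<forall>i\<in>S. \<forall>j\<in>S. herm M (e i) (e j) = (if i = j then 1 else 0)) \<and> (\<forall>i\<in>S. \<forall>k. k \<notin> S \<longrightarrow> e i $ k = 0)"
  using assms(2)
proof (induction S)
  case (insert p S)
  have Mh: "cadj M = M" using M by (simp add: posdef_def)
  obtain e where e: "\<And>i j. i \<in> S \<Longrightarrow> j \<in> S \<Longrightarrow> herm M (e i) (e j) = (if i = j then 1 else 0)"
    "\<And>i k. i \<in> S \<Longrightarrow> k \<notin> S \<Longrightarrow> e i $ k = 0" using insert.IH by blast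
  define a :: "complex^'n" where "a = axis p 1"
  define f where "f = a + (\<Sum>i\<in>S. (- herm M (e i) a) *s e i)"
  have ef: "herm M (e j) f = 0" if j: "j \<in> S" for j
  proof -
    have "herm M (e j) f = herm M (e j) a + (\<Sum>i\<in>S. (- herm M (e i) a) * (if j = i then 1 else 0))"
      unfolding f_def herm_add herm_sum by (simp add: e j cong: sum.cong)
    then show ?thesis using j insert.hyps by (simp add: mult_delta_right)
  qed
  have fe: "herm M f (e j) = 0" if "j \<in> S" for j using ef[OF that] herm_cnj[OF Mh, of "e j" f] by simp
  have f0: "f $ k = 0" if "k \<notin> insert p S" for k
    using that e(2) by (simp add: f_def a_def axis_def)
  have "f $ p = 1" using e(2) insert.hyps by (simp add: f_def a_def axis_def)
  then have "f \<noteq> 0" by auto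
  then have t: "Re (herm M f f) > 0" using M by (simp add: posdef_def)
  define t where "t = Re (herm M f f)"
  have ff: "herm M f f = of_real t" using herm_cnj[OF Mh, of f f] by (simp add: t_def complex_eq_iff)
  define r where "r = 1 / sqrt t"
  define g where "g = of_real r *s f"
  have gg: "herm M g g = 1"
  proof -
    have "herm M g g = of_real (r * r * t)" by (simp add: g_def herm_scale ff)
    also have "r * r * t = 1" using t by (simp add: t_def r_def)
    finally show ?thesis by simp
  qed
  define e' where "e' i = (if i = p then g else e i)" for i
  show ?case
  proof (intro exI[of _ e'] conjI ballI allI impI)
    fix i j assume ij: "i \<in> insert p S" "j \<in> insert p S"
    show "herm M (e' i) (e' j) = (if i = j then 1 else 0)"
      using ij gg ef fe e(1) insert.hyps by (auto simp: e'_def g_def herm_scale)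
  next
    fix i k assume "i \<in> insert p S" "k \<notin> insert p S"
    then show "e' i $ k = 0" using f0[of k] e(2) by (auto simp: e'_def g_def)
  qed
qed auto

text \<open>An \<open>M\<close>-orthonormal frame taken as the columns of \<open>E\<close> gives
  \<open>cadj E ** M ** E = mat 1\<close>, and \<open>C\<close> is the inverse of
  \<open>E\<close>.\<close>

lemma cholesky:
  fixes M :: "complex^'n^'n"
  assumes M: "M \<in> posdef"
  obtains C :: "complex^'n^'n" where "invertible C" "M = cadj C ** C"
proof -
  obtain e :: "'n \<Rightarrow> complex^'n" where e: "\<And>i j. herm M (e i) (e j) = (if i = j then 1 else 0)"
    using orthonormal_frame[OF M finite[of UNIV]] by blast
  define E :: "complex^'n^'n" where "E = (\<chi> i j. e j $ i)"
  have "(cadj E ** M ** E) $ i $ j = (mat 1 :: complex^'n^'n) $ i $ j" for i j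
  proof -
    have "(cadj E ** M ** E) $ i $ j = (\<Sum>l\<in>UNIV. \<Sum>k\<in>UNIV. cnj (e i $ k) * M $ k $ l * e j $ l)"
      by (simp add: matrix_matrix_mult_def E_def sum_distrib_right)
    also have "\<dots> = herm M (e i) (e j)" unfolding herm_def by (rule sum.swap)
    finally show ?thesis using e by (simp add: mat_def)
  qed
  then have EME: "cadj E ** M ** E = mat 1" by (simp add: vec_eq_iff)
  then have iE: "invertible E" using invertible_left_inverse by blast
  let ?C = "matrix_inv E"
  have "cadj ?C ** cadj E = mat 1" using matrix_inv_mult(1)[OF iE] by (metis cadj_mat_1 cadj_mult)
  then have "cadj ?C ** (cadj E ** M ** E) ** ?C = M ** (E ** ?C)" by (simp add: matrix_mul_assoc)
  then have "M = cadj ?C ** ?C" using matrix_inv_mult(1)[OF iE] EME by simp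
  with invertible_matrix_inv[OF iE] show thesis by (rule that)
qed

lemma convex_posdef: "convex posdef"
proof (rule convexI)
  fix M N :: "complex^'n^'n" and u v :: real assume MN: "M \<in> posdef" "N \<in> posdef" and uv: "0 \<le> u" "0 \<le> v" "u + v = 1"
  have h: "herm (u *\<^sub>R M + v *\<^sub>R N) x x = of_real u * herm M x x + of_real v * herm N x x" for x
    by (simp add: herm_def sum_distrib_left sum.distrib[symmetric]) (simp add: scaleR_conv_of_real algebra_simps)
  have "cadj (u *\<^sub>R M + v *\<^sub>R N) = u *\<^sub>R cadj M + v *\<^sub>R cadj N" by (simp add: vec_eq_iff)
  moreover have "Re (herm (u *\<^sub>R M + v *\<^sub>R N) x x) > 0" if "x \<noteq> 0" for x
  proof -
    have "Re (herm M x x) > 0" "Re (herm N x x) > 0" using MN that by (auto simp: posdef_def)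
    then have "u * Re (herm M x x) + v * Re (herm N x x) > 0"
      using uv by (cases "u = 0") (auto intro!: add_pos_nonneg mult_pos_pos mult_nonneg_nonneg)
    then show ?thesis by (simp add: h)
  qed
  ultimately show "u *\<^sub>R M + v *\<^sub>R N \<in> posdef" using MN by (simp add: posdef_def)
qed

lemma posdef_gram: 
  fixes B :: "complex^'n^'n"
  assumes "invertible B" shows "cadj B ** B \<in> posdef"
proof -
  have "herm (cadj B ** B) x x = of_real (\<Sum>k\<in>UNIV. (norm ((B *v x) $ k))\<^sup>2)" for x
  proof -
    have "herm (cadj B ** B) x x = (\<Sum>i\<in>UNIV. \<Sum>j\<in>UNIV. \<Sum>k\<in>UNIV. cnj (B $ k $ i * x $ i) * (B $ k $ j * x $ j))"
      by (simp add: herm_def matrix_matrix_mult_def sum_distrib_left sum_distrib_right mult_ac)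
    also have "\<dots> = (\<Sum>i\<in>UNIV. \<Sum>k\<in>UNIV. \<Sum>j\<in>UNIV. cnj (B $ k $ i * x $ i) * (B $ k $ j * x $ j))"
      by (intro sum.cong refl sum.swap)
    also have "\<dots> = (\<Sum>k\<in>UNIV. \<Sum>i\<in>UNIV. \<Sum>j\<in>UNIV. cnj (B $ k $ i * x $ i) * (B $ k $ j * x $ j))"
      by (rule sum.swap)
    also have "\<dots> = (\<Sum>k\<in>UNIV. (B *v x) $ k * cnj ((B *v x) $ k))"
      by (simp add: matrix_vector_mult_def sum_product sum_distrib_left sum_distrib_right mult_ac)
    finally show ?thesis unfolding of_real_sum complex_norm_square .
  qed
  moreover have "(\<Sum>k\<in>UNIV. (norm ((B *v x) $ k))\<^sup>2) > 0" if "x \<noteq> 0" for x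
  proof -
    have "B *v x \<noteq> 0" using assms that invertible_left_inverse matrix_left_invertible_ker by blast
    then obtain k where "(B *v x) $ k \<noteq> 0" by (metis vec_eq_iff zero_index)
    then show ?thesis by (intro sum_pos2[of _ k]) auto
  qed
  ultimately show ?thesis by (simp add: posdef_def cadj_mult)
qed

lemma congruence_norm_bound:
  fixes K :: "(complex^'n^'n) set"
  assumes "bounded K"
  obtains c where "c \<ge> 0" "\<And>B M. B \<in> K \<Longrightarrow> norm (cadj B ** M ** B) \<le> c * norm M"
proof -
  obtain b where b: "\<And>B. B \<in> K \<Longrightarrow> norm B \<le> b" "b \<ge> 0" using assms by (metis bounded_pos less_imp_le)
  let ?n = "real CARD('n)"
  have ent: "norm (B $ i $ j) \<le> b" if "B \<in> K" for B :: "complex^'n^'n" and i j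
    using b(1)[OF that] Finite_Cartesian_Product.norm_nth_le order_trans by meson
  have "norm (cadj B ** M ** B) \<le> (?n * (?n * (?n * (?n * (b * b))))) * norm M" if B: "B \<in> K" for B M
  proof -
    have "norm (cadj B ** M ** B) \<le> (\<Sum>i\<in>UNIV. \<Sum>j\<in>UNIV. norm ((cadj B ** M ** B) $ i $ j))"
      by (rule order_trans[OF norm_vec_le_sum]) (intro sum_mono norm_vec_le_sum)
    also have "\<dots> \<le> (\<Sum>i\<in>(UNIV::'n set). \<Sum>j\<in>(UNIV::'n set). \<Sum>l\<in>(UNIV::'n set). \<Sum>k\<in>(UNIV::'n set). b * norm M * b)"
    proof (intro sum_mono)
      fix i j
      have "(cadj B ** M ** B) $ i $ j = (\<Sum>l\<in>UNIV. \<Sum>k\<in>UNIV. cnj (B $ k $ i) * M $ k $ l * B $ l $ j)"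
        by (simp add: matrix_matrix_mult_def sum_distrib_right)
      also have "norm \<dots> \<le> (\<Sum>l\<in>UNIV. \<Sum>k\<in>UNIV. norm (cnj (B $ k $ i) * M $ k $ l * B $ l $ j))"
        by (rule order_trans[OF norm_sum]) (intro sum_mono norm_sum)
      also have "\<dots> \<le> (\<Sum>l\<in>(UNIV::'n set). \<Sum>k\<in>(UNIV::'n set). b * norm M * b)"
      proof (intro sum_mono)
        fix k l
        have "norm (M $ k $ l) \<le> norm M" by (meson Finite_Cartesian_Product.norm_nth_le order_trans)
        then show "norm (cnj (B $ k $ i) * M $ k $ l * B $ l $ j) \<le> b * norm M * b"
          using ent[OF B] b(2) by (simp add: norm_mult mult_mono)
      qed
      finally show "norm ((cadj B ** M ** B) $ i $ j) \<le> (\<Sum>l\<in>(UNIV::'n set). \<Sum>k\<in>(UNIV::'n set). b * norm M * b)" .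
    qed
    finally show ?thesis by (simp add: mult_ac)
  qed
  then show thesis using that[of "?n * (?n * (?n * (?n * (b * b))))"] b(2) by simp
qed

text \<open>The norm \<open>M \<mapsto> sup \<parallel>B\<^sup>* M B\<parallel>\<close> over the group is invariant and strictly convex along chords, so
  its minimizer on the convex hull of the orbit of the identity is a fixed positive definite form.\<close>

lemma compact_group_invariant_form:
  fixes K :: "(complex^'n^'n) set"
  assumes K: "compact K" "mat 1 \<in> K" "\<And>A B. A \<in> K \<Longrightarrow> B \<in> K \<Longrightarrow> A ** B \<in> K" "\<And>A. A \<in> K \<Longrightarrow> invertible A"
  obtains C :: "complex^'n^'n" where "invertible C" "\<And>A. A \<in> K \<Longrightarrow> cadj A ** (cadj C ** C) ** A = cadj C ** C"
proof -
  define act where "act B M = cadj B ** M ** B" for B M :: "complex^'n^'n"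
  have act_add: "act B (M + N) = act B M + act B N" for B M N by (simp add: act_def matrix_add_ldistrib matrix_add_rdistrib)
  have act_scale: "act B (r *\<^sub>R M) = r *\<^sub>R act B M" for B M r by (simp add: act_def cscale_of_real[symmetric] cscale_mult)
  have act_diff: "act B (M - N) = act B M - act B N" for B M N using act_add[of B "M - N" N] by simp
  have act_act: "act B (act A M) = act (A ** B) M" for A B M by (simp add: act_def cadj_mult matrix_mul_assoc)
  have lin: "linear (act B)" for B by (rule linearI) (simp_all add: act_add act_scale)
  define S where "S = (\<lambda>B. act B (mat 1)) ` K"
  define H where "H = convex hull S"
  have cont_act: "continuous_on X (\<lambda>B. act B M)" for X M
  proof -
    have "continuous_on X (\<lambda>B. cadj B)" unfolding cadj_def by (intro continuous_intros)
    then show ?thesis unfolding act_def by (intro continuous_intros)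
  qed
  have "compact S" unfolding S_def by (intro compact_continuous_image cont_act K(1))
  then have H: "compact H" unfolding H_def by (rule compact_convex_hull)
  have "mat 1 \<in> S" unfolding S_def using K(2) by (intro image_eqI[of _ _ "mat 1"]) (simp_all add: act_def)
  then have H0: "H \<noteq> {}" unfolding H_def using hull_inc[of "mat 1" S convex] by auto
  obtain c where c: "c \<ge> 0" "\<And>B M. B \<in> K \<Longrightarrow> norm (act B M) \<le> c * norm M"
    using congruence_norm_bound[OF compact_imp_bounded[OF K(1)]] unfolding act_def by metis
  define \<phi> where "\<phi> M = (SUP B\<in>K. norm (act B M))" for M
  have bdd: "bdd_above ((\<lambda>B. norm (act B M)) ` K)" for M using c(2) by (intro bdd_aboveI2)
  have upper: "norm (act B M) \<le> \<phi> M" if "B \<in> K" for B M unfolding \<phi>_def by (rule cSUP_upper[OF that bdd])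
  have least: "\<phi> M \<le> m" if "\<And>B. B \<in> K \<Longrightarrow> norm (act B M) \<le> m" for M m unfolding \<phi>_def using K(2) that by (intro cSUP_least) auto
  have lip: "\<phi> M \<le> \<phi> N + c * norm (M - N)" for M N
  proof (rule least)
    fix B assume B: "B \<in> K"
    have "norm (act B M) \<le> norm (act B N) + norm (act B (M - N))" using norm_triangle_ineq[of "act B N" "act B (M - N)"] by (simp add: act_diff)
    then show "norm (act B M) \<le> \<phi> N + c * norm (M - N)" using upper[OF B, of N] c(2)[OF B, of "M - N"] by linarith
  qed
  have "c-lipschitz_on H \<phi>"
  proof (rule lipschitz_onI)
    fix M N show "dist (\<phi> M) (\<phi> N) \<le> c * dist M N"
      using lip[of M N] lip[of N M] by (simp add: dist_norm norm_minus_commute abs_le_iff)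
  qed (use c in auto)
  then have "continuous_on H \<phi>" by (rule lipschitz_on_continuous_on)
  then obtain M0 where M0: "M0 \<in> H" "\<And>M. M \<in> H \<Longrightarrow> \<phi> M0 \<le> \<phi> M" using continuous_attains_inf[OF H H0] by blast
  have fixed: "act A M0 = M0" if A: "A \<in> K" for A
  proof (rule ccontr)
    assume ne: "act A M0 \<noteq> M0"
    define M1 where "M1 = act A M0"
    have "act A ` H = convex hull (act A ` S)" unfolding H_def by (rule convex_hull_linear_image[OF lin])
    also have "\<dots> \<subseteq> H" unfolding H_def by (rule hull_mono) (auto simp: S_def act_act intro!: K(3) A)
    finally have M1H: "M1 \<in> H" using M0(1) M1_def by blast
    have M1le: "norm (act B M1) \<le> \<phi> M0" if "B \<in> K" for B unfolding M1_def act_act by (rule upper[OF K(3)[OF A that]])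
    define M where "M = (1/2) *\<^sub>R M0 + (1/2) *\<^sub>R M1"
    have "M \<in> H" unfolding M_def H_def using M0(1) M1H H_def by (intro convexD[OF convex_convex_hull]) auto
    then have ge: "\<phi> M0 \<le> \<phi> M" by (rule M0(2))
    \<comment> \<open>The supremum for the midpoint is attained. A strict inequality at each group
      element would not suffice for a strict inequality of suprema otherwise.\<close>
    have "\<exists>B\<in>K. \<forall>B'\<in>K. norm (act B' M) \<le> norm (act B M)"
      by (rule continuous_attains_sup[OF K(1)]) (use K(2) cont_act in \<open>auto intro!: continuous_intros\<close>)
    then obtain B where B: "B \<in> K" "\<And>B'. B' \<in> K \<Longrightarrow> norm (act B' M) \<le> norm (act B M)" by blast
    define x y where "x = act B M0" and "y = act B M1"
    have xy: "norm x \<le> \<phi> M0" "norm y \<le> \<phi> M0" using upper M1le B(1) x_def y_def by auto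
    have "x \<noteq> y"
    proof
      assume "x = y"
      then have "cadj B ** M0 ** B ** matrix_inv B = cadj B ** M1 ** B ** matrix_inv B" by (simp add: x_def y_def act_def)
      then have e: "cadj B ** M0 = cadj B ** M1" using matrix_inv_mult(1)[OF K(4)[OF B(1)]] by (simp flip: matrix_mul_assoc)
      have i: "cadj (matrix_inv B) ** cadj B = mat 1" using matrix_inv_mult(1)[OF K(4)[OF B(1)]] by (metis cadj_mat_1 cadj_mult)
      have "cadj (matrix_inv B) ** cadj B ** M0 = cadj (matrix_inv B) ** cadj B ** M1" using e by (simp flip: matrix_mul_assoc)
      then show False using ne i by (simp add: M1_def)
    qed
    then have "norm (x - y) > 0" by simp
    \<comment> \<open>Parallelogram law: the norm on matrices comes from an inner product, so the
      midpoint of two distinct points of a ball lies strictly inside it.\<close>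
    have par: "(norm (x + y))\<^sup>2 + (norm (x - y))\<^sup>2 = 2 * (norm x)\<^sup>2 + 2 * (norm y)\<^sup>2"
      by (simp add: power2_norm_eq_inner inner_add_left inner_add_right inner_diff_left inner_diff_right inner_commute)
    have "norm (act B M) = norm (x + y) / 2" by (simp add: M_def act_add act_scale x_def y_def flip: scaleR_add_right)
    then have "\<phi> M0 \<le> norm (x + y) / 2" using ge least[of M, OF B(2)] by linarith
    then have "2 * \<phi> M0 \<le> norm (x + y)" by simp
    moreover have p0: "0 \<le> \<phi> M0" using xy(1) norm_ge_zero order_trans by blast
    ultimately have "(2 * \<phi> M0)\<^sup>2 \<le> (norm (x + y))\<^sup>2" by (intro power_mono) auto
    moreover have "(norm x)\<^sup>2 \<le> (\<phi> M0)\<^sup>2" "(norm y)\<^sup>2 \<le> (\<phi> M0)\<^sup>2" using xy by (intro power_mono; simp)+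
    moreover have "(norm (x - y))\<^sup>2 > 0" using \<open>x \<noteq> y\<close> by simp
    ultimately show False using par by (simp add: power_mult_distrib)
  qed
  have "S \<subseteq> posdef" unfolding S_def act_def using posdef_gram K(4) by auto
  then have "M0 \<in> posdef" using M0(1) hull_minimal[of S posdef convex] convex_posdef unfolding H_def by blast
  then obtain C :: "complex^'n^'n" where C: "invertible C" "M0 = cadj C ** C" by (rule cholesky)
  then show thesis using that[OF C(1)] fixed unfolding act_def by auto
qed

section \<open>Bounded pole order and the topology of the mapping group\<close>

lemma norm_cscale: "norm (cscale c (A :: complex^'n^'m)) = norm c * norm A"
proof -
  have 1: "norm (\<chi> j. c * v $ j) = norm c * norm v" for v :: "complex^'n"
    by (simp add: norm_vec_def norm_mult L2_set_right_distrib)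
  have "cscale c A = (\<chi> i. \<chi> j. c * A $ i $ j)" by (simp add: cscale_def)
  then show ?thesis unfolding norm_vec_def[of A] norm_vec_def[of "cscale c A"]
    by (simp add: 1 L2_set_right_distrib)
qed

lemma continuous_on_cscale [continuous_intros]: "continuous_on S f \<Longrightarrow> continuous_on S (\<lambda>x. cscale c (f x))"
  unfolding cscale_def by (intro continuous_intros)

lemma rat_fun_cong: "(\<And>k. k \<le> N * card T \<Longrightarrow> c k = c' k) \<Longrightarrow> rat_fun T N c x = rat_fun T N c' x"
  by (cases x) auto

lemma has_coeffs_iff_mpole_le: "(\<exists>c. has_coeffs T N f c) \<longleftrightarrow> mpole_le T N f"
proof
  assume "\<exists>c. has_coeffs T N f c"
  then show "mpole_le T N f" by (auto simp: has_coeffs_def mpole_le_def pole_le_def simp del: rat_fun.simps)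
next
  assume "mpole_le T N f"
  then obtain c where c: "\<And>i j x. x \<in> - T \<Longrightarrow> f x $ i $ j = rat_fun T N (c i j) x"
    unfolding mpole_le_def pole_le_def by metis
  define d where "d k = (\<chi> i j. if k \<le> N * card T then c i j k else 0)" for k
  have "has_coeffs T N f d" unfolding has_coeffs_def
  proof (intro conjI allI impI ballI)
    fix k assume "N * card T < k" then show "d k = 0" by (simp add: d_def vec_eq_iff)
  next
    fix x i j assume x: "x \<in> - T"
    have "rat_fun T N (c i j) x = rat_fun T N (\<lambda>k. d k $ i $ j) x" by (rule rat_fun_cong) (simp add: d_def)
    then show "f x $ i $ j = rat_fun T N (\<lambda>k. d k $ i $ j) x" using c[OF x] by simp
  qed
  then show "\<exists>c. has_coeffs T N f c" by blast
qed

text \<open>Interpolation serves twice: coefficients are unique, so the description in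
  \<open>coeffs_of\<close> denotes them, and they are finite linear combinations of values, hence
  continuous for pointwise convergence.\<close>

lemma coeffs_of_formula:
  assumes T: "finite T"
  obtains X :: "complex set" and l where "finite X" "\<And>z. z \<in> X \<Longrightarrow> Aff z \<notin> T"
    "\<And>f :: proj_line \<Rightarrow> complex^'n^'n. mpole_le T N f \<Longrightarrow>
       coeffs_of T N f = (\<lambda>k. if k \<le> N * card T then \<Sum>z\<in>X. cscale (l k z) (f (Aff z)) else 0)"
    "\<And>f :: proj_line \<Rightarrow> complex^'n^'n. mpole_le T N f \<Longrightarrow> has_coeffs T N f (coeffs_of T N f)"
proof -
  obtain X l where X: "finite X" "X \<subseteq> {z. Aff z \<notin> T}"
    and l: "\<And>c k. k \<le> N * card T \<Longrightarrow> c k = (\<Sum>z\<in>X. l k z * rat_fun T N c (Aff z))"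
    using rat_fun_coeff_interpolation[OF T ex_Aff_notin[OF T], of N] by blast
  have uniq: "c = (\<lambda>k. if k \<le> N * card T then \<Sum>z\<in>X. cscale (l k z) (f (Aff z)) else 0)" 
    if c: "has_coeffs T N f c" for f :: "proj_line \<Rightarrow> complex^'n^'n" and c
  proof
    fix k
    show "c k = (if k \<le> N * card T then \<Sum>z\<in>X. cscale (l k z) (f (Aff z)) else 0)"
    proof (cases "k \<le> N * card T")
      case True
      have "c k $ i $ j = (\<Sum>z\<in>X. cscale (l k z) (f (Aff z))) $ i $ j" for i j
      proof -
        have "c k $ i $ j = (\<Sum>z\<in>X. l k z * rat_fun T N (\<lambda>k. c k $ i $ j) (Aff z))" by (rule l[OF True])
        also have "\<dots> = (\<Sum>z\<in>X. l k z * f (Aff z) $ i $ j)"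
          by (intro sum.cong refl) (use c X in \<open>auto simp: has_coeffs_def simp del: rat_fun.simps\<close>)
        finally show ?thesis by simp
      qed
      then show ?thesis using True by (simp add: vec_eq_iff)
    qed (use c in \<open>auto simp: has_coeffs_def\<close>)
  qed
  have the: "has_coeffs T N f (coeffs_of T N f)" if f: "mpole_le T N f" for f :: "proj_line \<Rightarrow> complex^'n^'n"
  proof -
    obtain c where c: "has_coeffs T N f c" using f has_coeffs_iff_mpole_le by blast
    have "d = c" if "has_coeffs T N f d" for d using uniq[OF that] uniq[OF c] by (rule trans[OF _ sym])
    then show ?thesis unfolding coeffs_of_def by (intro theI[where P = "has_coeffs T N f", OF c])
  qed
  show thesis
  proof (rule that[OF X(1), of l])
    show "Aff z \<notin> T" if "z \<in> X" for z using X that by auto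
    show "coeffs_of T N f = (\<lambda>k. if k \<le> N * card T then \<Sum>z\<in>X. cscale (l k z) (f (Aff z)) else 0)"
      if "mpole_le T N f" for f :: "proj_line \<Rightarrow> complex^'n^'n" by (rule uniq[OF the[OF that]])
  qed (rule the)
qed

lemma piece_iff:
  assumes T: "finite T"
  shows "f \<in> piece G T N \<longleftrightarrow> f \<in> (- T) \<rightarrow>\<^sub>E G \<and> mpole_le T N f \<and> mpole_le T N (pointwise_inv f)"
  unfolding piece_def alg_maps_def has_coeffs_iff_mpole_le
  by (auto simp: mpole_le_def intro: pole_le_imp_regular_off[OF T, of N])

lemma piece_mono:
  assumes T: "finite T" and "N \<le> M" shows "piece G T N \<subseteq> piece G T M"
  using piece_iff[OF T, of _ G] mpole_le_mono[OF T _ assms(2)] by blast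

text \<open>Regularity of the finitely many entries gives a common pole order, and Cramer's rule
  bounds the poles of the inverse that a piece controls as well.\<close>

lemma alg_maps_eq_UN_piece:
  assumes T: "finite T" and G: "\<And>A. A \<in> G \<Longrightarrow> invertible (A :: complex^'n^'n)"
  shows "alg_maps G T = (\<Union>N. piece G T N)"
proof
  show "alg_maps G T \<subseteq> (\<Union>N. piece G T N)"
  proof
    fix f assume f: "f \<in> alg_maps G T"
    have "\<exists>N. pole_le T N (\<lambda>x. f x $ i $ j)" for i j
    proof -
      have "regular_off T (\<lambda>x. f x $ i $ j)" using f by (simp add: alg_maps_def)
      then show ?thesis using regular_off_imp_pole_le[OF T] by blast
    qed
    then have "\<exists>N. \<forall>ij\<in>UNIV. pole_le T N (\<lambda>x. f x $ fst ij $ snd ij)" by (intro bounded_pole_order[OF T finite])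
    then obtain N where N0: "\<forall>ij\<in>UNIV. pole_le T N (\<lambda>x. f x $ fst ij $ snd ij)" by blast
    have "pole_le T N (\<lambda>x. f x $ i $ j)" for i j using bspec[OF N0 UNIV_I[of "(i, j)"]] by simp
    then have N: "mpole_le T N f" by (simp add: mpole_le_def)
    have "mpole_le T (CARD('n) * N + CARD('n) * N * card T) (\<lambda>x. matrix_inv (f x))"
      by (rule mpole_le_matrix_inv[OF T N]) (use f G in \<open>auto simp: alg_maps_def\<close>)
    then have M: "mpole_le T (CARD('n) * N + CARD('n) * N * card T + N) (pointwise_inv f)"
      unfolding pointwise_inv_def by (rule mpole_le_mono[OF T]) simp
    have "mpole_le T (CARD('n) * N + CARD('n) * N * card T + N) f" by (rule mpole_le_mono[OF T N]) simp
    then show "f \<in> (\<Union>N. piece G T N)" using M f by (auto simp: piece_iff[OF T] alg_maps_def)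
  qed
qed (auto simp: piece_def)

lemma continuous_on_eval: "continuous_on S (\<lambda>f. f x)"
  by (rule continuous_on_subset[OF continuous_on_product_coordinates]) simp

text \<open>\<open>\<Phi>\<close> takes a map to its coefficients and is continuous by
  interpolation; \<open>\<Psi>\<close> evaluates coefficients by \<open>rat_fun\<close> and is
  continuous as well. Since \<open>\<Psi>\<close> undoes \<open>\<Phi>\<close>, the coefficient
  topology is that of pointwise convergence, and coefficients can be forgotten from here on.\<close>

lemma piece_topology_eq:
  assumes T: "finite T" and G: "\<And>A. A \<in> G \<Longrightarrow> invertible (A :: complex^'n^'n)"
  shows "piece_topology G T N = subtopology euclidean (piece G T N)"
proof -
  obtain X l where X: "finite X" "\<And>z. z \<in> X \<Longrightarrow> Aff z \<notin> T" 
    and co: "\<And>f :: proj_line \<Rightarrow> complex^'n^'n. mpole_le T N f \<Longrightarrow>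
       coeffs_of T N f = (\<lambda>k. if k \<le> N * card T then \<Sum>z\<in>X. cscale (l k z) (f (Aff z)) else 0)"
    "\<And>f :: proj_line \<Rightarrow> complex^'n^'n. mpole_le T N f \<Longrightarrow> has_coeffs T N f (coeffs_of T N f)"
    by (rule coeffs_of_formula[OF T, where N = N and 'n = 'n], rule that)
  let ?P = "piece G T N"
  define \<Phi> where "\<Phi> f = (coeffs_of T N f, coeffs_of T N (pointwise_inv f))" for f :: "proj_line \<Rightarrow> complex^'n^'n"
  define \<Psi> :: "(nat \<Rightarrow> complex^'n^'n) \<times> (nat \<Rightarrow> complex^'n^'n) \<Rightarrow> proj_line \<Rightarrow> complex^'n^'n"
    where "\<Psi> cd x = (if x \<in> T then undefined else \<chi> i j. rat_fun T N (\<lambda>k. fst cd k $ i $ j) x)" for cd x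
  have inv: "invertible (f x)" if "f \<in> ?P" "x \<notin> T" for f x using that G by (auto simp: piece_iff[OF T])
  have c1: "continuous_on ?P (coeffs_of T N)"
  proof (rule continuous_on_eq)
    show "continuous_on ?P (\<lambda>f k. if k \<le> N * card T then \<Sum>z\<in>X. cscale (l k z) (f (Aff z)) else 0)"
    proof (rule continuous_on_coordinatewise_then_product)
      fix k show "continuous_on ?P (\<lambda>f. if k \<le> N * card T then \<Sum>z\<in>X. cscale (l k z) (f (Aff z)) else 0)"
        by (cases "k \<le> N * card T") (auto intro!: continuous_intros continuous_on_eval)
    qed
  qed (use co(1) in \<open>auto simp: piece_iff[OF T]\<close>)
  have c2: "continuous_on ?P (\<lambda>f. coeffs_of T N (pointwise_inv f))"
  proof (rule continuous_on_eq)
    show "continuous_on ?P (\<lambda>f k. if k \<le> N * card T then \<Sum>z\<in>X. cscale (l k z) (matrix_inv (f (Aff z))) else 0)"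
    proof (rule continuous_on_coordinatewise_then_product)
      fix k show "continuous_on ?P (\<lambda>f. if k \<le> N * card T then \<Sum>z\<in>X. cscale (l k z) (matrix_inv (f (Aff z))) else 0)"
        using X(2) inv by (cases "k \<le> N * card T") (auto intro!: continuous_intros continuous_on_eval)
    qed
  qed (use co(1) in \<open>auto simp: piece_iff[OF T] pointwise_inv_def\<close>)
  have c\<Phi>: "continuous_on ?P \<Phi>" unfolding \<Phi>_def by (intro continuous_on_Pair c1 c2)
  have c\<Psi>: "continuous_on UNIV \<Psi>"
  proof (rule continuous_on_coordinatewise_then_product)
    fix x
    have e: "continuous_on UNIV (\<lambda>cd :: (nat \<Rightarrow> complex^'n^'n) \<times> (nat \<Rightarrow> complex^'n^'n). fst cd k)" for k
      by (rule continuous_on_compose2[OF continuous_on_eval[of UNIV] continuous_on_fst]) (auto intro: continuous_intros)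
    have "continuous_on UNIV (\<lambda>cd :: (nat \<Rightarrow> complex^'n^'n) \<times> (nat \<Rightarrow> complex^'n^'n). \<chi> i j. rat_fun T N (\<lambda>k. fst cd k $ i $ j) x)" if "x \<notin> T"
    proof (cases x)
      case (Aff z)
      have "(\<Prod>s | Aff s \<in> T. (z - s) ^ N) \<noteq> 0" using poly_den_poly_nonzero[OF T, of z N] that Aff by (simp add: poly_den_poly)
      then show ?thesis unfolding Aff by (auto intro!: continuous_intros e)
    qed (auto intro!: continuous_intros e)
    then show "continuous_on UNIV (\<lambda>cd. \<Psi> cd x)" unfolding \<Psi>_def by (cases "x \<in> T") auto
  qed
  have \<Psi>\<Phi>: "\<Psi> (\<Phi> f) = f" if f: "f \<in> ?P" for f
  proof
    fix x
    have h: "has_coeffs T N f (coeffs_of T N f)" and e: "f \<in> extensional (- T)" using f co(2) by (auto simp: piece_iff[OF T] PiE_def)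
    show "\<Psi> (\<Phi> f) x = f x"
      using h e by (auto simp: \<Psi>_def \<Phi>_def has_coeffs_def vec_eq_iff extensional_def simp del: rat_fun.simps)
  qed
  have pt: "piece_topology G T N = pullback_topology ?P \<Phi> euclidean"
    unfolding piece_topology_def by (rule arg_cong[where f = "\<lambda>h. pullback_topology ?P h euclidean"]) (simp add: \<Phi>_def fun_eq_iff)
  show ?thesis unfolding topology_eq
  proof (intro allI iffI)
    fix S assume "openin (piece_topology G T N) S"
    then obtain U where "openin euclidean U" "S = \<Phi> -` U \<inter> ?P" unfolding pt openin_pullback_topology by blast
    then show "openin (top_of_set ?P) S" using continuous_openin_preimage_gen[OF c\<Phi>, of U] by (simp add: Int_commute)
  next
    fix S assume "openin (top_of_set ?P) S"
    then obtain V where V: "open V" "S = ?P \<inter> V" by (auto simp: openin_open)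
    have o: "openin euclidean (\<Psi> -` V)" unfolding open_openin[symmetric] by (rule open_vimage[OF V(1) c\<Psi>])
    have e: "S = \<Phi> -` (\<Psi> -` V) \<inter> ?P" unfolding V(2)
    proof (intro equalityI subsetI)
      fix x assume "x \<in> \<Phi> -` (\<Psi> -` V) \<inter> ?P"
      then have "x \<in> ?P" "\<Psi> (\<Phi> x) \<in> V" by simp_all
      then show "x \<in> ?P \<inter> V" using \<Psi>\<Phi>[of x] by simp
    qed (simp add: \<Psi>\<Phi>)
    show "openin (piece_topology G T N) S"
      unfolding pt openin_pullback_topology by (rule exI[of _ "\<Psi> -` V"], rule conjI[OF o e])
  qed
qed

lemma mpole_le_interpolation:
  assumes T: "finite T" and Z: "infinite Z" "\<And>z. z \<in> Z \<Longrightarrow> Aff z \<notin> T"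
  obtains X :: "complex set" and l :: "proj_line \<Rightarrow> complex \<Rightarrow> complex" where "finite X" "X \<subseteq> Z"
    "\<And>f :: proj_line \<Rightarrow> complex^'n^'n. mpole_le T N f \<longleftrightarrow> (\<forall>x. x \<notin> T \<longrightarrow> f x = (\<Sum>z\<in>X. cscale (l x z) (f (Aff z))))"
proof -
  obtain X l where X: "finite X" "X \<subseteq> Z" and l: "\<And>f. pole_le T N f \<longleftrightarrow> (\<forall>x. x \<notin> T \<longrightarrow> f x = (\<Sum>z\<in>X. l x z * f (Aff z)))"
    using pole_le_interpolation[OF T Z, of N] by blast
  show thesis by (rule that[OF X, of l]) (auto simp: mpole_le_def l vec_eq_iff)
qed

text \<open>\<open>G\<close> itself may fail to be closed among all matrices. Bounding the inverse
  too exhibits the set as the projection of a compact set of pairs.\<close>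

lemma compact_bounded_part:
  assumes F: "\<And>p. p \<in> F \<Longrightarrow> matrix_poly p" and G: "G = {A :: complex^'n^'n. invertible A \<and> (\<forall>p\<in>F. p A = 0)}"
  shows "compact {A \<in> G. norm A \<le> r \<and> norm (matrix_inv A) \<le> r}" (is "compact ?K")
proof -
  define P where "P = {(A, B). A ** B = mat 1 \<and> B ** A = (mat 1 :: complex^'n^'n) \<and> (\<forall>p\<in>F. p A = 0) \<and> norm A \<le> r \<and> norm B \<le> r}"
  have "?K = fst ` P"
  proof (intro equalityI subsetI)
    fix A assume "A \<in> ?K"
    then have "(A, matrix_inv A) \<in> P" using matrix_inv_mult by (auto simp: P_def G)
    then show "A \<in> fst ` P" by force
  next
    fix A assume "A \<in> fst ` P"
    then obtain B where B: "(A, B) \<in> P" by auto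
    then have "matrix_inv A = B" by (auto simp: P_def intro: matrix_inv_unique)
    then show "A \<in> ?K" using B by (auto simp: P_def G invertible_def)
  qed
  moreover have "compact P"
  proof -
    have eq: "P = (\<lambda>x. fst x ** snd x) -` {mat 1} \<inter> (\<lambda>x. snd x ** fst x) -` {mat 1} \<inter> (\<Inter>p\<in>F. (\<lambda>x. p (fst x)) -` {0}) \<inter> (cball 0 r \<times> cball 0 r)"
      by (auto simp: P_def)
    have "closed ((\<lambda>x. p (fst x)) -` {0} :: ((complex^'n^'n) \<times> (complex^'n^'n)) set)" if "p \<in> F" for p
      by (intro closed_vimage closed_singleton continuous_on_compose2[OF continuous_on_matrix_poly[OF F[OF that], of UNIV]] continuous_on_fst continuous_on_id) auto
    then have "closed ((\<lambda>x. fst x ** snd x) -` {mat 1 :: complex^'n^'n} \<inter> (\<lambda>x. snd x ** fst x) -` {mat 1} \<inter> (\<Inter>p\<in>F. (\<lambda>x. p (fst x)) -` {0}))"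
      by (intro closed_Int closed_INT ballI closed_vimage closed_singleton continuous_intros) auto
    then show ?thesis unfolding eq by (intro closed_Int_compact compact_Times compact_cball)
  qed
  ultimately show ?thesis using compact_continuous_image[OF continuous_on_fst[OF continuous_on_id]] by metis
qed

lemma compact_PiE_UNIV:
  fixes C :: "'a \<Rightarrow> 'b::topological_space set"
  assumes "\<And>x. compact (C x)" shows "compact (PiE UNIV C)"
proof -
  have "compactin (product_topology (\<lambda>x. euclidean) UNIV) (PiE UNIV C)" using assms by (simp add: compactin_PiE)
  then show ?thesis by (simp add: euclidean_product_topology)
qed

text \<open>Interpolation spreads the bounds at the nodes to bounds \<open>\<rho> x\<close> at every
  point, so the set lies in a product of compact sets, a single point \<open>undefined\<close> being
  allowed over \<open>T\<close>. In this product the interpolation relations for the map and its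
  inverse cut out a closed subset.\<close>

lemma compact_bounded_piece:
  assumes F: "\<And>p. p \<in> F \<Longrightarrow> matrix_poly p" and G: "G = {A :: complex^'n^'n. invertible A \<and> (\<forall>p\<in>F. p A = 0)}"
    and T: "finite T" and Z: "infinite Z" "\<And>z. z \<in> Z \<Longrightarrow> Aff z \<notin> T"
  obtains X where "finite X" "X \<subseteq> Z"
    "\<And>r. compact {f \<in> piece G T N. \<forall>z\<in>X. norm (f (Aff z)) \<le> r \<and> norm (matrix_inv (f (Aff z))) \<le> r}"
proof -
  obtain X l where X: "finite X" "X \<subseteq> Z" and l: "\<And>f :: proj_line \<Rightarrow> complex^'n^'n. mpole_le T N f \<longleftrightarrow> (\<forall>x. x \<notin> T \<longrightarrow> f x = (\<Sum>z\<in>X. cscale (l x z) (f (Aff z))))"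
    using mpole_le_interpolation[OF T Z, where N = N and 'n = 'n] by metis
  have "compact {f \<in> piece G T N. \<forall>z\<in>X. norm (f (Aff z)) \<le> r \<and> norm (matrix_inv (f (Aff z))) \<le> r}" (is "compact ?K") for r
  proof -
    define \<rho> where "\<rho> x = (\<Sum>z\<in>X. norm (l x z) * r)" for x
    define C where "C x = (if x \<in> T then {undefined} else {A \<in> G. norm A \<le> \<rho> x \<and> norm (matrix_inv A) \<le> \<rho> x})" for x
    define Box where "Box = PiE UNIV C"
    have cP: "compact Box" unfolding Box_def
      by (rule compact_PiE_UNIV) (auto simp: C_def compact_bounded_part[OF F G])
    have inv: "invertible (f x)" if "f \<in> Box" "x \<notin> T" for f x using that by (auto simp: Box_def C_def PiE_iff G dest: spec[of _ x] split: if_splits)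
    have Xinv: "invertible (f (Aff z))" if "f \<in> Box" "z \<in> X" for f z using that X(2) Z(2) inv by blast
    define D1 where "D1 x = {f \<in> Box. f x - (\<Sum>z\<in>X. cscale (l x z) (f (Aff z))) = 0}" for x
    define D2 where "D2 x = {f \<in> Box. matrix_inv (f x) - (\<Sum>z\<in>X. cscale (l x z) (matrix_inv (f (Aff z)))) = 0}" for x
    have c1: "closedin (top_of_set Box) (D1 x)" for x unfolding D1_def
      by (intro continuous_closedin_preimage_constant continuous_intros continuous_on_eval)
    have c2: "closedin (top_of_set Box) (D2 x)" if "x \<notin> T" for x unfolding D2_def
      by (intro continuous_closedin_preimage_constant continuous_intros continuous_on_eval inv Xinv that)
    define D3 where "D3 z = {f \<in> Box. norm (f (Aff z)) \<le> r \<and> norm (matrix_inv (f (Aff z))) \<le> r}" for z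
    have c3: "closedin (top_of_set Box) (D3 z)" if "z \<in> X" for z
    proof -
      have "D3 z = (Box \<inter> (\<lambda>f. f (Aff z)) -` cball 0 r) \<inter> (Box \<inter> (\<lambda>f. matrix_inv (f (Aff z))) -` cball 0 r)" by (auto simp: D3_def)
      also have "closedin (top_of_set Box) \<dots>"
        by (intro closedin_Int continuous_closedin_preimage continuous_intros continuous_on_eval Xinv that closed_cball)
      finally show ?thesis .
    qed
    have "?K = Box \<inter> (\<Inter>x\<in>- T. D1 x) \<inter> (\<Inter>x\<in>- T. D2 x) \<inter> (\<Inter>z\<in>X. D3 z)"
    proof (intro equalityI subsetI)
      fix f assume f: "f \<in> ?K"
      then have fe: "f \<in> (- T) \<rightarrow>\<^sub>E G" "mpole_le T N f" "mpole_le T N (pointwise_inv f)" by (auto simp: piece_iff[OF T])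
      have e1: "f x = (\<Sum>z\<in>X. cscale (l x z) (f (Aff z)))" "matrix_inv (f x) = (\<Sum>z\<in>X. cscale (l x z) (matrix_inv (f (Aff z))))" if "x \<notin> T" for x
        using fe(2,3) that unfolding l pointwise_inv_def by blast+
      have "f x \<in> C x" for x
      proof (cases "x \<in> T")
        case True
        then show ?thesis using fe(1) by (auto simp: C_def PiE_def extensional_def)
      next
        case False
        have "norm (f x) \<le> \<rho> x" unfolding e1(1)[OF False] \<rho>_def
          by (rule order_trans[OF norm_sum]) (use f in \<open>auto simp: norm_cscale intro!: sum_mono mult_left_mono\<close>)
        moreover have "norm (matrix_inv (f x)) \<le> \<rho> x" unfolding e1(2)[OF False] \<rho>_def
          by (rule order_trans[OF norm_sum]) (use f in \<open>auto simp: norm_cscale intro!: sum_mono mult_left_mono\<close>)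
        ultimately show ?thesis using fe(1) False by (auto simp: C_def)
      qed
      then have "f \<in> Box" by (simp add: Box_def PiE_iff)
      then show "f \<in> Box \<inter> (\<Inter>x\<in>- T. D1 x) \<inter> (\<Inter>x\<in>- T. D2 x) \<inter> (\<Inter>z\<in>X. D3 z)"
        using f e1 by (auto simp: D1_def D2_def D3_def)
    next
      fix f assume f: "f \<in> Box \<inter> (\<Inter>x\<in>- T. D1 x) \<inter> (\<Inter>x\<in>- T. D2 x) \<inter> (\<Inter>z\<in>X. D3 z)"
      have Cx: "f x \<in> C x" for x using f by (auto simp: Box_def PiE_iff)
      have "f x \<in> G" if "x \<notin> T" for x using Cx[of x] that by (simp add: C_def)
      moreover have "f x = undefined" if "x \<in> T" for x using Cx[of x] that by (simp add: C_def)
      ultimately have "f \<in> (- T) \<rightarrow>\<^sub>E G" by (auto simp: PiE_iff extensional_def)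
      moreover have "mpole_le T N f" unfolding l using f by (auto simp: D1_def)
      moreover have "mpole_le T N (pointwise_inv f)" unfolding l pointwise_inv_def using f by (auto simp: D2_def)
      ultimately show "f \<in> ?K" using f by (auto simp: piece_iff[OF T] D3_def)
    qed
    moreover have "closedin (top_of_set Box) (Box \<inter> (\<Inter>x\<in>- T. D1 x) \<inter> (\<Inter>x\<in>- T. D2 x) \<inter> (\<Inter>z\<in>X. D3 z))"
    proof -
      have inter: "closedin (top_of_set Box) (Box \<inter> (\<Inter>x\<in>I. D x))" if "\<And>x. x \<in> I \<Longrightarrow> closedin (top_of_set Box) (D x)" for I and D :: "'i \<Rightarrow> _ set"
      proof (cases "I = {}")
        case False
        then show ?thesis using that by (intro closedin_Int closedin_INT) auto
      qed (use closedin_topspace[of "top_of_set Box"] in simp)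
      have "Box \<inter> (\<Inter>x\<in>- T. D1 x) \<inter> (\<Inter>x\<in>- T. D2 x) \<inter> (\<Inter>z\<in>X. D3 z) =
        (Box \<inter> (\<Inter>x\<in>- T. D1 x)) \<inter> (Box \<inter> (\<Inter>x\<in>- T. D2 x)) \<inter> (Box \<inter> (\<Inter>z\<in>X. D3 z))" by blast
      then show ?thesis using c1 c2 c3 by (simp only:) (intro closedin_Int inter; simp)
    qed
    ultimately show ?thesis using closedin_compact[OF cP] by simp
  qed
  then show thesis using that X by blast
qed

lemma locally_compact_piece:
  assumes F: "\<And>p. p \<in> F \<Longrightarrow> matrix_poly p" and G: "G = {A :: complex^'n^'n. invertible A \<and> (\<forall>p\<in>F. p A = 0)}"
    and T: "finite T"
  shows "locally_compact_space (top_of_set (piece G T N))"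
proof -
  obtain X where X: "finite X" "X \<subseteq> {z. Aff z \<notin> T}"
    and K: "\<And>r. compact {f \<in> piece G T N. \<forall>z\<in>X. norm (f (Aff z)) \<le> r \<and> norm (matrix_inv (f (Aff z))) \<le> r}"
    by (rule compact_bounded_piece[OF F G T ex_Aff_notin[OF T], where N = N], assumption, blast, rule that)
  have inv: "invertible (f (Aff z))" if "f \<in> piece G T N" "z \<in> X" for f z using that X by (auto simp: piece_iff[OF T] G)
  show ?thesis unfolding locally_compact_space_def
  proof
    fix f assume "f \<in> topspace (top_of_set (piece G T N))"
    then have f: "f \<in> piece G T N" by simp
    define r where "r = (\<Sum>z\<in>X. norm (f (Aff z)) + norm (matrix_inv (f (Aff z)))) + 1"
    have r: "norm (f (Aff z)) < r \<and> norm (matrix_inv (f (Aff z))) < r" if "z \<in> X" for z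
    proof -
      have "norm (f (Aff z)) + norm (matrix_inv (f (Aff z))) \<le> (\<Sum>z\<in>X. norm (f (Aff z)) + norm (matrix_inv (f (Aff z))))"
        by (rule member_le_sum[OF that _ X(1)]) auto
      then show ?thesis using norm_ge_zero[of "f (Aff z)"] norm_ge_zero[of "matrix_inv (f (Aff z))"] unfolding r_def by linarith
    qed
    let ?K = "{f \<in> piece G T N. \<forall>z\<in>X. norm (f (Aff z)) \<le> r \<and> norm (matrix_inv (f (Aff z))) \<le> r}"
    define V where "V z = {f \<in> piece G T N. norm (f (Aff z)) < r \<and> norm (matrix_inv (f (Aff z))) < r}" for z
    have oV: "openin (top_of_set (piece G T N)) (V z)" if "z \<in> X" for z
    proof -
      have "V z = (piece G T N \<inter> (\<lambda>f. f (Aff z)) -` ball 0 r) \<inter> (piece G T N \<inter> (\<lambda>f. matrix_inv (f (Aff z))) -` ball 0 r)" by (auto simp: V_def)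
      also have "openin (top_of_set (piece G T N)) \<dots>"
        by (intro openin_Int continuous_openin_preimage_gen continuous_intros continuous_on_eval inv that open_ball)
      finally show ?thesis .
    qed
    define U where "U = piece G T N \<inter> (\<Inter>z\<in>X. V z)"
    have "openin (top_of_set (piece G T N)) U"
    proof (cases "X = {}")
      case True
      then show ?thesis by (simp add: U_def)
    next
      case False
      then show ?thesis unfolding U_def by (intro openin_Int openin_INT2 oV X(1)) auto
    qed
    moreover have "f \<in> U" using f r by (simp add: U_def V_def)
    moreover have "U \<subseteq> ?K" by (auto simp: U_def V_def less_imp_le)
    moreover have "compactin (top_of_set (piece G T N)) ?K" using K[of r] by (simp add: compactin_subtopology)
    ultimately show "\<exists>U K. openin (top_of_set (piece G T N)) U \<and> compactin (top_of_set (piece G T N)) K \<and> f \<in> U \<and> U \<subseteq> K" by blast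
  qed
qed

section \<open>The factorization\<close>

lemma matrix_poly_sum: "(\<And>i. i \<in> I \<Longrightarrow> matrix_poly (p i)) \<Longrightarrow> matrix_poly (\<lambda>A. \<Sum>i\<in>I. p i A)"
  by (induction I rule: infinite_finite_induct) (auto intro: matrix_poly.intros)

lemma matrix_poly_two_sided:
  assumes "matrix_poly p" shows "matrix_poly (\<lambda>X :: complex^'n^'n. p (A ** X ** B))"
  using assms
proof induction
  case (entry i j)
  have "matrix_poly (\<lambda>X :: complex^'n^'n. \<Sum>l\<in>UNIV. \<Sum>k\<in>UNIV. A $ i $ k * X $ k $ l * B $ l $ j)"
    by (intro matrix_poly_sum matrix_poly.mult matrix_poly.const matrix_poly.entry)
  then show ?case by (simp add: matrix_matrix_mult_def sum_distrib_right)
qed (auto intro: matrix_poly.intros)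

text \<open>What the factorization needs from the group: defining equations and a change of basis
  \<open>C\<close> after which \<open>G\<close> is stable under adjoints and \<open>Gc\<close> is
  its unitary part. \<open>T\<close> holds the poles allowed for the disc factor and
  \<open>SS\<close> all poles.\<close>

locale circle_factorization =
  fixes G Gc :: "(complex^'n^'n) set" and F :: "(complex^'n^'n \<Rightarrow> complex) set" and C :: "complex^'n^'n"
    and S Splus :: "complex set" and T SS :: "proj_line set" and s0 :: complex
  assumes F: "\<And>p. p \<in> F \<Longrightarrow> matrix_poly p" and G_eq: "G = {A. invertible A \<and> (\<forall>p\<in>F. p A = 0)}"
    and G_mult: "\<And>A B. A \<in> G \<Longrightarrow> B \<in> G \<Longrightarrow> A ** B \<in> G" and G_one: "mat 1 \<in> G"
    and G_inv: "\<And>A. A \<in> G \<Longrightarrow> matrix_inv A \<in> G"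
    and C: "invertible C"
    and star: "\<And>A. A \<in> G \<Longrightarrow> \<exists>B\<in>G. cadj (C ** A ** matrix_inv C) = C ** B ** matrix_inv C"
    and Gc_eq: "Gc = {A \<in> G. cadj (C ** A ** matrix_inv C) ** (C ** A ** matrix_inv C) = mat 1}"
    and Gc_compact: "compact Gc"
    and S: "finite S" "S \<subseteq> sphere 0 1" and Splus: "finite Splus" "Splus \<subseteq> ball 0 1"
    and T_eq: "T = kappa ` Aff ` Splus \<union> Aff ` S" and SS_eq: "SS = T \<union> Aff ` Splus"
    and s0: "s0 \<in> sphere 0 1 - S"
begin

text \<open>Passage to the basis in which \<open>Gc\<close> is unitary; \<open>jc\<close> is the way
  back.\<close>

definition cj :: "complex^'n^'n \<Rightarrow> complex^'n^'n" where "cj A = C ** A ** matrix_inv C"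
definition jc :: "complex^'n^'n \<Rightarrow> complex^'n^'n" where "jc A = matrix_inv C ** A ** C"

lemma CC: "C ** matrix_inv C = mat 1" "matrix_inv C ** C = mat 1" using matrix_inv_mult[OF C] by auto

lemma CCa: "X ** C ** matrix_inv C = X" "X ** matrix_inv C ** C = X"
  using CC by (simp_all flip: matrix_mul_assoc)

lemma cj_jc [simp]: "cj (jc A) = A" "jc (cj A) = A"
  by (simp_all add: cj_def jc_def matrix_mul_assoc CC CCa)

lemma cj_mult: "cj (A ** B) = cj A ** cj B" "jc (A ** B) = jc A ** jc B"
  by (simp_all add: cj_def jc_def matrix_mul_assoc CCa)

lemma cj_one [simp]: "cj (mat 1) = mat 1" "jc (mat 1) = mat 1"
  by (simp_all add: cj_def jc_def CC)

lemma cj_inv: "invertible A \<Longrightarrow> invertible (cj A) \<and> matrix_inv (cj A) = cj (matrix_inv A)"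
proof -
  assume A: "invertible A"
  have "cj A ** cj (matrix_inv A) = mat 1" "cj (matrix_inv A) ** cj A = mat 1"
    using matrix_inv_mult[OF A] by (simp_all flip: cj_mult)
  then show ?thesis using matrix_inv_unique invertible_def by metis
qed

lemma jc_inv: "invertible A \<Longrightarrow> invertible (jc A) \<and> matrix_inv (jc A) = jc (matrix_inv A)"
proof -
  assume A: "invertible A"
  have "jc A ** jc (matrix_inv A) = mat 1" "jc (matrix_inv A) ** jc A = mat 1"
    using matrix_inv_mult[OF A] by (simp_all flip: cj_mult)
  then show ?thesis using matrix_inv_unique invertible_def by metis
qed

lemma G_invertible: "A \<in> G \<Longrightarrow> invertible A" by (simp add: G_eq)

lemma Gc_iff: "A \<in> Gc \<longleftrightarrow> A \<in> G \<and> cadj (cj A) ** cj A = mat 1"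
  by (simp add: Gc_eq cj_def)

lemma finite_T: "finite T" "finite SS" using S Splus by (auto simp: T_eq SS_eq)
lemma T_SS: "T \<subseteq> SS" by (auto simp: SS_eq)

lemma Splus_facts: "a \<in> Splus \<Longrightarrow> norm a < 1 \<and> Aff a \<notin> T \<and> kappa (Aff a) \<in> T"
proof -
  assume a: "a \<in> Splus"
  then have n: "norm a < 1" using Splus by auto
  have "Aff a \<notin> T"
  proof
    assume "Aff a \<in> T"
    then consider "a \<in> S" | b where "b \<in> Splus" "Aff a = kappa (Aff b)" by (auto simp: T_eq)
    then show False
    proof cases
      case 2
      then have "b \<noteq> 0" "a = inverse (cnj b)" by (auto split: if_splits)
      moreover have "norm b < 1" using 2 Splus by auto
      ultimately have "norm a > 1" by (simp add: norm_inverse one_less_inverse)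
      then show False using n by simp
    qed (use n S in auto)
  qed
  then show ?thesis using a n unfolding T_eq by blast
qed

lemma T_disc: "Aff z \<in> T \<Longrightarrow> norm z \<ge> 1"
proof -
  assume "Aff z \<in> T"
  then consider "z \<in> S" | b where "b \<in> Splus" "Aff z = kappa (Aff b)" by (auto simp: T_eq)
  then show ?thesis
  proof cases
    case 2
    then have "b \<noteq> 0" "z = inverse (cnj b)" by (auto split: if_splits)
    moreover have "norm b < 1" using 2 Splus by auto
    ultimately have "norm z > 1" by (simp add: norm_inverse one_less_inverse)
    then show ?thesis by simp
  qed (use S in auto)
qed

lemma circle_SS: "norm z = 1 \<Longrightarrow> Aff z \<in> SS \<longleftrightarrow> z \<in> S"
proof -
  assume z: "norm z = 1"
  have "Aff z \<noteq> kappa (Aff b)" if "b \<in> Splus" for b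
  proof
    assume e: "Aff z = kappa (Aff b)"
    then have "b \<noteq> 0" "z = inverse (cnj b)" by (auto split: if_splits)
    moreover have "norm b < 1" using that Splus by auto
    ultimately have "norm z > 1" by (simp add: norm_inverse one_less_inverse)
    then show False using z by simp
  qed
  moreover have "z \<notin> Splus" using z Splus by auto
  ultimately show ?thesis by (auto simp: SS_eq T_eq simp del: kappa.simps)
qed

lemma circle_T: "norm z = 1 \<Longrightarrow> Aff z \<in> T \<longleftrightarrow> z \<in> S"
  using circle_SS[of z] Splus by (auto simp: SS_eq T_eq)

lemma s0_facts: "norm s0 = 1" "Aff s0 \<notin> T" "Aff s0 \<notin> SS"
  using s0 circle_T[of s0] circle_SS[of s0] by auto

lemma vanish_extends:
  assumes p: "matrix_poly p" and h: "mpole_le T M h" and z: "\<And>x. x \<notin> SS \<Longrightarrow> p (h x) = 0" and x: "x \<notin> T"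
  shows "p (h x) = 0"
proof -
  obtain K where "pole_le T K (\<lambda>x. p (h x))" using pole_le_matrix_poly[OF finite_T(1) p h] by blast
  from pole_le_eq_everywhere[OF finite_T(1) this pole_le_const[OF finite_T(1), of 0 0] ex_Aff_notin[OF finite_T(2)] _ x]
  show ?thesis using z T_SS by blast
qed

lemma mpole_two_sided: "finite U \<Longrightarrow> mpole_le U N f \<Longrightarrow> mpole_le U N (\<lambda>x. A ** f x ** B)"
  using mpole_le_mult[OF _ mpole_le_mult[OF _ mpole_le_const[of U 0 A], of N f] mpole_le_const[of U 0 B]] by simp

text \<open>In the basis of \<open>C\<close> the disc factor is found among invertible matrices,
  corrected by a constant, and only then shown to have values in \<open>G\<close>. The order bound
  is fixed before \<open>g\<close>, as continuity on pieces requires.\<close>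

lemma factorization_exists:
  "\<exists>M. \<forall>g\<in>piece G SS N. \<exists>u\<in>based_compact_maps G Gc S SS s0 \<inter> piece G SS M. \<exists>h\<in>piece G T M. map_mult SS u h = g"
proof -
  obtain M where M: "\<And>g :: proj_line \<Rightarrow> complex^'n^'n. mpole_le (T \<union> Aff ` Splus) N g \<Longrightarrow> (\<And>x. x \<notin> T \<union> Aff ` Splus \<Longrightarrow> invertible (g x)) \<Longrightarrow>
    (\<exists>h :: proj_line \<Rightarrow> complex^'n^'n. mpole_le T M h \<and> (\<forall>x. x \<notin> T \<longrightarrow> invertible (h x)) \<and>
    (\<forall>z. norm z = 1 \<and> Aff z \<notin> T \<longrightarrow> cadj (h (Aff z)) ** h (Aff z) = cadj (g (Aff z)) ** g (Aff z)))"
    using unitary_disc_factorization[OF Splus(1) finite_T(1) Splus_facts, where N = N and 'n = 'n] by blast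
  \<comment> \<open>\<open>M1\<close> is the Cramer bound for the inverse of \<open>h\<close>, whose
    order is at most \<open>M\<close>. Then \<open>K\<close> dominates \<open>N + M1\<close> for
    \<open>u\<close>, \<open>M + N\<close> for its inverse, and both bounds for
    \<open>h\<close>.\<close>
  define M1 where "M1 = CARD('n) * M + CARD('n) * M * card T"
  define K where "K = N + M + M1"
  show ?thesis
  proof (rule exI[of _ K], rule ballI)
    fix g assume g: "g \<in> piece G SS N"
    then have gG: "g x \<in> G" if "x \<notin> SS" for x using that by (auto simp: piece_iff[OF finite_T(2)])
    have ge: "g x = undefined" if "x \<in> SS" for x using g that by (auto simp: piece_iff[OF finite_T(2)] PiE_def extensional_def)
    have gp: "mpole_le SS N g" "mpole_le SS N (pointwise_inv g)" using g by (auto simp: piece_iff[OF finite_T(2)])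
    define gt where "gt x = cj (g x)" for x
    have gtp: "mpole_le SS N gt" unfolding gt_def cj_def by (rule mpole_two_sided[OF finite_T(2) gp(1)])
    have gti: "invertible (gt x)" if "x \<notin> SS" for x unfolding gt_def using cj_inv[OF G_invertible[OF gG[OF that]]] by blast
    obtain h1 :: "proj_line \<Rightarrow> complex^'n^'n" where h1: "mpole_le T M h1" "\<And>x. x \<notin> T \<Longrightarrow> invertible (h1 x)"
      "\<And>z. norm z = 1 \<Longrightarrow> Aff z \<notin> T \<Longrightarrow> cadj (h1 (Aff z)) ** h1 (Aff z) = cadj (gt (Aff z)) ** gt (Aff z)"
      using M[of gt] gtp gti unfolding SS_eq by blast
    \<comment> \<open>The condition on the circle leaves a constant unitary matrix on the left of
      \<open>h1\<close> free. \<open>u0\<close> makes the disc factor agree with \<open>gt\<close>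
      at \<open>s0\<close>; it is unitary because the Gram matrices agree there.\<close>
    define u0 where "u0 = gt (Aff s0) ** matrix_inv (h1 (Aff s0))"
    have h1s: "h1 (Aff s0) ** matrix_inv (h1 (Aff s0)) = mat 1" "matrix_inv (h1 (Aff s0)) ** h1 (Aff s0) = mat 1"
      using matrix_inv_mult[OF h1(2)[OF s0_facts(2)]] by auto
    have u0: "cadj u0 ** u0 = mat 1"
    proof -
      let ?k = "matrix_inv (h1 (Aff s0))"
      have "cadj u0 ** u0 = cadj ?k ** (cadj (gt (Aff s0)) ** gt (Aff s0)) ** ?k" by (simp add: u0_def cadj_mult matrix_mul_assoc)
      also have "\<dots> = cadj (h1 (Aff s0) ** ?k) ** (h1 (Aff s0) ** ?k)"
        unfolding h1(3)[OF s0_facts(1,2), symmetric] by (simp only: cadj_mult matrix_mul_assoc)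
      finally show ?thesis by (simp add: h1s)
    qed
    have u0i: "invertible u0" using u0 invertible_left_inverse by blast
    define h2 where "h2 x = u0 ** h1 x" for x
    have h2p: "mpole_le T M h2" unfolding h2_def using mpole_le_mult[OF finite_T(1) mpole_le_const[OF finite_T(1), of 0 u0] h1(1)] by simp
    have h2i: "invertible (h2 x)" if "x \<notin> T" for x unfolding h2_def by (rule invertible_mult[OF u0i h1(2)[OF that]])
    have h2c: "cadj (h2 (Aff z)) ** h2 (Aff z) = cadj (gt (Aff z)) ** gt (Aff z)" if "norm z = 1" "Aff z \<notin> T" for z
    proof -
      have "cadj (h2 (Aff z)) ** h2 (Aff z) = cadj (h1 (Aff z)) ** (cadj u0 ** u0) ** h1 (Aff z)" by (simp add: h2_def cadj_mult matrix_mul_assoc)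
      then show ?thesis using h1(3)[OF that] u0 by simp
    qed
    have h2s: "gt (Aff s0) = h2 (Aff s0)" by (simp add: h2_def u0_def h1s flip: matrix_mul_assoc)
    have uG: "jc (gt x ** matrix_inv (h2 x)) \<in> G" if x: "x \<notin> SS" for x
    proof -
      have "p (jc (gt x ** matrix_inv (h2 x))) = 0" if p: "p \<in> F" for p
      proof -
        have "(\<lambda>X. p (jc X)) (gt x ** matrix_inv (h2 x)) = 0"
        proof (rule unitary_factor_satisfies_equations[where H = "cj ` G" and T = T and T' = SS and g = gt and h = h2 and N = N and M = M])
          show "matrix_poly (\<lambda>X. p (jc X))" unfolding jc_def by (rule matrix_poly_two_sided[OF F[OF p]])
          show "p (jc A) = 0" if "A \<in> cj ` G" for A using that p G_eq by auto
          show "A ** B \<in> cj ` G" if "A \<in> cj ` G" "B \<in> cj ` G" for A B using that G_mult by (auto simp flip: cj_mult)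
          show "mat 1 \<in> cj ` G" using G_one by (intro image_eqI[of _ _ "mat 1"]) auto
          show "invertible A \<and> matrix_inv A \<in> cj ` G" if "A \<in> cj ` G" for A using that cj_inv G_invertible G_inv by auto
          show "cadj A \<in> cj ` G" if "A \<in> cj ` G" for A using that star unfolding cj_def by blast
          show "finite T" "finite SS" "T \<subseteq> SS" using finite_T T_SS by auto
          show "1 \<le> norm z" if "Aff z \<in> T" for z using T_disc[OF that] .
          show "Aff z \<in> T" if "norm z = 1" "Aff z \<in> SS" for z using that circle_SS circle_T by blast
          show "gt x \<in> cj ` G" if "x \<notin> SS" for x unfolding gt_def using gG[OF that] by blast
          show "norm s0 = 1" "Aff s0 \<notin> T" "gt (Aff s0) = h2 (Aff s0)" using s0_facts h2s by auto
        qed (use gtp h2p h2i h2c s0_facts h2s x in auto)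
        then show ?thesis by simp
      qed
      moreover have "invertible (jc (gt x ** matrix_inv (h2 x)))"
        using jc_inv invertible_mult[OF gti[OF x] invertible_matrix_inv[OF h2i]] x T_SS by blast
      ultimately show ?thesis by (simp add: G_eq)
    qed
    define u where "u = (\<lambda>x\<in>- SS. jc (gt x ** matrix_inv (h2 x)))"
    define h where "h = (\<lambda>x\<in>- T. jc (h2 x))"
    have ux: "u x = jc (gt x ** matrix_inv (h2 x))" if "x \<notin> SS" for x using that by (simp add: u_def)
    have hx: "h x = jc (h2 x)" if "x \<notin> T" for x using that by (simp add: h_def)
    have uh: "u x ** h x = g x" if "x \<notin> SS" for x
    proof -
      have xT: "x \<notin> T" using that T_SS by blast
      have "u x ** h x = jc (gt x ** (matrix_inv (h2 x) ** h2 x))" by (simp add: ux[OF that] hx[OF xT] matrix_mul_assoc flip: cj_mult)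
      then show ?thesis using matrix_inv_mult(2)[OF h2i[OF xT]] by (simp add: gt_def)
    qed
    have hp: "mpole_le T M h"
      by (rule mpole_le_cong[THEN iffD2, OF hx, unfolded jc_def, OF _ mpole_two_sided[OF finite_T(1) h2p]])
    have hi: "invertible (h x)" if "x \<notin> T" for x using hx[OF that] jc_inv[OF h2i[OF that]] by simp
    have hG0: "h x = matrix_inv (u x) ** g x" if "x \<notin> SS" for x
      using uh[OF that] matrix_inv_mult(2)[OF G_invertible[OF uG[OF that]]] ux[OF that] by (metis matrix_mul_assoc matrix_mul_lid)
    have hG: "h x \<in> G" if x: "x \<notin> T" for x
    proof -
      have "h y \<in> G" if "y \<notin> SS" for y unfolding hG0[OF that] using G_mult[OF G_inv gG[OF that]] uG[OF that] ux[OF that] by simp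
      then have "p (h y) = 0" if "p \<in> F" "y \<notin> SS" for p y using that G_eq by blast
      then have "p (h x) = 0" if "p \<in> F" for p using vanish_extends[OF F[OF that] hp _ x] that by blast
      then show ?thesis using hi[OF x] by (simp add: G_eq)
    qed
    have hip: "mpole_le T M1 (pointwise_inv h)" unfolding M1_def pointwise_inv_def by (rule mpole_le_matrix_inv[OF finite_T(1) hp hi])
    have hpiece: "h \<in> piece G T K"
      unfolding piece_iff[OF finite_T(1)]
      using hG hp hip by (auto simp: K_def h_def intro: mpole_le_mono[OF finite_T(1)])
    have u_eq: "u x = g x ** matrix_inv (h x)" if "x \<notin> SS" for x
    proof -
      have "x \<notin> T" using that T_SS by blast
      then show ?thesis using uh[OF that] matrix_inv_mult(1)[OF hi, of x] by (metis matrix_mul_assoc matrix_mul_rid)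
    qed
    have "mpole_le SS (N + M1) (\<lambda>x. g x ** matrix_inv (h x))"
      by (rule mpole_le_mult[OF finite_T(2) gp(1) mpole_le_superset[OF finite_T(2) T_SS hip[unfolded pointwise_inv_def]]])
    then have up: "mpole_le SS (N + M1) u" by (subst mpole_le_cong[OF u_eq]) assumption+
    have "mpole_le SS (M + N) (\<lambda>x. h x ** matrix_inv (g x))"
      by (rule mpole_le_mult[OF finite_T(2) mpole_le_superset[OF finite_T(2) T_SS hp] gp(2)[unfolded pointwise_inv_def]])
    moreover have "pointwise_inv u x = h x ** matrix_inv (g x)" if "x \<notin> SS" for x
    proof -
      have "x \<notin> T" using that T_SS by blast
      then show ?thesis unfolding pointwise_inv_def u_eq[OF that]
        by (simp add: matrix_inv_mult_distrib G_invertible[OF gG[OF that]] invertible_matrix_inv hi matrix_inv_matrix_inv)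
    qed
    ultimately have uip: "mpole_le SS (M + N) (pointwise_inv u)" by (subst mpole_le_cong) assumption+
    have "u \<in> (- SS) \<rightarrow>\<^sub>E G" using uG by (auto simp: u_def)
    moreover have "mpole_le SS K u" by (rule mpole_le_mono[OF finite_T(2) up]) (simp add: K_def)
    moreover have "mpole_le SS K (pointwise_inv u)" by (rule mpole_le_mono[OF finite_T(2) uip]) (simp add: K_def)
    ultimately have upiece: "u \<in> piece G SS K" by (simp add: piece_iff[OF finite_T(2)])
    have uc: "u (Aff z) \<in> Gc" if z: "z \<in> sphere 0 1 - S" for z
    proof -
      have z1: "norm z = 1" "Aff z \<notin> SS" "Aff z \<notin> T" using z circle_SS[of z] circle_T[of z] by auto
      let ?k = "matrix_inv (h2 (Aff z))"
      have hk: "h2 (Aff z) ** ?k = mat 1" using matrix_inv_mult(1)[OF h2i[OF z1(3)]] .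
      have "cadj (gt (Aff z) ** ?k) ** (gt (Aff z) ** ?k) = cadj ?k ** (cadj (gt (Aff z)) ** gt (Aff z)) ** ?k" by (simp add: cadj_mult matrix_mul_assoc)
      also have "\<dots> = cadj (h2 (Aff z) ** ?k) ** (h2 (Aff z) ** ?k)" unfolding h2c[OF z1(1,3), symmetric] by (simp only: cadj_mult matrix_mul_assoc)
      finally show ?thesis unfolding Gc_iff using uG[OF z1(2)] by (simp add: ux[OF z1(2)] hk)
    qed
    have us: "u (Aff s0) = mat 1"
      using matrix_inv_mult(1)[OF h2i[OF s0_facts(2)]] by (simp add: ux[OF s0_facts(3)] h2s)
    have "u \<in> based_compact_maps G Gc S SS s0"
      using upiece uc us by (auto simp: based_compact_maps_def compact_maps_def piece_def)
    moreover have "map_mult SS u h = g" using uh ge by (auto simp: map_mult_def fun_eq_iff)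
    ultimately show "\<exists>u\<in>based_compact_maps G Gc S SS s0 \<inter> piece G SS K. \<exists>h\<in>piece G T K. map_mult SS u h = g"
      using upiece hpiece by blast
  qed
qed

lemma Gc_inv_mult: 
  assumes "A \<in> Gc" "B \<in> Gc" shows "cadj (cj (matrix_inv A ** B)) ** cj (matrix_inv A ** B) = mat 1"
proof -
  have A: "invertible A" using assms G_invertible by (auto simp: Gc_iff)
  have "cj A ** cadj (cj A) = mat 1" using right_inverse_cadj assms(1) Gc_iff by blast
  then have "cj (matrix_inv A) = cadj (cj A)"
    using assms(1) cj_inv[OF A] matrix_inv_unique[of "cj A" "cadj (cj A)"] by (simp add: Gc_iff)
  then have e: "cj (matrix_inv A ** B) = cadj (cj A) ** cj B" by (simp add: cj_mult)
  have "cadj (cadj (cj A) ** cj B) ** (cadj (cj A) ** cj B) = cadj (cj B) ** (cj A ** cadj (cj A)) ** cj B"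
    by (simp add: cadj_mult matrix_mul_assoc)
  then show ?thesis unfolding e using \<open>cj A ** cadj (cj A) = mat 1\<close> assms(2) by (simp add: Gc_iff)
qed

text \<open>The quotient \<open>v\<close> of \<open>h2\<close> by \<open>h1\<close> has poles only
  in \<open>T\<close>, while off \<open>SS\<close> it is the quotient of the unitary factors, in the
  basis of \<open>C\<close>. So it is bounded and unitary on the circle, and reflection makes it
  constant, equal to its value 1 at \<open>s0\<close>.\<close>

lemma factorization_unique:
  assumes u: "u1 \<in> based_compact_maps G Gc S SS s0" "u2 \<in> based_compact_maps G Gc S SS s0"
    and h: "h1 \<in> alg_maps G T" "h2 \<in> alg_maps G T" and eq: "map_mult SS u1 h1 = map_mult SS u2 h2"
  shows "u1 = u2 \<and> h1 = h2"
proof -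
  obtain N1 N2 where "h1 \<in> piece G T N1" "h2 \<in> piece G T N2" using h alg_maps_eq_UN_piece[OF finite_T(1) G_invertible] by blast
  then have hp: "mpole_le T N1 h1" "mpole_le T N1 (pointwise_inv h1)" "mpole_le T N2 h2" "mpole_le T N2 (pointwise_inv h2)"
    by (auto simp: piece_iff[OF finite_T(1)])
  have hG: "h1 x \<in> G" "h2 x \<in> G" if "x \<notin> T" for x using h that by (auto simp: alg_maps_def)
  have uG: "u1 x \<in> G" "u2 x \<in> G" if "x \<notin> SS" for x using u that by (auto simp: based_compact_maps_def compact_maps_def alg_maps_def)
  have uc: "u1 (Aff z) \<in> Gc" "u2 (Aff z) \<in> Gc" if "norm z = 1" "z \<notin> S" for z
    using u that by (auto simp: based_compact_maps_def compact_maps_def)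
  have us: "u1 (Aff s0) = mat 1" "u2 (Aff s0) = mat 1" using u by (auto simp: based_compact_maps_def)
  have e: "u1 x ** h1 x = u2 x ** h2 x" if "x \<notin> SS" for x using fun_cong[OF eq, of x] that by (simp add: map_mult_def)
  define v where "v x = cj (h2 x ** matrix_inv (h1 x))" for x
  define w where "w x = cj (h1 x ** matrix_inv (h2 x))" for x
  have vp: "mpole_le T (N2 + N1) v" unfolding v_def cj_def
    by (rule mpole_two_sided[OF finite_T(1) mpole_le_mult[OF finite_T(1) hp(3) hp(2)[unfolded pointwise_inv_def]]])
  have wp: "mpole_le T (N1 + N2) w" unfolding w_def cj_def
    by (rule mpole_two_sided[OF finite_T(1) mpole_le_mult[OF finite_T(1) hp(1) hp(4)[unfolded pointwise_inv_def]]])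
  have vw: "v x ** w x = mat 1" "w x ** v x = mat 1" if "x \<notin> T" for x
  proof -
    have i: "invertible (h1 x)" "invertible (h2 x)" using hG[OF that] G_invertible by auto
    have "h2 x ** matrix_inv (h1 x) ** (h1 x ** matrix_inv (h2 x)) = mat 1"
      using matrix_inv_mult[OF i(1)] matrix_inv_mult[OF i(2)] by (metis matrix_mul_assoc matrix_mul_rid)
    then show "v x ** w x = mat 1" by (simp add: v_def w_def flip: cj_mult)
    have "h1 x ** matrix_inv (h2 x) ** (h2 x ** matrix_inv (h1 x)) = mat 1"
      using matrix_inv_mult[OF i(1)] matrix_inv_mult[OF i(2)] by (metis matrix_mul_assoc matrix_mul_rid)
    then show "w x ** v x = mat 1" by (simp add: v_def w_def flip: cj_mult)
  qed
  have vu: "v x = cj (matrix_inv (u2 x) ** u1 x)" if "x \<notin> SS" for x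
  proof -
    have xT: "x \<notin> T" using that T_SS by blast
    have i: "invertible (u2 x)" "invertible (h1 x)" using uG[OF that] hG[OF xT] G_invertible by auto
    have "h2 x = matrix_inv (u2 x) ** (u1 x ** h1 x)" unfolding e[OF that] using matrix_inv_mult(2)[OF i(1)] by (simp add: matrix_mul_assoc)
    then have "h2 x ** matrix_inv (h1 x) = matrix_inv (u2 x) ** u1 x ** (h1 x ** matrix_inv (h1 x))" by (simp add: matrix_mul_assoc)
    then show ?thesis using matrix_inv_mult(1)[OF i(2)] by (simp add: v_def)
  qed
  have vc: "cadj (v (Aff z)) ** v (Aff z) = mat 1" if "norm z = 1" "Aff z \<notin> T" for z
  proof -
    have "z \<notin> S" "Aff z \<notin> SS" using that circle_T circle_SS by auto
    then show ?thesis unfolding vu[OF \<open>Aff z \<notin> SS\<close>] by (intro Gc_inv_mult uc that)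
  qed
  \<comment> \<open>On the circle the adjoint of \<open>v\<close> is its inverse \<open>w\<close>,
    so the transposed entry of \<open>w\<close> is the rational function that agrees there with the
    conjugate entry of \<open>v\<close>.\<close>
  have vconst: "v x $ i $ j = v (Aff s0) $ i $ j" if x: "x \<notin> T" for x i j
  proof (rule rational_conjugate_on_circle_constant[OF finite_T(1) T_disc, where N = "N1 + N2" and g = "\<lambda>x. w x $ j $ i" and B = 1])
    show "pole_le T (N1 + N2) (\<lambda>x. v x $ i $ j)" using vp by (simp add: mpole_le_def add.commute)
    show "pole_le T (N1 + N2) (\<lambda>x. w x $ j $ i)" using wp by (simp add: mpole_le_def)
    fix z :: complex assume z: "norm z = 1" "Aff z \<notin> T"
    show "norm (v (Aff z) $ i $ j) \<le> 1" by (rule unitary_entry_le_1[OF vc[OF z]])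
    have "cadj (v (Aff z)) = cadj (v (Aff z)) ** (v (Aff z) ** w (Aff z))" using vw(1)[OF z(2)] by simp
    also have "\<dots> = w (Aff z)" using vc[OF z] by (simp add: matrix_mul_assoc)
    finally show "w (Aff z) $ j $ i = cnj (v (Aff z) $ i $ j)" by (metis cadj_entry)
  qed (use x s0_facts in auto)
  have "v (Aff s0) = mat 1" using vu[OF s0_facts(3)] us by (simp add: matrix_inv_mat_1)
  then have v1: "v x = mat 1" if "x \<notin> T" for x using vconst[OF that] by (simp add: vec_eq_iff)
  have h12: "h1 x = h2 x" if x: "x \<notin> T" for x
  proof -
    have "jc (v x) = mat 1" using v1[OF x] by simp
    then have "h2 x ** matrix_inv (h1 x) = mat 1" by (simp add: v_def)
    then have "h2 x ** (matrix_inv (h1 x) ** h1 x) = h1 x" by (simp add: matrix_mul_assoc)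
    then show ?thesis using matrix_inv_mult(2)[OF G_invertible[OF hG(1)[OF x]]] by simp
  qed
  have "h1 = h2" using h h12 by (intro PiE_ext[of h1 "- T" "\<lambda>_. G" h2]) (auto simp: alg_maps_def)
  moreover have "u1 = u2"
  proof (rule PiE_ext[of u1 "- SS" "\<lambda>_. G" u2])
    fix x assume "x \<in> - SS"
    then have x: "x \<notin> SS" "x \<notin> T" using T_SS by auto
    have "u1 x ** h1 x ** matrix_inv (h1 x) = u2 x ** h1 x ** matrix_inv (h1 x)" using e[OF x(1)] h12[OF x(2)] by simp
    then show "u1 x = u2 x" using matrix_inv_mult(1)[OF G_invertible[OF hG(1)[OF x(2)]]] by (simp flip: matrix_mul_assoc)
  qed (use u in \<open>auto simp: based_compact_maps_def compact_maps_def alg_maps_def\<close>)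
  ultimately show ?thesis by blast
qed

end

section \<open>Continuity of multiplication and of the two factors\<close>

context circle_factorization begin

abbreviation "X \<equiv> map_topology G SS"
abbreviation "Y \<equiv> map_topology G T"
abbreviation "BC \<equiv> based_compact_maps G Gc S SS s0"

lemma maps_UN: "finite U \<Longrightarrow> alg_maps G U = (\<Union>N. piece G U N)"
  by (intro alg_maps_eq_UN_piece G_invertible)

lemma piece_top: "finite U \<Longrightarrow> piece_topology G U N = top_of_set (piece G U N)"
  by (intro piece_topology_eq G_invertible)

lemma piece_in: "finite U \<Longrightarrow> f \<in> piece G U N \<Longrightarrow> x \<notin> U \<Longrightarrow> f x \<in> G"
  by (auto simp: piece_iff)

lemma openin_colimit:
  assumes U: "finite U"
  shows "openin (map_topology G U) W \<longleftrightarrow> W \<subseteq> (\<Union>n. piece G U n) \<and> (\<forall>n. openin (top_of_set (piece G U n)) (W \<inter> piece G U n))"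
  unfolding openin_map_topology piece_top[OF U] maps_UN[OF U] ..

lemma map_mult_piece:
  assumes f: "f \<in> piece G SS n" and h: "h \<in> piece G T n"
  shows "map_mult SS f h \<in> piece G SS (n + n)"
proof -
  have f': "f \<in> (- SS) \<rightarrow>\<^sub>E G" "mpole_le SS n f" "mpole_le SS n (pointwise_inv f)" using f by (auto simp: piece_iff[OF finite_T(2)])
  have h': "h \<in> (- T) \<rightarrow>\<^sub>E G" "mpole_le SS n h" "mpole_le SS n (pointwise_inv h)"
    using h mpole_le_superset[OF finite_T(2) T_SS] by (auto simp: piece_iff[OF finite_T(1)])
  have fG: "f x \<in> G" "h x \<in> G" if "x \<notin> SS" for x using f'(1) h'(1) T_SS that by auto
  have "mpole_le SS (n + n) (\<lambda>x. f x ** h x)" by (rule mpole_le_mult[OF finite_T(2) f'(2) h'(2)])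
  then have 1: "mpole_le SS (n + n) (map_mult SS f h)" by (rule mpole_le_cong[THEN iffD1, rotated]) (simp add: map_mult_def)
  have "mpole_le SS (n + n) (\<lambda>x. pointwise_inv h x ** pointwise_inv f x)" by (rule mpole_le_mult[OF finite_T(2) h'(3) f'(3)])
  then have 2: "mpole_le SS (n + n) (pointwise_inv (map_mult SS f h))"
    by (rule mpole_le_cong[THEN iffD1, rotated]) (simp add: map_mult_def pointwise_inv_def matrix_inv_mult_distrib G_invertible fG)
  have "map_mult SS f h \<in> (- SS) \<rightarrow>\<^sub>E G" using fG G_mult by (auto simp: map_mult_def)
  then show ?thesis using 1 2 by (simp add: piece_iff[OF finite_T(2)])
qed

lemma continuous_on_map_mult:
  fixes A :: "((proj_line \<Rightarrow> complex^'n^'n) \<times> (proj_line \<Rightarrow> complex^'n^'n)) set"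
  shows "continuous_on A (\<lambda>(f, h). map_mult SS f h)"
proof -
  have e: "continuous_on A (\<lambda>p. fst p x)" "continuous_on A (\<lambda>p. snd p x)" for x and A :: "((proj_line \<Rightarrow> complex^'n^'n) \<times> (proj_line \<Rightarrow> complex^'n^'n)) set"
    by (rule continuous_on_product_then_coordinatewise[OF continuous_on_fst[OF continuous_on_id]]
      continuous_on_product_then_coordinatewise[OF continuous_on_snd[OF continuous_on_id]])+
  have "continuous_on A (\<lambda>p. map_mult SS (fst p) (snd p))"
  proof (rule continuous_on_coordinatewise_then_product)
    fix x
    show "continuous_on A (\<lambda>p. map_mult SS (fst p) (snd p) x)"
    proof (cases "x \<in> SS")
      case True
      then show ?thesis by (simp add: map_mult_def)
    next
      case False
      have "continuous_on A (\<lambda>p. fst p x ** snd p x)" by (intro continuous_on_matrix_mult e)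
      then show ?thesis using False by (simp add: map_mult_def)
    qed
  qed
  then show ?thesis by (simp add: case_prod_unfold)
qed

text \<open>The domain carries the product of two colimit topologies. Local compactness of the
  pieces lets openness be tested on products of pieces, where multiplication is pointwise and lands
  in the piece of twice the order.\<close>

lemma continuous_map_mult: "continuous_map (prod_topology X Y) X (\<lambda>(f, h). map_mult SS f h)"
  unfolding continuous_map_def
proof (intro conjI allI impI)
  show "(\<lambda>(f, h). map_mult SS f h) \<in> topspace (prod_topology X Y) \<rightarrow> topspace X"
  proof
    fix p assume "p \<in> topspace (prod_topology X Y)"
    then obtain f h where p: "p = (f, h)" "f \<in> alg_maps G SS" "h \<in> alg_maps G T" by (auto simp: topspace_map_topology)
    then obtain i j where ij: "f \<in> piece G SS i" "h \<in> piece G T j"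
      using maps_UN[OF finite_T(1)] maps_UN[OF finite_T(2)] by blast
    have "f \<in> piece G SS (max i j)" "h \<in> piece G T (max i j)"
      using ij piece_mono[OF finite_T(2), of i "max i j"] piece_mono[OF finite_T(1), of j "max i j"] by auto
    from map_mult_piece[OF this] show "(case p of (f, h) \<Rightarrow> map_mult SS f h) \<in> topspace X"
      by (auto simp: p topspace_map_topology piece_def)
  qed
next
  fix W assume W: "openin X W"
  let ?P = "{p \<in> topspace (prod_topology X Y). (case p of (f, h) \<Rightarrow> map_mult SS f h) \<in> W}"
  show "openin (prod_topology X Y) ?P"
  proof (rule openin_prod_colimit[where A = "piece G SS" and B = "piece G T" and E = euclidean and E' = euclidean])
    show "openin X U = (U \<subseteq> (\<Union>n. piece G SS n) \<and> (\<forall>n. openin (top_of_set (piece G SS n)) (U \<inter> piece G SS n)))" for U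
      by (rule openin_colimit[OF finite_T(2)])
    show "openin Y U = (U \<subseteq> (\<Union>n. piece G T n) \<and> (\<forall>n. openin (top_of_set (piece G T n)) (U \<inter> piece G T n)))" for U
      by (rule openin_colimit[OF finite_T(1)])
    show "Hausdorff_space (euclidean :: (proj_line \<Rightarrow> complex^'n^'n) topology)" "Hausdorff_space (euclidean :: (proj_line \<Rightarrow> complex^'n^'n) topology)"
      unfolding euclidean_product_topology[symmetric] by (simp_all add: Hausdorff_space_product_topology)
    show "locally_compact_space (top_of_set (piece G SS n))" for n by (rule locally_compact_piece[OF F G_eq finite_T(2)])
    show "locally_compact_space (top_of_set (piece G T n))" for n by (rule locally_compact_piece[OF F G_eq finite_T(1)])
    show "piece G SS m \<subseteq> piece G SS n" if "m \<le> n" for m n by (rule piece_mono[OF finite_T(2) that])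
    show "piece G T m \<subseteq> piece G T n" if "m \<le> n" for m n by (rule piece_mono[OF finite_T(1) that])
    show "?P \<subseteq> (\<Union>n. piece G SS n) \<times> (\<Union>n. piece G T n)"
      unfolding maps_UN[OF finite_T(1), symmetric] maps_UN[OF finite_T(2), symmetric]
      by (auto simp: topspace_map_topology)
    fix n
    let ?A = "piece G SS n \<times> piece G T n"
    have "openin (top_of_set (piece G SS (n + n))) (W \<inter> piece G SS (n + n))" using W openin_colimit[OF finite_T(2)] by blast
    then obtain V where V: "open V" "W \<inter> piece G SS (n + n) = piece G SS (n + n) \<inter> V" by (auto simp: openin_open)
    have "?P \<inter> ?A = ?A \<inter> (\<lambda>(f, h). map_mult SS f h) -` V"
    proof (intro equalityI subsetI)
      fix p assume p: "p \<in> ?P \<inter> ?A"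
      obtain f h where fh: "p = (f, h)" by fastforce
      then show "p \<in> ?A \<inter> (\<lambda>(f, h). map_mult SS f h) -` V" using p map_mult_piece[of f n h] V(2) by auto
    next
      fix p assume p: "p \<in> ?A \<inter> (\<lambda>(f, h). map_mult SS f h) -` V"
      obtain f h where fh: "p = (f, h)" by fastforce
      then have "map_mult SS f h \<in> W" using p map_mult_piece[of f n h] V(2) by auto
      then show "p \<in> ?P \<inter> ?A" using p fh by (auto simp: topspace_map_topology piece_def)
    qed
    then show "openin (prod_topology (top_of_set (piece G SS n)) (top_of_set (piece G T n))) (?P \<inter> ?A)"
      using continuous_openin_preimage_gen[OF continuous_on_map_mult V(1), of ?A] by simp
  qed simp_all
qed

lemma continuous_map_colimit:
  assumes U: "finite U" and N: "\<And>n. \<exists>m. \<phi> ` piece G SS n \<subseteq> piece G U m" "\<And>n. continuous_on (piece G SS n) \<phi>"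
  shows "continuous_map X (map_topology G U) \<phi>"
  unfolding continuous_map_def
proof (intro conjI allI impI)
  show "\<phi> \<in> topspace X \<rightarrow> topspace (map_topology G U)"
    using N(1) unfolding topspace_map_topology maps_UN[OF U] maps_UN[OF finite_T(2)] by blast
  fix W assume W: "openin (map_topology G U) W"
  show "openin X {x \<in> topspace X. \<phi> x \<in> W}" unfolding openin_colimit[OF finite_T(2)]
  proof (intro conjI allI)
    show "{x \<in> topspace X. \<phi> x \<in> W} \<subseteq> (\<Union>n. piece G SS n)"
      unfolding topspace_map_topology maps_UN[OF finite_T(2)] by blast
    fix n
    obtain m where m: "\<phi> ` piece G SS n \<subseteq> piece G U m" using N(1) by blast
    have "openin (top_of_set (piece G U m)) (W \<inter> piece G U m)" using W openin_colimit[OF U] by blast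
    then obtain V where V: "open V" "W \<inter> piece G U m = piece G U m \<inter> V" by (auto simp: openin_open)
    have "{x \<in> topspace X. \<phi> x \<in> W} \<inter> piece G SS n = piece G SS n \<inter> \<phi> -` V"
      using m V(2) by (auto simp: topspace_map_topology piece_def)
    then show "openin (top_of_set (piece G SS n)) ({x \<in> topspace X. \<phi> x \<in> W} \<inter> piece G SS n)"
      using continuous_openin_preimage_gen[OF N(2) V(1)] by simp
  qed
qed

text \<open>Interpolation nodes are placed on the circle. There the values lie in the compact group
  \<open>Gc\<close>, so the bounds of \<open>compact_bounded_piece\<close> hold automatically and
  the other conditions are closed.\<close>

lemma compact_based_piece: "compact (BC \<inter> piece G SS M)"
proof -
  have Zi: "infinite (sphere 0 1 - S)" by (rule circle_minus_finite_infinite[OF S(1)])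
  have Zn: "Aff z \<notin> SS" if "z \<in> sphere 0 1 - S" for z using that circle_SS[of z] by auto
  obtain Q where Q: "finite Q" "Q \<subseteq> sphere 0 1 - S"
    and K: "\<And>r. compact {f \<in> piece G SS M. \<forall>z\<in>Q. norm (f (Aff z)) \<le> r \<and> norm (matrix_inv (f (Aff z))) \<le> r}"
    by (rule compact_bounded_piece[OF F G_eq finite_T(2) Zi Zn, where N = M], assumption, assumption, rule that)
  have "continuous_on Gc matrix_inv" using continuous_on_matrix_inv[OF continuous_on_id, of Gc] G_invertible Gc_iff by auto
  then have "compact (matrix_inv ` Gc)" using Gc_compact by (rule compact_continuous_image)
  then have "bounded (Gc \<union> matrix_inv ` Gc)" using Gc_compact by (simp add: compact_imp_bounded)
  then obtain r where r: "\<And>A. A \<in> Gc \<Longrightarrow> norm A \<le> r \<and> norm (matrix_inv A) \<le> r" unfolding bounded_iff by blast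
  let ?K = "{f \<in> piece G SS M. \<forall>z\<in>Q. norm (f (Aff z)) \<le> r \<and> norm (matrix_inv (f (Aff z))) \<le> r}"
  have cl: "closed ((\<lambda>f :: proj_line \<Rightarrow> complex^'n^'n. f x) -` D)" if "closed D" for x D
    by (rule closed_vimage[OF that]) (rule continuous_on_eval)
  have eq: "BC \<inter> piece G SS M = ?K \<inter> ((\<Inter>z\<in>sphere 0 1 - S. (\<lambda>f. f (Aff z)) -` Gc) \<inter> (\<lambda>f. f (Aff s0)) -` {mat 1})"
  proof (intro equalityI subsetI)
    fix f assume f: "f \<in> BC \<inter> piece G SS M"
    then have "f (Aff z) \<in> Gc" if "z \<in> sphere 0 1 - S" for z using that by (auto simp: based_compact_maps_def compact_maps_def)
    then show "f \<in> ?K \<inter> ((\<Inter>z\<in>sphere 0 1 - S. (\<lambda>f. f (Aff z)) -` Gc) \<inter> (\<lambda>f. f (Aff s0)) -` {mat 1})"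
      using f r Q(2) by (auto simp: based_compact_maps_def)
  next
    fix f assume "f \<in> ?K \<inter> ((\<Inter>z\<in>sphere 0 1 - S. (\<lambda>f. f (Aff z)) -` Gc) \<inter> (\<lambda>f. f (Aff s0)) -` {mat 1})"
    then show "f \<in> BC \<inter> piece G SS M" by (auto simp: based_compact_maps_def compact_maps_def piece_def)
  qed
  show ?thesis unfolding eq
    by (intro compact_Int_closed K closed_Int closed_INT ballI cl compact_imp_closed Gc_compact closed_singleton)
qed

lemma exists_factor: "g \<in> alg_maps G SS \<Longrightarrow> \<exists>u h. u \<in> BC \<and> h \<in> alg_maps G T \<and> map_mult SS u h = g"
proof -
  assume "g \<in> alg_maps G SS"
  then obtain N where g: "g \<in> piece G SS N" using maps_UN[OF finite_T(2)] by blast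
  obtain M where "\<forall>g\<in>piece G SS N. \<exists>u\<in>BC \<inter> piece G SS M. \<exists>h\<in>piece G T M. map_mult SS u h = g" using factorization_exists by blast
  then show ?thesis using g by (fastforce simp: piece_def)
qed

definition ufac where "ufac g = (SOME u. \<exists>h. u \<in> BC \<and> h \<in> alg_maps G T \<and> map_mult SS u h = g)"
definition hfac where "hfac g = (SOME h. h \<in> alg_maps G T \<and> map_mult SS (ufac g) h = g)"

lemma fac: "g \<in> alg_maps G SS \<Longrightarrow> ufac g \<in> BC \<and> hfac g \<in> alg_maps G T \<and> map_mult SS (ufac g) (hfac g) = g"
proof -
  assume "g \<in> alg_maps G SS"
  from someI_ex[OF exists_factor[OF this]] have 1: "\<exists>h. ufac g \<in> BC \<and> h \<in> alg_maps G T \<and> map_mult SS (ufac g) h = g" unfolding ufac_def .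
  then have "\<exists>h. h \<in> alg_maps G T \<and> map_mult SS (ufac g) h = g" by blast
  from someI_ex[OF this] 1 show ?thesis unfolding hfac_def by blast
qed

lemma fac_unique:
  assumes "u \<in> BC" "h \<in> alg_maps G T" shows "ufac (map_mult SS u h) = u \<and> hfac (map_mult SS u h) = h"
proof -
  have "u \<in> alg_maps G SS" using assms(1) by (auto simp: based_compact_maps_def compact_maps_def)
  then have "map_mult SS u h \<in> alg_maps G SS"
    using continuous_map_image_subset_topspace[OF continuous_map_mult] assms(2) by (auto simp: topspace_map_topology)
  from fac[OF this] factorization_unique[OF _ assms(1) _ assms(2)] show ?thesis by blast
qed

lemma fac_pieces: "\<exists>M. \<forall>g\<in>piece G SS N. ufac g \<in> piece G SS M \<and> hfac g \<in> piece G T M"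
proof -
  obtain M where M: "\<forall>g\<in>piece G SS N. \<exists>u\<in>BC \<inter> piece G SS M. \<exists>h\<in>piece G T M. map_mult SS u h = g" using factorization_exists by blast
  show ?thesis
  proof (rule exI[of _ M], rule ballI)
    fix g assume "g \<in> piece G SS N"
    then obtain u h where uh: "u \<in> BC" "u \<in> piece G SS M" "h \<in> piece G T M" "map_mult SS u h = g" using M by blast
    then have "h \<in> alg_maps G T" by (simp add: piece_def)
    from fac_unique[OF uh(1) this] uh show "ufac g \<in> piece G SS M \<and> hfac g \<in> piece G T M" by simp
  qed
qed

lemma hfac_off: "g \<in> alg_maps G SS \<Longrightarrow> x \<notin> SS \<Longrightarrow> hfac g x = matrix_inv (ufac g x) ** g x \<and> matrix_inv (hfac g x) = matrix_inv (g x) ** ufac g x"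
proof -
  assume g: "g \<in> alg_maps G SS" and x: "x \<notin> SS"
  have xT: "x \<notin> T" using x T_SS by blast
  have e: "ufac g x ** hfac g x = g x" using fac[OF g] x by (metis (no_types, lifting) Compl_iff map_mult_def restrict_apply')
  have i: "invertible (ufac g x)" "invertible (hfac g x)" "invertible (g x)"
    by (rule G_invertible, use fac[OF g] g x xT in \<open>auto simp: based_compact_maps_def compact_maps_def alg_maps_def\<close>)+
  have 1: "hfac g x = matrix_inv (ufac g x) ** g x" unfolding e[symmetric] using matrix_inv_mult(2)[OF i(1)] by (simp add: matrix_mul_assoc)
  show ?thesis using 1 by (simp add: matrix_inv_mult_distrib invertible_matrix_inv i matrix_inv_matrix_inv)
qed

text \<open>The graph of \<open>ufac\<close> on a piece is closed in the product with a compact set, so \<open>ufac\<close> is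
  continuous there.\<close>

lemma continuous_on_ufac: "continuous_on (piece G SS N) ufac"
proof -
  obtain M where M: "\<And>g. g \<in> piece G SS N \<Longrightarrow> ufac g \<in> piece G SS M \<and> hfac g \<in> piece G T M" using fac_pieces by blast
  define K where "K = BC \<inter> piece G SS M"
  let ?P = "piece G SS N"
  have Pa: "g \<in> alg_maps G SS" if "g \<in> ?P" for g using that by (simp add: piece_def)
  have Tn: "Aff z \<notin> T" if "z \<in> {z. Aff z \<notin> SS}" for z using that T_SS by blast
  obtain Q l where Q: "finite Q" "Q \<subseteq> {z. Aff z \<notin> SS}"
    and l: "\<And>f :: proj_line \<Rightarrow> complex^'n^'n. mpole_le T M f \<longleftrightarrow> (\<forall>x. x \<notin> T \<longrightarrow> f x = (\<Sum>z\<in>Q. cscale (l x z) (f (Aff z))))"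
    by (rule mpole_le_interpolation[OF finite_T(1) ex_Aff_notin[OF finite_T(2)] Tn, where N = M and 'n = 'n], assumption, rule that)
  \<comment> \<open>For a pair \<open>p = (g, u)\<close>, \<open>a\<close> is the only candidate for
    the disc factor and \<open>b\<close> for its inverse, both known only off \<open>SS\<close>.
    \<open>R x\<close> asks them to satisfy the interpolation relations of order \<open>M\<close>
    for poles in \<open>T\<close>, which expresses the extension over \<open>Splus\<close> by closed
    conditions at points off \<open>SS\<close>.\<close>
  define a where "a p x = matrix_inv (snd p x) ** fst p x" for p :: "(proj_line \<Rightarrow> complex^'n^'n) \<times> (proj_line \<Rightarrow> complex^'n^'n)" and x
  define b where "b p x = matrix_inv (fst p x) ** snd p x" for p :: "(proj_line \<Rightarrow> complex^'n^'n) \<times> (proj_line \<Rightarrow> complex^'n^'n)" and x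
  define R where "R x = {p \<in> ?P \<times> K. a p x - (\<Sum>z\<in>Q. cscale (l x z) (a p (Aff z))) = 0} \<inter>
      {p \<in> ?P \<times> K. b p x - (\<Sum>z\<in>Q. cscale (l x z) (b p (Aff z))) = 0}" for x
  have inv: "invertible (fst p x)" "invertible (snd p x)" if "p \<in> ?P \<times> K" "x \<notin> SS" for p x
    by (rule G_invertible, use that piece_in[OF finite_T(2), of _ _ x] in \<open>auto simp: K_def\<close>)+
  have e: "continuous_on A (\<lambda>p. fst p x)" "continuous_on A (\<lambda>p. snd p x)" for x and A :: "((proj_line \<Rightarrow> complex^'n^'n) \<times> (proj_line \<Rightarrow> complex^'n^'n)) set"
    by (rule continuous_on_product_then_coordinatewise[OF continuous_on_fst[OF continuous_on_id]]
      continuous_on_product_then_coordinatewise[OF continuous_on_snd[OF continuous_on_id]])+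
  have ca: "continuous_on (?P \<times> K) (\<lambda>p. a p x)" "continuous_on (?P \<times> K) (\<lambda>p. b p x)" if "x \<notin> SS" for x
    unfolding a_def b_def by (intro continuous_on_matrix_mult continuous_on_matrix_inv e inv that; assumption)+
  have cR: "closedin (top_of_set (?P \<times> K)) (R x)" if "x \<notin> SS" for x unfolding R_def
    by (intro closedin_Int continuous_closedin_preimage_constant continuous_on_diff continuous_on_sum continuous_on_cscale ca that) (use Q in auto)
  define Gr where "Gr = (?P \<times> K) \<inter> (\<Inter>x\<in>- SS. R x)"
  have graph: "Gr = {p \<in> ?P \<times> K. snd p = ufac (fst p)}"
  proof (intro equalityI subsetI)
    fix p assume "p \<in> {p \<in> ?P \<times> K. snd p = ufac (fst p)}"
    then have p: "p \<in> ?P \<times> K" "snd p = ufac (fst p)" by auto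
    then have g: "fst p \<in> ?P" by auto
    have ab: "a p x = hfac (fst p) x" "b p x = matrix_inv (hfac (fst p) x)" if "x \<notin> SS" for x
      using hfac_off[OF Pa[OF g] that] p(2) by (auto simp: a_def b_def)
    have hp: "mpole_le T M (hfac (fst p))" "mpole_le T M (\<lambda>x. matrix_inv (hfac (fst p) x))"
      using M[OF g] by (auto simp: piece_iff[OF finite_T(1)] pointwise_inv_def)
    have "p \<in> R x" if "x \<notin> SS" for x
    proof -
      have xT: "x \<notin> T" using that T_SS by blast
      have "a p x = (\<Sum>z\<in>Q. cscale (l x z) (a p (Aff z)))"
      proof -
        have "a p x = (\<Sum>z\<in>Q. cscale (l x z) (hfac (fst p) (Aff z)))" using hp(1) xT ab(1)[OF that] unfolding l by simp
        also have "\<dots> = (\<Sum>z\<in>Q. cscale (l x z) (a p (Aff z)))" by (intro sum.cong refl) (use ab Q in auto)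
        finally show ?thesis .
      qed
      moreover have "b p x = (\<Sum>z\<in>Q. cscale (l x z) (b p (Aff z)))"
      proof -
        have "b p x = (\<Sum>z\<in>Q. cscale (l x z) (matrix_inv (hfac (fst p) (Aff z))))" using hp(2) xT ab(2)[OF that] unfolding l by simp
        also have "\<dots> = (\<Sum>z\<in>Q. cscale (l x z) (b p (Aff z)))" by (intro sum.cong refl) (use ab Q in auto)
        finally show ?thesis .
      qed
      ultimately show ?thesis using p(1) by (simp add: R_def)
    qed
    then show "p \<in> Gr" using p(1) by (simp add: Gr_def)
  next
    fix p assume p: "p \<in> Gr"
    then have pp: "p \<in> ?P \<times> K" by (simp add: Gr_def)
    have r: "a p x = (\<Sum>z\<in>Q. cscale (l x z) (a p (Aff z)))" "b p x = (\<Sum>z\<in>Q. cscale (l x z) (b p (Aff z)))" if "x \<notin> SS" for x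
      using p that by (auto simp: Gr_def R_def)
    \<comment> \<open>The interpolation formula supplies the values at the points of
      \<open>Splus\<close>, where the pair carries no information.\<close>
    define h where "h = (\<lambda>x\<in>- T. \<Sum>z\<in>Q. cscale (l x z) (a p (Aff z)))"
    define k where "k x = (\<Sum>z\<in>Q. cscale (l x z) (b p (Aff z)))" for x
    have ha: "h x = a p x" if "x \<notin> SS" for x using that T_SS r(1)[OF that] by (auto simp: h_def)
    have kb: "k x = b p x" if "x \<notin> SS" for x using r(2)[OF that] by (simp add: k_def)
    have hpl: "mpole_le T M h" unfolding l
    proof (intro allI impI)
      fix x assume "x \<notin> T"
      then have "h x = (\<Sum>z\<in>Q. cscale (l x z) (a p (Aff z)))" by (simp add: h_def)
      also have "\<dots> = (\<Sum>z\<in>Q. cscale (l x z) (h (Aff z)))" by (intro sum.cong refl) (use ha Q in auto)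
      finally show "h x = (\<Sum>z\<in>Q. cscale (l x z) (h (Aff z)))" .
    qed
    have kpl: "mpole_le T M k" unfolding l
    proof (intro allI impI)
      fix x assume "x \<notin> T"
      show "k x = (\<Sum>z\<in>Q. cscale (l x z) (k (Aff z)))" unfolding k_def[of x] by (intro sum.cong refl) (use kb Q in auto)
    qed
    have gu: "fst p x \<in> G" "snd p x \<in> G" if "x \<notin> SS" for x using pp piece_in[OF finite_T(2) _ that] by (auto simp: K_def)
    have hG0: "h x \<in> G" if "x \<notin> SS" for x unfolding ha[OF that] a_def by (intro G_mult G_inv gu that)
    have hk0: "h x ** k x = mat 1" if "x \<notin> SS" for x
    proof -
      have i: "invertible (fst p x)" "invertible (snd p x)" using inv[OF pp that] by auto
      have "h x ** k x = matrix_inv (snd p x) ** (fst p x ** matrix_inv (fst p x)) ** snd p x"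
        by (simp add: ha[OF that] kb[OF that] a_def b_def matrix_mul_assoc)
      then show ?thesis using matrix_inv_mult[OF i(1)] matrix_inv_mult[OF i(2)] by simp
    qed
    \<comment> \<open>The relation extends over \<open>Splus\<close> by the identity theorem and
      gives invertibility of \<open>h\<close> there, which polynomial equations alone would
      not.\<close>
    have hk: "h x ** k x = mat 1" if x: "x \<notin> T" for x
    proof -
      have "mpole_le T (M + M) (\<lambda>x. h x ** k x)" by (rule mpole_le_mult[OF finite_T(1) hpl kpl])
      then have pl: "pole_le T (M + M) (\<lambda>x. (h x ** k x) $ i $ j)" for i j by (simp add: mpole_le_def)
      have "(h x ** k x) $ i $ j = mat 1 $ i $ j" for i j
        by (rule pole_le_eq_everywhere[OF finite_T(1) pl pole_le_const[OF finite_T(1), of 0] ex_Aff_notin[OF finite_T(2)] _ x])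
          (use hk0 T_SS in auto)
      then show ?thesis by (simp add: vec_eq_iff)
    qed
    have "h x \<in> G" if x: "x \<notin> T" for x
    proof -
      have "p' (h x) = 0" if "p' \<in> F" for p'
        
        by (rule vanish_extends[OF F[OF that] hpl _ x]) (use hG0 that G_eq in blast)
      moreover have "invertible (h x)" using hk[OF x] invertible_right_inverse by blast
      ultimately show ?thesis by (simp add: G_eq)
    qed
    then have "h \<in> (- T) \<rightarrow>\<^sub>E G" by (auto simp: h_def)
    moreover have "pointwise_inv h x = k x" if "x \<notin> T" for x
      unfolding pointwise_inv_def by (rule matrix_inv_unique) (use hk[OF that] matrix_left_right_inverse in auto)
    then have "mpole_le T M (pointwise_inv h)" by (subst mpole_le_cong) (assumption, rule kpl)
    ultimately have hA: "h \<in> alg_maps G T" using hpl piece_iff[OF finite_T(1), of h G M] by (simp add: piece_def)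
    have "map_mult SS (snd p) h x = fst p x" for x
    proof (cases "x \<in> SS")
      case True
      then show ?thesis using pp by (auto simp: map_mult_def piece_iff[OF finite_T(2)] PiE_def extensional_def)
    next
      case False
      then show ?thesis using matrix_inv_mult(1)[OF inv(2)[OF pp False]] by (simp add: map_mult_def ha a_def matrix_mul_assoc)
    qed
    then have "map_mult SS (snd p) h = fst p" by (rule ext)
    then have "ufac (fst p) = snd p" using fac_unique[OF _ hA, of "snd p"] pp by (auto simp: K_def)
    then show "p \<in> {p \<in> ?P \<times> K. snd p = ufac (fst p)}" using pp by simp
  qed
  have "closedin (top_of_set (?P \<times> K)) Gr"
  proof -
    have "- SS \<noteq> {}" using s0_facts by auto
    then show ?thesis unfolding Gr_def using cR closedin_topspace[of "top_of_set (?P \<times> K)"] by (intro closedin_Int closedin_INT) auto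
  qed
  then have cG: "closedin (prod_topology (top_of_set ?P) (top_of_set K)) Gr" by simp
  have "compact_space (top_of_set K)" unfolding K_def using compact_based_piece by (simp add: compact_space_subtopology)
  then have cm: "closed_map (prod_topology (top_of_set ?P) (top_of_set K)) (top_of_set ?P) fst" by (rule Abstract_Topological_Spaces.closed_map_fst)
  have uK: "ufac g \<in> K" if "g \<in> ?P" for g using M[OF that] fac[OF Pa[OF that]] by (simp add: K_def)
  have "continuous_map (top_of_set ?P) (top_of_set K) ufac" unfolding continuous_map_closedin
  proof (intro conjI allI impI ballI)
    show "ufac \<in> topspace (top_of_set ?P) \<rightarrow> topspace (top_of_set K)" using uK by auto
    fix D assume D: "closedin (top_of_set K) D"
    have "closedin (prod_topology (top_of_set ?P) (top_of_set K)) (?P \<times> D)"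
      unfolding closedin_prod_Times_iff by (intro disjI2 conjI closedin_subtopology_refl[THEN iffD2] D) simp
    then have "closedin (top_of_set ?P) (fst ` (Gr \<inter> ?P \<times> D))" using cm cG unfolding closed_map_def by blast
    moreover have "fst ` (Gr \<inter> ?P \<times> D) = {x \<in> topspace (top_of_set ?P). ufac x \<in> D}"
      unfolding graph using uK by (force simp: image_iff)
    ultimately show "closedin (top_of_set ?P) {x \<in> topspace (top_of_set ?P). ufac x \<in> D}" by simp
  qed
  then have "continuous_map (top_of_set ?P) euclidean ufac" by (rule continuous_map_into_fulltopology)
  then show ?thesis by simp
qed

text \<open>Off \<open>SS\<close> the disc factor is the inverse of \<open>ufac\<close> times
  \<open>g\<close>. With interpolation nodes there, its values at all points outside
  \<open>T\<close>, those of \<open>Splus\<close> included, are finite linear combinations of such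
  products.\<close>

lemma continuous_on_hfac: "continuous_on (piece G SS N) hfac"
proof -
  obtain M where M: "\<And>g. g \<in> piece G SS N \<Longrightarrow> ufac g \<in> piece G SS M \<and> hfac g \<in> piece G T M" using fac_pieces by blast
  let ?P = "piece G SS N"
  have Pa: "g \<in> alg_maps G SS" if "g \<in> ?P" for g using that by (simp add: piece_def)
  have Tn: "Aff z \<notin> T" if "z \<in> {z. Aff z \<notin> SS}" for z using that T_SS by blast
  obtain Q l where Q: "finite Q" "Q \<subseteq> {z. Aff z \<notin> SS}"
    and l: "\<And>f :: proj_line \<Rightarrow> complex^'n^'n. mpole_le T M f \<longleftrightarrow> (\<forall>x. x \<notin> T \<longrightarrow> f x = (\<Sum>z\<in>Q. cscale (l x z) (f (Aff z))))"
    by (rule mpole_le_interpolation[OF finite_T(1) ex_Aff_notin[OF finite_T(2)] Tn, where N = M and 'n = 'n], assumption, rule that)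
  have u: "continuous_on ?P (\<lambda>g. ufac g x)" for x
    by (rule continuous_on_product_then_coordinatewise[OF continuous_on_ufac])
  show ?thesis
  proof (rule continuous_on_coordinatewise_then_product)
    fix x
    show "continuous_on ?P (\<lambda>g. hfac g x)"
    proof (cases "x \<in> T")
      case True
      have "hfac g x = undefined" if "g \<in> ?P" for g using fac[OF Pa[OF that]] True by (auto simp: alg_maps_def PiE_def extensional_def)
      then show ?thesis using continuous_on_eq[of ?P "\<lambda>_. undefined" "\<lambda>g. hfac g x"] by auto
    next
      case False
      have "continuous_on ?P (\<lambda>g. \<Sum>z\<in>Q. cscale (l x z) (matrix_inv (ufac g (Aff z)) ** g (Aff z)))"
      proof (intro continuous_on_sum continuous_on_cscale continuous_on_matrix_mult continuous_on_matrix_inv u continuous_on_eval)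
        fix z g assume "z \<in> Q" "g \<in> ?P"
        then have "ufac g (Aff z) \<in> G" using fac[OF Pa[of g]] Q by (auto simp: based_compact_maps_def compact_maps_def alg_maps_def)
        then show "invertible (ufac g (Aff z))" by (rule G_invertible)
      qed
      moreover have "(\<Sum>z\<in>Q. cscale (l x z) (matrix_inv (ufac g (Aff z)) ** g (Aff z))) = hfac g x" if g: "g \<in> ?P" for g
      proof -
        have "mpole_le T M (hfac g)" using M[OF g] by (auto simp: piece_iff[OF finite_T(1)])
        then have "hfac g x = (\<Sum>z\<in>Q. cscale (l x z) (hfac g (Aff z)))" unfolding l using False by blast
        also have "\<dots> = (\<Sum>z\<in>Q. cscale (l x z) (matrix_inv (ufac g (Aff z)) ** g (Aff z)))"
          by (intro sum.cong refl) (use hfac_off[OF Pa[OF g]] Q in auto)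
        finally show ?thesis by simp
      qed
      ultimately show ?thesis by (rule continuous_on_eq)
    qed
  qed
qed

theorem factorization_homeomorphism:
  "homeomorphic_map (prod_topology (subtopology X BC) Y) X (\<lambda>(f, h). map_mult SS f h)"
proof -
  have BCa: "BC \<subseteq> alg_maps G SS" by (auto simp: based_compact_maps_def compact_maps_def)
  have ts: "topspace (prod_topology (subtopology X BC) Y) = BC \<times> alg_maps G T" using BCa by (auto simp: topspace_map_topology)
  have "homeomorphic_maps (prod_topology (subtopology X BC) Y) X (\<lambda>(f, h). map_mult SS f h) (\<lambda>g. (ufac g, hfac g))"
    unfolding homeomorphic_maps_def
  proof (intro conjI ballI)
    show "continuous_map (prod_topology (subtopology X BC) Y) X (\<lambda>(f, h). map_mult SS f h)"
      unfolding prod_topology_subtopology by (rule continuous_map_from_subtopology[OF continuous_map_mult])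
    have "continuous_map X X ufac"
      by (rule continuous_map_colimit[OF finite_T(2) _ continuous_on_ufac]) (use fac_pieces in blast)
    then have "continuous_map X (subtopology X BC) ufac"
      using fac by (auto simp: continuous_map_in_subtopology topspace_map_topology)
    moreover have "continuous_map X Y hfac"
      by (rule continuous_map_colimit[OF finite_T(1) _ continuous_on_hfac]) (use fac_pieces in blast)
    ultimately show "continuous_map X (prod_topology (subtopology X BC) Y) (\<lambda>g. (ufac g, hfac g))" by (rule continuous_map_pairedI)
    show "(ufac (case p of (f, h) \<Rightarrow> map_mult SS f h), hfac (case p of (f, h) \<Rightarrow> map_mult SS f h)) = p"
      if "p \<in> topspace (prod_topology (subtopology X BC) Y)" for p
      using that fac_unique unfolding ts by auto
    show "(case (ufac g, hfac g) of (f, h) \<Rightarrow> map_mult SS f h) = g" if "g \<in> topspace X" for g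
      using that fac by (simp add: topspace_map_topology)
  qed
  then show ?thesis by (rule homeomorphic_maps_imp_map)
qed

end

section \<open>The compact real form as the unitary part of the group\<close>

lemma subgroup_GL:
  assumes K: "subgroup K (GL :: (complex^'n^'n) monoid)"
  shows "A \<in> K \<Longrightarrow> invertible A" "A \<in> K \<Longrightarrow> B \<in> K \<Longrightarrow> A ** B \<in> K" "mat 1 \<in> K" "A \<in> K \<Longrightarrow> matrix_inv A \<in> K"
proof -
  show i: "A \<in> K \<Longrightarrow> invertible A" for A using subgroup.subset[OF K] by (auto simp: GL_def)
  show "A \<in> K \<Longrightarrow> B \<in> K \<Longrightarrow> A ** B \<in> K" using subgroup.m_closed[OF K] by (simp add: GL_def)
  show "mat 1 \<in> K" using subgroup.one_closed[OF K] by (simp add: GL_def)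
  show "matrix_inv A \<in> K" if A: "A \<in> K"
  proof -
    have "m_inv GL A = matrix_inv A" unfolding m_inv_def
      by (rule the_equality) (use i[OF A] matrix_inv_mult invertible_matrix_inv in \<open>auto simp: GL_def intro: matrix_inv_unique[symmetric]\<close>)
    then show ?thesis using subgroup.m_inv_closed[OF K A] by simp
  qed
qed

lemma subgroup_GLI:
  fixes K :: "(complex^'n^'n) set"
  assumes "\<And>A. A \<in> K \<Longrightarrow> invertible A" "\<And>A B. A \<in> K \<Longrightarrow> B \<in> K \<Longrightarrow> A ** B \<in> K" "mat 1 \<in> K" "\<And>A. A \<in> K \<Longrightarrow> matrix_inv A \<in> K"
  shows "subgroup K GL"
proof (rule subgroup.intro)
  show "m_inv GL A \<in> K" if A: "A \<in> K" for A
  proof -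
    have "m_inv GL A = matrix_inv A" unfolding m_inv_def
      by (rule the_equality) (use assms(1)[OF A] matrix_inv_mult invertible_matrix_inv in \<open>auto simp: GL_def intro: matrix_inv_unique[symmetric]\<close>)
    then show ?thesis using assms(4)[OF A] by simp
  qed
qed (use assms in \<open>auto simp: GL_def\<close>)

lemma compact_unitary: "compact {u :: complex^'n^'n. cadj u ** u = mat 1}"
proof -
  have c: "continuous_on UNIV (\<lambda>u :: complex^'n^'n. cadj u ** u)" unfolding cadj_def by (intro continuous_intros)
  have "{u :: complex^'n^'n. cadj u ** u = mat 1} = (\<lambda>u. cadj u ** u) -` {mat 1}" by auto
  then have "closed {u :: complex^'n^'n. cadj u ** u = mat 1}" using closed_vimage[OF closed_singleton c] by metis
  moreover have "bounded {u :: complex^'n^'n. cadj u ** u = mat 1}"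
  proof (rule boundedI)
    fix u :: "complex^'n^'n" assume u: "u \<in> {u. cadj u ** u = mat 1}"
    have "norm u \<le> (\<Sum>i\<in>UNIV. \<Sum>j\<in>UNIV. norm (u $ i $ j))" by (rule order_trans[OF norm_vec_le_sum]) (intro sum_mono norm_vec_le_sum)
    also have "\<dots> \<le> (\<Sum>i\<in>(UNIV::'n set). \<Sum>j\<in>(UNIV::'n set). 1)" by (intro sum_mono unitary_entry_le_1) (use u in simp)
    finally show "norm u \<le> (\<Sum>i\<in>(UNIV::'n set). \<Sum>j\<in>(UNIV::'n set). 1)" .
  qed
  ultimately show ?thesis unfolding compact_eq_bounded_closed by (intro conjI)
qed

theorem theorem1p2:
  fixes G Gc :: "(complex^'n^'n) set"
    and S Splus :: "complex set"
    and Sminus SS :: "proj_line set"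
    and s0 :: complex
  assumes "reductive G" and "connected G"
    and "maximal_compact_subgroup G Gc" and "compact_real_form G Gc"
    and "finite S" and "S \<subseteq> sphere 0 1"
    and "finite Splus" and "Splus \<subseteq> ball 0 1"
    and "Sminus = kappa ` Aff ` Splus"
    and "SS = Aff ` S \<union> Aff ` Splus \<union> Sminus"
    and "s0 \<in> sphere 0 1 - S"
  shows "homeomorphic_map
           (prod_topology
             (subtopology (map_topology G SS) (based_compact_maps G Gc S SS s0))
             (map_topology G (Sminus \<union> Aff ` S)))
           (map_topology G SS)
           (\<lambda>(f, h). map_mult SS f h)"
proof -
  have sG: "subgroup G GL" using assms(1) by (simp add: reductive_def linear_algebraic_group_def)
  obtain F where F: "\<And>p. p \<in> F \<Longrightarrow> matrix_poly p" and G_eq: "G = {A. invertible A \<and> (\<forall>p\<in>F. p A = 0)}"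
    using assms(1) by (auto simp: reductive_def linear_algebraic_group_def)
  note G = subgroup_GL[OF sG]
  have sK: "subgroup Gc GL" and KG: "Gc \<subseteq> G" and cK: "compact Gc"
    and max: "\<And>K. subgroup K GL \<Longrightarrow> K \<subseteq> G \<Longrightarrow> compact K \<Longrightarrow> Gc \<subseteq> K \<Longrightarrow> K = Gc"
    using assms(3) unfolding maximal_compact_subgroup_def by auto
  note K = subgroup_GL[OF sK]
  obtain C :: "complex^'n^'n" where C: "invertible C" "\<And>A. A \<in> Gc \<Longrightarrow> cadj A ** (cadj C ** C) ** A = cadj C ** C"
    using compact_group_invariant_form[OF cK K(3) K(2) K(1)] by metis
  let ?D = "matrix_inv C"
  note CD = matrix_inv_mult[OF C(1)]
  have CDa: "X ** C ** ?D = X" "X ** ?D ** C = X" for X :: "complex^'n^'n" using CD by (simp_all flip: matrix_mul_assoc)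
  have DC: "cadj ?D ** cadj C = mat 1" "cadj C ** cadj ?D = mat 1" using CD by (simp_all flip: cadj_mult)
  have unit: "cadj (C ** A ** ?D) ** (C ** A ** ?D) = mat 1" if "A \<in> Gc" for A
  proof -
    have "cadj (C ** A ** ?D) ** (C ** A ** ?D) = cadj ?D ** (cadj A ** (cadj C ** C) ** A) ** ?D" by (simp add: cadj_mult matrix_mul_assoc)
    also have "\<dots> = (cadj ?D ** cadj C) ** (C ** ?D)" unfolding C(2)[OF that] by (simp only: matrix_mul_assoc)
    finally show ?thesis using CD DC by simp
  qed
  obtain \<theta> where conj: "conjugation_on G \<theta>" and fixed: "Gc = {A \<in> G. \<theta> A = A}"
    using assms(4) by (auto simp: compact_real_form_def)
  have \<theta>hom: "\<theta> A \<in> G" "B \<in> G \<Longrightarrow> \<theta> (A ** B) = \<theta> A ** \<theta> B" if "A \<in> G" for A B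
    using conj that by (auto simp: conjugation_on_def hom_def GL_def)
  \<comment> \<open>The adjoint with respect to the Hermitian form \<open>cadj C ** C\<close>;
    invariance of the form makes it inversion on \<open>Gc\<close>.\<close>
  define dag where "dag A = ?D ** cadj (C ** A ** ?D) ** C" for A
  interpret matrix_group_dagger G F \<theta> dag
  proof
    show "\<exists>p k. matrix_poly p \<and> (\<forall>A\<in>G. \<theta> A $ i $ j = cnj (p A / det A ^ k))" for i j
      using conj unfolding conjugation_on_def by blast
    show "dag (A ** B) = dag B ** dag A" for A B
    proof -
      have "C ** (A ** B) ** ?D = (C ** A ** ?D) ** (C ** B ** ?D)" by (simp add: matrix_mul_assoc CDa)
      then show ?thesis unfolding dag_def by (simp only: cadj_mult[of "C ** A ** ?D"]) (simp add: matrix_mul_assoc CDa)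
    qed
    show "dag (A + B) = dag A + dag B" for A B
      by (simp add: dag_def matrix_add_ldistrib matrix_add_rdistrib cadj_add)
    have "cadj (cscale c A) = cscale (cnj c) (cadj A)" for c and A :: "complex^'n^'n" by (simp add: vec_eq_iff)
    then show "dag (cscale c A) = cscale (cnj c) (dag A)" for c A by (simp add: dag_def cscale_mult)
    show "dag (mat 1) = mat 1" using CD by (simp add: dag_def)
    have tc: "X \<longlonglongrightarrow> L \<Longrightarrow> (\<lambda>n. cadj (X n)) \<longlonglongrightarrow> cadj L" for X and L :: "complex^'n^'n" unfolding cadj_def by (intro tendsto_intros)
    show "X \<longlonglongrightarrow> L \<Longrightarrow> (\<lambda>n. dag (X n)) \<longlonglongrightarrow> dag L" for X L unfolding dag_def
      by (intro tendsto_matrix_mult tendsto_const tc)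
    show "dag A = matrix_inv A" if A: "A \<in> G" "\<theta> A = A" for A
    proof -
      have AK: "A \<in> Gc" using A fixed by simp
      have "?D ** (cadj (C ** A ** ?D) ** (C ** A ** ?D)) ** C = mat 1" unfolding unit[OF AK] using CD by simp
      then have "dag A ** A = mat 1" by (simp add: dag_def matrix_mul_assoc CDa)
      then show ?thesis using matrix_left_right_inverse matrix_inv_unique by metis
    qed
    show "\<And>p. p \<in> F \<Longrightarrow> matrix_poly p" by (rule F)
    show "G = {A. invertible A \<and> (\<forall>p\<in>F. p A = 0)}" by (rule G_eq)
    show "\<And>A B. A \<in> G \<Longrightarrow> B \<in> G \<Longrightarrow> A ** B \<in> G" by (rule G(2))
    show "mat 1 \<in> G" by (rule G(3))
    show "\<And>A. A \<in> G \<Longrightarrow> matrix_inv A \<in> G" by (rule G(4))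
    show "\<And>A. A \<in> G \<Longrightarrow> \<theta> A \<in> G" by (rule \<theta>hom(1))
    show "\<And>A B. A \<in> G \<Longrightarrow> B \<in> G \<Longrightarrow> \<theta> (A ** B) = \<theta> A ** \<theta> B" by (rule \<theta>hom(2))
    show "\<And>A. A \<in> G \<Longrightarrow> \<theta> (\<theta> A) = A" using conj by (simp add: conjugation_on_def)
    show "connected G" by (rule assms(2))
  qed
  have star: "\<exists>B\<in>G. cadj (C ** A ** ?D) = C ** B ** ?D" if "A \<in> G" for A
  proof (rule bexI[OF _ dag_closed[OF that]])
    have "C ** dag A ** ?D = (C ** ?D) ** cadj (C ** A ** ?D) ** (C ** ?D)" by (simp only: dag_def matrix_mul_assoc)
    then show "cadj (C ** A ** ?D) = C ** dag A ** ?D" using CD by simp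
  qed
  \<comment> \<open>The unitary part of \<open>G\<close> for the invariant form. It is a compact
    subgroup containing \<open>Gc\<close>, so maximality identifies the two, and unitary boundary
    values become values in \<open>Gc\<close>.\<close>
  define K where "K = {A \<in> G. cadj (C ** A ** ?D) ** (C ** A ** ?D) = mat 1}"
  have "K = Gc"
  proof (rule max)
    show "subgroup K GL"
    proof (rule subgroup_GLI)
      show "invertible A" if "A \<in> K" for A using that G(1) by (simp add: K_def)
      show "mat 1 \<in> K" using G(3) CD by (simp add: K_def)
      show "A ** B \<in> K" if A: "A \<in> K" and B: "B \<in> K" for A B
      proof -
        have e: "C ** (A ** B) ** ?D = (C ** A ** ?D) ** (C ** B ** ?D)" by (simp add: matrix_mul_assoc CDa)
        have "cadj (C ** (A ** B) ** ?D) ** (C ** (A ** B) ** ?D) = cadj (C ** B ** ?D) ** (cadj (C ** A ** ?D) ** (C ** A ** ?D)) ** (C ** B ** ?D)"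
          unfolding e cadj_mult[of "C ** A ** ?D"] by (simp only: matrix_mul_assoc)
        then show ?thesis using A B G(2) by (simp add: K_def)
      qed
      show "matrix_inv A \<in> K" if A: "A \<in> K" for A
      proof -
        let ?u = "C ** A ** ?D"
        have Ai: "invertible A" using A G(1) by (simp add: K_def)
        have uu: "cadj ?u ** ?u = mat 1" "?u ** cadj ?u = mat 1" using A right_inverse_cadj by (auto simp: K_def)
        have "?u ** (C ** matrix_inv A ** ?D) = C ** (A ** matrix_inv A) ** ?D" by (simp add: matrix_mul_assoc CDa)
        then have "?u ** (C ** matrix_inv A ** ?D) = mat 1" using matrix_inv_mult(1)[OF Ai] CD by simp
        then have "cadj ?u ** (?u ** (C ** matrix_inv A ** ?D)) = cadj ?u" by (simp only: matrix_mul_rid)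
        then have "C ** matrix_inv A ** ?D = cadj ?u" by (metis matrix_mul_assoc matrix_mul_lid uu(1))
        then show ?thesis using A G(4) uu by (simp add: K_def)
      qed
    qed
    show "K \<subseteq> G" "Gc \<subseteq> K" using KG unit by (auto simp: K_def)
    let ?V = "(\<lambda>u. ?D ** u ** C) ` {u. cadj u ** u = mat 1}"
    \<comment> \<open>Unitary matrices are invertible, so inside the compact set \<open>?V\<close>
      membership in \<open>G\<close> amounts to the polynomial equations, a closed
      condition.\<close>
    have Keq: "K = ?V \<inter> (\<Inter>p\<in>F. p -` {0})"
    proof (intro equalityI subsetI)
      fix A assume A: "A \<in> K"
      have "A = ?D ** (C ** A ** ?D) ** C" using CD by (simp add: matrix_mul_assoc CDa)
      then have "A \<in> ?V" using A by (auto simp: K_def)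
      then show "A \<in> ?V \<inter> (\<Inter>p\<in>F. p -` {0})" using A G_eq by (auto simp: K_def)
    next
      fix A assume A: "A \<in> ?V \<inter> (\<Inter>p\<in>F. p -` {0})"
      then obtain u where u: "A = ?D ** u ** C" "cadj u ** u = mat 1" by auto
      have Cu: "C ** A ** ?D = u" using CD by (simp add: u matrix_mul_assoc CDa)
      have "invertible u" using u(2) invertible_left_inverse by blast
      then have "invertible A" unfolding u(1) by (intro invertible_mult invertible_matrix_inv C(1))
      then show "A \<in> K" using A u(2) Cu by (auto simp: K_def G_eq)
    qed
    have "compact ?V" by (intro compact_continuous_image compact_unitary continuous_intros)
    moreover have "closed (\<Inter>p\<in>F. p -` {0})"
      by (intro closed_INT ballI closed_vimage closed_singleton continuous_on_matrix_poly F)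
    ultimately show "compact K" unfolding Keq by (rule compact_Int_closed)
  qed
  then have Gc_eq: "Gc = {A \<in> G. cadj (C ** A ** ?D) ** (C ** A ** ?D) = mat 1}" by (simp add: K_def)
  interpret circle_factorization G Gc F C S Splus "Sminus \<union> Aff ` S" SS s0
  proof
    show "\<And>p. p \<in> F \<Longrightarrow> matrix_poly p" by (rule F)
    show "G = {A. invertible A \<and> (\<forall>p\<in>F. p A = 0)}" by (rule G_eq)
    show "\<And>A B. A \<in> G \<Longrightarrow> B \<in> G \<Longrightarrow> A ** B \<in> G" by (rule G(2))
    show "mat 1 \<in> G" by (rule G(3))
    show "\<And>A. A \<in> G \<Longrightarrow> matrix_inv A \<in> G" by (rule G(4))
    show "invertible C" by (rule C(1))
    show "\<And>A. A \<in> G \<Longrightarrow> \<exists>B\<in>G. cadj (C ** A ** ?D) = C ** B ** ?D" by (rule star)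
    show "Gc = {A \<in> G. cadj (C ** A ** ?D) ** (C ** A ** ?D) = mat 1}" by (rule Gc_eq)
    show "compact Gc" by (rule cK)
    show "finite S" "S \<subseteq> sphere 0 1" "finite Splus" "Splus \<subseteq> ball 0 1" "s0 \<in> sphere 0 1 - S"
      by (rule assms)+
    show "Sminus \<union> Aff ` S = kappa ` Aff ` Splus \<union> Aff ` S" unfolding assms(9) ..
    show "SS = Sminus \<union> Aff ` S \<union> Aff ` Splus" unfolding assms(10) by blast
  qed
  show ?thesis by (rule factorization_homeomorphism)
qed

end
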